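(* Let $k\ge 0$ and let $\{\Omega_h\}_h$ be a sequence of polygonal decompositions of $\Omega$ for which there is a constant $\rho>0$ such that every polygon $E$ in every $\Omega_h$, with diameter $h_E$, is star-shaped with respect to a ball of radius $\ge\rho h_E$ and every edge $e$ of $E$ has length $h_e\ge\rho h_E$. Let $f=0$ and $\Gamma_R=\emptyset$. Let $(\boldsymbol{u},p)$ be the solution of the weak problem (WP) and let $(\boldsymbol{u}_h,p_h)$ be the solution of the semi-discrete virtual element problem (VP) of order $k$ on $\Omega_h$ (both problems are defined in the context). Assume that $\boldsymbol{u}_0,\ p_0\in H^{k+1}(\Omega_h)$ (componentwise for $\boldsymbol{u}_0$). Then there is a constant $C>0$, depending only on $\Omega$, on $k$ and on the mesh regularity constant $\rho$ (in particular independent of the mesh size $h$), such that for all $t\in(0,T)$ $$0\le\|(\boldsymbol{u},p)(t)\|_{\mathcal{E}}^2-\|(\boldsymbol{u}_h,p_h)(t)\|_{\mathcal{E}_h}^2\le C\,h^{2(k+1)}\Bigl(|\boldsymbol{u}_0|_{k+1,\Omega_h}^2+\widehat{c}^{\,2}\,|p_0|_{k+1,\Omega_h}^2\Bigr),$$ where $\widehat{c}:=\|c^{-1}\|_{L^\infty(\Omega\times(0,T))}$.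
   Context: **Continuous setting.** $\Omega\subset\mathbb{R}^2$ is a polygonal domain with Lipschitz boundary and outward unit normal $\boldsymbol{n}$. $\partial\Omega$ is divided into three parts $\Gamma_D,\Gamma_N,\Gamma_R$ with mutually disjoint interiors (one or two may be empty). $T>0$. $c$ is a positive piecewise constant function on $\Omega$. $(\cdot,\cdot)_\omega$ and $\|\cdot\|_{0,\omega}$ are the $L^2(\omega)$ inner product and norm. Set $\boldsymbol{V}=\{\boldsymbol{v}\in H(\mathrm{div},\Omega):\boldsymbol{v}\cdot\boldsymbol{n}=0\text{ on }\Gamma_N\}$ and $Q=L^2(\Omega)$. Data: $\boldsymbol{u}_0\in Q^2$, $p_0\in Q$, $f\in L^2(0,T;Q)$. Boundary data are homogeneous and the impedance parameter equals $1$. Forms: $m(\boldsymbol{u},\boldsymbol{v})=(\boldsymbol{u},\boldsymbol{v})_\Omega$, $n(p,q)=(c^{-2}p,q)_\Omega$, $b(\boldsymbol{v},q)=(\mathrm{div}\,\boldsymbol{v},q)_\Omega$, $r(\boldsymbol{u},\boldsymbol{v})=(c\,\boldsymbol{u}\cdot\boldsymbol{n},\boldsymbol{v}\cdot\boldsymbol{n})_{\Gamma_R}$ (zero if $\Gamma_R=\emptyset$), $F(q)=(f,q)_\Omega$. A subscript $t$ on a function denotes its time derivative. **Weak problem (WP).** Find $\boldsymbol{u}\in L^2(0,T;\boldsymbol{V})\cap C^0(0,T;Q^2)$ and $p\in L^2(0,T;Q)\cap C^0(0,T;Q)$ such that $m(\boldsymbol{u}_t,\boldsymbol{v})+b(\boldsymbol{v},p)+r(\boldsymbol{u},\boldsymbol{v})=0$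 for all $\boldsymbol{v}\in\boldsymbol{V}$ and $n(p_t,q)-b(\boldsymbol{u},q)=F(q)$ for all $q\in Q$, with $\boldsymbol{u}(\cdot,0)=\boldsymbol{u}_0$, $p(\cdot,0)=p_0$. **Meshes.** $\Omega_h$ is a decomposition of $\Omega$ into polygons $E$ with diameter $h_E$; $h=\sup_{E\in\Omega_h}h_E$; $h_e$ is the length of an edge $e$; $\boldsymbol{n}_E^e$ is the unit normal to $e$ outward to $E$. Mesh regularity: there is $\rho>0$ such that every $E$ in every $\Omega_h$ is star-shaped with respect to a ball of radius $\ge\rho h_E$ and every edge $e$ of $E$ satisfies $h_e\ge\rho h_E$. Each $\Omega_h$ matches the subdivision of $\partial\Omega$ into $\Gamma_D,\Gamma_N,\Gamma_R$, and $c$ is constant on each $E\in\Omega_h$. **Broken spaces and projections.** $\mathbb{P}_n(\omega)$ is the space of polynomials of degree $\le n$ on $\omega$, $\mathbb{P}_{-1}(\omega)=\{0\}$. $\mathbb{P}_n(\Omega_h)=\{q\in L^2(\Omega): q|_E\in\mathbb{P}_n(E)\ \forall E\in\Omega_h\}$. $H^s(\Omega_h)=\{v\in L^2(\Omega): v|_E\in H^s(E)\ \forall E\in\Omega_h\}$, with broken seminorm $|v|_{s,\Omega_h}^2=\sum_E|v|_{H^s(E)}^2$. $\Pi^{0,E}_k$ is the $L^2(E)$-orthogonal projection onto $\mathbb{P}_k(E)$ (componentwise on vectors), and $\Pi_k^0$ is its global elementwise version. **Virtual element spaces.** $\boldsymbol{V}_k(E)$ is the set of $\boldsymbol{v}\in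 H(\mathrm{div},E)\cap H(\mathrm{curl},E)$ with $\mathrm{div}\,\boldsymbol{v}\in\mathbb{P}_k(E)$, $\mathrm{curl}\,\boldsymbol{v}\in\mathbb{P}_{k-1}(E)$ and $(\boldsymbol{v}\cdot\boldsymbol{n}_E^e)|_e\in\mathbb{P}_k(e)$ for every edge $e$ of $E$ (here $\mathrm{curl}$ is the scalar curl). It contains $[\mathbb{P}_k(E)]^2$. Its degrees of freedom are: the moments $\int_E(\mathrm{div}\,\boldsymbol{w})\,p_k$ for $p_k\in\mathbb{P}_k(E)\setminus\mathbb{R}$ (i.e. polynomials modulo constants), the moments $\int_E\boldsymbol{w}\cdot(p_{k-1}\boldsymbol{x}^\perp)$ for $p_{k-1}\in\mathbb{P}_{k-1}(E)$ with $\boldsymbol{x}^\perp=(y,-x)^{T}$, and the edge moments $\int_e(\boldsymbol{w}\cdot\boldsymbol{n}_E^e)\,p_k$ for $p_k\in\mathbb{P}_k(e)$ and every edge $e$ of $E$. Global spaces: $\boldsymbol{V}_k=\{\boldsymbol{v}\in\boldsymbol{V}:\boldsymbol{v}|_E\in\boldsymbol{V}_k(E)\ \forall E\in\Omega_h\}$ and $Q_k=\mathbb{P}_k(\Omega_h)$. **Discrete form.** $m_h(\boldsymbol{v}_h,\boldsymbol{w}_h)=\sum_{E\in\Omega_h}m_h^E(\boldsymbol{v}_h,\boldsymbol{w}_h)$, where $$m_h^E(\boldsymbol{v}_h,\boldsymbol{w}_h)=\int_E(\Pi_k^{0,E}\boldsymbol{v}_h)\cdot(\Pi_k^{0,E}\boldsymbol{w}_h)\,dE+h_E^{2}\,S^E\bigl((I-\Pi_k^{0,E})\boldsymbol{v}_h,(I-\Pi_k^{0,E})\boldsymbol{w}_h\bigr),$$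 and $S^E(\boldsymbol{v}_h,\boldsymbol{w}_h)=\vec{\boldsymbol{v}}_h\cdot\vec{\boldsymbol{w}}_h$ is the Euclidean product of the vectors of the (properly scaled) degrees of freedom in $\boldsymbol{V}_k(E)$. Under the mesh regularity condition stated above, $S^E$ satisfies the known bound $C_1\|\boldsymbol{v}_h\|_{0,E}^2\le h_E^2S^E(\boldsymbol{v}_h,\boldsymbol{v}_h)\le C_2\|\boldsymbol{v}_h\|_{0,E}^2$ for all $\boldsymbol{v}_h\in\boldsymbol{V}_k(E)\cap\ker\Pi_k^{0,E}$, with $C_1,C_2>0$ depending only on $k$ and $\rho$. The form $m_h$ is used for all fields whose restriction to each $E$ lies in $\boldsymbol{V}_k(E)$. **Semi-discrete problem (VP).** Find $\boldsymbol{u}_h\in L^2(0,T;\boldsymbol{V}_k)\cap C^0(0,T;Q^2)$ and $p_h\in L^2(0,T;Q_k)\cap C^0(0,T;Q_k)$ such that $m_h((\boldsymbol{u}_h)_t,\boldsymbol{v}_h)+b(\boldsymbol{v}_h,p_h)+r(\boldsymbol{u}_h,\boldsymbol{v}_h)=0$ for all $\boldsymbol{v}_h\in\boldsymbol{V}_k$ and $n((p_h)_t,q_h)-b(\boldsymbol{u}_h,q_h)=F(q_h)$ for all $q_h\in Q_k$, with $\boldsymbol{u}_h(\cdot,0)=\Pi_k^0\boldsymbol{u}_0$, $p_h(\cdot,0)=\Pi_k^0p_0$. **Energy norms.** $\|(\boldsymbol{v},q)\|_{\mathcal{E}}^2=\|\boldsymbol{v}\|_{0,\Omega}^2+\|c^{-1}q\|_{0,\Omega}^2$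 for $(\boldsymbol{v},q)\in[L^2(\Omega)]^2\times Q$, and $\|(\boldsymbol{v}_h,q_h)\|_{\mathcal{E}_h}^2=m_h(\boldsymbol{v}_h,\boldsymbol{v}_h)+\|c^{-1}q_h\|_{0,\Omega}^2$ for $(\boldsymbol{v}_h,q_h)\in(\boldsymbol{V}_k\cup[\mathbb{P}_k(\Omega_h)]^2)\times Q_k$. *)

theory Defs
  imports "HOL-Analysis.Analysis" "HOL-Probability.Essential_Supremum"
begin

section \<open>Test functions and Lebesgue spaces\<close>

text \<open>Functions stand for their classes modulo null sets: membership in the spaces below and all
  integrals depend only on the values almost everywhere on the set in question.\<close>

definition pd :: "'a::euclidean_space \<Rightarrow> ('a \<Rightarrow> real) \<Rightarrow> 'a \<Rightarrow> real" where
  "pd b \<phi> x = frechet_derivative \<phi> (at x) b"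

primrec C_k :: "nat \<Rightarrow> ('a::euclidean_space \<Rightarrow> real) \<Rightarrow> bool" where
  "C_k 0 \<phi> \<longleftrightarrow> continuous_on UNIV \<phi>"
| "C_k (Suc n) \<phi> \<longleftrightarrow> (\<forall>x. \<phi> differentiable (at x)) \<and> (\<forall>b\<in>Basis. C_k n (pd b \<phi>))"

definition supp :: "('a::euclidean_space \<Rightarrow> real) \<Rightarrow> 'a set" where
  "supp \<phi> = closure (support_on UNIV \<phi>)"

definition test_functions :: "'a::euclidean_space set \<Rightarrow> ('a \<Rightarrow> real) set" where
  "test_functions U = {\<phi>. (\<forall>n. C_k n \<phi>) \<and> compact (supp \<phi>) \<and> supp \<phi> \<subseteq> U}"

definition L2 :: "'a::euclidean_space set \<Rightarrow> ('a \<Rightarrow> 'b::euclidean_space) set" where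
  "L2 A = {f. f \<in> borel_measurable (lebesgue_on A) \<and>
              integrable (lebesgue_on A) (\<lambda>x. (norm (f x))\<^sup>2)}"

definition L2_inner :: "'a::euclidean_space set \<Rightarrow> ('a \<Rightarrow> 'b::euclidean_space) \<Rightarrow> ('a \<Rightarrow> 'b) \<Rightarrow> real" where
  "L2_inner A f g = (\<integral>x. f x \<bullet> g x \<partial>lebesgue_on A)"

definition L2_norm :: "'a::euclidean_space set \<Rightarrow> ('a \<Rightarrow> 'b::euclidean_space) \<Rightarrow> real" where
  "L2_norm A f = sqrt (\<integral>x. (norm (f x))\<^sup>2 \<partial>lebesgue_on A)"


section \<open>Weak derivatives, Sobolev spaces, weak divergence and curl\<close>

type_synonym pt = "real^2"

abbreviation e1 :: pt where "e1 \<equiv> axis 1 1"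
abbreviation e2 :: pt where "e2 \<equiv> axis 2 1"

definition grad :: "(pt \<Rightarrow> real) \<Rightarrow> pt \<Rightarrow> pt" where
  "grad \<phi> x = vector [pd e1 \<phi> x, pd e2 \<phi> x]"

definition rot :: "(pt \<Rightarrow> real) \<Rightarrow> pt \<Rightarrow> pt" where
  "rot \<phi> x = vector [pd e2 \<phi> x, - pd e1 \<phi> x]"

definition has_weak_partial :: "pt set \<Rightarrow> nat \<Rightarrow> nat \<Rightarrow> (pt \<Rightarrow> real) \<Rightarrow> (pt \<Rightarrow> real) \<Rightarrow> bool" where
  "has_weak_partial E i j f g \<longleftrightarrow> g \<in> L2 E \<and>
     (\<forall>\<phi>\<in>test_functions E.
        L2_inner E f ((pd e1 ^^ i) ((pd e2 ^^ j) \<phi>)) = (-1) ^ (i + j) * L2_inner E g \<phi>)"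

definition weak_partial :: "pt set \<Rightarrow> nat \<Rightarrow> nat \<Rightarrow> (pt \<Rightarrow> real) \<Rightarrow> (pt \<Rightarrow> real)" where
  "weak_partial E i j f = (SOME g. has_weak_partial E i j f g)"

definition sobolev :: "nat \<Rightarrow> pt set \<Rightarrow> (pt \<Rightarrow> real) set" where
  "sobolev s E = {f \<in> L2 E. \<forall>i j. i + j \<le> s \<longrightarrow> (\<exists>g. has_weak_partial E i j f g)}"

definition sobolev_seminorm :: "nat \<Rightarrow> pt set \<Rightarrow> (pt \<Rightarrow> real) \<Rightarrow> real" where
  "sobolev_seminorm s E f = sqrt (\<Sum>i\<le>s. (L2_norm E (weak_partial E i (s - i) f))\<^sup>2)"

definition has_weak_div :: "pt set \<Rightarrow> (pt \<Rightarrow> pt) \<Rightarrow> (pt \<Rightarrow> real) \<Rightarrow> bool" where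
  "has_weak_div E v d \<longleftrightarrow> d \<in> L2 E \<and>
     (\<forall>\<phi>\<in>test_functions E. L2_inner E v (grad \<phi>) = - L2_inner E d \<phi>)"

definition weak_div :: "pt set \<Rightarrow> (pt \<Rightarrow> pt) \<Rightarrow> (pt \<Rightarrow> real)" where
  "weak_div E v = (SOME d. has_weak_div E v d)"

text \<open>The scalar curl is $\partial_1 v_2 - \partial_2 v_1$.\<close>

definition has_weak_curl :: "pt set \<Rightarrow> (pt \<Rightarrow> pt) \<Rightarrow> (pt \<Rightarrow> real) \<Rightarrow> bool" where
  "has_weak_curl E v r \<longleftrightarrow> r \<in> L2 E \<and>
     (\<forall>\<phi>\<in>test_functions E. L2_inner E v (rot \<phi>) = L2_inner E r \<phi>)"

definition Hdiv :: "pt set \<Rightarrow> (pt \<Rightarrow> pt) set" where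
  "Hdiv E = {v \<in> L2 E. \<exists>d. has_weak_div E v d}"

definition Hcurl :: "pt set \<Rightarrow> (pt \<Rightarrow> pt) set" where
  "Hcurl E = {v \<in> L2 E. \<exists>r. has_weak_curl E v r}"

definition Hdiv_norm :: "pt set \<Rightarrow> (pt \<Rightarrow> pt) \<Rightarrow> real" where
  "Hdiv_norm E v = sqrt ((L2_norm E v)\<^sup>2 + (L2_norm E (weak_div E v))\<^sup>2)"


section \<open>Segments and normal traces\<close>

type_synonym seg = "pt \<times> pt"

definition seg_pt :: "seg \<Rightarrow> real \<Rightarrow> pt" where
  "seg_pt e s = fst e + s *\<^sub>R (snd e - fst e)"

definition seg_length :: "seg \<Rightarrow> real" where
  "seg_length e = dist (fst e) (snd e)"

definition seg_set :: "seg \<Rightarrow> pt set" where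
  "seg_set e = closed_segment (fst e) (snd e)"

definition seg_interior :: "seg \<Rightarrow> pt set" where
  "seg_interior e = open_segment (fst e) (snd e)"

definition L2_seg :: "seg \<Rightarrow> (pt \<Rightarrow> real) set" where
  "L2_seg e = {g. (\<lambda>s. g (seg_pt e s)) \<in> L2 {0..1}}"

definition seg_integral :: "seg \<Rightarrow> (pt \<Rightarrow> real) \<Rightarrow> real" where
  "seg_integral e g = seg_length e * (\<integral>s. g (seg_pt e s) \<partial>lebesgue_on {0..1})"

text \<open>For a field \<open>v\<close> in $H(\mathrm{div},E)$ the trace $v \cdot n$ on a part $\Gamma$ of
  $\partial E$, with \<open>n\<close> the outward normal, is defined by duality through Green's formula
  $\int_E v \cdot \nabla\phi + (\mathrm{div}\, v)\,\phi = \langle v \cdot n, \phi\rangle$, tested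
  with functions vanishing near the rest of $\partial E$. Below, $\Gamma$ is the union of the
  segments in \<open>\<Gamma>\<close>, and \<open>g\<close> is the trace when the trace is square integrable on $\Gamma$.\<close>

definition has_normal_trace :: "pt set \<Rightarrow> seg set \<Rightarrow> (pt \<Rightarrow> pt) \<Rightarrow> (pt \<Rightarrow> real) \<Rightarrow> bool" where
  "has_normal_trace E \<Gamma> v g \<longleftrightarrow> v \<in> Hdiv E \<and> (\<forall>e\<in>\<Gamma>. g \<in> L2_seg e) \<and>
     (\<forall>\<phi>\<in>test_functions UNIV. supp \<phi> \<inter> closure (frontier E - \<Union>(seg_set ` \<Gamma>)) = {} \<longrightarrow>
        L2_inner E v (grad \<phi>) + L2_inner E (weak_div E v) \<phi>
          = (\<Sum>e\<in>\<Gamma>. seg_integral e (\<lambda>x. g x * \<phi> x)))"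

definition normal_trace :: "pt set \<Rightarrow> seg set \<Rightarrow> (pt \<Rightarrow> pt) \<Rightarrow> (pt \<Rightarrow> real)" where
  "normal_trace E \<Gamma> v = (SOME g. has_normal_trace E \<Gamma> v g)"


section \<open>The domain and its boundary\<close>

definition lipschitz_boundary :: "pt set \<Rightarrow> bool" where
  "lipschitz_boundary \<Omega> \<longleftrightarrow>
     (\<forall>x\<in>frontier \<Omega>. \<exists>r>0. \<exists>\<nu> \<tau> L \<gamma>.
        norm \<nu> = 1 \<and> norm \<tau> = 1 \<and> \<nu> \<bullet> \<tau> = 0 \<and> L-lipschitz_on UNIV \<gamma> \<and>
        \<Omega> \<inter> ball x r = {y \<in> ball x r. y \<bullet> \<nu> > \<gamma> (y \<bullet> \<tau>)})"

definition polygonal_domain :: "pt set \<Rightarrow> bool" where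
  "polygonal_domain \<Omega> \<longleftrightarrow> open \<Omega> \<and> connected \<Omega> \<and> bounded \<Omega> \<and> \<Omega> \<noteq> {} \<and> lipschitz_boundary \<Omega> \<and>
     (\<exists>S. finite S \<and> frontier \<Omega> = \<Union>(seg_set ` S))"

text \<open>The parts $\Gamma_D$, $\Gamma_N$, $\Gamma_R$ are given by the segments composing them.\<close>

definition boundary_division :: "pt set \<Rightarrow> seg set \<Rightarrow> seg set \<Rightarrow> seg set \<Rightarrow> bool" where
  "boundary_division \<Omega> \<Gamma>D \<Gamma>N \<Gamma>R \<longleftrightarrow>
     finite (\<Gamma>D \<union> \<Gamma>N \<union> \<Gamma>R) \<and>
     frontier \<Omega> = \<Union>(seg_set ` (\<Gamma>D \<union> \<Gamma>N \<union> \<Gamma>R)) \<and>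
     (\<forall>e\<in>\<Gamma>D \<union> \<Gamma>N \<union> \<Gamma>R. fst e \<noteq> snd e) \<and>
     \<Gamma>D \<inter> \<Gamma>N = {} \<and> \<Gamma>D \<inter> \<Gamma>R = {} \<and> \<Gamma>N \<inter> \<Gamma>R = {} \<and>
     pairwise (\<lambda>e e'. seg_interior e \<inter> seg_interior e' = {}) (\<Gamma>D \<union> \<Gamma>N \<union> \<Gamma>R)"


section \<open>Meshes\<close>

text \<open>A polygon is given by its cyclic list of vertices. The interior angle at a vertex may be
  $\pi$, so that hanging nodes count as vertices.\<close>

type_synonym polygon = "pt list"

definition edge :: "polygon \<Rightarrow> nat \<Rightarrow> seg" where
  "edge K i = (K ! i, K ! (Suc i mod length K))"

definition edges :: "polygon \<Rightarrow> seg set" where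
  "edges K = edge K ` {..<length K}"

definition simple_polygon :: "polygon \<Rightarrow> bool" where
  "simple_polygon K \<longleftrightarrow> length K \<ge> 3 \<and> distinct K \<and>
     pairwise (\<lambda>e e'. seg_set e \<inter> seg_set e' \<subseteq> {fst e, snd e} \<inter> {fst e', snd e'}) (edges K)"

definition region :: "polygon \<Rightarrow> pt set" where
  "region K = inside (\<Union>(seg_set ` edges K))"

type_synonym mesh = "polygon set"

definition decomposition :: "pt set \<Rightarrow> mesh \<Rightarrow> bool" where
  "decomposition \<Omega> \<T> \<longleftrightarrow> finite \<T> \<and> (\<forall>K\<in>\<T>. simple_polygon K \<and> region K \<subseteq> \<Omega>) \<and>
     pairwise (\<lambda>K K'. region K \<inter> region K' = {}) \<T> \<and>
     closure \<Omega> = (\<Union>K\<in>\<T>. closure (region K))"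

definition matches_boundary :: "pt set \<Rightarrow> seg set \<Rightarrow> seg set \<Rightarrow> seg set \<Rightarrow> mesh \<Rightarrow> bool" where
  "matches_boundary \<Omega> \<Gamma>D \<Gamma>N \<Gamma>R \<T> \<longleftrightarrow>
     (\<forall>K\<in>\<T>. \<forall>e\<in>edges K. seg_interior e \<subseteq> \<Omega> \<or>
        (\<exists>\<Gamma>\<in>{\<Gamma>D, \<Gamma>N, \<Gamma>R}. seg_set e \<subseteq> \<Union>(seg_set ` \<Gamma>)))"

definition diam :: "polygon \<Rightarrow> real" where
  "diam K = diameter (region K)"

definition mesh_size :: "mesh \<Rightarrow> real" where
  "mesh_size \<T> = (SUP K\<in>\<T>. diam K)"

definition star_shaped_wrt :: "pt set \<Rightarrow> pt set \<Rightarrow> bool" where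
  "star_shaped_wrt E B \<longleftrightarrow> B \<subseteq> E \<and> (\<forall>z\<in>B. \<forall>y\<in>E. closed_segment z y \<subseteq> E)"

definition regular_mesh :: "real \<Rightarrow> mesh \<Rightarrow> bool" where
  "regular_mesh \<rho> \<T> \<longleftrightarrow>
     (\<forall>K\<in>\<T>. (\<exists>x r. r \<ge> \<rho> * diam K \<and> star_shaped_wrt (region K) (ball x r)) \<and>
            (\<forall>e\<in>edges K. seg_length e \<ge> \<rho> * diam K))"


section \<open>Polynomials, broken spaces and projections\<close>

text \<open>Polynomial functions of total degree at most \<open>n\<close>; for $n = -1$ this is the zero space.
  Polynomials on a region or an edge are restrictions of these.\<close>

definition poly_fun :: "int \<Rightarrow> (pt \<Rightarrow> real) set" where
  "poly_fun n = {p. \<exists>a. p = (\<lambda>x. \<Sum>(i, j)\<in>{(i, j). int (i + j) \<le> n}. a i j * (x $ 1) ^ i * (x $ 2) ^ j)}"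

definition broken_poly :: "nat \<Rightarrow> pt set \<Rightarrow> mesh \<Rightarrow> (pt \<Rightarrow> real) set" where
  "broken_poly k \<Omega> \<T> = {q \<in> L2 \<Omega>. \<forall>K\<in>\<T>. \<exists>p\<in>poly_fun (int k). AE x in lebesgue_on (region K). q x = p x}"

definition broken_sobolev :: "nat \<Rightarrow> pt set \<Rightarrow> mesh \<Rightarrow> (pt \<Rightarrow> real) set" where
  "broken_sobolev s \<Omega> \<T> = {f \<in> L2 \<Omega>. \<forall>K\<in>\<T>. f \<in> sobolev s (region K)}"

definition broken_seminorm :: "nat \<Rightarrow> mesh \<Rightarrow> (pt \<Rightarrow> real) \<Rightarrow> real" where
  "broken_seminorm s \<T> f = sqrt (\<Sum>K\<in>\<T>. (sobolev_seminorm s (region K) f)\<^sup>2)"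

definition broken_sobolev_vec :: "nat \<Rightarrow> pt set \<Rightarrow> mesh \<Rightarrow> (pt \<Rightarrow> pt) set" where
  "broken_sobolev_vec s \<Omega> \<T> = {v. \<forall>l. (\<lambda>x. v x $ l) \<in> broken_sobolev s \<Omega> \<T>}"

definition broken_seminorm_vec :: "nat \<Rightarrow> mesh \<Rightarrow> (pt \<Rightarrow> pt) \<Rightarrow> real" where
  "broken_seminorm_vec s \<T> v = sqrt (\<Sum>l\<in>UNIV. (broken_seminorm s \<T> (\<lambda>x. v x $ l))\<^sup>2)"

definition proj :: "nat \<Rightarrow> polygon \<Rightarrow> (pt \<Rightarrow> real) \<Rightarrow> (pt \<Rightarrow> real)" where
  "proj k K f = (THE p. p \<in> poly_fun (int k) \<and>
     (\<forall>q\<in>poly_fun (int k). L2_inner (region K) (\<lambda>x. f x - p x) q = 0))"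

definition proj_vec :: "nat \<Rightarrow> polygon \<Rightarrow> (pt \<Rightarrow> pt) \<Rightarrow> (pt \<Rightarrow> pt)" where
  "proj_vec k K v x = (\<chi> l. proj k K (\<lambda>y. v y $ l) x)"

definition global_proj :: "nat \<Rightarrow> mesh \<Rightarrow> (pt \<Rightarrow> real) \<Rightarrow> (pt \<Rightarrow> real)" where
  "global_proj k \<T> f x = (\<Sum>K\<in>\<T>. indicator (region K) x * proj k K f x)"

definition global_proj_vec :: "nat \<Rightarrow> mesh \<Rightarrow> (pt \<Rightarrow> pt) \<Rightarrow> (pt \<Rightarrow> pt)" where
  "global_proj_vec k \<T> v x = (\<Sum>K\<in>\<T>. indicator (region K) x *\<^sub>R proj_vec k K v x)"


section \<open>Virtual element spaces\<close>

definition V_local :: "nat \<Rightarrow> polygon \<Rightarrow> (pt \<Rightarrow> pt) set" where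
  "V_local k K = {v \<in> Hdiv (region K) \<inter> Hcurl (region K).
     (\<exists>d\<in>poly_fun (int k). has_weak_div (region K) v d) \<and>
     (\<exists>r\<in>poly_fun (int k - 1). has_weak_curl (region K) v r) \<and>
     (\<forall>e\<in>edges K. \<exists>g\<in>poly_fun (int k). has_normal_trace (region K) {e} v g)}"

definition V_space :: "pt set \<Rightarrow> seg set \<Rightarrow> (pt \<Rightarrow> pt) set" where
  "V_space \<Omega> \<Gamma>N = {v \<in> Hdiv \<Omega>. has_normal_trace \<Omega> \<Gamma>N v (\<lambda>_. 0)}"

definition V_discrete :: "nat \<Rightarrow> pt set \<Rightarrow> seg set \<Rightarrow> mesh \<Rightarrow> (pt \<Rightarrow> pt) set" where
  "V_discrete k \<Omega> \<Gamma>N \<T> = {v \<in> V_space \<Omega> \<Gamma>N. \<forall>K\<in>\<T>. v \<in> V_local k K}"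


section \<open>Degrees of freedom and the discrete form\<close>

text \<open>A vector of degrees of freedom is fixed by choosing, on each element and edge, bases of the
  polynomial spaces against which the moments are taken. Multiplying a basis element by a constant
  rescales the corresponding degree of freedom, so the scaling is part of this choice.\<close>

record dof_bases =
  div_basis :: "polygon \<Rightarrow> (pt \<Rightarrow> real) set"
  curl_basis :: "polygon \<Rightarrow> (pt \<Rightarrow> real) set"
  edge_basis :: "polygon \<Rightarrow> seg \<Rightarrow> (pt \<Rightarrow> real) set"

definition is_basis_on :: "pt set \<Rightarrow> (pt \<Rightarrow> real) set \<Rightarrow> (pt \<Rightarrow> real) set \<Rightarrow> bool" where
  "is_basis_on A B P \<longleftrightarrow> finite B \<and> B \<subseteq> P \<and>
     (\<forall>p\<in>P. \<exists>!a. (\<forall>b. b \<notin> B \<longrightarrow> a b = 0) \<and> (\<forall>x\<in>A. p x = (\<Sum>b\<in>B. a b * b x)))"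

text \<open>The divergence moments are taken against polynomials modulo constants.\<close>

definition dof_choice :: "nat \<Rightarrow> mesh \<Rightarrow> dof_bases \<Rightarrow> bool" where
  "dof_choice k \<T> \<B> \<longleftrightarrow> (\<forall>K\<in>\<T>.
     (\<lambda>_. 1) \<notin> div_basis \<B> K \<and>
     is_basis_on (region K) (insert (\<lambda>_. 1) (div_basis \<B> K)) (poly_fun (int k)) \<and>
     is_basis_on (region K) (curl_basis \<B> K) (poly_fun (int k - 1)) \<and>
     (\<forall>e\<in>edges K. is_basis_on (seg_set e) (edge_basis \<B> K e) (poly_fun (int k))))"

definition perp :: "pt \<Rightarrow> pt" where
  "perp x = vector [x $ 2, - x $ 1]"

definition div_moment :: "polygon \<Rightarrow> (pt \<Rightarrow> real) \<Rightarrow> (pt \<Rightarrow> pt) \<Rightarrow> real" where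
  "div_moment K p w = L2_inner (region K) (weak_div (region K) w) p"

definition curl_moment :: "polygon \<Rightarrow> (pt \<Rightarrow> real) \<Rightarrow> (pt \<Rightarrow> pt) \<Rightarrow> real" where
  "curl_moment K p w = L2_inner (region K) w (\<lambda>x. p x *\<^sub>R perp x)"

definition edge_moment :: "polygon \<Rightarrow> seg \<Rightarrow> (pt \<Rightarrow> real) \<Rightarrow> (pt \<Rightarrow> pt) \<Rightarrow> real" where
  "edge_moment K e p w = seg_integral e (\<lambda>x. normal_trace (region K) {e} w x * p x)"

definition dof_product :: "dof_bases \<Rightarrow> polygon \<Rightarrow> (pt \<Rightarrow> pt) \<Rightarrow> (pt \<Rightarrow> pt) \<Rightarrow> real" where
  "dof_product \<B> K v w =
     (\<Sum>p\<in>div_basis \<B> K. div_moment K p v * div_moment K p w) +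
     (\<Sum>p\<in>curl_basis \<B> K. curl_moment K p v * curl_moment K p w) +
     (\<Sum>e\<in>edges K. \<Sum>p\<in>edge_basis \<B> K e. edge_moment K e p v * edge_moment K e p w)"

definition properly_scaled :: "nat \<Rightarrow> mesh \<Rightarrow> real \<Rightarrow> real \<Rightarrow> dof_bases \<Rightarrow> bool" where
  "properly_scaled k \<T> C\<^sub>1 C\<^sub>2 \<B> \<longleftrightarrow> (\<forall>K\<in>\<T>. \<forall>v\<in>V_local k K. (\<forall>x. proj_vec k K v x = 0) \<longrightarrow>
     C\<^sub>1 * (L2_norm (region K) v)\<^sup>2 \<le> (diam K)\<^sup>2 * dof_product \<B> K v v \<and>
     (diam K)\<^sup>2 * dof_product \<B> K v v \<le> C\<^sub>2 * (L2_norm (region K) v)\<^sup>2)"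

definition m_local :: "nat \<Rightarrow> dof_bases \<Rightarrow> polygon \<Rightarrow> (pt \<Rightarrow> pt) \<Rightarrow> (pt \<Rightarrow> pt) \<Rightarrow> real" where
  "m_local k \<B> K v w =
     L2_inner (region K) (proj_vec k K v) (proj_vec k K w) +
     (diam K)\<^sup>2 * dof_product \<B> K (\<lambda>x. v x - proj_vec k K v x) (\<lambda>x. w x - proj_vec k K w x)"

definition m_h :: "nat \<Rightarrow> dof_bases \<Rightarrow> mesh \<Rightarrow> (pt \<Rightarrow> pt) \<Rightarrow> (pt \<Rightarrow> pt) \<Rightarrow> real" where
  "m_h k \<B> \<T> v w = (\<Sum>K\<in>\<T>. m_local k \<B> K v w)"


section \<open>Functions of time\<close>

definition strongly_measurable ::
    "real \<Rightarrow> (pt \<Rightarrow> 'b::euclidean_space) set \<Rightarrow> ((pt \<Rightarrow> 'b) \<Rightarrow> real) \<Rightarrow> (real \<Rightarrow> pt \<Rightarrow> 'b) \<Rightarrow> bool" where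
  "strongly_measurable T X N u \<longleftrightarrow>
     (\<exists>s :: nat \<Rightarrow> real \<Rightarrow> pt \<Rightarrow> 'b.
        (\<forall>n. finite (s n ` {0<..<T}) \<and> s n ` {0<..<T} \<subseteq> X \<and>
             (\<forall>y. {t \<in> {0<..<T}. s n t = y} \<in> sets lebesgue)) \<and>
        (AE t in lebesgue_on {0<..<T}. (\<lambda>n. N (\<lambda>x. u t x - s n t x)) \<longlonglongrightarrow> 0))"

text \<open>$L^2(0,T;X)$ and $C^0([0,T];X)$ for a function space \<open>X\<close> with norm \<open>N\<close>.\<close>

definition L2_time ::
    "real \<Rightarrow> (pt \<Rightarrow> 'b::euclidean_space) set \<Rightarrow> ((pt \<Rightarrow> 'b) \<Rightarrow> real) \<Rightarrow> (real \<Rightarrow> pt \<Rightarrow> 'b) set" where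
  "L2_time T X N = {u. strongly_measurable T X N u \<and>
     (AE t in lebesgue_on {0<..<T}. u t \<in> X) \<and>
     integrable (lebesgue_on {0<..<T}) (\<lambda>t. (N (u t))\<^sup>2)}"

definition C0_time ::
    "real \<Rightarrow> (pt \<Rightarrow> 'b::euclidean_space) set \<Rightarrow> ((pt \<Rightarrow> 'b) \<Rightarrow> real) \<Rightarrow> (real \<Rightarrow> pt \<Rightarrow> 'b) set" where
  "C0_time T X N = {u. \<forall>t\<in>{0..T}. u t \<in> X \<and>
     ((\<lambda>s. N (\<lambda>x. u s x - u t x)) \<longlongrightarrow> 0) (at t within {0..T})}"

definition has_weak_time_deriv :: "real \<Rightarrow> (real \<Rightarrow> real) \<Rightarrow> (real \<Rightarrow> real) \<Rightarrow> bool" where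
  "has_weak_time_deriv T g g' \<longleftrightarrow>
     integrable (lebesgue_on {0<..<T}) g \<and> integrable (lebesgue_on {0<..<T}) g' \<and>
     (\<forall>\<psi>\<in>test_functions {0<..<T}.
        (\<integral>t. g t * deriv \<psi> t \<partial>lebesgue_on {0<..<T}) = - (\<integral>t. g' t * \<psi> t \<partial>lebesgue_on {0<..<T}))"


section \<open>The continuous and the semi-discrete problem\<close>

definition m_form :: "pt set \<Rightarrow> (pt \<Rightarrow> pt) \<Rightarrow> (pt \<Rightarrow> pt) \<Rightarrow> real" where
  "m_form \<Omega> u v = L2_inner \<Omega> u v"

definition n_form :: "pt set \<Rightarrow> (pt \<Rightarrow> real) \<Rightarrow> (pt \<Rightarrow> real) \<Rightarrow> (pt \<Rightarrow> real) \<Rightarrow> real" where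
  "n_form \<Omega> c p q = L2_inner \<Omega> (\<lambda>x. p x / (c x)\<^sup>2) q"

definition b_form :: "pt set \<Rightarrow> (pt \<Rightarrow> pt) \<Rightarrow> (pt \<Rightarrow> real) \<Rightarrow> real" where
  "b_form \<Omega> v q = L2_inner \<Omega> (weak_div \<Omega> v) q"

text \<open>The boundary values of the piecewise constant \<open>c\<close> are its limits from inside $\Omega$.
  On a nonempty \<open>\<Gamma>R\<close> this form requires fields with square integrable normal trace there.\<close>

definition r_form :: "pt set \<Rightarrow> seg set \<Rightarrow> (pt \<Rightarrow> real) \<Rightarrow> (pt \<Rightarrow> pt) \<Rightarrow> (pt \<Rightarrow> pt) \<Rightarrow> real" where
  "r_form \<Omega> \<Gamma>R c u v = (\<Sum>e\<in>\<Gamma>R. seg_integral e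
     (\<lambda>x. Lim (at x within \<Omega>) c * normal_trace \<Omega> \<Gamma>R u x * normal_trace \<Omega> \<Gamma>R v x))"

definition F_form :: "pt set \<Rightarrow> (pt \<Rightarrow> real) \<Rightarrow> (pt \<Rightarrow> real) \<Rightarrow> real" where
  "F_form \<Omega> f q = L2_inner \<Omega> f q"

text \<open>The velocity of a weak solution need not be differentiable in time with values in $L^2$:
  $m(u_t, v)$ is the distributional derivative of $m(u(\cdot), v)$ on $(0,T)$, and similarly for
  the other terms with time derivatives. The part \<open>\<Gamma>D\<close> carries a natural condition and does
  not enter.\<close>

definition weak_solution ::
    "pt set \<Rightarrow> seg set \<Rightarrow> seg set \<Rightarrow> (pt \<Rightarrow> real) \<Rightarrow> real \<Rightarrow> (real \<Rightarrow> pt \<Rightarrow> real) \<Rightarrow>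
     (pt \<Rightarrow> pt) \<Rightarrow> (pt \<Rightarrow> real) \<Rightarrow> (real \<Rightarrow> pt \<Rightarrow> pt) \<Rightarrow> (real \<Rightarrow> pt \<Rightarrow> real) \<Rightarrow> bool" where
  "weak_solution \<Omega> \<Gamma>N \<Gamma>R c T f u\<^sub>0 p\<^sub>0 u p \<longleftrightarrow>
     u \<in> L2_time T (V_space \<Omega> \<Gamma>N) (Hdiv_norm \<Omega>) \<inter> C0_time T (L2 \<Omega>) (L2_norm \<Omega>) \<and>
     p \<in> L2_time T (L2 \<Omega>) (L2_norm \<Omega>) \<inter> C0_time T (L2 \<Omega>) (L2_norm \<Omega>) \<and>
     (\<forall>v\<in>V_space \<Omega> \<Gamma>N. has_weak_time_deriv T
        (\<lambda>t. m_form \<Omega> (u t) v) (\<lambda>t. - b_form \<Omega> v (p t) - r_form \<Omega> \<Gamma>R c (u t) v)) \<and>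
     (\<forall>q\<in>L2 \<Omega>. has_weak_time_deriv T
        (\<lambda>t. n_form \<Omega> c (p t) q) (\<lambda>t. b_form \<Omega> (u t) q + F_form \<Omega> (f t) q)) \<and>
     (AE x in lebesgue_on \<Omega>. u 0 x = u\<^sub>0 x) \<and>
     (AE x in lebesgue_on \<Omega>. p 0 x = p\<^sub>0 x)"

definition vem_solution ::
    "nat \<Rightarrow> dof_bases \<Rightarrow> mesh \<Rightarrow> pt set \<Rightarrow> seg set \<Rightarrow> seg set \<Rightarrow> (pt \<Rightarrow> real) \<Rightarrow> real \<Rightarrow>
     (real \<Rightarrow> pt \<Rightarrow> real) \<Rightarrow> (pt \<Rightarrow> pt) \<Rightarrow> (pt \<Rightarrow> real) \<Rightarrow>
     (real \<Rightarrow> pt \<Rightarrow> pt) \<Rightarrow> (real \<Rightarrow> pt \<Rightarrow> real) \<Rightarrow> bool" where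
  "vem_solution k \<B> \<T> \<Omega> \<Gamma>N \<Gamma>R c T f u\<^sub>0 p\<^sub>0 u\<^sub>h p\<^sub>h \<longleftrightarrow>
     u\<^sub>h \<in> L2_time T (V_discrete k \<Omega> \<Gamma>N \<T>) (Hdiv_norm \<Omega>) \<inter> C0_time T (L2 \<Omega>) (L2_norm \<Omega>) \<and>
     p\<^sub>h \<in> L2_time T (broken_poly k \<Omega> \<T>) (L2_norm \<Omega>) \<inter> C0_time T (broken_poly k \<Omega> \<T>) (L2_norm \<Omega>) \<and>
     (\<forall>v\<in>V_discrete k \<Omega> \<Gamma>N \<T>. has_weak_time_deriv T
        (\<lambda>t. m_h k \<B> \<T> (u\<^sub>h t) v) (\<lambda>t. - b_form \<Omega> v (p\<^sub>h t) - r_form \<Omega> \<Gamma>R c (u\<^sub>h t) v)) \<and>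
     (\<forall>q\<in>broken_poly k \<Omega> \<T>. has_weak_time_deriv T
        (\<lambda>t. n_form \<Omega> c (p\<^sub>h t) q) (\<lambda>t. b_form \<Omega> (u\<^sub>h t) q + F_form \<Omega> (f t) q)) \<and>
     (AE x in lebesgue_on \<Omega>. u\<^sub>h 0 x = global_proj_vec k \<T> u\<^sub>0 x) \<and>
     (AE x in lebesgue_on \<Omega>. p\<^sub>h 0 x = global_proj k \<T> p\<^sub>0 x)"

definition energy_norm :: "pt set \<Rightarrow> (pt \<Rightarrow> real) \<Rightarrow> (pt \<Rightarrow> pt) \<Rightarrow> (pt \<Rightarrow> real) \<Rightarrow> real" where
  "energy_norm \<Omega> c v q = sqrt ((L2_norm \<Omega> v)\<^sup>2 + (L2_norm \<Omega> (\<lambda>x. inverse (c x) * q x))\<^sup>2)"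

definition discrete_energy_norm ::
    "nat \<Rightarrow> dof_bases \<Rightarrow> mesh \<Rightarrow> pt set \<Rightarrow> (pt \<Rightarrow> real) \<Rightarrow> (pt \<Rightarrow> pt) \<Rightarrow> (pt \<Rightarrow> real) \<Rightarrow> real" where
  "discrete_energy_norm k \<B> \<T> \<Omega> c v q =
     sqrt (m_h k \<B> \<T> v v + (L2_norm \<Omega> (\<lambda>x. inverse (c x) * q x))\<^sup>2)"

definition c_hat :: "pt set \<Rightarrow> real \<Rightarrow> (pt \<Rightarrow> real) \<Rightarrow> real" where
  "c_hat \<Omega> T c = real_of_ereal
     (esssup (lebesgue_on (\<Omega> \<times> {0<..<T})) (\<lambda>(x, t). ereal \<bar>inverse (c x)\<bar>))"

end

theory Submission
  imports Defs "HOL-Computational_Algebra.Polynomial"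
begin

text \<open>Without sources and without an absorbing boundary part, both evolutions conserve their energy: tested
with the solution itself, the two equations have opposite \<open>b\<close> terms. So the energy error at time
\<open>t\<close> is the energy error at time \<open>0\<close>. There the discrete data are the elementwise $L^2$ projections
of \<open>u\<^sub>0\<close> and \<open>p\<^sub>0\<close> onto polynomials. The stabilisation acts only on the part of a field that the
projection annihilates, hence \<open>m_h\<close> is the $L^2$ product on such data, and Pythagoras on each element
turns the initial error into
$\sum_E \|u_0-\Pi u_0\|_{0,E}^2 + c_E^{-2}\|p_0-\Pi p_0\|_{0,E}^2$ (\<open>energy_error\<close>). This is
nonnegative, and polynomial approximation on regions that are star-shaped with respect to a ball
bounds it by the right-hand side (\<open>proj_error_bound\<close>, \<open>energy_error_bound\<close>).

Four points of this argument need work.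

\<^item> The solution cannot be inserted as a test function into its own equation, since $m(u_t,v)$ is only
  a distributional derivative for fixed \<open>v\<close>. Instead, time is doubled. With $M(s,t)=m(u(s),u(t))$,
  $N(s,t)=n(p(s),p(t))$ and $B(s,t)=b(u(s),p(t))$ the equations read $\partial_t M=-B$ and
  $\partial_s N=B$ on the square $(0,T)^2$. By symmetry of \<open>m\<close> and \<open>n\<close> also
  $\partial_s M+\partial_t N=0$, so $(\partial_s+\partial_t)(M+N)=0$ in the weak sense, and \<open>M + N\<close>
  is constant along the diagonal (\<open>conservation_interior\<close>, \<open>energy_conserved\<close>).

\<^item> The discrete velocity belongs to the virtual element space at almost every time only, while linearity
  and continuity of \<open>m_h\<close> are properties on that space. The space is separated by finitely many
  functionals, hence closed, so that continuity in time extends the membership to every time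
  (\<open>proximal_functionals\<close>, \<open>V_discrete_closed\<close>).

\<^item> Linearity and boundedness of \<open>m_h\<close> require $v-\Pi v$ to belong to the local space, hence polynomial
  fields must have polynomial normal traces in the sense of the duality definition. This is Green's
  formula at one straight edge of an otherwise unspecified open set (\<open>green_at_edge\<close>, \<open>poly_V_local\<close>).

\<^item> The approximation constant may depend on the shape of an element through \<open>\<rho>\<close> only. It comes from
  iterating a Poincare inequality on star-shaped sets, which is obtained by comparing the values at
  two points with the value at their midpoint (\<open>poincare\<close>, \<open>bramble_hilbert\<close>).\<close>

section \<open>Smooth functions and test functions\<close>

definition smooth :: "('a::euclidean_space => real) => bool" where
 "smooth f \<longleftrightarrow> (\<forall>n. C_k n f)"

lemma pd_eq: "(f has_derivative f') (at x) ==> pd b f x = f' b"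
 unfolding pd_def using frechet_derivative_at by metis

lemma C_k_imp_continuous: "C_k n f ==> continuous_on UNIV f"
 by (cases n) (auto simp: differentiable_imp_continuous_within continuous_on_eq_continuous_within)

lemma C_k_SucD: "C_k (Suc n) f ==> C_k n f"
proof (induction n arbitrary: f)
 case 0
 then show ?case using C_k_imp_continuous[of "Suc 0" f] by simp
qed auto

lemma smooth_differentiable: "smooth f ==> f differentiable (at x)"
 unfolding smooth_def by (metis C_k.simps(2))

lemma smooth_has_derivative: "smooth f ==> (f has_derivative (\<lambda>h. pd h f x)) (at x)"
 unfolding pd_def using smooth_differentiable frechet_derivative_works by blast

lemma smooth_continuous: "smooth f ==> continuous_on A f"
 unfolding smooth_def using C_k_imp_continuous continuous_on_subset by blast

lemma smooth_pd: "smooth f ==> b \<in> Basis ==> smooth (pd b f)"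
 unfolding smooth_def by (metis C_k.simps(2))

lemma smooth_pd_linear: "smooth f ==> linear (\<lambda>b. pd b f x)"
 using smooth_has_derivative has_derivative_linear by blast

lemma C_k_const: "C_k n (\<lambda>x::'a::euclidean_space. c)"
proof (induction n arbitrary: c)
 case (Suc n)
 have "pd b (\<lambda>x::'a. c) = (\<lambda>x. 0)" for b
  by (rule ext, subst pd_eq[OF has_derivative_const]) simp
 then show ?case using Suc by simp
qed simp

lemma pd_plus:
 assumes "f differentiable (at x)" "g differentiable (at x)"
 shows "pd b (\<lambda>x. f x + g x) x = pd b f x + pd b g x"
proof -
 from has_derivative_add[OF assms[unfolded frechet_derivative_works]]
 show ?thesis by (subst pd_eq) (auto simp: pd_def)
qed

lemma C_k_add: "C_k n f ==> C_k n g ==> C_k n (\<lambda>x. f x + g x)"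
proof (induction n arbitrary: f g)
 case 0 then show ?case by (auto intro: continuous_on_add)
next
 case (Suc n)
 have "pd b (\<lambda>x. f x + g x) = (\<lambda>x. pd b f x + pd b g x)" for b
  using Suc.prems by (intro ext pd_plus) auto
 then show ?case using Suc by (auto intro!: differentiable_add)
qed

lemma pd_mult: "f differentiable (at x) ==> g differentiable (at x) ==>
  pd b (\<lambda>x. f x * g x :: real) x = f x * pd b g x + pd b f x * g x"
 unfolding pd_def frechet_derivative_works
 by (subst pd_eq[unfolded pd_def, OF has_derivative_mult]) auto

lemma C_k_mult: "C_k n f ==> C_k n g ==> C_k n (\<lambda>x. f x * g x)"
proof (induction n arbitrary: f g)
 case 0 then show ?case by (auto intro: continuous_on_mult)
next
 case (Suc n)
 have "pd b (\<lambda>x. f x * g x) = (\<lambda>x. f x * pd b g x + pd b f x * g x)" for b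
  using Suc.prems by (auto simp: pd_mult)
 then show ?case using Suc C_k_SucD[OF Suc.prems(1)] C_k_SucD[OF Suc.prems(2)]
  by (auto intro!: differentiable_mult C_k_add)
qed

lemma C_k_uminus: "C_k n f ==> C_k n (\<lambda>x. - f x)"
 using C_k_mult[OF C_k_const[of n "-1"], of f] by simp

text \<open>The derivative of \<open>1 / f\<close> is again built from \<open>1 / f\<close> and a derivative of \<open>f\<close>, which allows an
 induction on the order of smoothness.\<close>

lemma C_k_inverse: "C_k n f ==> (\<And>x. f x \<noteq> 0) ==> C_k n (\<lambda>x. inverse (f x))"
proof (induction n arbitrary: f)
 case 0 then show ?case by (auto intro: continuous_on_inverse)
next
 case (Suc n)
 have "pd b (\<lambda>x. inverse (f x)) = (\<lambda>x. (-1) * (inverse (f x) * pd b f x * inverse (f x)))" for b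
 proof
  fix x
  have "(f has_derivative frechet_derivative f (at x)) (at x)"
   using Suc.prems frechet_derivative_works by auto
  from Deriv.has_derivative_inverse[OF Suc.prems(2) this]
  show "pd b (\<lambda>x. inverse (f x)) x = (-1) * (inverse (f x) * pd b f x * inverse (f x))"
   by (subst pd_eq) (auto simp: pd_def)
 qed
 moreover have "(\<lambda>x. inverse (f x)) differentiable at x" for x
  using Suc.prems by (intro differentiable_inverse) auto
 ultimately show ?case using Suc C_k_SucD[OF Suc.prems(1)]
  by (auto intro!: C_k_mult C_k_const C_k_uminus)
qed

lemma C_k_sum: "finite A ==> (\<And>i. i \<in> A ==> C_k n (f i)) ==> C_k n (\<lambda>x. \<Sum>i\<in>A. f i x)"
 by (induction A rule: finite_induct) (auto intro: C_k_add C_k_const)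

lemma C_k_prod: "finite A ==> (\<And>i. i \<in> A ==> C_k n (f i)) ==> C_k n (\<lambda>x. \<Prod>i\<in>A. f i x)"
 by (induction A rule: finite_induct) (auto intro: C_k_mult C_k_const)

lemma C_k_bounded_linear: "bounded_linear f ==> C_k n f"
proof (cases n)
 case (Suc m)
 assume f: "bounded_linear f"
 have "pd b f = (\<lambda>x. f b)" for b
  by (rule ext, subst pd_eq[OF bounded_linear_imp_has_derivative[OF f]]) simp
 then show ?thesis using Suc f by (auto intro: C_k_const bounded_linear_imp_differentiable)
qed (simp add: linear_continuous_on)

lemma pd_Basis_sum:
 assumes "f differentiable (at x)"
 shows "pd h f x = (\<Sum>b\<in>Basis. (h \<bullet> b) * pd b f x)"
proof -
 have l: "linear (frechet_derivative f (at x))"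
  using assms by (rule linear_frechet_derivative)
 have "frechet_derivative f (at x) h = frechet_derivative f (at x) (\<Sum>b\<in>Basis. (h \<bullet> b) *\<^sub>R b)"
  by (simp add: euclidean_representation)
 also have "\<dots> = (\<Sum>b\<in>Basis. (h \<bullet> b) * frechet_derivative f (at x) b)"
  using l by (simp add: linear_sum linear_cmul)
 finally show ?thesis by (simp add: pd_def)
qed

lemma pd_compose_affine:
 assumes "bounded_linear L" "f differentiable (at (L x + c))"
 shows "pd b (\<lambda>x. f (L x + c)) x = pd (L b) f (L x + c)"
  and "(\<lambda>x. f (L x + c)) differentiable (at x)"
proof -
 have "((\<lambda>x. L x + c) has_derivative L) (at x)"
  using has_derivative_add[OF bounded_linear_imp_has_derivative[OF assms(1)] has_derivative_const]
  by simp
 moreover have "(f has_derivative frechet_derivative f (at (L x + c))) (at (L x + c))"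
  using assms(2) frechet_derivative_works by blast
 ultimately have d: "((\<lambda>x. f (L x + c)) has_derivative (\<lambda>h. frechet_derivative f (at (L x + c)) (L h))) (at x)"
  by (rule has_derivative_compose)
 show "pd b (\<lambda>x. f (L x + c)) x = pd (L b) f (L x + c)"
  by (subst pd_eq[OF d]) (simp add: pd_def)
 show "(\<lambda>x. f (L x + c)) differentiable (at x)" using d by (auto simp: differentiable_def)
qed

lemma C_k_compose_affine:
 assumes "bounded_linear L"
 shows "C_k n f ==> C_k n (\<lambda>x. f (L x + c))"
proof (induction n arbitrary: f)
 case 0
 have "continuous_on UNIV (\<lambda>x. L x + c)"
  using assms by (intro continuous_intros linear_continuous_on)
 with 0 show ?case by (auto intro: continuous_on_compose2)
next
 case (Suc n)
 then have d: "f differentiable at y" for y by simp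
 have "pd b (\<lambda>x. f (L x + c)) = (\<lambda>x. \<Sum>b'\<in>Basis. (L b \<bullet> b') * pd b' f (L x + c))" for b
  by (rule ext) (simp add: pd_compose_affine[OF assms d] pd_Basis_sum[OF d, of "L b"])
 then show ?case using Suc pd_compose_affine[OF assms d]
  by (auto intro!: C_k_sum C_k_mult C_k_const)
qed

lemma smooth_const: "smooth (\<lambda>x::'a::euclidean_space. c)"
 and smooth_add: "smooth f ==> smooth g ==> smooth (\<lambda>x. f x + g x)"
 and smooth_mult: "smooth f ==> smooth g ==> smooth (\<lambda>x. f x * g x)"
 and smooth_inverse: "smooth f ==> (\<And>x. f x \<noteq> 0) ==> smooth (\<lambda>x. inverse (f x))"
 and smooth_sum: "finite A ==> (\<And>i. i \<in> A ==> smooth (F i)) ==> smooth (\<lambda>x. \<Sum>i\<in>A. F i x)"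
 and smooth_prod: "finite A ==> (\<And>i. i \<in> A ==> smooth (F i)) ==> smooth (\<lambda>x. \<Prod>i\<in>A. F i x)"
 and smooth_linear: "bounded_linear f ==> smooth f"
 for f :: "'a::euclidean_space => real" and F :: "'i => 'a::euclidean_space => real"
 unfolding smooth_def
 by (auto intro: C_k_const C_k_add C_k_mult C_k_inverse C_k_sum C_k_prod C_k_bounded_linear)

lemma smooth_compose_affine: "bounded_linear L ==> smooth f ==> smooth (\<lambda>x. f (L x + c))"
 unfolding smooth_def by (auto intro: C_k_compose_affine)

lemma smooth_cmult: "smooth f ==> smooth (\<lambda>x. c * f x)"
 by (intro smooth_mult smooth_const)

lemma smooth_uminus: "smooth f ==> smooth (\<lambda>x. - f x)"
 using smooth_cmult[of f "-1"] by simp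

lemma smooth_diff: "smooth f ==> smooth g ==> smooth (\<lambda>x. f x - g x)"
 using smooth_add[of f "\<lambda>x. - g x"] smooth_uminus[of g] by simp

lemma smooth_power: "smooth f ==> smooth (\<lambda>x. f x ^ n)"
 by (induction n) (auto intro: smooth_const smooth_mult)

lemma smooth_nth: "smooth (\<lambda>x::real^'n. x $ i)"
 by (rule smooth_linear) (simp add: bounded_linear_vec_nth)

lemma smooth_real_polynomial_function: "real_polynomial_function f ==> smooth f"
 by (induction f rule: real_polynomial_function.induct)
   (auto intro: smooth_linear smooth_const smooth_add smooth_mult)

lemma pd_add: "smooth f ==> smooth g ==> pd b (\<lambda>x. f x + g x) x = pd b f x + pd b g x"
 by (simp add: pd_plus smooth_differentiable)

lemma pd_cmult: "smooth f ==> pd b (\<lambda>x. c * f x) x = c * pd b f x"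
 by (subst pd_mult) (auto simp: smooth_differentiable pd_eq[OF has_derivative_const])

lemma pd_const: "pd b (\<lambda>x. c) x = 0"
 by (subst pd_eq[OF has_derivative_const]) simp

text \<open>By the mean value theorem the second difference quotient is a mixed derivative at a nearby point.
 Its symmetry in \<open>a\<close> and \<open>b\<close> identifies the two mixed derivatives.\<close>

lemma second_difference:
 assumes f: "smooth f" and a: "a \<in> Basis" and b: "b \<in> Basis" and h: "h > 0"
 shows "\<exists>s r. 0 < s \<and> s < h \<and> 0 < r \<and> r < h \<and>
  f (x + h *\<^sub>R a + h *\<^sub>R b) - f (x + h *\<^sub>R a) - f (x + h *\<^sub>R b) + f x
   = h * h * pd b (pd a f) (x + s *\<^sub>R a + r *\<^sub>R b)"
proof -
 have line: "((\<lambda>t. g (y + t *\<^sub>R v)) has_real_derivative pd v g (y + t *\<^sub>R v)) (at t)"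
  if "smooth g" for g v y and t :: real
 proof -
  have "((\<lambda>t. y + t *\<^sub>R v) has_derivative (\<lambda>t. t *\<^sub>R v)) (at t)"
   by (auto intro!: derivative_eq_intros)
  from has_derivative_compose[OF this smooth_has_derivative[OF that]]
  have d: "((\<lambda>t. g (y + t *\<^sub>R v)) has_derivative (\<lambda>t'. pd (t' *\<^sub>R v) g (y + t *\<^sub>R v))) (at t)" .
  moreover have "(\<lambda>t'. pd (t' *\<^sub>R v) g (y + t *\<^sub>R v)) = (*) (pd v g (y + t *\<^sub>R v))"
   using linear_cmul[OF smooth_pd_linear[OF that]] by (auto simp: fun_eq_iff)
  ultimately show ?thesis by (simp add: has_field_derivative_def)
 qed
 define \<psi> where "\<psi> s = f (x + h *\<^sub>R b + s *\<^sub>R a) - f (x + s *\<^sub>R a)" for s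
 have "\<exists>s. 0 < s \<and> s < h \<and> \<psi> h - \<psi> 0 = (h - 0) * (pd a f (x + h *\<^sub>R b + s *\<^sub>R a) - pd a f (x + s *\<^sub>R a))"
  unfolding \<psi>_def by (rule MVT2[OF h]) (intro DERIV_diff line f)
 then obtain s where s: "0 < s" "s < h"
  "\<psi> h - \<psi> 0 = h * (pd a f (x + s *\<^sub>R a + h *\<^sub>R b) - pd a f (x + s *\<^sub>R a + 0 *\<^sub>R b))"
  by (auto simp: algebra_simps)
 have "\<exists>r. 0 < r \<and> r < h \<and> pd a f (x + s *\<^sub>R a + h *\<^sub>R b) - pd a f (x + s *\<^sub>R a + 0 *\<^sub>R b)
   = (h - 0) * pd b (pd a f) (x + s *\<^sub>R a + r *\<^sub>R b)"
  by (rule MVT2[OF h]) (rule line[OF smooth_pd[OF f a]])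
 then obtain r where r: "0 < r" "r < h" "pd a f (x + s *\<^sub>R a + h *\<^sub>R b) - pd a f (x + s *\<^sub>R a + 0 *\<^sub>R b)
   = h * pd b (pd a f) (x + s *\<^sub>R a + r *\<^sub>R b)" by auto
 have "\<psi> h - \<psi> 0 = f (x + h *\<^sub>R a + h *\<^sub>R b) - f (x + h *\<^sub>R a) - f (x + h *\<^sub>R b) + f x"
  by (simp add: \<psi>_def algebra_simps)
 with s r show ?thesis by (metis mult.assoc)
qed

lemma pd_commute:
 assumes f: "smooth f" and a: "a \<in> Basis" and b: "b \<in> Basis"
 shows "pd a (pd b f) = pd b (pd a f)"
proof
 fix x
 define h :: "nat => real" where "h n = inverse (real (Suc n))" for n
 have h: "h n > 0" for n by (simp add: h_def)
 have h0: "h \<longlonglongrightarrow> 0" unfolding h_def by (rule LIMSEQ_inverse_real_of_nat)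
 let ?D = "\<lambda>n. (f (x + h n *\<^sub>R a + h n *\<^sub>R b) - f (x + h n *\<^sub>R a) - f (x + h n *\<^sub>R b) + f x) / (h n * h n)"
 have gen: "(\<lambda>n. (f (x + h n *\<^sub>R u + h n *\<^sub>R v) - f (x + h n *\<^sub>R u) - f (x + h n *\<^sub>R v) + f x) / (h n * h n))
   \<longlonglongrightarrow> pd v (pd u f) x" if u: "u \<in> Basis" and v: "v \<in> Basis" for u v
 proof -
  from second_difference[OF f u v h, of _ x] obtain s r where
   s: "\<And>n. 0 < s n" "\<And>n. s n < h n" and r: "\<And>n. 0 < r n" "\<And>n. r n < h n" and
   e: "\<And>n. f (x + h n *\<^sub>R u + h n *\<^sub>R v) - f (x + h n *\<^sub>R u) - f (x + h n *\<^sub>R v) + f x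
    = h n * h n * pd v (pd u f) (x + s n *\<^sub>R u + r n *\<^sub>R v)" by metis
  have "s \<longlonglongrightarrow> 0" "r \<longlonglongrightarrow> 0"
   by (rule tendsto_sandwich[OF _ _ tendsto_const h0];
     auto intro!: always_eventually less_imp_le s r)+
  then have "(\<lambda>n. x + s n *\<^sub>R u + r n *\<^sub>R v) \<longlonglongrightarrow> x + 0 *\<^sub>R u + 0 *\<^sub>R v"
   by (intro tendsto_intros)
  moreover have "isCont (pd v (pd u f)) x"
   using smooth_continuous[OF smooth_pd[OF smooth_pd[OF f u] v], of UNIV]
   by (simp add: continuous_on_eq_continuous_within)
  ultimately have "(\<lambda>n. pd v (pd u f) (x + s n *\<^sub>R u + r n *\<^sub>R v)) \<longlonglongrightarrow> pd v (pd u f) x"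
   using isCont_tendsto_compose by fastforce
  moreover have "(f (x + h n *\<^sub>R u + h n *\<^sub>R v) - f (x + h n *\<^sub>R u) - f (x + h n *\<^sub>R v) + f x) / (h n * h n)
    = pd v (pd u f) (x + s n *\<^sub>R u + r n *\<^sub>R v)" for n
   using h[of n] by (subst e) simp
  ultimately show ?thesis by simp
 qed
 have eq: "?D = (\<lambda>n. (f (x + h n *\<^sub>R b + h n *\<^sub>R a) - f (x + h n *\<^sub>R b) - f (x + h n *\<^sub>R a) + f x) / (h n * h n))"
 proof
  fix n
  have "f (x + h n *\<^sub>R a + h n *\<^sub>R b) = f (x + h n *\<^sub>R b + h n *\<^sub>R a)" by (simp only: add_ac)
  then show "?D n = (f (x + h n *\<^sub>R b + h n *\<^sub>R a) - f (x + h n *\<^sub>R b) - f (x + h n *\<^sub>R a) + f x) / (h n * h n)"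
   by (intro arg_cong2[where f="(/)"] refl) linarith
 qed
 have "?D \<longlonglongrightarrow> pd a (pd b f) x" unfolding eq by (rule gen[OF b a])
 from LIMSEQ_unique[OF this gen[OF a b]] show "pd a (pd b f) x = pd b (pd a f) x" .
qed

subsection \<open>Bump functions\<close>

text \<open>The functions \<open>p (1 / x) exp (- 1 / x)\<close>, extended by zero, form a family that is closed under
 differentiation; this is what makes \<open>bump0\<close> smooth at the origin.\<close>

definition flat :: "real poly => real => real" where
 "flat p x = (if x > 0 then poly p (1 / x) * exp (- (1 / x)) else 0)"

lemma poly_exp_tendsto_0: "((\<lambda>x::real. poly p x * exp (- x)) \<longlongrightarrow> 0) at_top"
proof -
 have "((\<lambda>x::real. coeff p i * (x ^ i / exp x)) \<longlongrightarrow> 0) at_top" for i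
  using tendsto_mult_right_zero[OF tendsto_power_div_exp_0] .
 then have "((\<lambda>x::real. \<Sum>i\<le>degree p. coeff p i * (x ^ i / exp x)) \<longlongrightarrow> 0) at_top"
  by (rule tendsto_null_sum)
 then show ?thesis
  by (simp add: poly_altdef sum_distrib_right exp_minus divide_inverse mult.assoc)
qed

lemma flat_tendsto_0: "(flat p \<longlongrightarrow> 0) (at 0)"
proof -
 have "((\<lambda>x::real. poly p (inverse x) * exp (- inverse x)) \<longlongrightarrow> 0) (at_right 0)"
  using filterlim_compose[OF poly_exp_tendsto_0 filterlim_inverse_at_top_right] .
 then have "(flat p \<longlongrightarrow> 0) (at_right 0)"
  by (rule Lim_transform_eventually)
    (auto simp: flat_def eventually_at_right_less inverse_eq_divide eventually_at_filter)
 moreover have "(flat p \<longlongrightarrow> 0) (at_left 0)"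
  by (rule Lim_transform_eventually[OF tendsto_const])
    (auto simp: flat_def eventually_at_filter)
 ultimately show ?thesis by (simp add: filterlim_split_at_real filterlim_split_at)
qed

lemma flat_deriv: "(flat p has_real_derivative flat ([:0, 0, 1:] * (p - pderiv p)) x) (at x)"
proof -
 consider "x > 0" | "x < 0" | "x = 0" by linarith
 then show ?thesis
 proof cases
  case 1
  have "((\<lambda>x. poly p (1 / x) * exp (- (1 / x))) has_real_derivative
    flat ([:0, 0, 1:] * (p - pderiv p)) x) (at x)"
   using 1 by (auto intro!: derivative_eq_intros poly_DERIV[THEN DERIV_chain2]
    simp: flat_def field_simps power2_eq_square)
  then show ?thesis
   by (rule has_field_derivative_transform_within_open[where S="{0<..}"]) (use 1 in \<open>auto simp: flat_def\<close>)
 next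
  case 2
  have "((\<lambda>x. 0) has_real_derivative flat ([:0, 0, 1:] * (p - pderiv p)) x) (at x)"
   using 2 by (auto simp: flat_def)
  then show ?thesis
   by (rule has_field_derivative_transform_within_open[where S="{..<0}"]) (use 2 in \<open>auto simp: flat_def\<close>)
 next
  case 3
  have "((\<lambda>h. flat ([:0, 1:] * p) h) \<longlongrightarrow> 0) (at 0)" by (rule flat_tendsto_0)
  then have "((\<lambda>h. (flat p (0 + h) - flat p 0) / h) \<longlongrightarrow> 0) (at 0)"
   by (rule Lim_transform_eventually) (auto simp: flat_def eventually_at_filter)
  then show ?thesis using 3 by (simp add: DERIV_def flat_def)
 qed
qed

lemma smooth_flat: "smooth (flat p)"
 unfolding smooth_def
proof
 fix n show "C_k n (flat p)"
 proof (induction n arbitrary: p)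
  case 0
  show ?case using DERIV_isCont[OF flat_deriv] by (auto intro: continuous_at_imp_continuous_on)
 next
  case (Suc n)
  have "pd 1 (flat p) = flat ([:0, 0, 1:] * (p - pderiv p))"
   by (rule ext, subst pd_eq[OF flat_deriv[unfolded has_field_derivative_def]]) simp
  moreover have "flat p differentiable (at x)" for x
   using flat_deriv real_differentiable_def by blast
  ultimately show ?case using Suc by simp
 qed
qed

abbreviation bump0 :: "real => real" where "bump0 \<equiv> flat 1"

lemma bump0_pos: "x > 0 ==> bump0 x > 0" and bump0_nonpos: "x \<le> 0 ==> bump0 x = 0"
 and bump0_nonneg: "bump0 x \<ge> 0" and bump0_le1: "bump0 x \<le> 1"
 by (auto simp: flat_def)

lemma smooth_bump0_affine: "smooth (\<lambda>x::'a::euclidean_space. bump0 (x \<bullet> v + c))"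
 by (rule smooth_compose_affine[OF bounded_linear_inner_left smooth_flat])

definition box_bump :: "'a::euclidean_space => 'a => 'a => real" where
 "box_bump a b x = (\<Prod>i\<in>Basis. bump0 (x \<bullet> i + (- (a \<bullet> i))) * bump0 (x \<bullet> (- i) + b \<bullet> i))"

lemma smooth_box_bump: "smooth (box_bump a b)"
 unfolding box_bump_def by (intro smooth_prod smooth_mult smooth_bump0_affine finite_Basis)

lemma box_bump_pos: "x \<in> box a b ==> box_bump a b x > 0"
 unfolding box_bump_def by (intro prod_pos ballI mult_pos_pos bump0_pos) (auto simp: mem_box algebra_simps)

lemma box_bump_zero: "x \<notin> box a b ==> box_bump a b x = 0"
proof -
 assume "x \<notin> box a b"
 then obtain i where "i \<in> Basis" "x \<bullet> i \<le> a \<bullet> i \<or> b \<bullet> i \<le> x \<bullet> i"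
  by (auto simp: mem_box not_less)
 then show ?thesis unfolding box_bump_def
  by (intro prod_zero finite_Basis) (auto intro!: bexI[of _ i] simp: bump0_nonpos)
qed

lemma box_bump_bounds: "0 \<le> box_bump a b x" "box_bump a b x \<le> 1"
 unfolding box_bump_def
 by (auto intro!: prod_nonneg prod_le_1 mult_nonneg_nonneg mult_le_one bump0_nonneg bump0_le1)

definition smooth_step :: "real => real" where
 "smooth_step x = bump0 x * inverse (bump0 x + bump0 (1 - x))"

lemma smooth_step_denom: "bump0 x + bump0 (1 - x) > 0"
 using bump0_pos[of x] bump0_pos[of "1 - x"] bump0_nonneg[of x] bump0_nonneg[of "1 - x"]
 by (cases "x > 0") (auto intro: add_pos_nonneg add_nonneg_pos)

lemma smooth_smooth_step: "smooth smooth_step"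
proof -
 have "smooth (\<lambda>x::real. bump0 (1 - x))"
  using smooth_bump0_affine[of "-1::real" 1] by (simp add: algebra_simps)
 with smooth_step_denom show ?thesis unfolding smooth_step_def
  by (intro smooth_mult smooth_inverse smooth_add smooth_flat) (auto simp: less_imp_neq[symmetric])
qed

lemma smooth_step_0: "x \<le> 0 ==> smooth_step x = 0" and smooth_step_1: "x \<ge> 1 ==> smooth_step x = 1"
 using smooth_step_denom[of x] by (auto simp: smooth_step_def bump0_nonpos)

lemma smooth_step_bounds: "0 \<le> smooth_step x" "smooth_step x \<le> 1"
 using smooth_step_denom[of x] bump0_nonneg[of x] bump0_nonneg[of "1 - x"]
 by (auto simp: smooth_step_def field_simps)

subsection \<open>Supports and test functions\<close>

lemma supp_closed: "closed (supp f)" by (simp add: supp_def)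

lemma not_in_supp: "x \<notin> supp f ==> f x = 0"
 unfolding supp_def support_on_def using closure_subset[of "{x\<in>UNIV. f x \<noteq> 0}"] by auto

lemma supp_subset: "(\<And>x. x \<notin> S ==> f x = 0) ==> closed S ==> supp f \<subseteq> S"
 unfolding supp_def support_on_def by (intro closure_minimal) auto

lemma pd_outside_supp: assumes "x \<notin> supp f" shows "pd b f x = 0"
proof -
 have "((\<lambda>x. 0) has_derivative (\<lambda>h. 0)) (at x)" by simp
 then have "(f has_derivative (\<lambda>h. 0)) (at x)"
  by (rule has_derivative_transform_within_open[where s="- supp f"])
    (use assms supp_closed in \<open>auto simp: not_in_supp\<close>)
 from pd_eq[OF this] show ?thesis by simp
qed

lemma supp_pd: "supp (pd b f) \<subseteq> supp f"
 by (intro supp_subset pd_outside_supp supp_closed)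

lemma test_functions_def': "\<phi> \<in> test_functions U \<longleftrightarrow> smooth \<phi> \<and> compact (supp \<phi>) \<and> supp \<phi> \<subseteq> U"
 by (simp add: test_functions_def smooth_def)

lemma test_functionsI:
 assumes "smooth f" "compact S" "S \<subseteq> U" "\<And>x. x \<notin> S ==> f x = 0"
 shows "f \<in> test_functions U"
proof -
 have "supp f \<subseteq> S" using assms by (intro supp_subset compact_imp_closed) auto
 moreover have "compact (supp f)"
  using compact_Int_closed[OF assms(2) supp_closed] calculation by (metis inf.absorb2 inf_commute)
 ultimately show ?thesis using assms by (auto simp: test_functions_def')
qed

lemma test_smooth: "\<phi> \<in> test_functions U ==> smooth \<phi>"
 and test_compact: "\<phi> \<in> test_functions U ==> compact (supp \<phi>)"
 and test_supp: "\<phi> \<in> test_functions U ==> supp \<phi> \<subseteq> U"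
 by (auto simp: test_functions_def')

lemma test_mult_smooth: "\<phi> \<in> test_functions U ==> smooth f ==> (\<lambda>x. f x * \<phi> x) \<in> test_functions U"
 by (rule test_functionsI[of _ "supp \<phi>"])
   (auto simp: test_functions_def' not_in_supp intro: smooth_mult)

lemma test_add: "\<phi> \<in> test_functions U ==> \<psi> \<in> test_functions U ==> (\<lambda>x. \<phi> x + \<psi> x) \<in> test_functions U"
 by (rule test_functionsI[of _ "supp \<phi> \<union> supp \<psi>"])
   (auto simp: test_functions_def' not_in_supp intro: smooth_add)

lemma test_pd: "\<phi> \<in> test_functions U ==> b \<in> Basis ==> pd b \<phi> \<in> test_functions U"
 by (rule test_functionsI[of _ "supp \<phi>"])
   (auto simp: test_functions_def' pd_outside_supp intro: smooth_pd)

lemma test_zero: "\<phi> \<in> test_functions U ==> x \<notin> U ==> \<phi> x = 0"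
 using test_supp not_in_supp by blast

lemma test_bounded:
 assumes "\<phi> \<in> test_functions U" obtains B where "B > 0" "\<And>x. \<bar>\<phi> x\<bar> \<le> B"
proof -
 have "bounded (\<phi> ` supp \<phi>)"
  using assms by (intro compact_imp_bounded compact_continuous_image smooth_continuous)
   (auto simp: test_functions_def')
 then obtain B where "B > 0" "\<And>x. x \<in> supp \<phi> ==> \<bar>\<phi> x\<bar> \<le> B"
  by (auto simp: bounded_pos)
 with that[of B] show ?thesis by (metis abs_zero less_imp_le not_in_supp)
qed

text \<open>Countably many boxes with rational corners exhaust \<open>U\<close>. A point of \<open>U\<close> lies in one of them, so a
 fixed factor of the product over the first \<open>n\<close> boxes is below one there, and the \<open>n\<close>-th power
 sends the product to zero.\<close>

lemma cutoff_sequence: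
 fixes U :: "'a::euclidean_space set"
 assumes "open U"
 obtains \<kappa> :: "nat => 'a => real" where "\<And>n. \<kappa> n \<in> test_functions U" "\<And>n x. 0 \<le> \<kappa> n x" "\<And>n x. \<kappa> n x \<le> 1"
  "\<And>x. x \<in> U ==> (\<lambda>n. \<kappa> n x) \<longlonglongrightarrow> 1"
proof -
 define pts where "pts = {(c :: 'a, d :: 'a). (\<forall>i\<in>Basis. c \<bullet> i \<in> \<rat> \<and> d \<bullet> i \<in> \<rat>) \<and> cbox c d \<subseteq> U}"
 show ?thesis
 proof (cases "U = {}")
  case True
  have "(\<lambda>_. 0) \<in> test_functions U" using test_functionsI[of "\<lambda>_. 0" "{}"] smooth_const by auto
  with True show ?thesis using that[of "\<lambda>_ _. 0"] by auto
 next
  case False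
  have "countable {x::'a. \<forall>i\<in>Basis. x \<bullet> i \<in> \<rat>}"
  proof -
   have "{x::'a. \<forall>i\<in>Basis. x \<bullet> i \<in> \<rat>} \<subseteq> (\<lambda>f. \<Sum>i\<in>Basis. f i *\<^sub>R i) ` (PiE Basis (\<lambda>_. \<rat>))"
   proof
    fix x :: 'a assume "x \<in> {x. \<forall>i\<in>Basis. x \<bullet> i \<in> \<rat>}"
    then show "x \<in> (\<lambda>f. \<Sum>i\<in>Basis. f i *\<^sub>R i) ` (PiE Basis (\<lambda>_. \<rat>))"
     by (intro image_eqI[of _ _ "restrict (\<lambda>i. x \<bullet> i) Basis"])
       (auto simp: euclidean_representation)
   qed
   moreover have "countable (PiE Basis (\<lambda>_::'a. \<rat>::real set))"
    by (intro countable_PiE finite_Basis countable_rat)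
   ultimately show ?thesis by (rule countable_subset[OF _ countable_image])
  qed
  then have "countable (SIGMA c:{x::'a. \<forall>i\<in>Basis. x \<bullet> i \<in> \<rat>}. {x::'a. \<forall>i\<in>Basis. x \<bullet> i \<in> \<rat>})"
   by (intro countable_SIGMA)
  moreover have "pts \<subseteq> (SIGMA c:{x::'a. \<forall>i\<in>Basis. x \<bullet> i \<in> \<rat>}. {x::'a. \<forall>i\<in>Basis. x \<bullet> i \<in> \<rat>})"
   unfolding pts_def by auto
  ultimately have cnt: "countable pts" by (rule countable_subset[rotated])
  have ex: "\<exists>p\<in>pts. x \<in> box (fst p) (snd p)" if "x \<in> U" for x
  proof -
   obtain e where e: "e > 0" "ball x e \<subseteq> U" using openE[OF assms \<open>x \<in> U\<close>] by metis
   from e have "0 < e / 2" by simp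
   from rational_boxes[OF this, of x] obtain c d where cd: "\<forall>i\<in>Basis. c \<bullet> i \<in> \<rat> \<and> d \<bullet> i \<in> \<rat>" "x \<in> box c d"
     "box c d \<subseteq> ball x (e/2)" by blast
   have "cbox c d = closure (box c d)" using cd(2) by (intro closure_box[symmetric]) auto
   also have "\<dots> \<subseteq> cball x (e/2)" using cd(3) ball_subset_cball by (intro closure_minimal) auto
   also have "\<dots> \<subseteq> ball x e" using e by auto
   finally have "cbox c d \<subseteq> U" using e(2) by simp
   with cd have "(c, d) \<in> pts" by (simp add: pts_def)
   with cd(2) show ?thesis by (intro bexI[of _ "(c,d)"]) simp_all
  qed
  from False obtain x0 where "x0 \<in> U" by (meson equals0I)
  from ex[OF this] have ne: "pts \<noteq> {}" by force
  define q where "q = from_nat_into pts"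
  have q: "q i \<in> pts" for i using ne by (auto simp: q_def from_nat_into)
  define \<beta> where "\<beta> i = box_bump (fst (q i)) (snd (q i))" for i
  define \<kappa> where "\<kappa> n x = 1 - (\<Prod>i<n. (1 - \<beta> i x)) ^ n" for n x
  have b: "0 \<le> \<beta> i x" "\<beta> i x \<le> 1" for i x by (auto simp: \<beta>_def box_bump_bounds)
  have P: "0 \<le> (\<Prod>i<n. (1 - \<beta> i x))" "(\<Prod>i<n. (1 - \<beta> i x)) \<le> 1" for n x
   using b by (auto intro!: prod_nonneg prod_le_1)
  show ?thesis
  proof (rule that[of \<kappa>])
   fix n show "\<kappa> n \<in> test_functions U"
   proof (rule test_functionsI[of _ "\<Union>i<n. cbox (fst (q i)) (snd (q i))"])
    show "smooth (\<kappa> n)" unfolding \<kappa>_def \<beta>_def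
     by (intro smooth_diff smooth_power smooth_prod smooth_const smooth_box_bump finite_lessThan)
    show "(\<Union>i<n. cbox (fst (q i)) (snd (q i))) \<subseteq> U" using q by (intro UN_least) (simp add: pts_def case_prod_beta)
    show "\<kappa> n x = 0" if "x \<notin> (\<Union>i<n. cbox (fst (q i)) (snd (q i)))" for x
    proof -
     have "\<beta> i x = 0" if "i < n" for i
      unfolding \<beta>_def using \<open>x \<notin> _\<close> that box_subset_cbox[of "fst (q i)" "snd (q i)"]
      by (intro box_bump_zero) auto
     then show ?thesis by (simp add: \<kappa>_def)
    qed
   qed (auto intro!: compact_UN)
   show "0 \<le> \<kappa> n x" "\<kappa> n x \<le> 1" for x
    using P[of x n] by (auto simp: \<kappa>_def intro: power_le_one)
  next
   fix x assume "x \<in> U"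
   then obtain p where p: "p \<in> pts" "x \<in> box (fst p) (snd p)" using ex[OF \<open>x \<in> U\<close>] by metis
   then obtain m where m: "q m = p" using from_nat_into_surj[OF cnt p(1)] unfolding q_def by metis
   define r where "r = 1 - \<beta> m x"
   have r: "0 \<le> r" "r < 1" using p m b box_bump_pos[of x "fst p" "snd p"] by (auto simp: r_def \<beta>_def)
   have "(\<lambda>n. (\<Prod>i<n. (1 - \<beta> i x)) ^ n) \<longlonglongrightarrow> 0"
   proof (rule tendsto_sandwich[OF _ _ tendsto_const LIMSEQ_realpow_zero[OF r]])
    show "\<forall>\<^sub>F n in sequentially. 0 \<le> (\<Prod>i<n. (1 - \<beta> i x)) ^ n" using P by auto
    show "\<forall>\<^sub>F n in sequentially. (\<Prod>i<n. (1 - \<beta> i x)) ^ n \<le> r ^ n"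
    proof (rule eventually_sequentiallyI[of "Suc m"])
     fix n assume "Suc m \<le> n"
     then have "(\<Prod>i<n. (1 - \<beta> i x)) = r * (\<Prod>i\<in>{..<n} - {m}. (1 - \<beta> i x))"
      by (subst prod.remove[of _ m]) (auto simp: r_def)
     also have "\<dots> \<le> r * 1" using b r by (intro mult_left_mono prod_le_1) auto
     finally show "(\<Prod>i<n. (1 - \<beta> i x)) ^ n \<le> r ^ n" using P by (intro power_mono) auto
    qed
   qed
   from tendsto_diff[OF tendsto_const this, of 1] show "(\<lambda>n. \<kappa> n x) \<longlonglongrightarrow> 1"
    by (simp add: \<kappa>_def)
  qed
 qed
qed

section \<open>The pre-Hilbert space of square integrable functions\<close>

lemma L2_measurable: "f \<in> L2 A ==> f \<in> borel_measurable (lebesgue_on A)"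
 and L2_integrable: "f \<in> L2 A ==> integrable (lebesgue_on A) (\<lambda>x. (norm (f x))\<^sup>2)"
 by (auto simp: L2_def)

lemma L2_integrable_inner:
 fixes f g :: "'a::euclidean_space => 'b::euclidean_space"
 assumes f: "f \<in> L2 A" and g: "g \<in> L2 A"
 shows "integrable (lebesgue_on A) (\<lambda>x. f x \<bullet> g x)"
proof (rule Bochner_Integration.integrable_bound)
 show "integrable (lebesgue_on A) (\<lambda>x. (norm (f x))\<^sup>2 + (norm (g x))\<^sup>2)"
  using f g by (intro Bochner_Integration.integrable_add L2_integrable)
 show "(\<lambda>x. f x \<bullet> g x) \<in> borel_measurable (lebesgue_on A)"
  using f g by (intro borel_measurable_inner L2_measurable)
 have "\<bar>f x \<bullet> g x\<bar> \<le> (norm (f x))\<^sup>2 + (norm (g x))\<^sup>2" for x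
 proof -
  have "\<bar>f x \<bullet> g x\<bar> \<le> norm (f x) * norm (g x)" by (rule Cauchy_Schwarz_ineq2)
  also have "\<dots> \<le> (norm (f x))\<^sup>2 + (norm (g x))\<^sup>2"
  proof -
   have "0 \<le> norm (f x) * norm (g x)" by simp
   moreover have "2 * (norm (f x) * norm (g x)) \<le> (norm (f x))\<^sup>2 + (norm (g x))\<^sup>2"
    using sum_squares_bound[of "norm (f x)" "norm (g x)"] by (simp only: mult.assoc)
   ultimately show ?thesis by linarith
  qed
  finally show ?thesis .
 qed
 then show "AE x in lebesgue_on A. norm (f x \<bullet> g x) \<le> norm ((norm (f x))\<^sup>2 + (norm (g x))\<^sup>2)"
  by (intro AE_I2) simp
qed

lemma L2_scale: "f \<in> L2 A ==> (\<lambda>x. c *\<^sub>R f x) \<in> L2 A"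
 by (auto simp: L2_def power_mult_distrib intro!: borel_measurable_scaleR)

lemma L2_add:
 fixes f g :: "'a::euclidean_space => 'b::euclidean_space"
 assumes f: "f \<in> L2 A" and g: "g \<in> L2 A"
 shows "(\<lambda>x. f x + g x) \<in> L2 A"
proof -
 have "integrable (lebesgue_on A) (\<lambda>x. (norm (f x))\<^sup>2 + 2 * (f x \<bullet> g x) + (norm (g x))\<^sup>2)"
  using f g by (intro Bochner_Integration.integrable_add integrable_mult_right L2_integrable L2_integrable_inner)
 moreover have "(norm (f x + g x))\<^sup>2 = (norm (f x))\<^sup>2 + 2 * (f x \<bullet> g x) + (norm (g x))\<^sup>2" for x
  by (simp add: power2_norm_eq_inner inner_add inner_commute)
 ultimately show ?thesis using f g by (simp add: L2_def borel_measurable_add)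
qed

lemma L2_uminus: "f \<in> L2 A ==> (\<lambda>x. - f x) \<in> L2 A"
 using L2_scale[of f A "-1"] by simp

lemma L2_diff: "f \<in> L2 A ==> g \<in> L2 A ==> (\<lambda>x. f x - g x) \<in> L2 A"
 using L2_add[of f A "\<lambda>x. - g x"] L2_uminus[of g A] by simp

lemma L2_cmult: "f \<in> L2 A ==> (\<lambda>x. c * f x) \<in> L2 A" for f :: "_ => real"
 using L2_scale[of f A c] by simp

lemma L2_zero: "(\<lambda>x. 0) \<in> L2 A" by (simp add: L2_def)

lemma L2_sum: "finite I ==> (\<And>i. i \<in> I ==> f i \<in> L2 A) ==> (\<lambda>x. \<Sum>i\<in>I. f i x) \<in> L2 A"
 by (induction I rule: finite_induct) (auto intro: L2_add L2_zero)

lemma L2_inner_commute: "L2_inner A f g = L2_inner A g f"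
 by (simp add: L2_inner_def inner_commute)

lemma L2_inner_add_left: "f \<in> L2 A ==> g \<in> L2 A ==> h \<in> L2 A ==>
  L2_inner A (\<lambda>x. f x + g x) h = L2_inner A f h + L2_inner A g h"
 by (simp add: L2_inner_def inner_add L2_integrable_inner)

lemma L2_inner_diff_left: "f \<in> L2 A ==> g \<in> L2 A ==> h \<in> L2 A ==>
  L2_inner A (\<lambda>x. f x - g x) h = L2_inner A f h - L2_inner A g h"
 by (simp add: L2_inner_def inner_diff L2_integrable_inner)

lemma L2_inner_scale_left: "L2_inner A (\<lambda>x. c *\<^sub>R f x) h = c * L2_inner A f h"
 by (simp add: L2_inner_def)

lemma L2_inner_cmult_left: "L2_inner A (\<lambda>x. c * f x) h = c * L2_inner A f h" for f :: "_ => real"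
 using L2_inner_scale_left[of A c f h] by simp

lemma L2_inner_add_right: "f \<in> L2 A ==> g \<in> L2 A ==> h \<in> L2 A ==>
  L2_inner A h (\<lambda>x. f x + g x) = L2_inner A h f + L2_inner A h g"
 by (simp add: L2_inner_commute[of A h] L2_inner_add_left)

lemma L2_inner_diff_right: "f \<in> L2 A ==> g \<in> L2 A ==> h \<in> L2 A ==>
  L2_inner A h (\<lambda>x. f x - g x) = L2_inner A h f - L2_inner A h g"
 by (simp add: L2_inner_commute[of A h] L2_inner_diff_left)

lemma L2_inner_scale_right: "L2_inner A h (\<lambda>x. c *\<^sub>R f x) = c * L2_inner A h f"
 by (simp add: L2_inner_def)

lemma L2_inner_cmult_right: "L2_inner A h (\<lambda>x. c * f x) = c * L2_inner A h f" for f :: "_ => real"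
 using L2_inner_scale_right[of A h c f] by simp

lemma L2_inner_zero: "L2_inner A (\<lambda>x. 0) h = 0" "L2_inner A h (\<lambda>x. 0) = 0"
 by (simp_all add: L2_inner_def)

lemma L2_inner_sum_left: "finite I ==> (\<And>i. i \<in> I ==> f i \<in> L2 A) ==> h \<in> L2 A ==>
  L2_inner A (\<lambda>x. \<Sum>i\<in>I. f i x) h = (\<Sum>i\<in>I. L2_inner A (f i) h)"
 by (simp add: L2_inner_def inner_sum_left L2_integrable_inner)

lemma L2_inner_cong_AE:
 assumes "f \<in> L2 A" "f' \<in> L2 A" "g \<in> L2 A" "g' \<in> L2 A"
  and "AE x in lebesgue_on A. f x = f' x" "AE x in lebesgue_on A. g x = g' x"
 shows "L2_inner A f g = L2_inner A f' g'"
 unfolding L2_inner_def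
proof (rule integral_cong_AE)
 show "AE x in lebesgue_on A. f x \<bullet> g x = f' x \<bullet> g' x" using assms(5,6) by eventually_elim simp
qed (use assms L2_measurable in \<open>auto intro!: borel_measurable_inner\<close>)

lemma L2_norm_nonneg: "0 \<le> L2_norm A f" by (simp add: L2_norm_def)

lemma L2_norm_power2: "(L2_norm A f)\<^sup>2 = L2_inner A f f"
 by (simp add: L2_norm_def L2_inner_def power2_norm_eq_inner)

lemma L2_inner_self_nonneg: "0 \<le> L2_inner A f f"
 using L2_norm_power2[of A f] zero_le_power2 by metis

lemma L2_norm_eq_0: "f \<in> L2 A ==> L2_norm A f = 0 \<longleftrightarrow> (AE x in lebesgue_on A. f x = 0)"
 unfolding L2_norm_def by (subst real_sqrt_eq_zero_cancel_iff, subst integral_nonneg_eq_0_iff_AE) (auto simp: L2_integrable)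

text \<open>The quadratic polynomial \<open>c \<mapsto> \<parallel>f + c g\<parallel>\<^sup>2\<close> is nonnegative.\<close>

lemma L2_Cauchy_Schwarz:
 fixes f g :: "'a::euclidean_space => 'b::euclidean_space"
 assumes f: "f \<in> L2 A" and g: "g \<in> L2 A"
 shows "\<bar>L2_inner A f g\<bar> \<le> L2_norm A f * L2_norm A g"
proof (cases "L2_norm A g = 0")
 case True
 then have "AE x in lebesgue_on A. g x = 0" using L2_norm_eq_0[OF g] by simp
 then have "L2_inner A f g = L2_inner A f (\<lambda>x. 0)"
  using f g by (intro L2_inner_cong_AE) (auto simp: L2_zero)
 then show ?thesis by (simp add: L2_inner_zero True)
next
 case False
 define b c where "b = L2_inner A g g" and "c = L2_inner A f g"
 have b: "b > 0" using False L2_norm_power2[of A g] by (metis b_def zero_less_power2)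
 have "0 \<le> L2_inner A (\<lambda>x. f x - (c / b) *\<^sub>R g x) (\<lambda>x. f x - (c / b) *\<^sub>R g x)"
  by (rule L2_inner_self_nonneg)
 also have "\<dots> = L2_inner A f f - 2 * (c / b) * c + (c / b) * (c / b) * b"
  using f g by (simp add: L2_inner_diff_left L2_inner_diff_right L2_diff L2_scale L2_inner_scale_left
   L2_inner_scale_right b_def c_def L2_inner_commute[of A g f] algebra_simps)
 also have "\<dots> = L2_inner A f f - c\<^sup>2 / b"
  using b by (simp add: field_simps power2_eq_square)
 finally have "c\<^sup>2 \<le> L2_inner A f f * b" using b by (simp add: field_simps)
 then have "c\<^sup>2 \<le> (L2_norm A f * L2_norm A g)\<^sup>2"
  by (simp add: b_def L2_norm_power2 power_mult_distrib)
 then show ?thesis unfolding c_def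
  using L2_norm_nonneg abs_le_square_iff by (metis abs_of_nonneg mult_nonneg_nonneg)
qed

lemma L2_norm_triangle:
 assumes f: "f \<in> L2 A" and g: "g \<in> L2 A"
 shows "L2_norm A (\<lambda>x. f x + g x) \<le> L2_norm A f + L2_norm A g"
proof (rule power2_le_imp_le)
 have "(L2_norm A (\<lambda>x. f x + g x))\<^sup>2 = (L2_norm A f)\<^sup>2 + 2 * L2_inner A f g + (L2_norm A g)\<^sup>2"
  using f g by (simp add: L2_norm_power2 L2_inner_add_left L2_inner_add_right L2_add L2_inner_commute[of A g f])
 also have "\<dots> \<le> (L2_norm A f + L2_norm A g)\<^sup>2"
  using L2_Cauchy_Schwarz[OF f g] by (simp add: power2_sum)
 finally show "(L2_norm A (\<lambda>x. f x + g x))\<^sup>2 \<le> (L2_norm A f + L2_norm A g)\<^sup>2" .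
qed (simp add: L2_norm_nonneg)

lemma L2_norm_minus_commute: "L2_norm A (\<lambda>x. f x - g x) = L2_norm A (\<lambda>x. g x - f x)"
 by (simp add: L2_norm_def norm_minus_commute)

lemma L2_norm_triangle_diff:
 assumes f: "f \<in> L2 A" and g: "g \<in> L2 A" and h: "h \<in> L2 A"
 shows "L2_norm A (\<lambda>x. f x - h x) \<le> L2_norm A (\<lambda>x. f x - g x) + L2_norm A (\<lambda>x. g x - h x)"
 using L2_norm_triangle[OF L2_diff[OF f g] L2_diff[OF g h]] by simp

lemma AE_lebesgue_on_iff:
 "A \<in> sets lebesgue ==> (AE x in lebesgue_on A. P x) \<longleftrightarrow> (AE x in lebesgue. x \<in> A \<longrightarrow> P x)"
 by (subst AE_restrict_space_iff) auto

lemma integral_lebesgue_on: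
 fixes f :: "'a::euclidean_space => 'b::euclidean_space"
 assumes "A \<in> sets lebesgue"
 shows "integral\<^sup>L (lebesgue_on A) f = (\<integral>x. indicator A x *\<^sub>R f x \<partial>lebesgue)"
  and "integrable (lebesgue_on A) f \<longleftrightarrow> integrable lebesgue (\<lambda>x. indicator A x *\<^sub>R f x)"
 using assms by (auto simp: integral_restrict_space integrable_restrict_space)

lemma measurable_lebesgue_on_AE:
 fixes f g :: "'a::euclidean_space => 'b::euclidean_space"
 assumes A: "A \<in> sets lebesgue" and f: "f \<in> borel_measurable (lebesgue_on A)"
  and e: "AE x in lebesgue_on A. f x = g x"
 shows "g \<in> borel_measurable (lebesgue_on A)"
proof -
 have "(\<lambda>x. if x \<in> A then f x else 0) \<in> borel_measurable lebesgue"
  using f A by (rule borel_measurable_if_I)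
 moreover have "AE x in lebesgue. (if x \<in> A then f x else 0) = (if x \<in> A then g x else 0)"
  using e unfolding AE_lebesgue_on_iff[OF A] by eventually_elim auto
 ultimately have "(\<lambda>x. if x \<in> A then g x else 0) \<in> borel_measurable lebesgue"
  by (rule borel_measurable_AE)
 then show ?thesis by (rule borel_measurable_if_D)
qed

lemma L2_cong_AE:
 assumes A: "A \<in> sets lebesgue" and f: "f \<in> L2 A" and e: "AE x in lebesgue_on A. f x = g x"
 shows "g \<in> L2 A"
proof -
 have g: "g \<in> borel_measurable (lebesgue_on A)"
  by (rule measurable_lebesgue_on_AE[OF A L2_measurable[OF f] e])
 have "integrable (lebesgue_on A) (\<lambda>x. (norm (g x))\<^sup>2)"
  by (rule integrable_cong_AE_imp[OF L2_integrable[OF f]])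
    (use g e in \<open>auto intro!: borel_measurable_power borel_measurable_norm\<close>)
 with g show ?thesis by (simp add: L2_def)
qed

lemma AE_subset:
 assumes "A \<in> sets lebesgue" "B \<in> sets lebesgue" "B \<subseteq> A" "AE x in lebesgue_on A. P x"
 shows "AE x in lebesgue_on B. P x"
 using assms(4) unfolding AE_lebesgue_on_iff[OF assms(1)] AE_lebesgue_on_iff[OF assms(2)]
 by eventually_elim (use assms(3) in auto)

lemma L2_subset:
 assumes A: "A \<in> sets lebesgue" and B: "B \<in> sets lebesgue" and BA: "B \<subseteq> A" and f: "f \<in> L2 A"
 shows "f \<in> L2 B"
proof -
 have "f \<in> borel_measurable (lebesgue_on B)"
  using L2_measurable[OF f] BA by (rule measurable_restrict_mono)
 moreover have "integrable (lebesgue_on B) (\<lambda>x. (norm (f x))\<^sup>2)"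
 proof -
  have "integrable lebesgue (\<lambda>x. indicator A x *\<^sub>R (norm (f x))\<^sup>2)"
   using L2_integrable[OF f] by (simp add: integral_lebesgue_on[OF A])
  from integrable_mult_indicator[OF B this]
  have "integrable lebesgue (\<lambda>x. indicator B x *\<^sub>R (norm (f x))\<^sup>2)"
   by (rule Bochner_Integration.integrable_cong[THEN iffD1, OF refl, rotated])
     (use BA in \<open>auto simp: indicator_def\<close>)
  then show ?thesis by (simp add: integral_lebesgue_on[OF B])
 qed
 ultimately show ?thesis by (simp add: L2_def)
qed

lemma L2_inner_supported:
 assumes A: "A \<in> sets lebesgue" and B: "B \<in> sets lebesgue" and BA: "B \<subseteq> A"
  and z: "\<And>x. x \<in> A - B ==> f x \<bullet> g x = 0"
 shows "L2_inner A f g = L2_inner B f g"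
 unfolding L2_inner_def integral_lebesgue_on[OF A] integral_lebesgue_on[OF B]
 by (rule Bochner_Integration.integral_cong) (use BA z in \<open>auto simp: indicator_def\<close>)

lemma L2_bounded:
 fixes f :: "'a::euclidean_space => 'b::euclidean_space"
 assumes A: "A \<in> sets lebesgue" "bounded A" and f: "f \<in> borel_measurable (lebesgue_on A)"
  and B: "\<And>x. x \<in> A ==> norm (f x) \<le> B"
 shows "f \<in> L2 A"
proof -
 have "A \<in> lmeasurable" using A by (simp add: bounded_set_imp_lmeasurable)
 then interpret finite_measure "lebesgue_on A" by (rule finite_measure_lebesgue_on)
 have "integrable (lebesgue_on A) (\<lambda>x. (norm (f x))\<^sup>2)"
  by (rule integrable_const_bound[where B="B\<^sup>2"]) (use f B in \<open>auto intro!: AE_I2 power_mono\<close>)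
 with f show ?thesis by (simp add: L2_def)
qed

lemma continuous_measurable_lebesgue_on:
 fixes f :: "'a::euclidean_space => 'b::euclidean_space"
 assumes "continuous_on UNIV f"
 shows "f \<in> borel_measurable (lebesgue_on A)"
 using borel_measurable_continuous_onI[OF assms]
 by (intro measurable_restrict_space1 measurable_completion) simp

lemma L2_continuous:
 fixes f :: "'a::euclidean_space => 'b::euclidean_space"
 assumes A: "A \<in> sets lebesgue" "bounded A" and f: "continuous_on UNIV f"
 shows "f \<in> L2 A"
proof -
 have "compact (closure A)" using A by (simp add: compact_closure)
 then have "bounded (f ` closure A)"
  by (intro compact_imp_bounded compact_continuous_image continuous_on_subset[OF f]) auto
 then obtain B where "\<And>x. x \<in> closure A ==> norm (f x) \<le> B" by (auto simp: bounded_iff)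
 then show ?thesis using closure_subset[of A]
  by (intro L2_bounded[OF A continuous_measurable_lebesgue_on[OF f], of B]) auto
qed

lemma L2_const: "A \<in> sets lebesgue ==> bounded A ==> (\<lambda>_. c) \<in> L2 A"
 by (intro L2_continuous) auto

lemma L2_continuous_compact_support:
 fixes f :: "'a::euclidean_space => 'b::euclidean_space"
 assumes A: "A \<in> sets lebesgue" and f: "continuous_on UNIV f" and K: "compact K" "\<And>x. x \<notin> K ==> f x = 0"
 shows "f \<in> L2 A"
proof -
 have K': "K \<in> sets lebesgue" using K by (simp add: compact_imp_closed lebesgue_closedin)
 have "f \<in> L2 K" using K K' f by (intro L2_continuous) (auto simp: compact_imp_bounded)
 then have "integrable lebesgue (\<lambda>x. indicator K x *\<^sub>R (norm (f x))\<^sup>2)"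
  using L2_integrable[of f K] by (simp add: integral_lebesgue_on(2)[OF K'])
 also have "(\<lambda>x. indicator K x *\<^sub>R (norm (f x))\<^sup>2) = (\<lambda>x. (norm (f x))\<^sup>2)"
  using K(2) by (auto simp: indicator_def fun_eq_iff)
 finally have "f \<in> L2 UNIV"
  using continuous_measurable_lebesgue_on[OF f, of UNIV] by (simp add: L2_def lebesgue_on_UNIV_eq)
 then show ?thesis using L2_subset[of UNIV A f] A by simp
qed

lemma test_L2: "\<phi> \<in> test_functions U ==> A \<in> sets lebesgue ==> \<phi> \<in> L2 A"
 by (rule L2_continuous_compact_support[of A \<phi> "supp \<phi>"])
   (auto simp: test_functions_def' smooth_continuous not_in_supp)

lemma smooth_L2: "smooth f ==> A \<in> sets lebesgue ==> bounded A ==> f \<in> L2 A"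
 by (intro L2_continuous smooth_continuous)

lemma L2_vec_nth:
 fixes w :: "'a::euclidean_space => real^'n"
 assumes "w \<in> L2 A" shows "(\<lambda>x. w x $ l) \<in> L2 A"
proof -
 have m: "(\<lambda>x. w x $ l) \<in> borel_measurable (lebesgue_on A)"
  by (rule borel_measurable_continuous_on[of "\<lambda>y. y $ l", OF _ L2_measurable[OF assms]])
   (intro continuous_intros)
 have b: "(norm (w x $ l))\<^sup>2 \<le> (norm (w x))\<^sup>2" for x
  by (rule power_mono) (simp_all add: component_le_norm_cart)
 have "integrable (lebesgue_on A) (\<lambda>x. (norm (w x $ l))\<^sup>2)"
  by (rule Bochner_Integration.integrable_bound[OF L2_integrable[OF assms]])
    (use m b in \<open>auto intro!: AE_I2\<close>)
 with m show ?thesis by (simp add: L2_def)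
qed

lemma L2_inner_vec: "u \<in> L2 A ==> v \<in> L2 A ==> L2_inner A u v = (\<Sum>l\<in>UNIV. L2_inner A (\<lambda>x. u x $ l) (\<lambda>x. v x $ l))"
 for u v :: "'a::euclidean_space => real^'n"
 unfolding L2_inner_def inner_vec_def
 using L2_integrable_inner[OF L2_vec_nth L2_vec_nth, of u A v] by (subst Bochner_Integration.integral_sum) auto

lemma L2_vecI:
 fixes w :: "'a::euclidean_space => real^'n"
 assumes "\<And>l. (\<lambda>x. w x $ l) \<in> L2 A" shows "w \<in> L2 A"
proof -
 have "(\<lambda>x. \<Sum>l\<in>UNIV. (w x $ l) *\<^sub>R axis l (1::real)) \<in> L2 A"
 proof (rule L2_sum)
  fix l :: 'n
  show "(\<lambda>x. (w x $ l) *\<^sub>R axis l (1::real)) \<in> L2 A"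
   using assms[of l] by (auto simp: L2_def power_mult_distrib intro!: borel_measurable_scaleR)
 qed simp
 moreover have "(\<Sum>l\<in>UNIV. (w x $ l) *\<^sub>R axis l (1::real)) = w x" for x
  by (simp add: vec_eq_iff axis_def if_distrib cong: if_cong)
 ultimately show ?thesis by simp
qed

subsection \<open>Functions are determined by their products with test functions\<close>

text \<open>A measurable function is an almost everywhere limit of continuous ones. These are truncated at \<open>B\<close>
 and replaced by polynomials that are uniformly close on the compact support of \<open>\<kappa>\<close>; multiplication
 by \<open>\<kappa>\<close> then gives test functions with a common integrable bound.\<close>

lemma bounded_measurable_test_approx:
 fixes w :: "'a::euclidean_space => real"
 assumes w: "w \<in> borel_measurable lebesgue" and B: "\<And>x. \<bar>w x\<bar> \<le> B" and \<kappa>: "\<kappa> \<in> test_functions U"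
 obtains \<theta> where "\<And>m. \<theta> m \<in> test_functions U" "\<And>m x. \<bar>\<theta> m x\<bar> \<le> (B + 1) * \<bar>\<kappa> x\<bar>"
  "AE x in lebesgue. (\<lambda>m. \<theta> m x) \<longlonglongrightarrow> w x * \<kappa> x"
proof -
 have B0: "B \<ge> 0" using B[of undefined] by linarith
 have "w measurable_on UNIV" using w by (simp add: lebesgue_measurable_imp_measurable_on)
 then obtain N g where N: "negligible N" and gc: "\<And>n::nat. continuous_on UNIV (g n)"
  and gl: "\<And>x. x \<notin> N ==> (\<lambda>n. g n x) \<longlonglongrightarrow> w x"
  unfolding measurable_on_def by auto
 define g' where "g' n x = max (- B) (min B (g n x))" for n x
 have g'c: "continuous_on S (g' n)" for n S unfolding g'_def
  by (intro continuous_on_max continuous_on_min continuous_on_const continuous_on_subset[OF gc]) auto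
 have g'b: "\<bar>g' n x\<bar> \<le> B" for n x using B0 by (auto simp: g'_def)
 have g'l: "(\<lambda>n. g' n x) \<longlonglongrightarrow> w x" if "x \<notin> N" for x
 proof -
  have "(\<lambda>n. g' n x) \<longlonglongrightarrow> max (- B) (min B (w x))" unfolding g'_def
   by (intro tendsto_intros tendsto_max tendsto_min gl that)
  moreover have "max (- B) (min B (w x)) = w x" using B[of x] by auto
  ultimately show ?thesis by simp
 qed
 have "\<exists>p. real_polynomial_function p \<and> (\<forall>x\<in>supp \<kappa>. \<bar>g' m x - p x\<bar> < inverse (real (Suc m)))" for m
  using Stone_Weierstrass_real_polynomial_function[OF test_compact[OF \<kappa>] g'c[of "supp \<kappa>" m], of "inverse (real (Suc m))"]
  by (metis inverse_positive_iff_positive of_nat_0_less_iff zero_less_Suc)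
 then obtain p where p: "\<And>m. real_polynomial_function (p m)"
  "\<And>m x. x \<in> supp \<kappa> ==> \<bar>g' m x - p m x\<bar> < inverse (real (Suc m))" by metis
 show ?thesis
 proof (rule that[of "\<lambda>m x. p m x * \<kappa> x"])
  show "(\<lambda>x. p m x * \<kappa> x) \<in> test_functions U" for m
   by (rule test_mult_smooth[OF \<kappa> smooth_real_polynomial_function[OF p(1)]])
  show "\<bar>p m x * \<kappa> x\<bar> \<le> (B + 1) * \<bar>\<kappa> x\<bar>" for m x
  proof (cases "x \<in> supp \<kappa>")
   case True
   have "inverse (real (Suc m)) \<le> 1" by (simp add: field_simps)
   then have "\<bar>p m x\<bar> \<le> B + 1" using p(2)[OF True, of m] g'b[of m x] by linarith
   then show ?thesis by (simp add: abs_mult mult_right_mono)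
  qed (simp add: not_in_supp)
  have "(\<lambda>m. p m x * \<kappa> x) \<longlonglongrightarrow> w x * \<kappa> x" if "x \<notin> N" for x
  proof (cases "x \<in> supp \<kappa>")
   case True
   have "(\<lambda>m. g' m x - p m x) \<longlonglongrightarrow> 0"
    by (rule Lim_null_comparison[OF _ LIMSEQ_inverse_real_of_nat])
      (use p(2)[OF True] in \<open>auto intro!: always_eventually less_imp_le\<close>)
   from tendsto_diff[OF g'l[OF that] this] have "(\<lambda>m. p m x) \<longlonglongrightarrow> w x" by simp
   then show ?thesis by (intro tendsto_intros)
  qed (simp add: not_in_supp)
  moreover have "AE x in lebesgue. x \<notin> N"
   using N by (simp add: negligible_iff_null_sets AE_not_in)
  ultimately show "AE x in lebesgue. (\<lambda>m. p m x * \<kappa> x) \<longlonglongrightarrow> w x * \<kappa> x"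
   by (auto elim: eventually_mono)
 qed
qed

text \<open>Test functions approximating the truncations of \<open>w\<close>, cut off near the boundary of \<open>U\<close>, show that
 the truncated and cut-off functions satisfy the bound, which passes to the limit.\<close>

lemma L2_duality:
 fixes w :: "'a::euclidean_space => real"
 assumes U: "open U" and w: "w \<in> L2 U" and M: "M \<ge> 0"
  and dual: "\<And>\<theta>. \<theta> \<in> test_functions U ==> L2_inner U w \<theta> \<le> M * L2_norm U \<theta>"
 shows "L2_norm U w \<le> M"
proof -
 have Us: "U \<in> sets lebesgue" using U by simp
 let ?\<mu> = "lebesgue_on U"
 from cutoff_sequence[OF U] obtain \<kappa> :: "nat => 'a => real" where \<kappa>: "\<And>n. \<kappa> n \<in> test_functions U"
  and \<kappa>0: "\<And>n x. 0 \<le> \<kappa> n x" and \<kappa>1: "\<And>n x. \<kappa> n x \<le> 1" and \<kappa>l: "\<And>x. x \<in> U ==> (\<lambda>n. \<kappa> n x) \<longlonglongrightarrow> 1" by blast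
 define v where "v n x = (if x \<in> U then (if \<bar>w x\<bar> \<le> real n then w x else 0) else 0)" for n :: nat and x
 have wm: "w \<in> borel_measurable ?\<mu>" by (rule L2_measurable[OF w])
 have vm: "v n \<in> borel_measurable lebesgue" for n unfolding v_def
  by (intro borel_measurable_if_I Us) (use wm in measurable)
 have vmU: "v n \<in> borel_measurable ?\<mu>" for n using vm by (rule measurable_restrict_space1)
 have km: "\<kappa> n \<in> borel_measurable ?\<mu>" for n using test_L2[OF \<kappa> Us] L2_measurable by blast
 have vb: "\<bar>v n x\<bar> \<le> real n" for n x by (auto simp: v_def)
 have wi: "integrable ?\<mu> (\<lambda>x. (w x)\<^sup>2)" using L2_integrable[OF w] by simp
 have key: "(\<integral>x. (v n x)\<^sup>2 * \<kappa> n x \<partial>?\<mu>) \<le> M\<^sup>2" for n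
 proof -
  obtain \<theta> where \<theta>: "\<And>m. \<theta> m \<in> test_functions U" "\<And>m x. \<bar>\<theta> m x\<bar> \<le> (real n + 1) * \<bar>\<kappa> n x\<bar>"
   "AE x in lebesgue. (\<lambda>m. \<theta> m x) \<longlonglongrightarrow> v n x * \<kappa> n x"
   using bounded_measurable_test_approx[OF vm[of n] vb[of n] \<kappa>[of n]] by blast
  have \<theta>l: "AE x in ?\<mu>. (\<lambda>m. \<theta> m x) \<longlonglongrightarrow> v n x * \<kappa> n x"
   using \<theta>(3) unfolding AE_lebesgue_on_iff[OF Us] by eventually_elim simp
  have \<theta>m: "\<theta> m \<in> borel_measurable ?\<mu>" for m using test_L2[OF \<theta>(1) Us] L2_measurable by blast
  have l1: "(\<lambda>m. L2_inner U w (\<theta> m)) \<longlonglongrightarrow> (\<integral>x. w x * (v n x * \<kappa> n x) \<partial>?\<mu>)"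
   unfolding L2_inner_def inner_real_def
  proof (rule integral_dominated_convergence[where w="\<lambda>x. (real n + 1) * \<bar>w x * \<kappa> n x\<bar>"])
   show "integrable ?\<mu> (\<lambda>x. (real n + 1) * \<bar>w x * \<kappa> n x\<bar>)"
    using L2_integrable_inner[OF w test_L2[OF \<kappa> Us], of n] by (intro integrable_mult_right integrable_abs) simp
   show "AE x in ?\<mu>. (\<lambda>m. w x * \<theta> m x) \<longlonglongrightarrow> w x * (v n x * \<kappa> n x)"
    using \<theta>l by eventually_elim (intro tendsto_intros)
   show "AE x in ?\<mu>. norm (w x * \<theta> m x) \<le> (real n + 1) * \<bar>w x * \<kappa> n x\<bar>" for m
    using mult_left_mono[OF \<theta>(2), of "\<bar>w _\<bar>"] by (intro AE_I2) (simp add: abs_mult algebra_simps)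
  qed (use wm vmU km \<theta>m in \<open>auto\<close>)
  have l2: "(\<lambda>m. (\<integral>x. (norm (\<theta> m x))\<^sup>2 \<partial>?\<mu>)) \<longlonglongrightarrow> (\<integral>x. (v n x * \<kappa> n x)\<^sup>2 \<partial>?\<mu>)"
  proof (rule integral_dominated_convergence[where w="\<lambda>x. (real n + 1)\<^sup>2 * (\<kappa> n x)\<^sup>2"])
   show "integrable ?\<mu> (\<lambda>x. (real n + 1)\<^sup>2 * (\<kappa> n x)\<^sup>2)"
    using L2_integrable[OF test_L2[OF \<kappa> Us], of n] by (intro integrable_mult_right) simp
   show "AE x in ?\<mu>. (\<lambda>m. (norm (\<theta> m x))\<^sup>2) \<longlonglongrightarrow> (v n x * \<kappa> n x)\<^sup>2"
    using \<theta>l by eventually_elim (auto intro!: tendsto_intros)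
   show "AE x in ?\<mu>. norm ((norm (\<theta> m x))\<^sup>2) \<le> (real n + 1)\<^sup>2 * (\<kappa> n x)\<^sup>2" for m
    using power_mono[OF \<theta>(2) abs_ge_zero, of _ _ 2] by (intro AE_I2) (simp add: power_mult_distrib)
  qed (use vmU km \<theta>m in \<open>auto\<close>)
  have "(\<integral>x. w x * (v n x * \<kappa> n x) \<partial>?\<mu>) \<le> M * sqrt (\<integral>x. (v n x * \<kappa> n x)\<^sup>2 \<partial>?\<mu>)"
   by (rule LIMSEQ_le[OF l1 tendsto_mult_left[OF tendsto_real_sqrt[OF l2]]])
     (use dual[OF \<theta>(1)] in \<open>auto simp: L2_norm_def\<close>)
  moreover have "(\<integral>x. w x * (v n x * \<kappa> n x) \<partial>?\<mu>) = (\<integral>x. (v n x)\<^sup>2 * \<kappa> n x \<partial>?\<mu>)"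
   by (rule Bochner_Integration.integral_cong) (auto simp: v_def power2_eq_square)
  moreover have "(\<integral>x. (v n x * \<kappa> n x)\<^sup>2 \<partial>?\<mu>) \<le> (\<integral>x. (v n x)\<^sup>2 * \<kappa> n x \<partial>?\<mu>)"
  proof (rule integral_mono)
   have k: "(v n x)\<^sup>2 * \<kappa> n x \<le> (w x)\<^sup>2" "(v n x * \<kappa> n x)\<^sup>2 \<le> (v n x)\<^sup>2 * \<kappa> n x" if "x \<in> U" for x
   proof -
    have "(v n x)\<^sup>2 * \<kappa> n x \<le> (v n x)\<^sup>2" using \<kappa>0 \<kappa>1 by (simp add: mult_left_le)
    moreover have "(v n x)\<^sup>2 \<le> (w x)\<^sup>2" by (auto simp: v_def)
    ultimately show "(v n x)\<^sup>2 * \<kappa> n x \<le> (w x)\<^sup>2" by linarith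
    show "(v n x * \<kappa> n x)\<^sup>2 \<le> (v n x)\<^sup>2 * \<kappa> n x"
     using \<kappa>0[of n x] \<kappa>1[of n x] unfolding power_mult_distrib
     by (intro mult_left_mono) (auto simp: power2_eq_square mult_left_le)
   qed
   show "integrable ?\<mu> (\<lambda>x. (v n x)\<^sup>2 * \<kappa> n x)"
    by (rule Bochner_Integration.integrable_bound[OF wi]) (use vmU km k \<kappa>0 in \<open>auto intro!: AE_I2\<close>)
   then show "integrable ?\<mu> (\<lambda>x. (v n x * \<kappa> n x)\<^sup>2)"
    by (rule Bochner_Integration.integrable_bound) (use vmU km k \<kappa>0 in \<open>auto intro!: AE_I2\<close>)
   show "(v n x * \<kappa> n x)\<^sup>2 \<le> (v n x)\<^sup>2 * \<kappa> n x" if "x \<in> space ?\<mu>" for x using k that by simp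
  qed
  ultimately have "(\<integral>x. (v n x)\<^sup>2 * \<kappa> n x \<partial>?\<mu>) \<le> M * sqrt (\<integral>x. (v n x)\<^sup>2 * \<kappa> n x \<partial>?\<mu>)" (is "?I \<le> M * sqrt ?I")
   using M by (smt (verit) mult_left_mono real_sqrt_le_mono)
  moreover have I0: "?I \<ge> 0" using \<kappa>0 by (intro Bochner_Integration.integral_nonneg) auto
  ultimately have "sqrt ?I * sqrt ?I \<le> M * sqrt ?I" by (subst real_sqrt_mult_self) simp
  then have "sqrt ?I \<le> M" using M I0
   by (cases "sqrt ?I = 0") (auto dest: mult_right_le_imp_le simp del: real_sqrt_mult_self)
  from power_mono[OF this, of 2] I0 show ?thesis by simp
 qed
 have "(\<lambda>n. (\<integral>x. (v n x)\<^sup>2 * \<kappa> n x \<partial>?\<mu>)) \<longlonglongrightarrow> (\<integral>x. (w x)\<^sup>2 \<partial>?\<mu>)"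
 proof (rule integral_dominated_convergence[where w="\<lambda>x. (w x)\<^sup>2"])
  show "AE x in ?\<mu>. (\<lambda>n. (v n x)\<^sup>2 * \<kappa> n x) \<longlonglongrightarrow> (w x)\<^sup>2"
  proof (rule AE_I2)
   fix x assume "x \<in> space ?\<mu>"
   then have x: "x \<in> U" by simp
   have "(\<lambda>n. (w x)\<^sup>2 * \<kappa> n x) \<longlonglongrightarrow> (w x)\<^sup>2 * 1" by (intro tendsto_intros \<kappa>l x)
   moreover have "\<forall>\<^sub>F n in sequentially. (w x)\<^sup>2 * \<kappa> n x = (v n x)\<^sup>2 * \<kappa> n x"
    using eventually_ge_at_top[of "nat \<lceil>\<bar>w x\<bar>\<rceil>"] by eventually_elim (auto simp: v_def x)
   ultimately show "(\<lambda>n. (v n x)\<^sup>2 * \<kappa> n x) \<longlonglongrightarrow> (w x)\<^sup>2"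
    by (simp add: Lim_transform_eventually)
  qed
  show "AE x in ?\<mu>. norm ((v n x)\<^sup>2 * \<kappa> n x) \<le> (w x)\<^sup>2" for n
  proof (rule AE_I2)
   fix x
   have "(v n x)\<^sup>2 * \<kappa> n x \<le> (v n x)\<^sup>2" using \<kappa>0 \<kappa>1 by (simp add: mult_left_le)
   moreover have "(v n x)\<^sup>2 \<le> (w x)\<^sup>2" by (auto simp: v_def)
   ultimately show "norm ((v n x)\<^sup>2 * \<kappa> n x) \<le> (w x)\<^sup>2" using \<kappa>0[of n x] by simp
  qed
 qed (use wm vmU km wi in \<open>auto\<close>)
 then have "(\<integral>x. (w x)\<^sup>2 \<partial>?\<mu>) \<le> M\<^sup>2" by (rule LIMSEQ_le_const2) (use key in auto)
 then have "(L2_norm U w)\<^sup>2 \<le> M\<^sup>2" by (simp add: L2_norm_def)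
 then show ?thesis using M by (rule power2_le_imp_le)
qed

lemma L2_eq_zero_by_test:
 fixes w :: "'a::euclidean_space => real"
 assumes U: "open U" and w: "w \<in> L2 U" and "\<And>\<theta>. \<theta> \<in> test_functions U ==> L2_inner U w \<theta> = 0"
 shows "AE x in lebesgue_on U. w x = 0"
 using L2_duality[OF U w, of 0] L2_norm_nonneg[of U w] assms(3) L2_norm_eq_0[OF w] by force

lemma L2_eq_by_test:
 fixes v w :: "'a::euclidean_space => real"
 assumes U: "open U" and v: "v \<in> L2 U" and w: "w \<in> L2 U"
  and e: "\<And>\<theta>. \<theta> \<in> test_functions U ==> L2_inner U v \<theta> = L2_inner U w \<theta>"
 shows "AE x in lebesgue_on U. v x = w x"
proof -
 have "AE x in lebesgue_on U. v x - w x = 0"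
  using U v w e by (intro L2_eq_zero_by_test L2_diff) (auto simp: L2_inner_diff_left test_L2)
 then show ?thesis by eventually_elim simp
qed

section \<open>Differentiation under the integral and integration by parts\<close>

lemma smooth_line_deriv:
 assumes "smooth f"
 shows "((\<lambda>t. f (y + t *\<^sub>R v)) has_real_derivative pd v f (y + t *\<^sub>R v)) (at t)"
proof -
 have "((\<lambda>t. y + t *\<^sub>R v) has_derivative (\<lambda>t. t *\<^sub>R v)) (at t)"
  by (auto intro!: derivative_eq_intros)
 from has_derivative_compose[OF this smooth_has_derivative[OF assms]]
 have d: "((\<lambda>t. f (y + t *\<^sub>R v)) has_derivative (\<lambda>t'. pd (t' *\<^sub>R v) f (y + t *\<^sub>R v))) (at t)" .
 moreover have "(\<lambda>t'. pd (t' *\<^sub>R v) f (y + t *\<^sub>R v)) = (*) (pd v f (y + t *\<^sub>R v))"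
  using linear_cmul[OF smooth_pd_linear[OF assms]] by (auto simp: fun_eq_iff)
 ultimately show ?thesis by (simp add: has_field_derivative_def)
qed

text \<open>The mean value theorem bounds the difference quotients by \<open>G\<close>, so dominated convergence applies.\<close>

lemma deriv_under_integral:
 fixes F F' :: "real => 'a => real"
 assumes s: "l < s" "s < r"
  and der: "\<And>\<sigma> x. l < \<sigma> ==> \<sigma> < r ==> x \<in> space M ==> ((\<lambda>\<sigma>. F \<sigma> x) has_real_derivative F' \<sigma> x) (at \<sigma>)"
  and int: "\<And>\<sigma>. l < \<sigma> ==> \<sigma> < r ==> integrable M (F \<sigma>)"
  and bnd: "\<And>\<sigma> x. l < \<sigma> ==> \<sigma> < r ==> x \<in> space M ==> \<bar>F' \<sigma> x\<bar> \<le> G x"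
  and G: "integrable M G"
 shows "((\<lambda>\<sigma>. \<integral>x. F \<sigma> x \<partial>M) has_real_derivative (\<integral>x. F' s x \<partial>M)) (at s)"
proof -
 have quot: "(\<lambda>n. ((\<integral>x. F (s + X n) x \<partial>M) - (\<integral>x. F s x \<partial>M)) / X n) \<longlonglongrightarrow> (\<integral>x. F' s x \<partial>M)"
  if X: "\<And>n. X n \<noteq> 0" "X \<longlonglongrightarrow> 0" for X
 proof -
  have "eventually (\<lambda>n. \<bar>X n\<bar> < min (s - l) (r - s)) sequentially"
   using X(2) s by (intro order_tendstoD(2)[OF tendsto_rabs_zero]) auto
  then obtain N where N: "\<And>n. n \<ge> N ==> \<bar>X n\<bar> < min (s - l) (r - s)"
   unfolding eventually_sequentially by blast
  define Y where "Y n = X (n + N)" for n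
  have Y0: "Y n \<noteq> 0" for n using X by (simp add: Y_def)
  have Yb: "\<bar>Y n\<bar> < min (s - l) (r - s)" for n using N[of "n + N"] by (simp add: Y_def)
  have Yr: "l < s + Y n" "s + Y n < r" for n using Yb[of n] by auto
  have Yl: "Y \<longlonglongrightarrow> 0" unfolding Y_def using X(2) by (rule LIMSEQ_ignore_initial_segment)
  let ?D = "\<lambda>n x. (F (s + Y n) x - F s x) / Y n"
  have Dm: "?D n \<in> borel_measurable M" for n
   using int[OF Yr] int[OF s] by (intro borel_measurable_divide borel_measurable_diff) auto
  have Dl: "(\<lambda>n. ?D n x) \<longlonglongrightarrow> F' s x" if "x \<in> space M" for x
  proof -
   have "((\<lambda>h. (F (s + h) x - F s x) / h) \<longlongrightarrow> F' s x) (at 0)"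
    using der[OF s that] by (simp add: DERIV_def)
   then show ?thesis using Y0 Yl unfolding tendsto_at_iff_sequentially comp_def by simp
  qed
  have Db: "\<bar>?D n x\<bar> \<le> G x" if x: "x \<in> space M" for n x
  proof -
   have "\<exists>z. l < z \<and> z < r \<and> F (s + Y n) x - F s x = Y n * F' z x"
   proof (cases "Y n > 0")
    case True
    have "\<exists>z. s < z \<and> z < s + Y n \<and> F (s + Y n) x - F s x = (s + Y n - s) * F' z x"
     using True Yr[of n] s by (intro MVT2 der x) auto
    then show ?thesis using Yr[of n] s by (metis add_diff_cancel_left' less_trans)
   next
    case False
    then have "Y n < 0" using Y0[of n] by simp
    have "\<exists>z. s + Y n < z \<and> z < s \<and> F s x - F (s + Y n) x = (s - (s + Y n)) * F' z x"
     using \<open>Y n < 0\<close> Yr[of n] s by (intro MVT2 der x) auto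
    then obtain z where z: "s + Y n < z" "z < s" "F s x - F (s + Y n) x = (s - (s + Y n)) * F' z x" by blast
    then have "F (s + Y n) x - F s x = Y n * F' z x" by (simp add: algebra_simps)
    with z Yr[of n] s show ?thesis by (intro exI[of _ z]) auto
   qed
   then obtain z where z: "l < z" "z < r" "F (s + Y n) x - F s x = Y n * F' z x" by blast
   then have "?D n x = F' z x" using Y0 by simp
   with bnd[OF z(1,2) x] show ?thesis by simp
  qed
  have F'm: "F' s \<in> borel_measurable M"
   by (rule borel_measurable_LIMSEQ_real[OF Dl Dm])
  have "(\<lambda>n. \<integral>x. ?D n x \<partial>M) \<longlonglongrightarrow> (\<integral>x. F' s x \<partial>M)"
   by (rule integral_dominated_convergence[where w=G]) (use F'm Dm G Dl Db in auto)
  then have "(\<lambda>n. ((\<integral>x. F (s + Y n) x \<partial>M) - (\<integral>x. F s x \<partial>M)) / Y n) \<longlonglongrightarrow> (\<integral>x. F' s x \<partial>M)"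
   using int[OF Yr] int[OF s] by simp
  then show ?thesis unfolding Y_def by (rule LIMSEQ_offset)
 qed
 show ?thesis unfolding DERIV_def tendsto_at_iff_sequentially comp_def
  using quot by auto
qed

lemma test_borel: "\<phi> \<in> test_functions U ==> \<phi> \<in> borel_measurable borel"
 by (intro borel_measurable_continuous_onI smooth_continuous test_smooth)

lemma integral_lebesgue_borel:
 fixes f :: "'a::euclidean_space => real"
 assumes "f \<in> borel_measurable borel"
 shows "integral\<^sup>L lebesgue f = integral\<^sup>L lborel f" "integrable lebesgue f \<longleftrightarrow> integrable lborel f"
 using assms by (auto simp: integral_completion integrable_completion)

lemma test_integrable: 
 assumes "\<phi> \<in> test_functions U" shows "integrable lborel \<phi>"
proof -
 have "integrable lborel (\<lambda>x. indicator (supp \<phi>) x *\<^sub>R \<phi> x)"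
  using assms by (intro borel_integrable_compact smooth_continuous) (auto simp: test_functions_def')
 also have "(\<lambda>x. indicator (supp \<phi>) x *\<^sub>R \<phi> x) = \<phi>"
  using not_in_supp[of _ \<phi>] by (auto simp: indicator_def fun_eq_iff)
 finally show ?thesis .
qed

lemma lborel_integral_translation:
 fixes f :: "'a::euclidean_space => real"
 assumes "f \<in> borel_measurable borel"
 shows "(\<integral>x. f (x + c) \<partial>lborel) = (\<integral>x. f x \<partial>lborel)"
  and "integrable lborel (\<lambda>x. f (x + c)) \<longleftrightarrow> integrable lborel f"
proof -
 have "(\<integral>x. f x \<partial>lborel) = (\<integral>x. f x \<partial>distr lborel borel ((+) c))"
  by (simp add: lborel_distr_plus)
 also have "\<dots> = (\<integral>x. f (c + x) \<partial>lborel)"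
  using assms by (subst integral_distr) auto
 finally show "(\<integral>x. f (x + c) \<partial>lborel) = (\<integral>x. f x \<partial>lborel)" by (simp add: add.commute)
 have "integrable lborel f \<longleftrightarrow> integrable (distr lborel borel ((+) c)) f"
  by (simp add: lborel_distr_plus)
 also have "\<dots> \<longleftrightarrow> integrable lborel (\<lambda>x. f (c + x))"
  using assms by (subst integrable_distr_eq) auto
 finally show "integrable lborel (\<lambda>x. f (x + c)) \<longleftrightarrow> integrable lborel f" by (simp add: add.commute)
qed

text \<open>The integral of a translate does not depend on the translation; differentiating in the direction of
 the translation gives zero.\<close>

lemma integral_pd_test:
 fixes \<phi> :: "'a::euclidean_space => real"
 assumes \<phi>: "\<phi> \<in> test_functions U" and b: "b \<in> Basis"
 shows "(\<integral>x. pd b \<phi> x \<partial>lborel) = 0"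
proof -
 obtain B where B: "B > 0" "\<And>x. \<bar>pd b \<phi> x\<bar> \<le> B" using test_bounded[OF test_pd[OF \<phi> b]] by blast
 obtain R where R: "\<And>x. x \<in> supp \<phi> ==> norm x \<le> R"
  using compact_imp_bounded[OF test_compact[OF \<phi>]] unfolding bounded_iff by blast
 have "((\<lambda>\<sigma>. \<integral>x. \<phi> (x + \<sigma> *\<^sub>R b) \<partial>lborel) has_real_derivative (\<integral>x. pd b \<phi> (x + 0 *\<^sub>R b) \<partial>lborel)) (at 0)"
 proof (rule deriv_under_integral[where l="-1" and r=1 and G="\<lambda>x. indicator (cball 0 (R + 1)) x *\<^sub>R B"])
  show "((\<lambda>\<sigma>. \<phi> (x + \<sigma> *\<^sub>R b)) has_real_derivative pd b \<phi> (x + \<sigma> *\<^sub>R b)) (at \<sigma>)" for \<sigma> x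
   by (rule smooth_line_deriv[OF test_smooth[OF \<phi>]])
  show "integrable lborel (\<lambda>x. \<phi> (x + \<sigma> *\<^sub>R b))" for \<sigma>
   using test_integrable[OF \<phi>] by (simp add: lborel_integral_translation(2)[OF test_borel[OF \<phi>]])
  show "integrable lborel (\<lambda>x. indicator (cball 0 (R + 1)) x *\<^sub>R B)"
   by (rule borel_integrable_compact) auto
  show "\<bar>pd b \<phi> (x + \<sigma> *\<^sub>R b)\<bar> \<le> indicator (cball 0 (R + 1)) x *\<^sub>R B"
   if "-1 < \<sigma>" "\<sigma> < 1" for \<sigma> x
  proof (cases "x + \<sigma> *\<^sub>R b \<in> supp \<phi>")
   case True
   have "norm x \<le> norm (x + \<sigma> *\<^sub>R b) + norm (\<sigma> *\<^sub>R b)" by (metis add_diff_cancel_right' norm_triangle_ineq4)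
   also have "\<dots> \<le> R + 1" using R[OF True] that b by (intro add_mono) auto
   finally show ?thesis using B by simp
  next
   case False
   then show ?thesis using B by (simp add: pd_outside_supp indicator_def)
  qed
 qed auto
 moreover have "(\<integral>x. \<phi> (x + \<sigma> *\<^sub>R b) \<partial>lborel) = (\<integral>x. \<phi> x \<partial>lborel)" for \<sigma>
  by (rule lborel_integral_translation(1)[OF test_borel[OF \<phi>]])
 ultimately have "((\<lambda>\<sigma>::real. (\<integral>x. \<phi> x \<partial>lborel)) has_real_derivative (\<integral>x. pd b \<phi> x \<partial>lborel)) (at 0)" by simp
 then show ?thesis using DERIV_const DERIV_unique by blast
qed

lemma L2_inner_lborel:
 fixes f g :: "'a::euclidean_space => 'b::euclidean_space"
 assumes "E \<in> sets borel" "f \<in> borel_measurable borel" "g \<in> borel_measurable borel"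
 shows "L2_inner E f g = (\<integral>x. indicator E x * (f x \<bullet> g x) \<partial>lborel)"
proof -
 have "E \<in> sets lebesgue" using assms(1) by simp
 then have "L2_inner E f g = (\<integral>x. indicator E x * (f x \<bullet> g x) \<partial>lebesgue)"
  by (simp add: L2_inner_def integral_lebesgue_on(1))
 also have "\<dots> = (\<integral>x. indicator E x * (f x \<bullet> g x) \<partial>lborel)"
  by (rule integral_lebesgue_borel) (use assms in measurable)
 finally show ?thesis .
qed

lemma L2_inner_test_lborel:
 assumes "\<phi> \<in> test_functions E" "E \<in> sets borel" "f \<in> borel_measurable borel"
 shows "L2_inner E f \<phi> = (\<integral>x. f x * \<phi> x \<partial>lborel)"
 using assms by (subst L2_inner_lborel)
  (auto simp: test_borel indicator_def dest: test_zero intro!: Bochner_Integration.integral_cong)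

definition weak_pd :: "'a::euclidean_space set => 'a => ('a => real) => ('a => real) => bool" where
 "weak_pd E b f g \<longleftrightarrow> (\<forall>\<phi>\<in>test_functions E. L2_inner E f (pd b \<phi>) = - L2_inner E g \<phi>)"

lemma weak_pd_smooth:
 assumes E: "open E" and f: "smooth f" and b: "b \<in> Basis"
 shows "weak_pd E b f (pd b f)"
 unfolding weak_pd_def
proof
 fix \<phi> assume \<phi>: "\<phi> \<in> test_functions E"
 note f\<phi> = test_mult_smooth[OF \<phi> f]
 have fb: "h \<in> borel_measurable borel" if "smooth h" for h :: "'a => real"
  using that by (intro borel_measurable_continuous_onI smooth_continuous)
 have Eb: "E \<in> sets borel" using E by simp
 have i1: "integrable lborel (\<lambda>x. f x * pd b \<phi> x)"
  by (rule test_integrable[OF test_mult_smooth[OF test_pd[OF \<phi> b] f]])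
 have i2: "integrable lborel (\<lambda>x. pd b f x * \<phi> x)"
  by (rule test_integrable[OF test_mult_smooth[OF \<phi> smooth_pd[OF f b]]])
 have "0 = (\<integral>x. pd b (\<lambda>x. f x * \<phi> x) x \<partial>lborel)" using integral_pd_test[OF f\<phi> b] by simp
 also have "\<dots> = (\<integral>x. f x * pd b \<phi> x + pd b f x * \<phi> x \<partial>lborel)"
  by (simp add: pd_mult smooth_differentiable f test_smooth[OF \<phi>])
 also have "\<dots> = L2_inner E f (pd b \<phi>) + L2_inner E (pd b f) \<phi>"
  using i1 i2 Eb f smooth_pd[OF f b] by (simp add: L2_inner_test_lborel \<phi> test_pd[OF \<phi> b] fb)
 finally show "L2_inner E f (pd b \<phi>) = - L2_inner E (pd b f) \<phi>" by simp
qed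

section \<open>The Poincare inequality on star-shaped domains\<close>

definition weak_grad :: "pt set => (pt => real) => (pt => pt) => bool" where
 "weak_grad E g G \<longleftrightarrow> G \<in> L2 E \<and> (\<forall>b\<in>Basis. weak_pd E b g (\<lambda>x. G x \<bullet> b))"

lemma lborel_integral_affine:
 fixes f :: "pt => real"
 assumes f: "f \<in> borel_measurable borel" and s: "s > 0"
 shows "(\<integral>x. f x \<partial>lborel) = s\<^sup>2 * (\<integral>x. f (c + s *\<^sub>R x) \<partial>lborel)"
  and "integrable lborel f \<longleftrightarrow> integrable lborel (\<lambda>x. f (c + s *\<^sub>R x))"
proof -
 have e: "lborel = density (distr lborel borel (\<lambda>x::pt. c + s *\<^sub>R x)) (\<lambda>_. \<bar>s\<bar> ^ 2)"
  using lborel_affine[of s c] s by simp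
 have "(\<integral>x. f x \<partial>lborel) = (\<integral>x. \<bar>s\<bar> ^ 2 *\<^sub>R f x \<partial>distr lborel borel (\<lambda>x::pt. c + s *\<^sub>R x))"
  by (subst e, subst integral_density) (use f in auto)
 also have "\<dots> = (\<integral>x. \<bar>s\<bar> ^ 2 *\<^sub>R f (c + s *\<^sub>R x) \<partial>lborel)"
  using f by (subst integral_distr) auto
 finally show "(\<integral>x. f x \<partial>lborel) = s\<^sup>2 * (\<integral>x. f (c + s *\<^sub>R x) \<partial>lborel)" by simp
 have "integrable lborel f \<longleftrightarrow> integrable (distr lborel borel (\<lambda>x::pt. c + s *\<^sub>R x)) (\<lambda>x. \<bar>s\<bar> ^ 2 *\<^sub>R f x)"
  by (subst e, subst integrable_density) (use f in auto)
 also have "\<dots> \<longleftrightarrow> integrable lborel (\<lambda>x. \<bar>s\<bar> ^ 2 *\<^sub>R f (c + s *\<^sub>R x))"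
  using f by (subst integrable_distr_eq) auto
 finally show "integrable lborel f \<longleftrightarrow> integrable lborel (\<lambda>x. f (c + s *\<^sub>R x))" using s by simp
qed

text \<open>By duality it suffices to test with a test function $\theta$. Transporting $\theta$ by the dilation with
 centre \<open>a\<close> and factor \<open>s\<close>, the derivative in \<open>s\<close> of $\int g(a+s(x-a))\,\theta(x)$ becomes
 the weak gradient tested with a vector field whose norm is at most \<open>2 h\<close> times that of $\theta$, as
 \<open>s\<close> is at least \<open>1/2\<close>. The interval $[1/2,1]$ has length \<open>1/2\<close>, and the mean value theorem concludes.\<close>

lemma dilation_estimate:
 fixes g :: "pt => real" and G :: "pt => pt"
 assumes E: "open E" "bounded E" and U: "open U"
  and star: "\<And>x s. x \<in> U ==> 1/2 \<le> s ==> s \<le> 1 ==> a + s *\<^sub>R (x - a) \<in> E"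
  and h: "\<And>x. x \<in> U ==> norm (x - a) \<le> h" "h \<ge> 0"
  and g: "g \<in> L2 E" "g \<in> borel_measurable borel" and G: "weak_grad E g G"
 shows "L2_norm U (\<lambda>x. g x - g (a + (1/2) *\<^sub>R (x - a))) \<le> h * L2_norm E G"
  and "(\<lambda>x. g x - g (a + (1/2) *\<^sub>R (x - a))) \<in> L2 U"
proof -
 have UE: "U \<subseteq> E"
 proof
  fix x assume "x \<in> U" from star[OF this, of 1] show "x \<in> E" by simp
 qed
 have Es: "E \<in> sets lebesgue" "E \<in> sets borel" and Us: "U \<in> sets lebesgue" "U \<in> sets borel" using E U by auto
 have gU: "g \<in> L2 U" by (rule L2_subset[OF Es(1) Us(1) UE g(1)])
 have GE: "G \<in> L2 E" using G by (simp add: weak_grad_def)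
 let ?f = "\<lambda>z. indicator E z * (g z)\<^sup>2"
 have fi: "integrable lborel ?f"
 proof -
  have "integrable lebesgue ?f" using L2_integrable[OF g(1)] by (simp add: integral_lebesgue_on(2)[OF Es(1)])
  moreover have "?f \<in> borel_measurable borel" using Es g by measurable
  ultimately show ?thesis by (simp add: integral_lebesgue_borel)
 qed
 have scale: "(\<lambda>x. g (a + s *\<^sub>R (x - a))) \<in> L2 U" if s: "1/2 \<le> s" "s \<le> 1" for s
 proof -
  have m: "(\<lambda>x. g (a + s *\<^sub>R (x - a))) \<in> borel_measurable borel" using g(2) by measurable
  have m': "?f \<in> borel_measurable borel" using Es g by measurable
  have "integrable lborel (\<lambda>x. ?f ((1 - s) *\<^sub>R a + s *\<^sub>R x))"
   using lborel_integral_affine(2)[OF m', of s "(1 - s) *\<^sub>R a"] fi s by simp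
  then have i: "integrable lborel (\<lambda>x. ?f (a + s *\<^sub>R (x - a)))"
   by (simp add: algebra_simps)
  have "integrable lborel (\<lambda>x. indicator U x * (g (a + s *\<^sub>R (x - a)))\<^sup>2)"
  proof (rule Bochner_Integration.integrable_bound[OF i])
   show "(\<lambda>x. indicator U x * (g (a + s *\<^sub>R (x - a)))\<^sup>2) \<in> borel_measurable lborel"
    using m Us by measurable
   show "AE x in lborel. norm (indicator U x * (g (a + s *\<^sub>R (x - a)))\<^sup>2) \<le> norm (?f (a + s *\<^sub>R (x - a)))"
    using star[OF _ s] by (intro AE_I2) (auto simp: indicator_def)
  qed
  moreover have "(\<lambda>x. indicator U x * (g (a + s *\<^sub>R (x - a)))\<^sup>2) \<in> borel_measurable borel"
   using m Us by measurable
  ultimately have "integrable (lebesgue_on U) (\<lambda>x. (norm (g (a + s *\<^sub>R (x - a))))\<^sup>2)"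
   by (simp add: integral_lebesgue_on(2)[OF Us(1)] integral_lebesgue_borel(2))
  moreover have "(\<lambda>x. g (a + s *\<^sub>R (x - a))) \<in> borel_measurable (lebesgue_on U)"
   using m by (intro measurable_restrict_space1 measurable_completion) simp
  ultimately show ?thesis by (simp add: L2_def)
 qed
 show w: "(\<lambda>x. g x - g (a + (1/2) *\<^sub>R (x - a))) \<in> L2 U" by (intro L2_diff gU scale) auto
 show "L2_norm U (\<lambda>x. g x - g (a + (1/2) *\<^sub>R (x - a))) \<le> h * L2_norm E G"
 proof (rule L2_duality[OF U w])
  show "0 \<le> h * L2_norm E G" by (intro mult_nonneg_nonneg h(2) L2_norm_nonneg)
  fix \<theta> assume \<theta>: "\<theta> \<in> test_functions U"
  have \<theta>s: "smooth \<theta>" by (rule test_smooth[OF \<theta>])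
  \<comment> \<open>the test function transported by the dilation with centre \<open>a\<close> and factor \<open>s\<close>\<close>
  define Y where "Y s z = (1 / s) *\<^sub>R z + (a - (1 / s) *\<^sub>R a)" for s and z :: pt
  have Ya: "Y s z = a + (1 / s) *\<^sub>R (z - a)" for s z by (simp add: Y_def algebra_simps)
  define \<Phi> where "\<Phi> s z = inverse (s\<^sup>2) * \<theta> (Y s z)" for s z
  have bl: "bounded_linear (\<lambda>z::pt. (1 / s) *\<^sub>R z)" for s :: real by (rule bounded_linear_scaleR_right)
  have \<Phi>s: "smooth (\<Phi> s)" for s unfolding \<Phi>_def Y_def
   by (intro smooth_cmult smooth_compose_affine[OF bl \<theta>s])
  have \<Phi>b: "\<Phi> s \<in> borel_measurable borel" for s
   using \<Phi>s by (intro borel_measurable_continuous_onI smooth_continuous)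
  have pd\<Phi>: "pd b (\<Phi> s) z = inverse (s\<^sup>2) * ((1 / s) * pd b \<theta> (Y s z))" for s b z
  proof -
   have "pd b (\<Phi> s) z = inverse (s\<^sup>2) * pd b (\<lambda>z. \<theta> (Y s z)) z"
    unfolding \<Phi>_def by (rule pd_cmult) (unfold Y_def, rule smooth_compose_affine[OF bl \<theta>s])
   also have "pd b (\<lambda>z. \<theta> (Y s z)) z = pd ((1 / s) *\<^sub>R b) \<theta> (Y s z)"
    unfolding Y_def by (rule pd_compose_affine(1)[OF bl]) (rule smooth_differentiable[OF \<theta>s])
   also have "\<dots> = (1 / s) * pd b \<theta> (Y s z)"
    using linear_cmul[OF smooth_pd_linear[OF \<theta>s]] by simp
   finally show ?thesis .
  qed
  have YU: "Y s (a + s *\<^sub>R (x - a)) = x" if "s > 0" for s x using that by (simp add: Ya)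
  have aY: "a + s *\<^sub>R (Y s z - a) = z" if "s > 0" for s z using that by (simp add: Ya)
  have \<Phi>t: "\<Phi> s \<in> test_functions E" if s: "1/2 \<le> s" "s \<le> 1" for s
  proof (rule test_functionsI[OF \<Phi>s, of "(\<lambda>x. a + s *\<^sub>R (x - a)) ` supp \<theta>"])
   show "compact ((\<lambda>x. a + s *\<^sub>R (x - a)) ` supp \<theta>)"
    by (intro compact_continuous_image test_compact[OF \<theta>] continuous_intros)
   show "(\<lambda>x. a + s *\<^sub>R (x - a)) ` supp \<theta> \<subseteq> E" using star[OF _ s] test_supp[OF \<theta>] by blast
   fix z assume "z \<notin> (\<lambda>x. a + s *\<^sub>R (x - a)) ` supp \<theta>"
   then have "Y s z \<notin> supp \<theta>" using aY[of s z] s by force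
   then show "\<Phi> s z = 0" by (simp add: \<Phi>_def not_in_supp)
  qed
  define D where "D s z = - (1 / s) * (\<Sum>b\<in>Basis. pd b (\<lambda>z. ((z - a) \<bullet> b) * \<Phi> s z) z)" for s z
  have sm: "smooth (\<lambda>z::pt. (z - a) \<bullet> b)" for b
   using smooth_compose_affine[OF bounded_linear_ident smooth_linear[OF bounded_linear_inner_left[of b]], of "-a"]
   by simp
  have pdl: "pd b (\<lambda>z::pt. (z - a) \<bullet> b) z = 1" if "b \<in> Basis" for b z
   using that by (subst pd_eq[where f'="\<lambda>h. h \<bullet> b"]) (auto intro!: derivative_eq_intros)
  have Deq: "D s z = - 2 / s ^ 3 * \<theta> (Y s z) - 1 / s ^ 4 * (\<Sum>b\<in>Basis. ((z - a) \<bullet> b) * pd b \<theta> (Y s z))"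
   if "s > 0" for s z
  proof -
   have "(\<Sum>b\<in>Basis. pd b (\<lambda>z. ((z - a) \<bullet> b) * \<Phi> s z) z)
    = (\<Sum>b\<in>Basis. ((z - a) \<bullet> b) * (inverse (s\<^sup>2) * ((1 / s) * pd b \<theta> (Y s z))) + \<Phi> s z)"
    by (intro sum.cong refl) (simp add: pd_mult smooth_differentiable sm \<Phi>s pdl pd\<Phi>)
   also have "\<dots> = inverse (s\<^sup>2) * (1 / s) * (\<Sum>b\<in>Basis. ((z - a) \<bullet> b) * pd b \<theta> (Y s z)) + 2 * \<Phi> s z"
    by (simp add: sum.distrib sum_distrib_left mult_ac)
   finally show ?thesis using that
    by (simp add: D_def \<Phi>_def divide_simps power2_eq_square power3_eq_cube power4_eq_xxxx algebra_simps)
  qed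
  have der: "((\<lambda>s. \<Phi> s z) has_real_derivative D s z) (at s)" if s: "s > 0" for s z
  proof -
   have "((\<lambda>s. (1 / s) *\<^sub>R (z - a)) has_vector_derivative (- 1 / s\<^sup>2) *\<^sub>R (z - a)) (at s)"
    using s by (auto intro!: derivative_eq_intros simp: power2_eq_square divide_simps)
   then have "((\<lambda>s. Y s z) has_vector_derivative (- 1 / s\<^sup>2) *\<^sub>R (z - a)) (at s)"
    unfolding Ya using has_vector_derivative_add[OF has_vector_derivative_const] by fastforce
   then have "((\<lambda>s. Y s z) has_derivative (\<lambda>h. h *\<^sub>R ((- 1 / s\<^sup>2) *\<^sub>R (z - a)))) (at s)"
    by (simp add: has_vector_derivative_def)
   from has_derivative_compose[OF this smooth_has_derivative[OF \<theta>s]]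
   have "((\<lambda>s. \<theta> (Y s z)) has_derivative (\<lambda>h. pd (h *\<^sub>R ((- 1 / s\<^sup>2) *\<^sub>R (z - a))) \<theta> (Y s z))) (at s)" .
   moreover have "pd (h *\<^sub>R ((- 1 / s\<^sup>2) *\<^sub>R (z - a))) \<theta> (Y s z)
     = (- 1 / s\<^sup>2 * (\<Sum>b\<in>Basis. ((z - a) \<bullet> b) * pd b \<theta> (Y s z))) * h" for h
   proof -
    have "pd (h *\<^sub>R ((- 1 / s\<^sup>2) *\<^sub>R (z - a))) \<theta> (Y s z) = h * ((- 1 / s\<^sup>2) * pd (z - a) \<theta> (Y s z))"
     by (simp only: linear_cmul[OF smooth_pd_linear[OF \<theta>s]] real_scaleR_def)
    then show ?thesis by (simp add: pd_Basis_sum[OF smooth_differentiable[OF \<theta>s], of "z - a"])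
   qed
   ultimately have d1: "((\<lambda>s. \<theta> (Y s z)) has_real_derivative (- 1 / s\<^sup>2 * (\<Sum>b\<in>Basis. ((z - a) \<bullet> b) * pd b \<theta> (Y s z)))) (at s)"
    unfolding has_field_derivative_def by (simp only:)
   have d2: "((\<lambda>s. inverse (s\<^sup>2)) has_real_derivative - 2 / s ^ 3) (at s)"
    using s by (auto intro!: derivative_eq_intros simp: divide_simps power2_eq_square power3_eq_cube)
   from DERIV_mult[OF d2 d1] show ?thesis unfolding \<Phi>_def Deq[OF s]
    by (rule DERIV_cong) (use s in \<open>simp add: divide_simps power2_eq_square power3_eq_cube power4_eq_xxxx algebra_simps\<close>)
  qed
  obtain B0 where B0: "B0 > 0" "\<And>x. \<bar>\<theta> x\<bar> \<le> B0" using test_bounded[OF \<theta>] by blast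
  have "\<forall>b\<in>Basis. \<exists>B>0. \<forall>x. \<bar>pd b \<theta> x\<bar> \<le> B" using test_bounded[OF test_pd[OF \<theta>]] by metis
  then obtain B1 where B1: "\<And>b. b \<in> Basis ==> B1 b > 0" "\<And>b x. b \<in> Basis ==> \<bar>pd b \<theta> x\<bar> \<le> B1 b" by metis
  obtain R where R: "R > 0" "\<And>z. z \<in> E ==> norm (z - a) \<le> R"
  proof -
   obtain R0 where R0: "\<And>z. z \<in> E ==> norm z \<le> R0" using E(2) unfolding bounded_iff by blast
   have "norm (z - a) \<le> \<bar>R0\<bar> + norm a + 1" if "z \<in> E" for z
    using R0[OF that] norm_triangle_ineq4[of z a] by linarith
   moreover have "0 < \<bar>R0\<bar> + norm a + 1" using norm_ge_zero[of a] by linarith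
   ultimately show ?thesis by (rule_tac that)
  qed
  define C where "C = 2 * 64 * B0 + 256 * (\<Sum>b\<in>(Basis::pt set). R * B1 b)"
  have Db: "\<bar>D s z\<bar> \<le> C" if s: "1/4 < s" "s < 2" and z: "z \<in> E" for s z
  proof -
   have s3: "1 / s ^ 3 \<le> 64" "1 / s ^ 4 \<le> 256" "0 < 1 / s ^ 3" "0 < 1 / s ^ 4"
   proof -
    have "(1/4) ^ 3 \<le> s ^ 3" "(1/4) ^ 4 \<le> s ^ 4" using s by (intro power_mono; simp)+
    then show "1 / s ^ 3 \<le> 64" "1 / s ^ 4 \<le> 256" using s by (auto simp: field_simps)
   qed (use s in auto)
   have "\<bar>\<Sum>b\<in>Basis. ((z - a) \<bullet> b) * pd b \<theta> (Y s z)\<bar> \<le> (\<Sum>b\<in>Basis. \<bar>((z - a) \<bullet> b) * pd b \<theta> (Y s z)\<bar>)"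
    by (rule sum_abs)
   also have "\<dots> \<le> (\<Sum>b\<in>(Basis::pt set). R * B1 b)"
   proof (rule sum_mono)
    fix b :: pt assume b: "b \<in> Basis"
    have "\<bar>(z - a) \<bullet> b\<bar> \<le> R" using Basis_le_norm[OF b, of "z - a"] R(2)[OF z] by linarith
    then show "\<bar>((z - a) \<bullet> b) * pd b \<theta> (Y s z)\<bar> \<le> R * B1 b"
     unfolding abs_mult using B1(2)[OF b] R(1) by (intro mult_mono) auto
   qed
   finally have S: "\<bar>\<Sum>b\<in>Basis. ((z - a) \<bullet> b) * pd b \<theta> (Y s z)\<bar> \<le> (\<Sum>b\<in>(Basis::pt set). R * B1 b)" .
   have "\<bar>D s z\<bar> \<le> 2 * (1 / s ^ 3) * \<bar>\<theta> (Y s z)\<bar> + 1 / s ^ 4 * \<bar>\<Sum>b\<in>Basis. ((z - a) \<bullet> b) * pd b \<theta> (Y s z)\<bar>"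
    using s by (subst Deq) (auto simp: abs_mult intro!: order_trans[OF abs_triangle_ineq4])
   also have "\<dots> \<le> 2 * 64 * B0 + 256 * (\<Sum>b\<in>(Basis::pt set). R * B1 b)"
    using s3 S B0(2)[of "Y s z"] by (intro add_mono mult_mono) auto
   finally show ?thesis by (simp add: C_def)
  qed
  have DERIV_H: "((\<lambda>s. \<integral>z. g z * \<Phi> s z \<partial>lebesgue_on E) has_real_derivative (\<integral>z. g z * D s z \<partial>lebesgue_on E)) (at s)"
   if s: "1/4 < s" "s < 2" for s
  proof (rule deriv_under_integral[OF s, where G="\<lambda>z. \<bar>g z\<bar> * C"])
   show "((\<lambda>s. g z * \<Phi> s z) has_real_derivative g z * D s z) (at s)" if "1/4 < s" "s < 2" for s z
    by (rule DERIV_cmult[OF der]) (use that in simp)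
   show "integrable (lebesgue_on E) (\<lambda>z. g z * \<Phi> s z)" for s
    using L2_integrable_inner[OF g(1) smooth_L2[OF \<Phi>s Es(1) E(2), of s]] by simp
   show "\<bar>g z * D s z\<bar> \<le> \<bar>g z\<bar> * C" if "1/4 < s" "s < 2" "z \<in> space (lebesgue_on E)" for s z
    using Db[OF that(1,2)] that(3) by (simp add: abs_mult mult_left_mono)
   show "integrable (lebesgue_on E) (\<lambda>z. \<bar>g z\<bar> * C)"
    using L2_integrable_inner[OF g(1) L2_const[OF Es(1) E(2), of 1]] by (intro integrable_mult_left integrable_abs) simp
  qed
  define N where "N = sqrt (\<integral>x. (\<theta> x)\<^sup>2 \<partial>lborel)"
  have N: "N = L2_norm U \<theta>"
  proof -
   have "L2_inner U \<theta> \<theta> = (\<integral>x. \<theta> x * \<theta> x \<partial>lborel)"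
    by (rule L2_inner_test_lborel[OF \<theta> Us(2) test_borel[OF \<theta>]])
   then have "(L2_norm U \<theta>)\<^sup>2 = (\<integral>x. (\<theta> x)\<^sup>2 \<partial>lborel)" unfolding L2_norm_power2 by (simp add: power2_eq_square)
   then show ?thesis unfolding N_def by (metis L2_norm_nonneg real_sqrt_unique)
  qed
  have bound: "\<bar>\<integral>z. g z * D s z \<partial>lebesgue_on E\<bar> \<le> 2 * h * L2_norm E G * N" if s: "1/2 \<le> s" "s \<le> 1" for s
  proof -
   have s0: "s > 0" using s by simp
   let ?V = "\<lambda>z. \<Phi> s z *\<^sub>R (z - a)"
   have t: "(\<lambda>z. ((z - a) \<bullet> b) * \<Phi> s z) \<in> test_functions E" for b
    by (rule test_mult_smooth[OF \<Phi>t[OF s] sm])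
   have V: "?V \<in> L2 E"
    by (intro L2_continuous Es E continuous_intros smooth_continuous \<Phi>s)
   have "(\<integral>z. g z * D s z \<partial>lebesgue_on E) = L2_inner E g (D s)" by (simp add: L2_inner_def)
   also have "\<dots> = - (1 / s) * (\<Sum>b\<in>Basis. L2_inner E g (pd b (\<lambda>z. ((z - a) \<bullet> b) * \<Phi> s z)))"
    unfolding D_def L2_inner_cmult_right
    by (subst L2_inner_commute, subst L2_inner_sum_left)
      (auto intro!: test_L2[OF test_pd[OF t]] Es g simp: L2_inner_commute)
   also have "\<dots> = (1 / s) * (\<Sum>b\<in>Basis. L2_inner E (\<lambda>x. G x \<bullet> b) (\<lambda>z. ((z - a) \<bullet> b) * \<Phi> s z))"
    using G t by (simp add: weak_grad_def weak_pd_def sum_negf)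
   also have "(\<Sum>b\<in>Basis. L2_inner E (\<lambda>x. G x \<bullet> b) (\<lambda>z. ((z - a) \<bullet> b) * \<Phi> s z)) = L2_inner E G ?V"
   proof -
    have "(\<Sum>b\<in>Basis. L2_inner E (\<lambda>x. G x \<bullet> b) (\<lambda>z. ((z - a) \<bullet> b) * \<Phi> s z))
     = (\<integral>x. (\<Sum>b\<in>Basis. (G x \<bullet> b) * (((x - a) \<bullet> b) * \<Phi> s x)) \<partial>lebesgue_on E)"
     unfolding L2_inner_def inner_real_def
    proof (subst Bochner_Integration.integral_sum)
     fix b :: pt assume b: "b \<in> Basis"
     have "(\<lambda>x. G x \<bullet> b) \<in> L2 E"
     proof -
      obtain l where "b = axis l 1" using b by (auto simp: Basis_vec_def)
      then show ?thesis using L2_vec_nth[OF GE, of l] by (simp add: inner_axis)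
     qed
     from L2_integrable_inner[OF this test_L2[OF t Es(1)], of b]
     show "integrable (lebesgue_on E) (\<lambda>x. (G x \<bullet> b) * (((x - a) \<bullet> b) * \<Phi> s x))" by simp
    qed simp
    also have "\<dots> = L2_inner E G ?V" unfolding L2_inner_def
     by (intro Bochner_Integration.integral_cong refl, subst euclidean_inner)
       (auto simp: mult_ac inner_diff_left)
    finally show ?thesis .
   qed
   finally have "\<bar>\<integral>z. g z * D s z \<partial>lebesgue_on E\<bar> = (1 / s) * \<bar>L2_inner E G ?V\<bar>" using s0 by (simp add: abs_mult)
   also have "\<dots> \<le> (1 / s) * (L2_norm E G * (h * N))"
   proof (intro mult_left_mono order_trans[OF L2_Cauchy_Schwarz[OF GE V]] L2_norm_nonneg)
    have fb: "(\<lambda>z. (\<theta> (Y s z))\<^sup>2) \<in> borel_measurable borel"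
     unfolding Y_def using test_borel[OF \<theta>] by measurable
    have "integrable lborel (\<lambda>x. (\<theta> x)\<^sup>2)"
     using test_integrable[OF test_mult_smooth[OF \<theta> \<theta>s]] by (simp add: power2_eq_square)
    moreover have e1: "(\<lambda>x. (\<theta> (Y s ((1 - s) *\<^sub>R a + s *\<^sub>R x)))\<^sup>2) = (\<lambda>x. (\<theta> x)\<^sup>2)"
     using YU[OF s0] by (simp add: algebra_simps)
    ultimately have i: "integrable lborel (\<lambda>z. (\<theta> (Y s z))\<^sup>2)"
     by (subst lborel_integral_affine(2)[OF fb s0, of "(1 - s) *\<^sub>R a"]) simp
    have I: "(\<integral>z. (\<theta> (Y s z))\<^sup>2 \<partial>lborel) = s\<^sup>2 * (\<integral>x. (\<theta> x)\<^sup>2 \<partial>lborel)"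
     by (subst lborel_integral_affine(1)[OF fb s0, of "(1 - s) *\<^sub>R a"]) (simp add: e1)
    have Vb: "?V \<in> borel_measurable borel" using \<Phi>b by measurable
    have "(L2_norm E ?V)\<^sup>2 = (\<integral>z. indicator E z * (?V z \<bullet> ?V z) \<partial>lborel)"
     unfolding L2_norm_power2 by (rule L2_inner_lborel[OF Es(2) Vb Vb])
    also have "\<dots> \<le> (\<integral>z. (h / s)\<^sup>2 * (\<theta> (Y s z))\<^sup>2 \<partial>lborel)"
    proof (rule integral_mono_AE')
     show "integrable lborel (\<lambda>z. (h / s)\<^sup>2 * (\<theta> (Y s z))\<^sup>2)" using i by simp
     have "indicator E z * (?V z \<bullet> ?V z) \<le> (h / s)\<^sup>2 * (\<theta> (Y s z))\<^sup>2" for z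
     proof (cases "Y s z \<in> U")
      case True
      have "norm (z - a) = s * norm (Y s z - a)" using s0 by (simp add: Ya)
      also have "\<dots> \<le> s * h" using h(1)[OF True] s0 by simp
      finally have n: "norm (z - a) \<le> s * h" .
      have "?V z \<bullet> ?V z = (norm (?V z))\<^sup>2" by (rule power2_norm_eq_inner[symmetric])
      also have "norm (?V z) = \<bar>\<theta> (Y s z)\<bar> / s\<^sup>2 * norm (z - a)"
       by (simp add: \<Phi>_def abs_mult divide_inverse)
      also have "(\<bar>\<theta> (Y s z)\<bar> / s\<^sup>2 * norm (z - a))\<^sup>2 \<le> (\<bar>\<theta> (Y s z)\<bar> / s\<^sup>2 * (s * h))\<^sup>2"
       using n by (intro power_mono mult_left_mono) auto
      also have "\<dots> = (h / s)\<^sup>2 * (\<theta> (Y s z))\<^sup>2"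
       using s0 by (simp add: power_mult_distrib power_divide) (simp add: field_simps power2_eq_square power4_eq_xxxx)
      finally show ?thesis by (auto simp: indicator_def)
     next
      case False
      then show ?thesis using test_zero[OF \<theta>] by (simp add: \<Phi>_def)
     qed
     then show "AE z in lborel. indicator E z * (?V z \<bullet> ?V z) \<le> (h / s)\<^sup>2 * (\<theta> (Y s z))\<^sup>2" by simp
    qed (auto simp: indicator_def)
    also have "\<dots> = h\<^sup>2 * N\<^sup>2" using s0 by (simp add: I N_def power_divide)
    finally have "(L2_norm E ?V)\<^sup>2 \<le> (h * N)\<^sup>2" by (simp add: power_mult_distrib)
    then show "L2_norm E ?V \<le> h * N" by (rule power2_le_imp_le) (use h(2) in \<open>simp add: N_def\<close>)
   qed (use s0 in auto)
   also have "\<dots> \<le> 2 * (L2_norm E G * (h * N))"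
    using s h(2) L2_norm_nonneg[of E G] by (intro mult_right_mono) (auto simp: N_def field_simps)
   finally show ?thesis by (simp add: mult_ac)
  qed
  have H: "(\<integral>z. g z * \<Phi> s z \<partial>lebesgue_on E) = L2_inner U (\<lambda>x. g (a + s *\<^sub>R (x - a))) \<theta>"
   if s: "1/2 \<le> s" "s \<le> 1" for s
  proof -
   have s0: "s > 0" using s by simp
   let ?F = "\<lambda>z. indicator E z * (g z * \<Phi> s z)"
   have Fm: "?F \<in> borel_measurable borel" using Es g \<Phi>b by measurable
   have "(\<integral>z. g z * \<Phi> s z \<partial>lebesgue_on E) = (\<integral>z. ?F z \<partial>lborel)"
    using L2_inner_lborel[OF Es(2) g(2) \<Phi>b] by (simp add: L2_inner_def)
   also have "\<dots> = s\<^sup>2 * (\<integral>x. ?F ((1 - s) *\<^sub>R a + s *\<^sub>R x) \<partial>lborel)"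
    by (rule lborel_integral_affine(1)[OF Fm s0])
   also have "\<dots> = (\<integral>x. s\<^sup>2 * ?F ((1 - s) *\<^sub>R a + s *\<^sub>R x) \<partial>lborel)" by simp
   also have "\<dots> = (\<integral>x. g (a + s *\<^sub>R (x - a)) * \<theta> x \<partial>lborel)"
   proof (rule Bochner_Integration.integral_cong[OF refl])
    fix x
    have e: "(1 - s) *\<^sub>R a + s *\<^sub>R x = a + s *\<^sub>R (x - a)" by (simp add: algebra_simps)
    have "\<theta> x \<noteq> 0 ==> a + s *\<^sub>R (x - a) \<in> E" using star[OF _ s] test_zero[OF \<theta>] by blast
    then show "s\<^sup>2 * ?F ((1 - s) *\<^sub>R a + s *\<^sub>R x) = g (a + s *\<^sub>R (x - a)) * \<theta> x"
     using s0 by (cases "\<theta> x = 0") (auto simp: e \<Phi>_def YU)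
   qed
   also have "\<dots> = L2_inner U (\<lambda>x. g (a + s *\<^sub>R (x - a))) \<theta>"
    by (rule L2_inner_test_lborel[OF \<theta> Us(2), symmetric]) (use g(2) in measurable)
   finally show ?thesis .
  qed
  have "\<exists>\<xi>>1/2. \<xi> < 1 \<and> (\<integral>z. g z * \<Phi> 1 z \<partial>lebesgue_on E) - (\<integral>z. g z * \<Phi> (1/2) z \<partial>lebesgue_on E)
    = (1 - 1/2) * (\<integral>z. g z * D \<xi> z \<partial>lebesgue_on E)"
   by (rule MVT2) (auto intro!: DERIV_H)
  then obtain \<xi> where \<xi>: "1/2 < \<xi>" "\<xi> < 1" "(\<integral>z. g z * \<Phi> 1 z \<partial>lebesgue_on E) - (\<integral>z. g z * \<Phi> (1/2) z \<partial>lebesgue_on E)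
    = 1/2 * (\<integral>z. g z * D \<xi> z \<partial>lebesgue_on E)" by auto
  have "L2_inner U (\<lambda>x. g x - g (a + (1/2) *\<^sub>R (x - a))) \<theta>
   = L2_inner U g \<theta> - L2_inner U (\<lambda>x. g (a + (1/2) *\<^sub>R (x - a))) \<theta>"
   by (intro L2_inner_diff_left gU scale test_L2[OF \<theta> Us(1)]) auto
  also have "\<dots> = 1/2 * (\<integral>z. g z * D \<xi> z \<partial>lebesgue_on E)"
   using H[of 1] H[of "1/2"] \<xi>(3) by simp
  also have "\<dots> \<le> 1/2 * (2 * h * L2_norm E G * N)" using bound[of \<xi>] \<xi> by simp
  finally show "L2_inner U (\<lambda>x. g x - g (a + (1/2) *\<^sub>R (x - a))) \<theta> \<le> h * L2_norm E G * L2_norm U \<theta>"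
   by (simp add: N)
 qed
qed

lemma nn_integral_L2:
 fixes w :: "'a::euclidean_space => real"
 assumes U: "U \<in> sets borel" and w: "w \<in> borel_measurable borel" "w \<in> L2 U"
 shows "(\<integral>\<^sup>+x. indicator U x * ennreal ((w x)\<^sup>2) \<partial>lborel) = ennreal ((L2_norm U w)\<^sup>2)"
proof -
 have Us: "U \<in> sets lebesgue" using U by simp
 have m: "(\<lambda>x. indicator U x * (w x)\<^sup>2) \<in> borel_measurable borel" using U w(1) by measurable
 have "integrable lebesgue (\<lambda>x. indicator U x * (w x)\<^sup>2)"
  using L2_integrable[OF w(2)] by (simp add: integral_lebesgue_on(2)[OF Us])
 then have i: "integrable lborel (\<lambda>x. indicator U x * (w x)\<^sup>2)"
  using m by (simp add: integral_lebesgue_borel)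
 have "(\<integral>\<^sup>+x. indicator U x * ennreal ((w x)\<^sup>2) \<partial>lborel) = (\<integral>\<^sup>+x. ennreal (indicator U x * (w x)\<^sup>2) \<partial>lborel)"
  by (intro nn_integral_cong) (auto simp: indicator_def)
 also have "\<dots> = ennreal (\<integral>x. indicator U x * (w x)\<^sup>2 \<partial>lborel)"
  by (rule nn_integral_eq_integral[OF i]) simp
 also have "(\<integral>x. indicator U x * (w x)\<^sup>2 \<partial>lborel) = (L2_norm U w)\<^sup>2"
  unfolding L2_norm_power2 by (subst L2_inner_lborel[OF U w(1) w(1)]) (simp add: power2_eq_square)
 finally show ?thesis .
qed

text \<open>Borel functions may be composed with the midpoint map, as the double integral in the Poincare
 inequality requires.\<close>

lemma L2_borel_representative:
 fixes g :: "'a::euclidean_space => real"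
 assumes E: "E \<in> sets lebesgue" and g: "g \<in> L2 E"
 obtains g' where "g' \<in> borel_measurable borel" "g' \<in> L2 E" "AE x in lebesgue_on E. g x = g' x"
proof -
 have "(\<lambda>x. if x \<in> E then g x else 0) \<in> borel_measurable lebesgue"
  by (rule borel_measurable_if_I[OF L2_measurable[OF g] E])
 from completion_ex_borel_measurable_real[OF this] obtain g' where
  g': "g' \<in> borel_measurable lborel" "AE x in lborel. (if x \<in> E then g x else 0) = g' x" by blast
 have e: "AE x in lebesgue_on E. g x = g' x"
  using AE_completion[OF g'(2)] unfolding AE_lebesgue_on_iff[OF E] by eventually_elim auto
 show ?thesis
  using that[of g'] g'(1) L2_cong_AE[OF E g e] e by simp
qed

text \<open>For \<open>x\<close> in \<open>E\<close> and \<open>y\<close> in the ball, both values are compared with the value at the midpoint, which is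
 the image of \<open>x\<close> under the dilation with centre \<open>y\<close> and factor \<open>1/2\<close> and vice versa. Integrating
 over \<open>y\<close> and using the vanishing mean over the ball leaves the norm of \<open>g\<close>; the quotient \<open>h / r\<close>
 enters through the ratio of the areas of \<open>E\<close> and the ball.\<close>

lemma poincare_borel:
 fixes g :: "pt => real" and G :: "pt => pt"
 assumes E: "open E" "bounded E" and r: "r > 0" and BE: "ball c r \<subseteq> E"
  and star: "\<And>z y. z \<in> ball c r ==> y \<in> E ==> closed_segment z y \<subseteq> E"
  and h: "\<And>x y. x \<in> E ==> y \<in> E ==> norm (x - y) \<le> h"
  and g: "g \<in> L2 E" "g \<in> borel_measurable borel" and G: "weak_grad E g G"
  and mean: "(\<integral>x. g x \<partial>lebesgue_on (ball c r)) = 0"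
 shows "(L2_norm E g)\<^sup>2 \<le> 2 * h\<^sup>2 * (1 + (h / r)\<^sup>2) * (L2_norm E G)\<^sup>2"
proof -
 let ?B = "ball c r"
 have cE: "c \<in> E" using r BE by auto
 have h0: "h \<ge> 0" using h[OF cE cE] by simp
 have Es: "E \<in> sets lebesgue" "E \<in> sets borel" "?B \<in> sets lebesgue" "?B \<in> sets borel" using E by auto
 have gB: "g \<in> L2 ?B" by (rule L2_subset[OF Es(1,3) BE g(1)])
 define K where "K = (h * L2_norm E G)\<^sup>2"
 define m where "m x y = (1/2) *\<^sub>R (x + y)" for x y :: pt
 have K0: "K \<ge> 0" by (simp add: K_def)
 have m1: "a + (1/2) *\<^sub>R (x - a) = m x a" for a x
 proof -
  have "a = (1/2) *\<^sub>R a + (1/2) *\<^sub>R a" by (simp flip: scaleR_add_left)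
  then show ?thesis by (simp add: m_def scaleR_add_right scaleR_diff_right)
 qed
 have m2: "m x y = m y x" for x y by (simp add: m_def add.commute)
 have gm: "(\<lambda>x. g x - g (m x y)) \<in> borel_measurable borel" for y unfolding m_def using g(2) by measurable
 have seg: "z + s *\<^sub>R (y - z) \<in> closed_segment z y" if "0 \<le> s" "s \<le> 1" for z y :: pt and s
  using that by (auto simp: in_segment algebra_simps intro!: exI[of _ s])
 have D1: "(\<integral>\<^sup>+x. indicator E x * ennreal ((g x - g (m x y))\<^sup>2) \<partial>lborel) \<le> ennreal K" if y: "y \<in> ?B" for y
 proof -
  have s: "y + s *\<^sub>R (x - y) \<in> E" if "x \<in> E" "1/2 \<le> s" "s \<le> 1" for x s
   using seg[of s y x] star[OF y that(1)] that by auto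
  have hy: "norm (x - y) \<le> h" if "x \<in> E" for x using h[OF that, of y] y BE by auto
  have "L2_norm E (\<lambda>x. g x - g (m x y)) \<le> h * L2_norm E G \<and> (\<lambda>x. g x - g (m x y)) \<in> L2 E"
   unfolding m1[symmetric]
   by (rule conjI; rule dilation_estimate[OF E E(1) s hy h0 g G])
  then show ?thesis
   by (subst nn_integral_L2[OF Es(2) gm]) (auto simp: K_def L2_norm_nonneg intro!: ennreal_leI power_mono)
 qed
 have D2: "(\<integral>\<^sup>+y. indicator ?B y * ennreal ((g y - g (m x y))\<^sup>2) \<partial>lborel) \<le> ennreal K" if x: "x \<in> E" for x
 proof -
  have s: "x + s *\<^sub>R (y - x) \<in> E" if "y \<in> ?B" "1/2 \<le> s" "s \<le> 1" for y s
   using seg[of s x y] star[OF that(1) x] that by (auto simp: closed_segment_commute)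
  have hx: "norm (y - x) \<le> h" if "y \<in> ?B" for y using h[OF _ x, of y] that BE by auto
  have "L2_norm ?B (\<lambda>y. g y - g (m y x)) \<le> h * L2_norm E G \<and> (\<lambda>y. g y - g (m y x)) \<in> L2 ?B"
   unfolding m1[symmetric]
   by (rule conjI; rule dilation_estimate[OF E open_ball s hx h0 g G])
  then show ?thesis unfolding m2[of x]
   by (subst nn_integral_L2[OF Es(4) gm]) (auto simp: K_def L2_norm_nonneg intro!: ennreal_leI power_mono)
 qed
 define \<alpha> where "\<alpha> = (\<lambda>x y. indicator E x * (indicator ?B y * ennreal ((g x - g (m x y))\<^sup>2)))"
 define \<beta> where "\<beta> = (\<lambda>x y. indicator E x * (indicator ?B y * ennreal ((g y - g (m x y))\<^sup>2)))"
 have [measurable]: "g \<in> borel_measurable borel" "E \<in> sets borel" "?B \<in> sets borel" using g(2) Es by auto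
 have "(\<lambda>(x, y). \<alpha> x y) \<in> borel_measurable (borel \<Otimes>\<^sub>M borel)"
  unfolding \<alpha>_def m_def by measurable
 then have \<alpha>m: "(\<lambda>(x, y). \<alpha> x y) \<in> borel_measurable (lborel \<Otimes>\<^sub>M lborel)"
  by (simp cong: measurable_cong_sets sets_pair_measure_cong)
 have "(\<lambda>(x, y). \<beta> x y) \<in> borel_measurable (borel \<Otimes>\<^sub>M borel)"
  unfolding \<beta>_def m_def by measurable
 then have \<beta>m: "(\<lambda>(x, y). \<beta> x y) \<in> borel_measurable (lborel \<Otimes>\<^sub>M lborel)"
  by (simp cong: measurable_cong_sets sets_pair_measure_cong)
 have \<alpha>y: "\<alpha> x \<in> borel_measurable lborel" and \<beta>y: "\<beta> x \<in> borel_measurable lborel" for x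
  using \<alpha>m \<beta>m by (auto dest: measurable_Pair2[where x=x])
 let ?me = "measure lborel E" and ?mb = "measure lborel ?B"
 have fin: "emeasure lborel E = ennreal ?me" "emeasure lborel ?B = ennreal ?mb"
  using emeasure_bounded_finite[OF E(2)] emeasure_bounded_finite[of ?B]
  by (auto simp: emeasure_eq_ennreal_measure top.not_eq_extremum)
 have A: "(\<integral>\<^sup>+x. \<integral>\<^sup>+y. \<alpha> x y \<partial>lborel \<partial>lborel) \<le> ennreal (K * ?mb)"
 proof -
  have "(\<integral>\<^sup>+x. \<integral>\<^sup>+y. \<alpha> x y \<partial>lborel \<partial>lborel) = (\<integral>\<^sup>+y. \<integral>\<^sup>+x. \<alpha> x y \<partial>lborel \<partial>lborel)"
   by (rule lborel_pair.Fubini'[OF \<alpha>m, symmetric])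
  also have "\<dots> \<le> (\<integral>\<^sup>+y. ennreal K * indicator ?B y \<partial>lborel)"
  proof (rule nn_integral_mono)
   fix y
   show "(\<integral>\<^sup>+x. \<alpha> x y \<partial>lborel) \<le> ennreal K * indicator ?B y"
    using D1[of y] by (cases "y \<in> ?B") (auto simp: \<alpha>_def)
  qed
  also have "\<dots> = ennreal (K * ?mb)"
   using K0 by (subst nn_integral_cmult_indicator) (auto simp: fin ennreal_mult)
  finally show ?thesis .
 qed
 have Bq: "(\<integral>\<^sup>+x. \<integral>\<^sup>+y. \<beta> x y \<partial>lborel \<partial>lborel) \<le> ennreal (K * ?me)"
 proof -
  have "(\<integral>\<^sup>+x. \<integral>\<^sup>+y. \<beta> x y \<partial>lborel \<partial>lborel) \<le> (\<integral>\<^sup>+x. ennreal K * indicator E x \<partial>lborel)"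
  proof (rule nn_integral_mono)
   fix x
   show "(\<integral>\<^sup>+y. \<beta> x y \<partial>lborel) \<le> ennreal K * indicator E x"
    using D2[of x] by (cases "x \<in> E") (auto simp: \<beta>_def)
  qed
  also have "\<dots> = ennreal (K * ?me)"
   using K0 Es by (subst nn_integral_cmult_indicator) (auto simp: fin ennreal_mult)
  finally show ?thesis .
 qed
 have low: "ennreal (?mb * (g x)\<^sup>2) \<le> (\<integral>\<^sup>+y. indicator ?B y * ennreal ((g x - g y)\<^sup>2) \<partial>lborel)" for x
 proof -
  have c: "(\<lambda>y::pt. g x) \<in> L2 ?B" by (rule L2_const) auto
  have cg: "L2_inner ?B (\<lambda>y. g x) g = 0" using mean by (simp add: L2_inner_def)
  have cc: "L2_inner ?B (\<lambda>y. g x) (\<lambda>y. g x) = ?mb * (g x)\<^sup>2"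
  proof -
   have "L2_inner ?B (\<lambda>y. g x) (\<lambda>y. g x) = (\<integral>y. indicator ?B y * (g x)\<^sup>2 \<partial>lborel)"
    by (subst L2_inner_lborel) (auto simp: power2_eq_square)
   then show ?thesis by simp
  qed
  have "(L2_norm ?B (\<lambda>y. g x - g y))\<^sup>2 = ?mb * (g x)\<^sup>2 + (L2_norm ?B g)\<^sup>2"
   unfolding L2_norm_power2 using c gB
   by (simp add: L2_inner_diff_left L2_inner_diff_right L2_diff cg cc L2_inner_commute[of ?B g "\<lambda>y. g x"])
  then have "?mb * (g x)\<^sup>2 \<le> (L2_norm ?B (\<lambda>y. g x - g y))\<^sup>2" by simp
  then show ?thesis
   by (subst nn_integral_L2[OF Es(4)]) (use g(2) L2_diff[OF c gB] in \<open>auto intro: ennreal_leI\<close>)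
 qed
 have up: "indicator E x * (indicator ?B y * ennreal ((g x - g y)\<^sup>2)) \<le> 2 * \<alpha> x y + 2 * \<beta> x y" for x y
 proof -
  have "(g x - g y)\<^sup>2 \<le> 2 * (g x - g (m x y))\<^sup>2 + 2 * (g y - g (m x y))\<^sup>2"
  proof -
   have "0 \<le> ((g x - g (m x y)) + (g y - g (m x y)))\<^sup>2" by simp
   then show ?thesis by (simp add: power2_eq_square algebra_simps)
  qed
  then have "ennreal ((g x - g y)\<^sup>2) \<le> ennreal (2 * (g x - g (m x y))\<^sup>2 + 2 * (g y - g (m x y))\<^sup>2)"
   by (rule ennreal_leI)
  also have "\<dots> = 2 * ennreal ((g x - g (m x y))\<^sup>2) + 2 * ennreal ((g y - g (m x y))\<^sup>2)"
   by (simp add: ennreal_mult flip: ennreal_numeral)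
  finally show ?thesis by (auto simp: \<alpha>_def \<beta>_def indicator_def)
 qed
 have "ennreal (?mb * (L2_norm E g)\<^sup>2) = ennreal ?mb * ennreal ((L2_norm E g)\<^sup>2)"
  by (simp add: ennreal_mult)
 also have "\<dots> = ennreal ?mb * (\<integral>\<^sup>+x. indicator E x * ennreal ((g x)\<^sup>2) \<partial>lborel)"
  by (subst nn_integral_L2[OF Es(2) g(2) g(1)]) simp
 also have "\<dots> = (\<integral>\<^sup>+x. ennreal ?mb * (indicator E x * ennreal ((g x)\<^sup>2)) \<partial>lborel)"
  by (rule nn_integral_cmult[symmetric]) (use g(2) Es in measurable)
 also have "\<dots> \<le> (\<integral>\<^sup>+x. \<integral>\<^sup>+y. 2 * \<alpha> x y + 2 * \<beta> x y \<partial>lborel \<partial>lborel)"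
 proof (rule nn_integral_mono)
  fix x
  have "ennreal ?mb * (indicator E x * ennreal ((g x)\<^sup>2)) = indicator E x * ennreal (?mb * (g x)\<^sup>2)"
   by (simp add: ennreal_mult mult_ac)
  also have "\<dots> \<le> indicator E x * (\<integral>\<^sup>+y. indicator ?B y * ennreal ((g x - g y)\<^sup>2) \<partial>lborel)"
   by (intro mult_left_mono low) simp
  also have "\<dots> = (\<integral>\<^sup>+y. indicator E x * (indicator ?B y * ennreal ((g x - g y)\<^sup>2)) \<partial>lborel)"
   by (rule nn_integral_cmult[symmetric]) (use g(2) in measurable)
  also have "\<dots> \<le> (\<integral>\<^sup>+y. 2 * \<alpha> x y + 2 * \<beta> x y \<partial>lborel)"
   by (intro nn_integral_mono up)
  finally show "ennreal ?mb * (indicator E x * ennreal ((g x)\<^sup>2)) \<le> (\<integral>\<^sup>+y. 2 * \<alpha> x y + 2 * \<beta> x y \<partial>lborel)" .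
 qed
 also have "\<dots> = (\<integral>\<^sup>+x. 2 * (\<integral>\<^sup>+y. \<alpha> x y \<partial>lborel) + 2 * (\<integral>\<^sup>+y. \<beta> x y \<partial>lborel) \<partial>lborel)"
  using \<alpha>y \<beta>y by (simp add: nn_integral_add nn_integral_cmult)
 also have "\<dots> = 2 * (\<integral>\<^sup>+x. \<integral>\<^sup>+y. \<alpha> x y \<partial>lborel \<partial>lborel) + 2 * (\<integral>\<^sup>+x. \<integral>\<^sup>+y. \<beta> x y \<partial>lborel \<partial>lborel)"
  using lborel.borel_measurable_nn_integral[OF \<alpha>m] lborel.borel_measurable_nn_integral[OF \<beta>m]
  by (subst nn_integral_add) (simp_all add: nn_integral_cmult)
 also have "\<dots> \<le> 2 * ennreal (K * ?mb) + 2 * ennreal (K * ?me)"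
  by (intro add_mono mult_left_mono A Bq) auto
 also have "\<dots> = ennreal (2 * (K * ?mb) + 2 * (K * ?me))"
  using K0 by (simp add: ennreal_mult flip: ennreal_numeral)
 finally have main: "?mb * (L2_norm E g)\<^sup>2 \<le> 2 * (K * ?mb) + 2 * (K * ?me)"
  using K0 by (subst (asm) ennreal_le_iff) auto
 have mb: "?mb = unit_ball_vol 2 * r\<^sup>2" using r content_ball[of r c] by simp
 have mb0: "?mb > 0" using r by (simp add: mb unit_ball_vol_pos)
 have "?me \<le> measure lborel (cball c h)"
  using h[OF _ cE] Es by (intro measure_mono_fmeasurable) (auto simp: dist_norm norm_minus_commute fmeasurable_def emeasure_bounded_finite[unfolded infinity_ennreal_def, OF bounded_cball])
 also have "\<dots> = unit_ball_vol 2 * h\<^sup>2" using h0 content_cball[of h c] by simp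
 finally have me: "?me \<le> (h / r)\<^sup>2 * ?mb" using r by (simp add: mb power_divide mult.commute)
 have "?mb * (L2_norm E g)\<^sup>2 \<le> 2 * (K * ?mb) + 2 * (K * ((h / r)\<^sup>2 * ?mb))"
  using main mult_left_mono[OF me K0] by linarith
 also have "\<dots> = ?mb * (2 * K * (1 + (h / r)\<^sup>2))" by (simp add: algebra_simps)
 finally have "(L2_norm E g)\<^sup>2 \<le> 2 * K * (1 + (h / r)\<^sup>2)" using mb0 by (simp only: mult_le_cancel_left_pos)
 then show ?thesis by (simp add: K_def power_mult_distrib mult_ac)
qed

lemma weak_grad_cong:
 assumes E: "open E" and g: "g \<in> L2 E" "g' \<in> L2 E" "AE x in lebesgue_on E. g x = g' x" and G: "weak_grad E g G"
 shows "weak_grad E g' G"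
proof -
 have "L2_inner E g' (pd b \<phi>) = L2_inner E g (pd b \<phi>)" if "\<phi> \<in> test_functions E" "b \<in> Basis" for \<phi> b
  using g E test_L2[OF test_pd[OF that]] by (intro L2_inner_cong_AE) (auto elim: eventually_mono)
 then show ?thesis using G by (simp add: weak_grad_def weak_pd_def)
qed

lemma poincare:
 fixes g :: "pt => real" and G :: "pt => pt"
 assumes E: "open E" "bounded E" and r: "r > 0" and BE: "ball c r \<subseteq> E"
  and star: "\<And>z y. z \<in> ball c r ==> y \<in> E ==> closed_segment z y \<subseteq> E"
  and h: "\<And>x y. x \<in> E ==> y \<in> E ==> norm (x - y) \<le> h"
  and g: "g \<in> L2 E" and G: "weak_grad E g G"
  and mean: "(\<integral>x. g x \<partial>lebesgue_on (ball c r)) = 0"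
 shows "(L2_norm E g)\<^sup>2 \<le> 2 * h\<^sup>2 * (1 + (h / r)\<^sup>2) * (L2_norm E G)\<^sup>2"
proof -
 have Es: "E \<in> sets lebesgue" and Bs: "ball c r \<in> sets lebesgue" using E by auto
 obtain g' where g': "g' \<in> borel_measurable borel" "g' \<in> L2 E" and e: "AE x in lebesgue_on E. g x = g' x"
  using L2_borel_representative[OF Es g] by blast
 have "(\<integral>x. g' x \<partial>lebesgue_on (ball c r)) = (\<integral>x. g x \<partial>lebesgue_on (ball c r))"
  using AE_subset[OF Es Bs BE e] L2_measurable[OF L2_subset[OF Es Bs BE g]] L2_measurable[OF L2_subset[OF Es Bs BE g'(2)]]
  by (intro integral_cong_AE) (auto elim: eventually_mono)
 with mean have "(\<integral>x. g' x \<partial>lebesgue_on (ball c r)) = 0" by simp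
 from poincare_borel[OF E r BE star h g'(2,1) weak_grad_cong[OF E(1) g g'(2) e G] this]
 have "(L2_norm E g')\<^sup>2 \<le> 2 * h\<^sup>2 * (1 + (h / r)\<^sup>2) * (L2_norm E G)\<^sup>2" by simp
 moreover have "(L2_norm E g')\<^sup>2 = (L2_norm E g)\<^sup>2"
  unfolding L2_norm_power2 using g g' e by (intro L2_inner_cong_AE) (auto elim: eventually_mono)
 ultimately show ?thesis by simp
qed

section \<open>Polynomials\<close>

definition mono2 :: "nat => nat => pt => real" where
 "mono2 i j x = (x $ 1) ^ i * (x $ 2) ^ j"

lemma finite_degree_set: "finite {(i, j). int (i + j) \<le> n}"
 by (rule finite_subset[of _ "{..nat n} \<times> {..nat n}"]) auto

lemma poly_fun_iff: "p \<in> poly_fun n \<longleftrightarrow>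
  (\<exists>a. p = (\<lambda>x. \<Sum>(i, j)\<in>{(i, j). int (i + j) \<le> n}. a i j * mono2 i j x))"
 by (simp add: poly_fun_def mono2_def mult.assoc)

lemma poly_fun_mono2: "int (i + j) \<le> n ==> mono2 i j \<in> poly_fun n"
proof -
 assume ij: "int (i + j) \<le> n"
 have "mono2 i j x = (\<Sum>p\<in>{(i, j). int (i + j) \<le> n}. (if p = (i, j) then 1 else 0) * mono2 (fst p) (snd p) x)" for x
  using ij finite_degree_set[of n] by (simp add: if_distrib[of "\<lambda>c. c * _"] sum.delta' cong: if_cong)
 then show ?thesis unfolding poly_fun_iff
  by (intro exI[of _ "\<lambda>i' j'. if (i', j') = (i, j) then 1 else 0"]) (auto simp: fun_eq_iff case_prod_beta prod_eq_iff)
qed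

lemma poly_fun_add: "p \<in> poly_fun n ==> q \<in> poly_fun n ==> (\<lambda>x. p x + q x) \<in> poly_fun n"
proof -
 assume "p \<in> poly_fun n" "q \<in> poly_fun n"
 then obtain a b where ab: "p = (\<lambda>x. \<Sum>(i, j)\<in>{(i, j). int (i + j) \<le> n}. a i j * mono2 i j x)"
  "q = (\<lambda>x. \<Sum>(i, j)\<in>{(i, j). int (i + j) \<le> n}. b i j * mono2 i j x)" unfolding poly_fun_iff by blast
 show ?thesis unfolding poly_fun_iff
  by (rule exI[of _ "\<lambda>i j. a i j + b i j"]) (simp add: ab case_prod_beta sum.distrib[symmetric] distrib_right)
qed

lemma poly_fun_cmult: "p \<in> poly_fun n ==> (\<lambda>x. c * p x) \<in> poly_fun n"
proof -
 assume "p \<in> poly_fun n"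
 then obtain a where a: "p = (\<lambda>x. \<Sum>(i, j)\<in>{(i, j). int (i + j) \<le> n}. a i j * mono2 i j x)"
  unfolding poly_fun_iff by blast
 show ?thesis unfolding poly_fun_iff
  by (rule exI[of _ "\<lambda>i j. c * a i j"]) (simp add: a case_prod_beta sum_distrib_left mult.assoc)
qed

lemma poly_fun_zero: "(\<lambda>x. 0) \<in> poly_fun n"
 unfolding poly_fun_iff by (rule exI[of _ "\<lambda>i j. 0"]) simp

lemma poly_fun_diff: "p \<in> poly_fun n ==> q \<in> poly_fun n ==> (\<lambda>x. p x - q x) \<in> poly_fun n"
 using poly_fun_add[of p n "\<lambda>x. (-1) * q x"] poly_fun_cmult[of q n "-1"] by simp

lemma poly_fun_induct [consumes 1, case_names zero mono]:
 assumes "p \<in> poly_fun n" and "P (\<lambda>x. 0)"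
  and "\<And>i j c q. int (i + j) \<le> n ==> q \<in> poly_fun n ==> P q ==> P (\<lambda>x. c * mono2 i j x + q x)"
 shows "P p"
proof -
 from assms(1) obtain a where a: "p = (\<lambda>x. \<Sum>(i, j)\<in>{(i, j). int (i + j) \<le> n}. a i j * mono2 i j x)"
  unfolding poly_fun_iff by blast
 have "P (\<lambda>x. \<Sum>(i, j)\<in>S. a i j * mono2 i j x) \<and> (\<lambda>x. \<Sum>(i, j)\<in>S. a i j * mono2 i j x) \<in> poly_fun n"
  if "finite S" "S \<subseteq> {(i, j). int (i + j) \<le> n}" for S
  using that
 proof (induction S rule: finite_induct)
  case empty then show ?case using assms(2) poly_fun_zero by simp
 next
  case (insert s S)
  obtain i j where s: "s = (i, j)" by fastforce
  with insert show ?case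
   by (auto intro!: assms(3) poly_fun_add poly_fun_cmult poly_fun_mono2)
 qed
 from this[OF finite_degree_set order_refl] show ?thesis by (simp add: a)
qed

lemma poly_fun_mono: "m \<le> n ==> p \<in> poly_fun m ==> p \<in> poly_fun n"
 by (rotate_tac 1, induction p rule: poly_fun_induct)
   (auto intro!: poly_fun_zero poly_fun_add poly_fun_cmult poly_fun_mono2)

lemma poly_fun_const: "n \<ge> 0 ==> (\<lambda>x. c) \<in> poly_fun n"
 using poly_fun_cmult[OF poly_fun_mono2[of 0 0 n], of c] by (simp add: mono2_def)

lemma mono2_00: "mono2 0 0 x = 1" by (simp add: mono2_def)

lemma smooth_mono2: "smooth (mono2 i j)"
 unfolding mono2_def by (intro smooth_mult smooth_power smooth_nth)

lemma smooth_poly_fun: "p \<in> poly_fun n ==> smooth p"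
 by (induction p rule: poly_fun_induct) (auto intro!: smooth_const smooth_add smooth_cmult smooth_mono2)

lemma e12_Basis [simp]: "e1 \<in> Basis" "e2 \<in> Basis"
 by (auto simp: axis_in_Basis_iff)

lemma Basis_pt: "(Basis :: pt set) = {e1, e2}"
 by (auto simp: Basis_vec_def) (metis (full_types) exhaust_2)

lemma e1_neq_e2 [simp]: "e1 \<noteq> e2" "e2 \<noteq> e1"
 by (auto simp: axis_eq_axis)

lemma pd_mono2:
 "pd e1 (mono2 i j) x = real i * mono2 (i - 1) j x"
 "pd e2 (mono2 i j) x = real j * mono2 i (j - 1) x"
proof -
 have d: "(mono2 i j has_derivative (\<lambda>h. (x $ 1) ^ i * (real j * h $ 2 * (x $ 2) ^ (j - 1))
   + real i * h $ 1 * (x $ 1) ^ (i - 1) * (x $ 2) ^ j)) (at x)"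
  unfolding mono2_def
  by (intro has_derivative_mult has_derivative_power bounded_linear_imp_has_derivative bounded_linear_vec_nth)
 show "pd e1 (mono2 i j) x = real i * mono2 (i - 1) j x"
  "pd e2 (mono2 i j) x = real j * mono2 i (j - 1) x"
  by (simp_all add: pd_eq[OF d] mono2_def axis_def)
qed

lemma pd_poly_fun: "p \<in> poly_fun n ==> b \<in> {e1, e2} ==> pd b p \<in> poly_fun (n - 1)"
proof (induction p rule: poly_fun_induct)
 case zero
 have "pd b (\<lambda>x::pt. 0) = (\<lambda>x. 0)" by (simp add: fun_eq_iff pd_const)
 then show ?case by (simp add: poly_fun_zero)
next
 case (mono i j c q)
 have e: "pd b (\<lambda>x. c * mono2 i j x + q x) = (\<lambda>x. c * pd b (mono2 i j) x + pd b q x)"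
  by (simp add: fun_eq_iff pd_add pd_cmult smooth_cmult smooth_mono2 smooth_poly_fun[OF mono(2)])
 have "pd b (mono2 i j) \<in> poly_fun (n - 1)"
 proof (cases "b = e1")
  case True
  then have "pd b (mono2 i j) = (\<lambda>x. real i * mono2 (i - 1) j x)" by (simp add: fun_eq_iff pd_mono2)
  then show ?thesis using mono(1)
   by (cases "i = 0") (auto intro!: poly_fun_zero poly_fun_cmult poly_fun_mono2)
 next
  case False
  then have "b = e2" using mono by auto
  then have "pd b (mono2 i j) = (\<lambda>x. real j * mono2 i (j - 1) x)" by (simp add: fun_eq_iff pd_mono2)
  then show ?thesis using mono(1)
   by (cases "j = 0") (auto intro!: poly_fun_zero poly_fun_cmult poly_fun_mono2)
 qed
 then show ?case unfolding e by (intro poly_fun_add poly_fun_cmult mono.IH mono.prems)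
qed

lemma continuous_AE_zero:
 fixes p :: "'a::euclidean_space => real"
 assumes E: "open E" and p: "continuous_on UNIV p" and ae: "AE x in lebesgue_on E. p x = 0" and x: "x \<in> E"
 shows "p x = 0"
proof (rule ccontr)
 assume nz: "p x \<noteq> 0"
 let ?S = "{y \<in> E. p y \<noteq> 0}"
 have "?S = E \<inter> (p -` (- {0}) \<inter> UNIV)" by auto
 then have o: "open ?S" using E continuous_openin_preimage_gen[OF p, of "- {0}"]
  by (auto intro!: open_Int simp: Int_commute)
 have Es: "E \<in> sets lebesgue" using E by simp
 have "AE x in lebesgue. x \<notin> ?S"
  using ae unfolding AE_lebesgue_on_iff[OF Es] by eventually_elim auto
 then have "?S \<in> null_sets lebesgue" using o by (subst AE_iff_null_sets) auto
 then have "negligible ?S" by (simp add: negligible_iff_null_sets)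
 with open_not_negligible[OF o] nz x show False by auto
qed

lemma poly_fun_line:
 assumes "p \<in> poly_fun n"
 shows "\<exists>P. \<forall>t. p (x + t *\<^sub>R d) = poly P t"
 using assms
proof (induction p rule: poly_fun_induct)
 case zero show ?case by (rule exI[of _ 0]) simp
next
 case (mono i j c q)
 then obtain P where P: "\<And>t. q (x + t *\<^sub>R d) = poly P t" by blast
 show ?case
  by (rule exI[of _ "smult c ([:x $ 1, d $ 1:] ^ i * [:x $ 2, d $ 2:] ^ j) + P"]) (simp add: P mono2_def)
qed

text \<open>On each line through a point of \<open>E\<close> the function is a univariate polynomial with infinitely many
 zeros.\<close>

lemma poly_fun_eq_zero:
 assumes p: "p \<in> poly_fun n" and E: "open E" "E \<noteq> {}" and z: "\<And>x. x \<in> E ==> p x = 0"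
 shows "p = (\<lambda>x. 0)"
proof
 fix y
 obtain x where x: "x \<in> E" using E by blast
 obtain P where P: "\<And>t. p (x + t *\<^sub>R (y - x)) = poly P t" using poly_fun_line[OF p] by blast
 obtain e where e: "e > 0" "ball x e \<subseteq> E" using E x openE by metis
 define \<delta> where "\<delta> = e / (norm (y - x) + 1)"
 have np: "norm (y - x) + 1 > 0" using norm_ge_zero[of "y - x"] by linarith
 have \<delta>: "\<delta> > 0" using e np by (simp add: \<delta>_def)
 have "{0<..<\<delta>} \<subseteq> {t. poly P t = 0}"
 proof
  fix t assume t: "t \<in> {0<..<\<delta>}"
  have "norm (t *\<^sub>R (y - x)) \<le> t * (norm (y - x) + 1)" using t by simp
  also have "\<dots> < \<delta> * (norm (y - x) + 1)" using t np by (intro mult_strict_right_mono) auto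
  also have "\<dots> = e" using np by (simp add: \<delta>_def)
  finally have "x + t *\<^sub>R (y - x) \<in> ball x e" by (simp add: dist_norm)
  then have "x + t *\<^sub>R (y - x) \<in> E" using e(2) by (rule subsetD[rotated])
  from z[OF this] show "t \<in> {t. poly P t = 0}" unfolding P by simp
 qed
 then have "infinite {t. poly P t = 0}"
  using \<delta> infinite_Ioo[of 0 \<delta>] finite_subset by blast
 then have "P = 0" using poly_roots_finite by blast
 then show "p y = 0" using P[of 1] by simp
qed

lemma poly_fun_AE_eq:
 assumes "p \<in> poly_fun n" "q \<in> poly_fun n" and E: "open E" "E \<noteq> {}" and ae: "AE x in lebesgue_on E. p x = q x"
 shows "p = q"
proof -
 have d: "(\<lambda>x. p x - q x) \<in> poly_fun n" using assms by (intro poly_fun_diff)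
 have "AE x in lebesgue_on E. p x - q x = 0" using ae by eventually_elim simp
 from continuous_AE_zero[OF E(1) smooth_continuous[OF smooth_poly_fun[OF d]] this]
 have "(\<lambda>x. p x - q x) = (\<lambda>x. 0)" by (rule poly_fun_eq_zero[OF d E])
 then show ?thesis by (simp add: fun_eq_iff)
qed

subsection \<open>Iterated derivatives\<close>

definition Dm :: "nat => nat => (pt => real) => (pt => real)" where
 "Dm i j \<phi> = (pd e1 ^^ i) ((pd e2 ^^ j) \<phi>)"

lemma smooth_pd_pow: "smooth \<phi> ==> b \<in> Basis ==> smooth ((pd b ^^ i) \<phi>)"
 by (induction i) (auto intro: smooth_pd)

lemma smooth_Dm: "smooth \<phi> ==> smooth (Dm i j \<phi>)"
 unfolding Dm_def by (intro smooth_pd_pow e12_Basis)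

lemma pd_pow_commute: "smooth \<phi> ==> a \<in> Basis ==> b \<in> Basis ==> (pd a ^^ i) (pd b \<phi>) = pd b ((pd a ^^ i) \<phi>)"
 by (induction i) (auto simp: pd_commute smooth_pd_pow)

lemma Dm_Suc1: "Dm (Suc i) j \<phi> = pd e1 (Dm i j \<phi>)" by (simp add: Dm_def)

lemma Dm_Suc2: "smooth \<phi> ==> Dm i (Suc j) \<phi> = pd e2 (Dm i j \<phi>)"
 by (simp add: Dm_def pd_pow_commute smooth_pd_pow)

lemma Dm_pd1: "smooth \<phi> ==> Dm i j (pd e1 \<phi>) = Dm (Suc i) j \<phi>"
 by (simp add: Dm_def pd_pow_commute smooth_pd_pow)

lemma Dm_pd2: "Dm i j (pd e2 \<phi>) = Dm i (Suc j) \<phi>"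
 by (simp add: Dm_def funpow_swap1)

lemma pd_pow_lin: "smooth f ==> smooth g ==> b \<in> Basis ==>
  (pd b ^^ i) (\<lambda>x. c * f x + g x) = (\<lambda>x. c * (pd b ^^ i) f x + (pd b ^^ i) g x)"
proof (induction i)
 case (Suc i)
 then show ?case by simp (simp add: fun_eq_iff pd_add pd_cmult smooth_cmult smooth_pd_pow)
qed simp

lemma Dm_lin: "smooth f ==> smooth g ==> Dm i j (\<lambda>x. c * f x + g x) = (\<lambda>x. c * Dm i j f x + Dm i j g x)"
 by (simp add: Dm_def pd_pow_lin smooth_pd_pow)

lemma Dm_zero: "Dm i j (\<lambda>x. 0) = (\<lambda>x. 0)"
proof -
 have "(pd b ^^ i) (\<lambda>x. 0) = (\<lambda>x. 0)" for b :: pt and i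
 proof (induction i)
  case (Suc i)
  then show ?case by simp (simp add: fun_eq_iff pd_const)
 qed simp
 then show ?thesis by (simp add: Dm_def)
qed

definition falling :: "nat => nat => real" where
 "falling n j = (\<Prod>t<j. real (n - t))"

lemma falling_Suc: "falling n (Suc j) = falling n j * real (n - j)"
 by (simp add: falling_def mult.commute)

lemma Dm_mono2: "Dm i j (mono2 a b) = (\<lambda>x. falling a i * falling b j * mono2 (a - i) (b - j) x)"
proof -
 have "(pd e2 ^^ j) (mono2 a b) = (\<lambda>x. falling b j * mono2 a (b - j) x)"
 proof (induction j)
  case (Suc j)
  then show ?case by simp (simp add: fun_eq_iff falling_Suc pd_cmult smooth_mono2 pd_mono2 mult_ac)
 qed (simp add: falling_def)
 then have "Dm i j (mono2 a b) = (pd e1 ^^ i) (\<lambda>x. falling b j * mono2 a (b - j) x)" by (simp add: Dm_def)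
 also have "\<dots> = (\<lambda>x. falling a i * falling b j * mono2 (a - i) (b - j) x)"
 proof (induction i)
  case (Suc i)
  have "pd e1 (\<lambda>x. falling a i * falling b j * mono2 (a - i) (b - j) x) =
    (\<lambda>x. falling a i * falling b j * pd e1 (mono2 (a - i) (b - j)) x)"
   by (simp add: fun_eq_iff pd_cmult smooth_mono2)
  with Suc show ?case by simp (simp add: fun_eq_iff falling_Suc pd_mono2 mult_ac)
 qed (simp add: falling_def)
 finally show ?thesis .
qed

lemma falling_zero: "i > a ==> falling a i = 0"
 unfolding falling_def by (intro prod_zero) (auto intro!: bexI[of _ a])

lemma falling_self: "falling a a > 0"
 unfolding falling_def by (intro prod_pos) auto

lemma Dm_poly_fun_zero: "p \<in> poly_fun n ==> int (i + j) > n ==> Dm i j p = (\<lambda>x. 0)"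
proof (induction p rule: poly_fun_induct)
 case zero then show ?case by (simp add: Dm_zero)
next
 case (mono a b c q)
 have "i > a \<or> j > b" using mono by linarith
 then show ?case
  using mono by (auto simp: Dm_lin smooth_mono2 smooth_poly_fun Dm_mono2 falling_zero)
qed

text \<open>A polynomial of degree at most \<open>k\<close> can be prescribed by the means of its derivatives
 of order at most \<open>k\<close>: the leading coefficients are fixed first, since the derivatives of highest order
 do not see the lower ones.\<close>

lemma prescribed_mean_derivatives:
 assumes B: "B \<in> sets lebesgue" "bounded B" "measure lebesgue B > 0"
 shows "\<exists>p\<in>poly_fun (int k). \<forall>i j. i + j \<le> k \<longrightarrow> (\<integral>x. Dm i j p x \<partial>lebesgue_on B) = c i j"
proof -
 let ?V = "measure lebesgue B"
 have int: "integrable (lebesgue_on B) f" if "smooth f" for f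
  using L2_integrable_inner[OF smooth_L2[OF that B(1,2)] L2_const[OF B(1,2), of 1]] by simp
 have Vm: "measure (lebesgue_on B) B = ?V" using B by (simp add: measure_restrict_space)
 have const: "(\<integral>x. d \<partial>lebesgue_on B) = ?V * d" for d :: real
  using B by (simp add: measure_restrict_space)
 \<comment> \<open>the homogeneous polynomial of degree \<open>m\<close> with prescribed derivatives of order \<open>m\<close>\<close>
 have top: "\<exists>q\<in>poly_fun (int m). \<forall>i j. i + j = m \<longrightarrow> Dm i j q = (\<lambda>x. d i j)" for m and d :: "nat => nat => real"
 proof -
  have "\<exists>q\<in>poly_fun (int m). \<forall>i j. i + j = m \<longrightarrow> Dm i j q = (\<lambda>x. if i \<in> S then d i j else 0)"
   if "finite S" "S \<subseteq> {..m}" for S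
   using that
  proof (induction S rule: finite_induct)
   case empty
   show ?case by (intro bexI[of _ "\<lambda>x. 0"]) (auto simp: Dm_zero poly_fun_zero)
  next
   case (insert a S)
   then obtain q where q: "q \<in> poly_fun (int m)" "\<And>i j. i + j = m ==> Dm i j q = (\<lambda>x. if i \<in> S then d i j else 0)"
    by auto
   define b where "b = m - a"
   have ab: "a + b = m" using insert by (auto simp: b_def)
   define e where "e = d a b / (falling a a * falling b b)"
   have "Dm i j (\<lambda>x. e * mono2 a b x + q x) = (\<lambda>x. if i \<in> insert a S then d i j else 0)" if ij: "i + j = m" for i j
   proof (cases "i = a")
    case True
    then have "j = b" using ij ab by auto
    have "Dm a b (\<lambda>x. e * mono2 a b x + q x) = (\<lambda>x. e * Dm a b (mono2 a b) x + Dm a b q x)"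
     by (rule Dm_lin[OF smooth_mono2 smooth_poly_fun[OF q(1)]])
    also have "\<dots> = (\<lambda>x. d a b)"
     using q(2)[OF ab] insert falling_self[of a] falling_self[of b]
     by (simp add: Dm_mono2 mono2_00 e_def)
    finally show ?thesis using True \<open>j = b\<close> by simp
   next
    case False
    then have "i > a \<or> j > b" using ij ab by auto
    then show ?thesis using False q(2)[OF ij]
     by (auto simp: Dm_lin smooth_mono2 smooth_poly_fun[OF q(1)] Dm_mono2 falling_zero)
   qed
   moreover have "(\<lambda>x. e * mono2 a b x + q x) \<in> poly_fun (int m)"
    by (intro poly_fun_add poly_fun_cmult poly_fun_mono2 q) (simp add: ab)
   ultimately show ?case by (rule_tac bexI[rotated]) auto
  qed
  from this[of "{..m}"] obtain q where q: "q \<in> poly_fun (int m)"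
   "\<And>i j. i + j = m ==> Dm i j q = (\<lambda>x. if i \<in> {..m} then d i j else 0)" by auto
  have "Dm i j q = (\<lambda>x. d i j)" if "i + j = m" for i j using q(2)[OF that] that by simp
  with q(1) show ?thesis by blast
 qed
 show ?thesis
 proof (induction k arbitrary: c)
  case 0
  obtain q where q: "q \<in> poly_fun (int 0)" "\<And>i j. i + j = 0 ==> Dm i j q = (\<lambda>x. c i j / ?V)"
   using top[of 0 "\<lambda>i j. c i j / ?V"] by blast
  then show ?case using B by (intro bexI[of _ q]) (auto simp: const Vm)
 next
  case (Suc k)
  obtain q where q: "q \<in> poly_fun (int (Suc k))" "\<And>i j. i + j = Suc k ==> Dm i j q = (\<lambda>x. c i j / ?V)"
   using top[of "Suc k" "\<lambda>i j. c i j / ?V"] by blast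
  obtain p where p: "p \<in> poly_fun (int k)"
   "\<And>i j. i + j \<le> k ==> (\<integral>x. Dm i j p x \<partial>lebesgue_on B) = c i j - (\<integral>x. Dm i j q x \<partial>lebesgue_on B)"
   using Suc.IH[of "\<lambda>i j. c i j - (\<integral>x. Dm i j q x \<partial>lebesgue_on B)"] by blast
  have sm: "smooth p" "smooth q" using p q smooth_poly_fun by blast+
  have "(\<integral>x. Dm i j (\<lambda>x. 1 * p x + q x) x \<partial>lebesgue_on B) = c i j" if ij: "i + j \<le> Suc k" for i j
  proof (cases "i + j = Suc k")
   case True
   then have "Dm i j p = (\<lambda>x. 0)" by (intro Dm_poly_fun_zero[OF p(1)]) simp
   then show ?thesis using q(2)[OF True] B by (subst Dm_lin[OF sm]) (simp add: const Vm)
  next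
   case False
   then have "i + j \<le> k" using ij by simp
   then show ?thesis using p(2)
    by (subst Dm_lin[OF sm]) (simp add: int smooth_Dm sm)
  qed
  moreover have "(\<lambda>x. 1 * p x + q x) \<in> poly_fun (int (Suc k))"
   by (intro poly_fun_add poly_fun_cmult q poly_fun_mono[OF _ p(1)]) simp
  ultimately show ?case by (rule_tac bexI[rotated]) auto
 qed
qed

section \<open>The Bramble--Hilbert estimate\<close>

lemma has_weak_partial_step:
 assumes f: "has_weak_partial E i j f g"
 shows "has_weak_partial E (Suc i) j f g1 ==> weak_pd E e1 g g1"
  and "has_weak_partial E i (Suc j) f g2 ==> weak_pd E e2 g g2"
proof -
 have *: "L2_inner E f (Dm i j \<phi>) = (-1) ^ (i + j) * L2_inner E g \<phi>" if "\<phi> \<in> test_functions E" for \<phi>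
  using f that by (simp add: has_weak_partial_def Dm_def)
 show "weak_pd E e1 g g1" if "has_weak_partial E (Suc i) j f g1"
  unfolding weak_pd_def
 proof
  fix \<phi> assume \<phi>: "\<phi> \<in> test_functions E"
  have "(-1) ^ (i + j) * L2_inner E g (pd e1 \<phi>) = L2_inner E f (Dm (Suc i) j \<phi>)"
   using *[OF test_pd[OF \<phi>, of e1]] by (simp add: Dm_pd1 test_smooth[OF \<phi>])
  also have "\<dots> = (-1) ^ (Suc i + j) * L2_inner E g1 \<phi>"
   using that \<phi> by (simp add: has_weak_partial_def Dm_def)
  also have "\<dots> = (-1) ^ (i + j) * (- L2_inner E g1 \<phi>)" by simp
  finally show "L2_inner E g (pd e1 \<phi>) = - L2_inner E g1 \<phi>"
   by (metis mult_cancel_left power_not_zero zero_neq_neg_one)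
 qed
 show "weak_pd E e2 g g2" if "has_weak_partial E i (Suc j) f g2"
  unfolding weak_pd_def
 proof
  fix \<phi> assume \<phi>: "\<phi> \<in> test_functions E"
  have "(-1) ^ (i + j) * L2_inner E g (pd e2 \<phi>) = L2_inner E f (Dm i (Suc j) \<phi>)"
   using *[OF test_pd[OF \<phi>, of e2]] by (simp add: Dm_pd2)
  also have "\<dots> = (-1) ^ (i + Suc j) * L2_inner E g2 \<phi>"
   using that \<phi> unfolding has_weak_partial_def Dm_def by blast
  also have "\<dots> = (-1) ^ (i + j) * (- L2_inner E g2 \<phi>)" by simp
  finally show "L2_inner E g (pd e2 \<phi>) = - L2_inner E g2 \<phi>"
   by (metis mult_cancel_left power_not_zero zero_neq_neg_one)
 qed
qed

lemma weak_pd_diff: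
 assumes E: "open E" "bounded E" and f: "f \<in> L2 E" "g \<in> L2 E" "weak_pd E b f g"
  and p: "smooth p" and b: "b \<in> Basis"
 shows "weak_pd E b (\<lambda>x. f x - p x) (\<lambda>x. g x - pd b p x)"
 unfolding weak_pd_def
proof
 fix \<phi> assume \<phi>: "\<phi> \<in> test_functions E"
 have Es: "E \<in> sets lebesgue" using E by simp
 note * = smooth_L2[OF p Es E(2)] smooth_L2[OF smooth_pd[OF p b] Es E(2)] test_L2[OF \<phi> Es] test_L2[OF test_pd[OF \<phi> b] Es]
 show "L2_inner E (\<lambda>x. f x - p x) (pd b \<phi>) = - L2_inner E (\<lambda>x. g x - pd b p x) \<phi>"
  using f(3) weak_pd_smooth[OF E(1) p b] \<phi>
  by (simp add: L2_inner_diff_left f * weak_pd_def)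
qed

lemma weak_grad_pair:
 assumes "g1 \<in> L2 E" "g2 \<in> L2 E" "weak_pd E e1 g g1" "weak_pd E e2 g g2"
 shows "weak_grad E g (\<lambda>x. vector [g1 x, g2 x])"
  and "(L2_norm E (\<lambda>x. vector [g1 x, g2 x] :: pt))\<^sup>2 = (L2_norm E g1)\<^sup>2 + (L2_norm E g2)\<^sup>2"
proof -
 let ?G = "\<lambda>x. vector [g1 x, g2 x] :: pt"
 have n: "(\<lambda>x. ?G x $ 1) = g1" "(\<lambda>x. ?G x $ 2) = g2" by (auto simp: vector_2)
 have "(\<lambda>x. ?G x $ l) \<in> L2 E" for l :: 2
  using assms n exhaust_2[of l] by auto
 then have L: "?G \<in> L2 E" by (rule L2_vecI)
 have "(\<lambda>x. ?G x \<bullet> e1) = g1" "(\<lambda>x. ?G x \<bullet> e2) = g2" by (auto simp: inner_axis vector_2)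
 with assms L show "weak_grad E g ?G" unfolding weak_grad_def Basis_pt by auto
 show "(L2_norm E ?G)\<^sup>2 = (L2_norm E g1)\<^sup>2 + (L2_norm E g2)\<^sup>2"
  unfolding L2_norm_power2 by (subst L2_inner_vec[OF L L]) (simp add: UNIV_2 n)
qed

text \<open>Each derivative of order \<open>l < m\<close> has vanishing mean, so its norm is bounded by those of its two first
 derivatives. Every derivative of order \<open>l + 1\<close> arises at most twice, whence the factor \<open>4\<close>
 instead of the \<open>2\<close> of the Poincare inequality.\<close>

lemma iterated_poincare:
 fixes W :: "nat => nat => pt => real"
 assumes E: "open E" "bounded E" and r: "r > 0" and BE: "ball c r \<subseteq> E"
  and star: "\<And>z y. z \<in> ball c r ==> y \<in> E ==> closed_segment z y \<subseteq> E"
  and h: "\<And>x y. x \<in> E ==> y \<in> E ==> norm (x - y) \<le> h"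
  and W: "\<And>i j. i + j \<le> m ==> W i j \<in> L2 E"
  and W1: "\<And>i j. i + j < m ==> weak_pd E e1 (W i j) (W (Suc i) j)"
  and W2: "\<And>i j. i + j < m ==> weak_pd E e2 (W i j) (W i (Suc j))"
  and mean: "\<And>i j. i + j < m ==> (\<integral>x. W i j x \<partial>lebesgue_on (ball c r)) = 0"
 shows "(L2_norm E (W 0 0))\<^sup>2 \<le> (4 * h\<^sup>2 * (1 + (h / r)\<^sup>2)) ^ m * (\<Sum>i\<le>m. (L2_norm E (W i (m - i)))\<^sup>2)"
proof -
 define S where "S l = (\<Sum>i\<le>l. (L2_norm E (W i (l - i)))\<^sup>2)" for l
 \<comment> \<open>the Poincare constant\<close>
 define \<kappa> where "\<kappa> = 2 * h\<^sup>2 * (1 + (h / r)\<^sup>2)"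
 have \<kappa>0: "\<kappa> \<ge> 0" by (simp add: \<kappa>_def)
 have step: "S l \<le> 2 * \<kappa> * S (Suc l)" if l: "l < m" for l
 proof -
  have "(L2_norm E (W i (l - i)))\<^sup>2 \<le> \<kappa> * ((L2_norm E (W (Suc i) (l - i)))\<^sup>2 + (L2_norm E (W i (Suc l - i)))\<^sup>2)"
   if i: "i \<le> l" for i
  proof -
   have ij: "i + (l - i) < m" using i l by simp
   have L: "W i (l - i) \<in> L2 E" "W (Suc i) (l - i) \<in> L2 E" "W i (Suc (l - i)) \<in> L2 E"
    using ij by (auto intro!: W)
   note wg = weak_grad_pair[OF L(2,3) W1[OF ij] W2[OF ij]]
   from poincare[OF E r BE star h L(1) wg(1) mean[OF ij]]
   show ?thesis using i by (simp add: wg(2) \<kappa>_def Suc_diff_le)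
  qed
  then have "S l \<le> (\<Sum>i\<le>l. \<kappa> * ((L2_norm E (W (Suc i) (l - i)))\<^sup>2 + (L2_norm E (W i (Suc l - i)))\<^sup>2))"
   unfolding S_def by (intro sum_mono) auto
  also have "\<dots> = \<kappa> * ((\<Sum>i\<le>l. (L2_norm E (W (Suc i) (l - i)))\<^sup>2) + (\<Sum>i\<le>l. (L2_norm E (W i (Suc l - i)))\<^sup>2))"
   by (simp only: sum_distrib_left sum.distrib distrib_left)
  also have "\<dots> \<le> \<kappa> * (S (Suc l) + S (Suc l))"
  proof (intro mult_left_mono add_mono \<kappa>0)
   show "(\<Sum>i\<le>l. (L2_norm E (W (Suc i) (l - i)))\<^sup>2) \<le> S (Suc l)"
    unfolding S_def by (subst sum.atMost_Suc_shift) simp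
   show "(\<Sum>i\<le>l. (L2_norm E (W i (Suc l - i)))\<^sup>2) \<le> S (Suc l)"
    unfolding S_def by simp
  qed
  finally show ?thesis by simp
 qed
 have "S 0 \<le> (2 * \<kappa>) ^ l * S l" if "l \<le> m" for l
  using that
 proof (induction l)
  case (Suc l)
  then have "S 0 \<le> (2 * \<kappa>) ^ l * S l" by simp
  also have "\<dots> \<le> (2 * \<kappa>) ^ l * (2 * \<kappa> * S (Suc l))"
   using Suc.prems \<kappa>0 by (intro mult_left_mono step) auto
  finally show ?case by (simp add: mult_ac)
 qed simp
 moreover have "2 * \<kappa> = 4 * h\<^sup>2 * (1 + (h / r)\<^sup>2)" by (simp add: \<kappa>_def)
 ultimately have "S 0 \<le> (4 * h\<^sup>2 * (1 + (h / r)\<^sup>2)) ^ m * S m" by (metis order_refl)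
 then show ?thesis by (simp add: S_def)
qed

text \<open>The polynomial is the one whose derivatives up to order \<open>k\<close> have the same means over the ball as those
 of \<open>f\<close>: all derivatives of the difference of order at most \<open>k\<close> then have vanishing mean, and those of
 order \<open>k + 1\<close> are the ones of \<open>f\<close>.\<close>

lemma bramble_hilbert:
 assumes E: "open E" "bounded E" and r: "r > 0" and BE: "ball c r \<subseteq> E"
  and star: "\<And>z y. z \<in> ball c r ==> y \<in> E ==> closed_segment z y \<subseteq> E"
  and h: "\<And>x y. x \<in> E ==> y \<in> E ==> norm (x - y) \<le> h"
  and f: "f \<in> sobolev (Suc k) E"
 shows "\<exists>p\<in>poly_fun (int k). (L2_norm E (\<lambda>x. f x - p x))\<^sup>2
  \<le> (4 * h\<^sup>2 * (1 + (h / r)\<^sup>2)) ^ Suc k * (sobolev_seminorm (Suc k) E f)\<^sup>2"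
proof -
 let ?B = "ball c r"
 have Es: "E \<in> sets lebesgue" "?B \<in> sets lebesgue" using E by auto
 have fL: "f \<in> L2 E" using f by (simp add: sobolev_def)
 define D where "D i j = weak_partial E i j f" for i j
 have D: "has_weak_partial E i j f (D i j)" if "i + j \<le> Suc k" for i j
 proof -
  have "\<exists>g. has_weak_partial E i j f g" using f that by (simp add: sobolev_def)
  then show ?thesis unfolding D_def weak_partial_def by (rule someI_ex)
 qed
 have DL: "D i j \<in> L2 E" if "i + j \<le> Suc k" for i j
  using D[OF that] by (simp add: has_weak_partial_def)
 have DB: "integrable (lebesgue_on ?B) (D i j)" if "i + j \<le> Suc k" for i j
  using L2_integrable_inner[OF L2_subset[OF Es BE DL[OF that]] L2_const[OF Es(2) bounded_ball, of 1]] by simp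
 have "measure lebesgue ?B > 0"
  using r content_ball[of r c] unit_ball_vol_pos[of 2] by simp
 from prescribed_mean_derivatives[OF Es(2) bounded_ball this, of k "\<lambda>i j. \<integral>x. D i j x \<partial>lebesgue_on ?B"]
 obtain p where p: "p \<in> poly_fun (int k)"
  "\<And>i j. i + j \<le> k ==> (\<integral>x. Dm i j p x \<partial>lebesgue_on ?B) = (\<integral>x. D i j x \<partial>lebesgue_on ?B)" by blast
 have sp: "smooth p" by (rule smooth_poly_fun[OF p(1)])
 have pB: "integrable (lebesgue_on ?B) (Dm i j p)" for i j
  using L2_integrable_inner[OF smooth_L2[OF smooth_Dm[OF sp] Es(2) bounded_ball] L2_const[OF Es(2) bounded_ball, of 1]] by simp
 define W where "W i j = (\<lambda>x. D i j x - Dm i j p x)" for i j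
 have "(L2_norm E (W 0 0))\<^sup>2 \<le> (4 * h\<^sup>2 * (1 + (h / r)\<^sup>2)) ^ Suc k * (\<Sum>i\<le>Suc k. (L2_norm E (W i (Suc k - i)))\<^sup>2)"
 proof (rule iterated_poincare[OF E r BE star h])
  show "W i j \<in> L2 E" if "i + j \<le> Suc k" for i j
   unfolding W_def by (intro L2_diff DL that smooth_L2[OF smooth_Dm[OF sp]] Es E)
  show "weak_pd E e1 (W i j) (W (Suc i) j)" if "i + j < Suc k" for i j
   unfolding W_def Dm_Suc1 using that
   by (intro weak_pd_diff E DL has_weak_partial_step(1)[OF D D] smooth_Dm sp) auto
  show "weak_pd E e2 (W i j) (W i (Suc j))" if "i + j < Suc k" for i j
   unfolding W_def Dm_Suc2[OF sp] using that
   by (intro weak_pd_diff E DL has_weak_partial_step(2)[OF D D] smooth_Dm sp) auto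
  show "(\<integral>x. W i j x \<partial>lebesgue_on ?B) = 0" if "i + j < Suc k" for i j
   unfolding W_def using that DB[of i j] pB p(2)[of i j] by simp
 qed
 also have "(\<Sum>i\<le>Suc k. (L2_norm E (W i (Suc k - i)))\<^sup>2) = (\<Sum>i\<le>Suc k. (L2_norm E (D i (Suc k - i)))\<^sup>2)"
 proof (intro sum.cong refl)
  fix i assume "i \<in> {..Suc k}"
  then have "Dm i (Suc k - i) p = (\<lambda>x. 0)" by (intro Dm_poly_fun_zero[OF p(1)]) auto
  then show "(L2_norm E (W i (Suc k - i)))\<^sup>2 = (L2_norm E (D i (Suc k - i)))\<^sup>2" by (simp add: W_def)
 qed
 also have "\<dots> = (sobolev_seminorm (Suc k) E f)\<^sup>2"
  unfolding sobolev_seminorm_def D_def by (subst real_sqrt_pow2) (intro sum_nonneg zero_le_power2, rule refl)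
 finally have est: "(L2_norm E (W 0 0))\<^sup>2 \<le> (4 * h\<^sup>2 * (1 + (h / r)\<^sup>2)) ^ Suc k * (sobolev_seminorm (Suc k) E f)\<^sup>2" .
 have D0: "AE x in lebesgue_on E. f x = D 0 0 x"
  using D[of 0 0] by (intro L2_eq_by_test E fL DL) (auto simp: has_weak_partial_def)
 have pL: "p \<in> L2 E" by (rule smooth_L2[OF sp Es(1) E(2)])
 have ae: "AE x in lebesgue_on E. f x - p x = W 0 0 x"
  using D0 by eventually_elim (simp add: W_def Dm_def)
 have fpL: "(\<lambda>x. f x - p x) \<in> L2 E" by (rule L2_diff[OF fL pL])
 have WL: "W 0 0 \<in> L2 E" by (rule L2_cong_AE[OF Es(1) fpL ae])
 have "(L2_norm E (\<lambda>x. f x - p x))\<^sup>2 = (L2_norm E (W 0 0))\<^sup>2"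
  unfolding L2_norm_power2 by (rule L2_inner_cong_AE[OF fpL WL fpL WL ae ae])
 with est show ?thesis by (intro bexI[of _ p] p(1)) simp
qed

section \<open>Orthogonal projections onto finite-dimensional spaces\<close>

text \<open>The subspaces in use consist of functions rather than of classes, and the orthogonal projection is
 asked for instead of closedness; for a subspace that is invariant under changes on null sets it
 implies closedness (\<open>proximal_closed\<close>).\<close>

definition proximal :: "'a::euclidean_space set => ('a => 'b::euclidean_space) set => bool" where
 "proximal A X \<longleftrightarrow> (\<forall>f\<in>L2 A. \<exists>p\<in>X. \<forall>q\<in>X. L2_inner A (\<lambda>x. f x - p x) q = 0)"

lemma L2_inner_null: "f \<in> L2 A ==> g \<in> L2 A ==> L2_norm A g = 0 ==> L2_inner A f g = 0"
 using L2_Cauchy_Schwarz[of f A g] by simp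

text \<open>Adding one vector to a subspace: by Gram--Schmidt only the component of \<open>v\<close> orthogonal to \<open>X'\<close>
 matters.\<close>

lemma proximal_step:
 fixes X :: "('a::euclidean_space => 'b::euclidean_space) set"
 assumes X': "proximal A X'" "X' \<subseteq> X" and X: "X \<subseteq> L2 A"
  and add: "\<And>f g c. f \<in> X ==> g \<in> X ==> (\<lambda>x. f x + c *\<^sub>R g x) \<in> X"
  and v: "v \<in> X" and dec: "\<And>q. q \<in> X ==> \<exists>c. (\<lambda>x. q x - c *\<^sub>R v x) \<in> X'"
 shows "proximal A X"
 unfolding proximal_def
proof
 fix f :: "'a => 'b" assume f: "f \<in> L2 A"
 obtain p' where p': "p' \<in> X'" "\<And>q. q \<in> X' ==> L2_inner A (\<lambda>x. f x - p' x) q = 0"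
  using X'(1) f by (auto simp: proximal_def)
 obtain v' where v': "v' \<in> X'" "\<And>q. q \<in> X' ==> L2_inner A (\<lambda>x. v x - v' x) q = 0"
  using X'(1) subsetD[OF X v] unfolding proximal_def by blast
 have L: "q \<in> X' ==> q \<in> L2 A" for q using X X' by blast
 have vL: "v \<in> L2 A" using v X by blast
 define w where "w = (\<lambda>x. v x - v' x)"
 have wL: "w \<in> L2 A" unfolding w_def by (intro L2_diff vL L v')
 have wX: "w \<in> X" using add[of v v' "-1"] v v' X' by (auto simp: w_def)
 have vdec: "v = (\<lambda>x. v' x + w x)" by (simp add: w_def)
 \<comment> \<open>it is enough to be orthogonal to \<open>X'\<close> and to \<open>w\<close>\<close>
 have red: "L2_inner A g q = 0"
  if g: "g \<in> L2 A" "\<And>q. q \<in> X' ==> L2_inner A g q = 0" "L2_inner A g w = 0" and q: "q \<in> X" for g q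
 proof -
  obtain c where c: "(\<lambda>x. q x - c *\<^sub>R v x) \<in> X'" using dec[OF q] by blast
  have "L2_inner A g v = 0"
   using g(2)[OF v'(1)] g(3) by (subst vdec) (simp add: L2_inner_add_right[OF L[OF v'(1)] wL g(1)])
  moreover have "L2_inner A g q = L2_inner A g (\<lambda>x. q x - c *\<^sub>R v x) + c * L2_inner A g v"
   using L2_inner_add_right[OF L[OF c] L2_scale[OF vL, of c] g(1)] by (simp add: L2_inner_scale_right)
  ultimately show ?thesis using g(2)[OF c] by simp
 qed
 show "\<exists>p\<in>X. \<forall>q\<in>X. L2_inner A (\<lambda>x. f x - p x) q = 0"
 proof (cases "L2_norm A w = 0")
  case True
  have "L2_inner A (\<lambda>x. f x - p' x) w = 0"
   using True by (intro L2_inner_null L2_diff f L p' wL)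
  then show ?thesis using red[OF L2_diff[OF f L[OF p'(1)]] p'(2)] p'(1) X' by blast
 next
  case False
  define b where "b = L2_inner A w w"
  have b: "b \<noteq> 0" using False by (simp add: b_def flip: L2_norm_power2)
  define s where "s = L2_inner A f w / b"
  define p where "p = (\<lambda>x. p' x + s *\<^sub>R w x)"
  have pX: "p \<in> X" unfolding p_def using add p' X' wX by blast
  have pL: "p \<in> L2 A" using pX X by blast
  have fp'L: "(\<lambda>x. f x - p' x) \<in> L2 A" and swL: "(\<lambda>x. s *\<^sub>R w x) \<in> L2 A" and p'L: "p' \<in> L2 A"
   by (rule L2_diff[OF f L[OF p'(1)]]) (rule L2_scale[OF wL], rule L[OF p'(1)])
  have fp: "(\<lambda>x. f x - p x) = (\<lambda>x. (f x - p' x) - s *\<^sub>R w x)" by (simp add: p_def diff_diff_eq)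
  have "L2_inner A (\<lambda>x. f x - p x) q = 0" if q: "q \<in> X'" for q
  proof -
   have "L2_inner A w q = 0" using v'(2)[OF q] by (simp add: w_def)
   then show ?thesis unfolding fp using p'(2)[OF q]
    by (simp add: L2_inner_diff_left[OF fp'L swL L[OF q]] L2_inner_scale_left)
  qed
  moreover have "L2_inner A (\<lambda>x. f x - p x) w = 0"
  proof -
   have "L2_inner A p' w = 0" using v'(2)[OF p'(1)] by (simp add: w_def L2_inner_commute)
   then have "L2_inner A (\<lambda>x. f x - p' x) w = L2_inner A f w"
    by (simp add: L2_inner_diff_left[OF f p'L wL])
   then have "L2_inner A (\<lambda>x. f x - p x) w = L2_inner A f w - s * b"
    unfolding fp by (simp add: L2_inner_diff_left[OF fp'L swL wL] L2_inner_scale_left b_def)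
   then show ?thesis using b by (simp add: s_def)
  qed
  ultimately show ?thesis using red[OF L2_diff[OF f pL]] pX by blast
 qed
qed

lemma L2_pythagoras:
 assumes "f \<in> L2 A" "p \<in> L2 A" "L2_inner A (\<lambda>x. f x - p x) p = 0"
 shows "(L2_norm A f)\<^sup>2 = (L2_norm A (\<lambda>x. f x - p x))\<^sup>2 + (L2_norm A p)\<^sup>2"
 using assms(3) by (simp add: L2_norm_power2 L2_inner_diff_left L2_inner_diff_right L2_diff assms(1,2) L2_inner_commute[of A p f])

lemma projection_minimises:
 assumes f: "f \<in> L2 A" and X: "X \<subseteq> L2 A" and p: "p \<in> X" "\<And>q. q \<in> X ==> L2_inner A (\<lambda>x. f x - p x) q = 0"
  and q: "q \<in> X" and diff: "(\<lambda>x. p x - q x) \<in> X"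
 shows "L2_norm A (\<lambda>x. f x - p x) \<le> L2_norm A (\<lambda>x. f x - q x)"
proof (rule power2_le_imp_le)
 have "(L2_norm A (\<lambda>x. f x - q x))\<^sup>2 = (L2_norm A (\<lambda>x. (f x - q x) - (p x - q x)))\<^sup>2 + (L2_norm A (\<lambda>x. p x - q x))\<^sup>2"
  by (rule L2_pythagoras[OF L2_diff[OF f subsetD[OF X q]] subsetD[OF X diff]]) (use p(2)[OF diff] in simp)
 then show "(L2_norm A (\<lambda>x. f x - p x))\<^sup>2 \<le> (L2_norm A (\<lambda>x. f x - q x))\<^sup>2" by simp
qed (rule L2_norm_nonneg)

lemma proximal_closed:
 assumes P: "proximal A X" and X: "X \<subseteq> L2 A"
  and diff: "\<And>f g. f \<in> X ==> g \<in> X ==> (\<lambda>x. f x - g x) \<in> X"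
  and u: "u \<in> L2 A" and approx: "\<And>e. e > 0 ==> \<exists>q\<in>X. L2_norm A (\<lambda>x. u x - q x) < e"
 shows "\<exists>p\<in>X. AE x in lebesgue_on A. u x = p x"
proof -
 obtain p where p: "p \<in> X" "\<And>q. q \<in> X ==> L2_inner A (\<lambda>x. u x - p x) q = 0"
  using P u by (auto simp: proximal_def)
 have up: "(\<lambda>x. u x - p x) \<in> L2 A" using u p X by (auto intro: L2_diff)
 have "L2_norm A (\<lambda>x. u x - p x) < e" if e: "e > 0" for e
 proof -
  obtain q where q: "q \<in> X" "L2_norm A (\<lambda>x. u x - q x) < e" using approx[OF e] by blast
  have "L2_norm A (\<lambda>x. u x - p x) \<le> L2_norm A (\<lambda>x. u x - q x)"
   by (rule projection_minimises[OF u X p q(1) diff[OF p(1) q(1)]])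
  with q show ?thesis by linarith
 qed
 then have "L2_norm A (\<lambda>x. u x - p x) = 0"
  using L2_norm_nonneg[of A "\<lambda>x. u x - p x"] by (metis less_irrefl order_le_less)
 then have "AE x in lebesgue_on A. u x - p x = 0" using L2_norm_eq_0[OF up] by simp
 then have "AE x in lebesgue_on A. u x = p x" by eventually_elim simp
 with p show ?thesis by blast
qed

text \<open>The common kernel of the functionals consists of null functions, and leaving out one functional
 enlarges the kernel of the others by at most one dimension.\<close>

lemma proximal_functionals:
 fixes X :: "('a::euclidean_space => 'b::euclidean_space) set" and \<Lambda> :: "'i => ('a => 'b) => real"
 assumes J: "finite J"
  and X: "X \<subseteq> L2 A" and zero: "(\<lambda>x. 0) \<in> X"
  and add: "\<And>f g c. f \<in> X ==> g \<in> X ==> (\<lambda>x. f x + c *\<^sub>R g x) \<in> X"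
  and lin: "\<And>j f g c. j \<in> J ==> f \<in> X ==> g \<in> X ==> \<Lambda> j (\<lambda>x. f x + c *\<^sub>R g x) = \<Lambda> j f + c * \<Lambda> j g"
  and inj: "\<And>f. f \<in> X ==> (\<And>j. j \<in> J ==> \<Lambda> j f = 0) ==> L2_norm A f = 0"
 shows "proximal A X"
 using J X zero add lin inj
proof (induction J arbitrary: X rule: finite_induct)
 case empty
 have z: "L2_inner A f q = 0" if "f \<in> L2 A" "q \<in> X" for f q
  using that empty.prems(1) empty.prems(5)[OF that(2)] by (intro L2_inner_null) auto
 show ?case unfolding proximal_def
  by (intro ballI bexI[of _ "\<lambda>x. 0"] empty.prems(2)) (simp add: z)
next
 case (insert j J)
 note X = insert.prems(1) and zero = insert.prems(2) and add = insert.prems(3)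
  and lin = insert.prems(4) and inj = insert.prems(5)
 define X' where "X' = {f \<in> X. \<Lambda> j f = 0}"
 have z: "\<Lambda> j (\<lambda>x. 0) = 0" using lin[of j "\<lambda>x. 0" "\<lambda>x. 0" 1] zero by simp
 have P': "proximal A X'"
 proof (rule insert.IH)
  show "X' \<subseteq> L2 A" using X by (auto simp: X'_def)
  show "(\<lambda>x. 0) \<in> X'" using zero z by (simp add: X'_def)
  show "(\<lambda>x. f x + c *\<^sub>R g x) \<in> X'" if "f \<in> X'" "g \<in> X'" for f g c
   using that add lin[of j f g c] by (simp add: X'_def)
  show "\<Lambda> i (\<lambda>x. f x + c *\<^sub>R g x) = \<Lambda> i f + c * \<Lambda> i g" if "i \<in> J" "f \<in> X'" "g \<in> X'" for i f g c
   using that lin by (simp add: X'_def)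
  show "L2_norm A f = 0" if "f \<in> X'" "\<And>i. i \<in> J ==> \<Lambda> i f = 0" for f
   using that by (intro inj) (auto simp: X'_def)
 qed
 show ?case
 proof (cases "\<exists>v\<in>X. \<Lambda> j v \<noteq> 0")
  case False
  then have "X' = X" by (auto simp: X'_def)
  with P' show ?thesis by simp
 next
  case True
  then obtain v where v: "v \<in> X" "\<Lambda> j v \<noteq> 0" by blast
  show ?thesis
  proof (rule proximal_step[OF P' _ X add v(1)])
   show "X' \<subseteq> X" by (auto simp: X'_def)
   fix q assume q: "q \<in> X"
   show "\<exists>c. (\<lambda>x. q x - c *\<^sub>R v x) \<in> X'"
    using add[OF q v(1), of "- (\<Lambda> j q / \<Lambda> j v)"] lin[of j q v "- (\<Lambda> j q / \<Lambda> j v)"] q v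
    by (intro exI[of _ "\<Lambda> j q / \<Lambda> j v"]) (simp add: X'_def)
  qed
 qed
qed

subsection \<open>The projection onto polynomials\<close>

lemma proximal_poly_fun:
 assumes A: "A \<in> sets lebesgue" "bounded A"
 shows "proximal A (poly_fun n)"
proof -
 define X where "X S = {p. \<exists>a. p = (\<lambda>x. \<Sum>(i, j)\<in>S. a i j * mono2 i j x)}" for S
 have XL: "X S \<subseteq> L2 A" if "finite S" for S
  unfolding X_def using that
  by (auto simp: case_prod_beta intro!: smooth_L2 A smooth_sum smooth_cmult smooth_mono2)
 have "proximal A (X S)" if "finite S" for S
  using that
 proof (induction S rule: finite_induct)
  case empty
  then show ?case by (auto simp: proximal_def X_def L2_inner_zero)
 next
  case (insert s S)
  obtain i0 j0 where s: "s = (i0, j0)" by fastforce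
  have ins: "(\<lambda>x. \<Sum>(i, j)\<in>insert s S. a i j * mono2 i j x)
   = (\<lambda>x. a i0 j0 * mono2 i0 j0 x + (\<Sum>(i, j)\<in>S. a i j * mono2 i j x))" for a
   using insert s by simp
  show ?case
  proof (rule proximal_step[OF insert.IH _ XL])
   show "X S \<subseteq> X (insert s S)"
   proof
    fix p assume "p \<in> X S"
    then obtain a where a: "p = (\<lambda>x. \<Sum>(i, j)\<in>S. a i j * mono2 i j x)" by (auto simp: X_def)
    define a' where "a' i j = (if (i, j) = s then 0 else a i j)" for i j
    have "(\<Sum>(i, j)\<in>S. a i j * mono2 i j x) = (\<Sum>(i, j)\<in>S. a' i j * mono2 i j x)" for x
     using insert by (intro sum.cong) (auto simp: a'_def)
    then have "p = (\<lambda>x. \<Sum>(i, j)\<in>insert s S. a' i j * mono2 i j x)"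
     unfolding a ins by (simp add: a'_def s)
    then show "p \<in> X (insert s S)" by (auto simp: X_def)
   qed
   show "(\<lambda>x. f x + c *\<^sub>R g x) \<in> X (insert s S)" if "f \<in> X (insert s S)" "g \<in> X (insert s S)" for f g c
   proof -
    from that obtain a b where ab: "f = (\<lambda>x. \<Sum>(i, j)\<in>insert s S. a i j * mono2 i j x)"
     "g = (\<lambda>x. \<Sum>(i, j)\<in>insert s S. b i j * mono2 i j x)" unfolding X_def by blast
    have "(\<lambda>x. f x + c *\<^sub>R g x) = (\<lambda>x. \<Sum>(i, j)\<in>insert s S. (a i j + c * b i j) * mono2 i j x)"
     unfolding ab
     by (rule ext) (simp only: split_def sum_distrib_left sum.distrib[symmetric] real_scaleR_def distrib_right mult.assoc)
    then show ?thesis unfolding X_def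
     by (intro CollectI exI[of _ "\<lambda>i j. a i j + c * b i j"])
   qed
   show "mono2 i0 j0 \<in> X (insert s S)"
    unfolding X_def ins using insert s
    by (intro CollectI exI[of _ "\<lambda>i j. if (i, j) = s then 1 else 0"])
      (auto simp: fun_eq_iff case_prod_beta intro!: sum.neutral)
   fix q assume "q \<in> X (insert s S)"
   then obtain a where "q = (\<lambda>x. \<Sum>(i, j)\<in>insert s S. a i j * mono2 i j x)" by (auto simp: X_def)
   then show "\<exists>c. (\<lambda>x. q x - c *\<^sub>R mono2 i0 j0 x) \<in> X S"
    unfolding ins by (intro exI[of _ "a i0 j0"]) (auto simp: X_def)
  qed (use insert in auto)
 qed
 moreover have "poly_fun n = X {(i, j). int (i + j) \<le> n}"
  unfolding X_def using poly_fun_iff[of _ n] by (intro set_eqI) simp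
 ultimately show ?thesis using finite_degree_set by simp
qed

lemma proj_characterisation:
 assumes E: "open (region K)" "bounded (region K)" "region K \<noteq> {}" and f: "f \<in> L2 (region K)"
 shows "proj k K f \<in> poly_fun (int k)"
  and "q \<in> poly_fun (int k) ==> L2_inner (region K) (\<lambda>x. f x - proj k K f x) q = 0"
  and "p \<in> poly_fun (int k) ==> (\<And>q. q \<in> poly_fun (int k) ==> L2_inner (region K) (\<lambda>x. f x - p x) q = 0)
   ==> proj k K f = p"
proof -
 let ?E = "region K"
 have Es: "?E \<in> sets lebesgue" using E by simp
 have L: "p \<in> L2 ?E" if "p \<in> poly_fun n" for p n by (rule smooth_L2[OF smooth_poly_fun[OF that] Es E(2)])
 let ?P = "\<lambda>p. p \<in> poly_fun (int k) \<and> (\<forall>q\<in>poly_fun (int k). L2_inner ?E (\<lambda>x. f x - p x) q = 0)"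
 have uniq: "p = p'" if p: "?P p" "?P p'" for p p'
 proof -
  let ?d = "\<lambda>x. p x - p' x"
  have d: "?d \<in> poly_fun (int k)" using p by (intro poly_fun_diff) auto
  have "L2_inner ?E ?d ?d = L2_inner ?E (\<lambda>x. (f x - p' x) - (f x - p x)) ?d" by simp
  also have "\<dots> = 0" using p d
   by (subst L2_inner_diff_left) (auto intro!: L2_diff[OF f] intro: L)
  finally have "L2_norm ?E ?d = 0" using L2_norm_power2[of ?E ?d] by simp
  then have "AE x in lebesgue_on ?E. p x - p' x = 0" using L2_norm_eq_0[OF L[OF d]] by simp
  then have "AE x in lebesgue_on ?E. p x = p' x" by eventually_elim simp
  then show ?thesis using poly_fun_AE_eq[of p "int k" p' ?E] p E by blast
 qed
 obtain p0 where p0: "?P p0"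
  using proximal_poly_fun[OF Es E(2), of "int k"] f unfolding proximal_def by blast
 then have ex1: "\<exists>!p. ?P p" using uniq by blast
 have pr: "?P (proj k K f)" unfolding proj_def by (rule theI'[OF ex1])
 show "proj k K f \<in> poly_fun (int k)" using pr by blast
 show "q \<in> poly_fun (int k) ==> L2_inner ?E (\<lambda>x. f x - proj k K f x) q = 0" using pr by blast
 show "p \<in> poly_fun (int k) ==> (\<And>q. q \<in> poly_fun (int k) ==> L2_inner ?E (\<lambda>x. f x - p x) q = 0)
   ==> proj k K f = p" using pr uniq by blast
qed

section \<open>Weak time derivatives\<close>

lemma smooth_real_deriv: "smooth f ==> (f has_real_derivative pd 1 f x) (at x)" for f :: "real => real"
 using smooth_line_deriv[of f 0 1 x] by simp

abbreviation step' :: "real => real" where "step' \<equiv> pd 1 smooth_step"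

lemma step'_smooth: "smooth step'" by (rule smooth_pd[OF smooth_smooth_step]) simp

lemma step'_zero: "x \<notin> {0..1} ==> step' x = 0"
proof -
 assume x: "x \<notin> {0..1}"
 have "(smooth_step has_derivative (\<lambda>_. 0)) (at x)"
 proof (cases "x < 0")
  case True
  show ?thesis
   by (rule has_derivative_transform_within_open[where s="{..<0}" and f="\<lambda>_. 0"]) (use True in \<open>auto simp: smooth_step_0\<close>)
 next
  case False
  show ?thesis
   by (rule has_derivative_transform_within_open[where s="{1<..}" and f="\<lambda>_. 1"]) (use False x in \<open>auto simp: smooth_step_1\<close>)
 qed
 from pd_eq[OF this] show ?thesis by simp
qed

lemma step'_integral: "integrable lborel step'" "(\<integral>x. step' x \<partial>lborel) = 1"
proof -
 have ind: "indicator {0..1} x *\<^sub>R step' x = step' x" for x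
  using step'_zero[of x] by (auto simp: indicator_def)
 have "integrable lborel (\<lambda>x. indicator {0..1} x *\<^sub>R step' x)"
  by (intro borel_integrable_compact smooth_continuous step'_smooth) auto
 then show "integrable lborel step'" by (simp only: ind)
 have "(\<integral>x. indicator {0..1} x *\<^sub>R step' x \<partial>lborel) = smooth_step 1 - smooth_step 0"
  by (rule integral_FTC_atLeastAtMost)
    (auto intro!: smooth_continuous step'_smooth has_field_derivative_at_within smooth_real_deriv smooth_smooth_step
     simp flip: has_real_derivative_iff_has_vector_derivative)
 then show "(\<integral>x. step' x \<partial>lborel) = 1" by (simp only: ind) (simp add: smooth_step_0 smooth_step_1)
qed

text \<open>The function \<open>step'\<close> is a density of total mass one on \<open>{0..1}\<close>, so its rescalings form an
 approximate identity that approaches \<open>a\<close> from the side given by \<open>\<sigma>\<close>.\<close>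

lemma step'_delta:
 fixes g :: "real => real"
 assumes g: "continuous_on UNIV g" and B: "\<And>x. \<bar>g x\<bar> \<le> B" and \<sigma>: "\<sigma> = 1 \<or> \<sigma> = -1"
 shows "(\<lambda>n. \<integral>t. g t * (real (Suc n) * step' (\<sigma> * real (Suc n) * (t - a))) \<partial>lborel) \<longlonglongrightarrow> g a"
proof -
 have sub: "(\<integral>t. g t * (real (Suc n) * step' (\<sigma> * real (Suc n) * (t - a))) \<partial>lborel)
   = (\<integral>x. g (a + \<sigma> / real (Suc n) * x) * step' x \<partial>lborel)" for n
 proof -
  have "(\<integral>t. g t * (real (Suc n) * step' (\<sigma> * real (Suc n) * (t - a))) \<partial>lborel)
    = \<bar>\<sigma> / real (Suc n)\<bar> *\<^sub>R (\<integral>x. g (a + \<sigma> / real (Suc n) * x) * (real (Suc n) * step' (\<sigma> * real (Suc n) * ((a + \<sigma> / real (Suc n) * x) - a))) \<partial>lborel)"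
   by (rule lborel_integral_real_affine) (use \<sigma> in auto)
  also have "\<dots> = (\<integral>x. \<bar>\<sigma> / real (Suc n)\<bar> * (g (a + \<sigma> / real (Suc n) * x) * (real (Suc n) * step' (\<sigma> * real (Suc n) * ((a + \<sigma> / real (Suc n) * x) - a)))) \<partial>lborel)"
   by (simp only: integral_mult_right_zero real_scaleR_def)
  also have "\<dots> = (\<integral>x. g (a + \<sigma> / real (Suc n) * x) * step' x \<partial>lborel)"
  proof (intro Bochner_Integration.integral_cong refl)
   fix x
   have R: "real (Suc n) > 0" by simp
   have c1: "\<sigma> * real (Suc n) * ((a + \<sigma> / real (Suc n) * x) - a) = x"
    using \<sigma> R by (elim disjE) (simp_all del: of_nat_Suc)
   have c2: "\<bar>\<sigma> / real (Suc n)\<bar> * real (Suc n) = 1"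
    using \<sigma> R by (elim disjE) (simp_all del: of_nat_Suc)
   have "\<bar>\<sigma> / real (Suc n)\<bar> * (y * (real (Suc n) * z)) = (\<bar>\<sigma> / real (Suc n)\<bar> * real (Suc n)) * (y * z)" for y z
    by (simp only: mult_ac)
   then show "\<bar>\<sigma> / real (Suc n)\<bar> * (g (a + \<sigma> / real (Suc n) * x) * (real (Suc n) * step' (\<sigma> * real (Suc n) * ((a + \<sigma> / real (Suc n) * x) - a))))
     = g (a + \<sigma> / real (Suc n) * x) * step' x"
    unfolding c1 c2 by (simp only: mult_1)
  qed
  finally show ?thesis .
 qed
 have gm: "g \<in> borel_measurable borel" using g by (rule borel_measurable_continuous_onI)
 have sm: "step' \<in> borel_measurable borel" using step'_smooth by (intro borel_measurable_continuous_onI smooth_continuous)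
 have "(\<lambda>n. \<integral>x. g (a + \<sigma> / real (Suc n) * x) * step' x \<partial>lborel) \<longlonglongrightarrow> (\<integral>x. g a * step' x \<partial>lborel)"
 proof (rule integral_dominated_convergence[where w="\<lambda>x. B * \<bar>step' x\<bar>"])
  show "(\<lambda>x. g a * step' x) \<in> borel_measurable lborel" using sm by measurable
  show "(\<lambda>x. g (a + \<sigma> / real (Suc n) * x) * step' x) \<in> borel_measurable lborel" for n
   using sm gm by measurable
  show "integrable lborel (\<lambda>x. B * \<bar>step' x\<bar>)" using step'_integral by simp
  show "AE x in lborel. (\<lambda>n. g (a + \<sigma> / real (Suc n) * x) * step' x) \<longlonglongrightarrow> g a * step' x"
  proof (rule AE_I2)
   fix x
   have "(\<lambda>n. a + \<sigma> * inverse (real (Suc n)) * x) \<longlonglongrightarrow> a + \<sigma> * 0 * x"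
    by (intro tendsto_intros LIMSEQ_inverse_real_of_nat)
   then have "(\<lambda>n. a + \<sigma> / real (Suc n) * x) \<longlonglongrightarrow> a" by (simp add: divide_inverse)
   moreover have "isCont g a" using g by (simp add: continuous_on_eq_continuous_within)
   ultimately have "(\<lambda>n. g (a + \<sigma> / real (Suc n) * x)) \<longlonglongrightarrow> g a"
    by (rule isCont_tendsto_compose[rotated])
   then show "(\<lambda>n. g (a + \<sigma> / real (Suc n) * x) * step' x) \<longlonglongrightarrow> g a * step' x"
    by (intro tendsto_intros)
  qed
  show "AE x in lborel. norm (g (a + \<sigma> / real (Suc n) * x) * step' x) \<le> B * \<bar>step' x\<bar>" for n
   using B by (intro AE_I2) (simp add: abs_mult mult_right_mono)
 qed
 then show ?thesis unfolding sub using step'_integral by simp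
qed

text \<open>The weak derivative is tested with smooth approximations of the indicator of \<open>{t1<..<t2}\<close>; their
 derivatives concentrate at the two end points, where \<open>g\<close> is continuous.\<close>

lemma weak_time_deriv_FTC:
 assumes w: "has_weak_time_deriv T g g'" and g: "continuous_on {0<..<T} g" and t: "0 < t1" "t1 < t2" "t2 < T"
 shows "g t2 - g t1 = (\<integral>\<tau>. indicator {t1<..<t2} \<tau> * g' \<tau> \<partial>lebesgue_on {0<..<T})"
proof -
 let ?\<mu> = "lebesgue_on {0<..<T}"
 have gi: "integrable ?\<mu> g" "integrable ?\<mu> g'" and
  wd: "\<And>\<psi>. \<psi> \<in> test_functions {0<..<T} ==> (\<integral>t. g t * deriv \<psi> t \<partial>?\<mu>) = - (\<integral>t. g' t * \<psi> t \<partial>?\<mu>)"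
  using w by (auto simp: has_weak_time_deriv_def)
 define c where "c x = max t1 (min t2 x)" for x
 have cc: "continuous_on UNIV c" unfolding c_def by (intro continuous_intros)
 define G where "G x = g (c x)" for x
 have cr: "c x \<in> {t1..t2}" for x using t by (auto simp: c_def)
 have gc: "continuous_on {t1..t2} g" by (rule continuous_on_subset[OF g]) (use t in auto)
 have Gc: "continuous_on UNIV G" unfolding G_def
  by (rule continuous_on_compose2[OF gc cc]) (use cr in auto)
 have "bounded (g ` {t1..t2})" by (intro compact_imp_bounded compact_continuous_image gc) auto
 then obtain B where B': "\<forall>y\<in>g ` {t1..t2}. norm y \<le> B" unfolding bounded_iff by blast
 have B: "\<bar>g x\<bar> \<le> B" if "x \<in> {t1..t2}" for x using B' that by simp
 have GB: "\<bar>G x\<bar> \<le> B" for x unfolding G_def by (rule B[OF cr])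
 have Gg: "G x = g x" if "x \<in> {t1..t2}" for x using that by (auto simp: G_def c_def)
 obtain N :: nat where N: "N > 2 / (t2 - t1)" using reals_Archimedean2 by blast
 define m where "m n = real (Suc (n + N))" for n
 have m: "m n > 0" "1 / m n \<le> (t2 - t1) / 2" for n
 proof -
  show "m n > 0" by (simp add: m_def)
  have "2 / (t2 - t1) \<le> m n" using N by (simp add: m_def)
  then show "1 / m n \<le> (t2 - t1) / 2" using t \<open>m n > 0\<close> by (simp add: field_simps)
 qed
 have aux: "r \<le> t2 - t" if "t - t1 \<le> r" "r \<le> (t2 - t1) / 2" for r t :: real
 proof -
  have "2 * r \<le> t2 - t1" using that(2) by simp
  then show ?thesis using that(1) by simp
 qed
 have aux': "r \<le> t - t1" if "t2 - t \<le> r" "r \<le> (t2 - t1) / 2" for r t :: real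
 proof -
  have "2 * r \<le> t2 - t1" using that(2) by simp
  then show ?thesis using that(1) by simp
 qed
 define \<psi> where "\<psi> n t = smooth_step (m n * (t - t1)) * smooth_step (m n * (t2 - t))" for n t
 have s1: "smooth (\<lambda>t. smooth_step (m n * (t - t1)))" for n
  using smooth_compose_affine[OF bounded_linear_mult_right[of "m n"] smooth_smooth_step, of "- (m n * t1)"]
  by (simp add: algebra_simps)
 have s2: "smooth (\<lambda>t. smooth_step (m n * (t2 - t)))" for n
  using smooth_compose_affine[OF bounded_linear_mult_right[of "- m n"] smooth_smooth_step, of "m n * t2"]
  by (simp add: algebra_simps)
 have sz: "\<psi> n t = 0" if "t \<notin> {t1..t2}" for n t
 proof -
  have "m n * (t - t1) \<le> 0 \<or> m n * (t2 - t) \<le> 0"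
   using that m(1)[of n] by (auto simp: mult_le_0_iff)
  then show ?thesis by (auto simp: \<psi>_def smooth_step_0)
 qed
 have \<psi>t: "\<psi> n \<in> test_functions {0<..<T}" for n
 proof (rule test_functionsI[of _ "{t1..t2}"])
  show "smooth (\<psi> n)" unfolding \<psi>_def[abs_def] by (intro smooth_mult s1 s2)
 qed (use t sz in auto)
 have DH: "(smooth_step has_real_derivative step' x) (at x)" for x
  by (rule smooth_real_deriv[OF smooth_smooth_step])
 have der: "deriv (\<psi> n) t = m n * step' (1 * m n * (t - t1)) - m n * step' (-1 * m n * (t - t2))" for n t
 proof -
  have d1: "((\<lambda>t. smooth_step (m n * (t - t1))) has_real_derivative step' (m n * (t - t1)) * m n) (at t)"
   by (rule DERIV_chain2[OF DH]) (auto intro!: derivative_eq_intros)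
  have d2: "((\<lambda>t. smooth_step (m n * (t2 - t))) has_real_derivative step' (m n * (t2 - t)) * (- m n)) (at t)"
   by (rule DERIV_chain2[OF DH]) (auto intro!: derivative_eq_intros)
  have D: "deriv (\<psi> n) t = step' (m n * (t - t1)) * m n * smooth_step (m n * (t2 - t))
    + step' (m n * (t2 - t)) * (- m n) * smooth_step (m n * (t - t1))"
   unfolding \<psi>_def by (rule DERIV_imp_deriv[OF DERIV_mult[OF d1 d2]])
  have e1: "step' (m n * (t - t1)) * smooth_step (m n * (t2 - t)) = step' (m n * (t - t1))"
  proof (cases "m n * (t - t1) \<in> {0..1}")
   case True
   then have "t - t1 \<le> 1 / m n" using m(1)[of n] by (simp add: field_simps)
   then have "1 / m n \<le> t2 - t" using m(2)[of n] by (rule aux)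
   then have "1 \<le> m n * (t2 - t)" using m(1)[of n] by (simp add: field_simps)
   then show ?thesis by (simp add: smooth_step_1)
  qed (simp add: step'_zero)
  have e2: "step' (m n * (t2 - t)) * smooth_step (m n * (t - t1)) = step' (m n * (t2 - t))"
  proof (cases "m n * (t2 - t) \<in> {0..1}")
   case True
   then have "t2 - t \<le> 1 / m n" using m(1)[of n] by (simp add: field_simps)
   then have "1 / m n \<le> t - t1" using m(2)[of n] by (rule aux')
   then have "1 \<le> m n * (t - t1)" using m(1)[of n] by (simp add: field_simps)
   then show ?thesis by (simp add: smooth_step_1)
  qed (simp add: step'_zero)
  have "deriv (\<psi> n) t = m n * (step' (m n * (t - t1)) * smooth_step (m n * (t2 - t)))
    - m n * (step' (m n * (t2 - t)) * smooth_step (m n * (t - t1)))"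
   unfolding D by (simp add: algebra_simps)
  then show ?thesis unfolding e1 e2 by (simp add: algebra_simps)
 qed
 have \<psi>'pd: "deriv (\<psi> n) = pd 1 (\<psi> n)" for n
  by (rule ext, rule DERIV_imp_deriv, rule smooth_real_deriv[OF test_smooth[OF \<psi>t]])
 have lhs: "(\<integral>t. g t * deriv (\<psi> n) t \<partial>?\<mu>) = (\<integral>t. G t * deriv (\<psi> n) t \<partial>lborel)" for n
 proof -
  have supp: "deriv (\<psi> n) t = 0" if "t \<notin> {t1..t2}" for t
  proof -
   have "t \<notin> supp (\<psi> n)" using that supp_subset[of "{t1..t2}" "\<psi> n"] sz by auto
   then show ?thesis unfolding \<psi>'pd by (rule pd_outside_supp)
  qed
  have m: "(\<lambda>t. G t * deriv (\<psi> n) t) \<in> borel_measurable borel"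
   unfolding \<psi>'pd
   by (rule borel_measurable_continuous_onI, rule continuous_on_mult[OF Gc], rule smooth_continuous,
     rule smooth_pd[OF test_smooth[OF \<psi>t]]) simp
  have "(\<integral>t. g t * deriv (\<psi> n) t \<partial>?\<mu>) = (\<integral>t. indicator {0<..<T} t *\<^sub>R (g t * deriv (\<psi> n) t) \<partial>lebesgue)"
   by (rule integral_lebesgue_on) simp
  also have "\<dots> = (\<integral>t. G t * deriv (\<psi> n) t \<partial>lebesgue)"
  proof (intro Bochner_Integration.integral_cong refl)
   fix x
   show "indicator {0<..<T} x *\<^sub>R (g x * deriv (\<psi> n) x) = G x * deriv (\<psi> n) x"
   proof (cases "x \<in> {t1..t2}")
    case True
    then have "x \<in> {0<..<T}" using t by simp
    then show ?thesis using Gg[OF True] by simp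
   qed (simp add: supp)
  qed
  also have "\<dots> = (\<integral>t. G t * deriv (\<psi> n) t \<partial>lborel)" by (rule integral_lebesgue_borel(1)[OF m])
  finally show ?thesis .
 qed
 have Gi: "integrable lborel (\<lambda>t. G t * (m n * step' (\<sigma> * m n * (t - a))))" if "\<sigma> = 1 \<or> \<sigma> = -1" for n \<sigma> a
 proof (rule Bochner_Integration.integrable_bound)
  show "integrable lborel (\<lambda>t. B * (m n * step' (- (\<sigma> * m n * a) + \<sigma> * m n * t)))"
   using step'_integral m(1)[of n] that by (intro integrable_mult_right lborel_integrable_real_affine) auto
  show "(\<lambda>t. G t * (m n * step' (\<sigma> * m n * (t - a)))) \<in> borel_measurable lborel"
   using borel_measurable_continuous_onI[OF Gc] borel_measurable_continuous_onI[OF smooth_continuous[OF step'_smooth]]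
   by measurable
  have nb: "norm (G t * z) \<le> norm (B * z)" for t z
   unfolding norm_mult using GB[of t] by (intro mult_right_mono) auto
  have arg: "- (\<sigma> * m n * a) + \<sigma> * m n * t = \<sigma> * m n * (t - a)" for t by (simp add: algebra_simps)
  show "AE t in lborel. norm (G t * (m n * step' (\<sigma> * m n * (t - a)))) \<le> norm (B * (m n * step' (- (\<sigma> * m n * a) + \<sigma> * m n * t)))"
   unfolding arg by (intro AE_I2 nb)
 qed
 have off: "(\<lambda>n. \<integral>t. G t * (m n * step' (\<sigma> * m n * (t - a))) \<partial>lborel) \<longlonglongrightarrow> G a" if "\<sigma> = 1 \<or> \<sigma> = -1" for \<sigma> a
  unfolding m_def using LIMSEQ_ignore_initial_segment[OF step'_delta[OF Gc GB that, of a], of N] by simp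
 have "(\<integral>t. G t * deriv (\<psi> n) t \<partial>lborel) = (\<integral>t. G t * (m n * step' (1 * m n * (t - t1))) \<partial>lborel)
   - (\<integral>t. G t * (m n * step' (-1 * m n * (t - t2))) \<partial>lborel)" for n
 proof -
  have "G t * deriv (\<psi> n) t = G t * (m n * step' (1 * m n * (t - t1))) - G t * (m n * step' (-1 * m n * (t - t2)))" for t
   unfolding der by (rule right_diff_distrib)
  then show ?thesis
   by (simp only:) (rule Bochner_Integration.integral_diff[OF Gi[of 1] Gi[of "-1"]]; simp)
 qed
 then have L: "(\<lambda>n. \<integral>t. g t * deriv (\<psi> n) t \<partial>?\<mu>) \<longlonglongrightarrow> G t1 - G t2"
  unfolding lhs by (simp only:) (intro tendsto_diff off; simp)
 have R: "(\<lambda>n. \<integral>t. g' t * \<psi> n t \<partial>?\<mu>) \<longlonglongrightarrow> (\<integral>\<tau>. indicator {t1<..<t2} \<tau> * g' \<tau> \<partial>?\<mu>)"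
 proof (rule integral_dominated_convergence[where w="\<lambda>t. \<bar>g' t\<bar>"])
  have \<psi>m: "\<psi> n \<in> borel_measurable ?\<mu>" for n using test_L2[OF \<psi>t] by (intro L2_measurable) auto
  show "(\<lambda>t. g' t * \<psi> n t) \<in> borel_measurable ?\<mu>" for n using gi \<psi>m by measurable
  have im: "(indicator {t1<..<t2} :: real => real) \<in> borel_measurable ?\<mu>"
   by (intro measurable_restrict_space1 measurable_completion) simp
  then show "(\<lambda>\<tau>. indicator {t1<..<t2} \<tau> * g' \<tau>) \<in> borel_measurable ?\<mu>" using gi by measurable
  show "integrable ?\<mu> (\<lambda>t. \<bar>g' t\<bar>)" using gi by simp
  show "AE t in ?\<mu>. norm (g' t * \<psi> n t) \<le> \<bar>g' t\<bar>" for n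
   by (intro AE_I2) (auto simp: abs_mult \<psi>_def abs_of_nonneg smooth_step_bounds intro!: mult_left_le mult_le_one)
  have "(\<lambda>n. \<psi> n t) \<longlonglongrightarrow> indicator {t1<..<t2} t" for t
  proof (cases "t \<in> {t1<..<t2}")
   case True
   define d where "d = min (t - t1) (t2 - t)"
   have d: "d > 0" using True by (auto simp: d_def)
   obtain M :: nat where M: "M > 1 / d" using reals_Archimedean2 by blast
   have "\<psi> n t = 1" if "n \<ge> M" for n
   proof -
    have "1 / d \<le> m n" using M that by (simp add: m_def)
    then have "1 \<le> m n * d" using d by (simp add: field_simps)
    then have "1 \<le> m n * (t - t1)" "1 \<le> m n * (t2 - t)"
    proof -
     have "d \<le> t - t1" "d \<le> t2 - t" by (simp_all add: d_def)
     then have "m n * d \<le> m n * (t - t1)" "m n * d \<le> m n * (t2 - t)"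
      using m(1)[of n] by (intro mult_left_mono; simp)+
     then show "1 \<le> m n * (t - t1)" "1 \<le> m n * (t2 - t)" using \<open>1 \<le> m n * d\<close> by linarith+
    qed
    then show ?thesis by (simp add: \<psi>_def smooth_step_1)
   qed
   then have "\<forall>\<^sub>F n in sequentially. \<psi> n t = 1" by (auto simp: eventually_sequentially)
   then show ?thesis using True by (simp add: tendsto_eventually)
  next
   case False
   then have "\<psi> n t = 0" for n
   proof -
    have "m n * (t - t1) \<le> 0 \<or> m n * (t2 - t) \<le> 0"
     using False m(1)[of n] by (auto simp: mult_le_0_iff)
    then show ?thesis by (auto simp: \<psi>_def smooth_step_0)
   qed
   with False show ?thesis by simp
  qed
  then show "AE t in ?\<mu>. (\<lambda>n. g' t * \<psi> n t) \<longlonglongrightarrow> indicator {t1<..<t2} t * g' t"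
   by (intro AE_I2) (subst mult.commute, intro tendsto_mult tendsto_const)
 qed
 have "(\<lambda>n. \<integral>t. g t * deriv (\<psi> n) t \<partial>?\<mu>) \<longlonglongrightarrow> - (\<integral>\<tau>. indicator {t1<..<t2} \<tau> * g' \<tau> \<partial>?\<mu>)"
  unfolding wd[OF \<psi>t] using R by (intro tendsto_minus)
 from LIMSEQ_unique[OF L this] show ?thesis using Gg t by simp
qed

section \<open>Conservation along the diagonal\<close>

lemma deriv_moving_integral:
 fixes f :: "real => real"
 assumes f: "continuous_on UNIV f" and \<delta>: "\<delta> > 0"
 shows "((\<lambda>t. integral {0..\<delta>} (\<lambda>y. f (t + y))) has_real_derivative f (t0 + \<delta>) - f t0) (at t0)"
proof -
 define c where "c = t0 - 1"
 have fi: "f integrable_on {a..b}" for a b by (intro integrable_continuous_real continuous_on_subset[OF f]) auto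
 have Id: "((\<lambda>t. integral {c..t} f) has_real_derivative f t) (at t)" if "t > c" for t
 proof -
  have "((\<lambda>t. integral {c..t} f) has_real_derivative f t) (at t within {c..t+1})"
   by (rule integral_has_real_derivative) (use that in \<open>auto intro: continuous_on_subset[OF f]\<close>)
  moreover have "at t within {c..t+1} = at t" using that by (intro at_within_interior) auto
  ultimately show ?thesis by simp
 qed
 have "((\<lambda>t. integral {c..t + \<delta>} f - integral {c..t} f) has_real_derivative f (t0 + \<delta>) * 1 - f t0) (at t0)"
  using \<delta> by (intro DERIV_diff Id DERIV_chain2[OF Id]) (auto simp: c_def intro!: derivative_eq_intros)
 then have "((\<lambda>t. integral {c..t + \<delta>} f - integral {c..t} f) has_real_derivative f (t0 + \<delta>) - f t0) (at t0)" by simp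
 then show ?thesis
 proof (rule has_field_derivative_transform_within_open[where S="{c<..}"])
  fix t assume t: "t \<in> {c<..}"
  have "integral {c..t} f + integral {t..t + \<delta>} f = integral {c..t + \<delta>} f"
   using t \<delta> by (intro Henstock_Kurzweil_Integration.integral_combine fi) auto
  moreover have "integral {0..\<delta>} (\<lambda>y. f (t + y)) = integral {t..t + \<delta>} f"
   using integral_shift_Icc_real[of 0 \<delta> f t] by (simp add: comp_def add.commute)
  ultimately show "integral {c..t + \<delta>} f - integral {c..t} f = integral {0..\<delta>} (\<lambda>y. f (t + y))" by simp
 qed (auto simp: c_def)
qed

text \<open>A function on the square that satisfies the rectangle identity solves \<open>\<partial>\<^sub>1 F + \<partial>\<^sub>2 F = 0\<close>
 weakly. Averaging it over small squares gives a differentiable function with the same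
 property, which is constant along the diagonal.\<close>

lemma diagonal_constant_clamped:
 fixes F :: "real => real => real"
 assumes F: "continuous_on UNIV (\<lambda>(x, y). F x y)"
  and rect: "\<And>s t \<delta>. \<alpha> \<le> s ==> s + \<delta> \<le> \<beta> ==> \<alpha> \<le> t ==> t + \<delta> \<le> \<beta> ==> \<delta> > 0 ==>
   integral {0..\<delta>} (\<lambda>x. F (s + x) (t + \<delta>) - F (s + x) t)
   + integral {0..\<delta>} (\<lambda>y. F (s + \<delta>) (t + y) - F s (t + y)) = 0"
  and p: "\<alpha> < p" "p < \<beta>" and q: "\<alpha> < q" "q < \<beta>"
 shows "F p p = F q q"
proof -
 have Fc: "continuous_on A (\<lambda>z. F (f z) (g z))" if "continuous_on A f" "continuous_on A g" for A :: "'z::topological_space set" and f g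
  using continuous_on_compose2[OF F, of A "\<lambda>z. (f z, g z)"] that by (auto intro: continuous_on_Pair)
 define P where "P \<delta> x t = integral {0..\<delta>} (\<lambda>y. F x (t + y))" for \<delta> x t
 define \<psi> where "\<psi> \<delta> s t = integral {0..\<delta>} (\<lambda>x. P \<delta> (s + x) t)" for \<delta> s t
 define A where "A \<delta> s t = integral {0..\<delta>} (\<lambda>x. F (s + x) (t + \<delta>) - F (s + x) t)" for \<delta> s t
 have Pc: "continuous_on UNIV (\<lambda>z. P \<delta> (f z) (g z))"
  if "continuous_on UNIV f" "continuous_on UNIV g" for \<delta> and f g :: "'z::topological_space => real"
 proof -
  have "continuous_on (UNIV \<times> cbox 0 \<delta>) (\<lambda>(z, y). F (fst z) (snd z + y))"
   unfolding case_prod_unfold by (intro Fc continuous_intros)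
  from integral_continuous_on_param[OF this]
  have "continuous_on UNIV (\<lambda>z. P \<delta> (fst z) (snd z))" by (simp add: P_def)
  from continuous_on_compose2[OF this, of UNIV "\<lambda>z. (f z, g z)"] that show ?thesis
   by (auto intro: continuous_on_Pair)
 qed
 have dP: "((\<lambda>t. P \<delta> x t) has_real_derivative F x (t + \<delta>) - F x t) (at t)" if "\<delta> > 0" for \<delta> x t
  unfolding P_def by (rule deriv_moving_integral[OF _ that]) (intro Fc continuous_intros)
 have d2: "((\<lambda>t. \<psi> \<delta> s t) has_real_derivative A \<delta> s t) (at t)" if \<delta>: "\<delta> > 0" for \<delta> s t
 proof -
  have "((\<lambda>t. integral (cbox 0 \<delta>) (\<lambda>x. P \<delta> (s + x) t)) has_real_derivative
    integral (cbox 0 \<delta>) (\<lambda>x. F (s + x) (t + \<delta>) - F (s + x) t)) (at t within UNIV)"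
  proof (rule leibniz_rule_field_derivative)
   show "((\<lambda>t. P \<delta> (s + x) t) has_real_derivative F (s + x) (t + \<delta>) - F (s + x) t) (at t within UNIV)" for t x
    using dP[OF \<delta>] by simp
   show "(\<lambda>x. P \<delta> (s + x) t) integrable_on cbox 0 \<delta>" for t
    by (intro integrable_continuous continuous_on_subset[OF Pc]) (auto intro!: continuous_intros)
   show "continuous_on (UNIV \<times> cbox 0 \<delta>) (\<lambda>(t, x). F (s + x) (t + \<delta>) - F (s + x) t)"
    unfolding case_prod_unfold by (intro continuous_on_diff Fc continuous_intros)
  qed auto
  then show ?thesis by (simp add: \<psi>_def A_def)
 qed
 have d1: "((\<lambda>s. \<psi> \<delta> s t) has_real_derivative - A \<delta> s t) (at s)"
  if \<delta>: "\<delta> > 0" and st: "\<alpha> \<le> s" "s + \<delta> \<le> \<beta>" "\<alpha> \<le> t" "t + \<delta> \<le> \<beta>" for \<delta> s t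
 proof -
  have "((\<lambda>s. \<psi> \<delta> s t) has_real_derivative P \<delta> (s + \<delta>) t - P \<delta> s t) (at s)"
   unfolding \<psi>_def by (rule deriv_moving_integral[OF Pc \<delta>]) (intro continuous_intros)+
  moreover have "P \<delta> (s + \<delta>) t - P \<delta> s t = integral {0..\<delta>} (\<lambda>y. F (s + \<delta>) (t + y) - F s (t + y))"
   unfolding P_def by (intro Henstock_Kurzweil_Integration.integral_diff[symmetric] integrable_continuous_real Fc continuous_intros)
  moreover have "integral {0..\<delta>} (\<lambda>y. F (s + \<delta>) (t + y) - F s (t + y)) = - A \<delta> s t"
   using rect[OF st(1,2,3,4) \<delta>] unfolding A_def by linarith
  ultimately show ?thesis by simp
 qed
 have Ac: "continuous_on UNIV (\<lambda>z. A \<delta> (fst z) (snd z))" for \<delta>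
 proof -
  have "continuous_on (UNIV \<times> cbox 0 \<delta>) (\<lambda>(z, x). F (fst z + x) (snd z + \<delta>) - F (fst z + x) (snd z))"
   unfolding case_prod_unfold by (intro continuous_on_diff Fc continuous_intros)
  from integral_continuous_on_param[OF this] show ?thesis by (simp add: A_def)
 qed
 have diag: "((\<lambda>t. \<psi> \<delta> t t) has_real_derivative 0) (at t)" if \<delta>: "\<delta> > 0" and t: "\<alpha> < t" "t + \<delta> < \<beta>" for \<delta> t
 proof -
  have "\<exists>\<xi>. \<bar>\<xi> - t\<bar> \<le> \<bar>h\<bar> \<and> \<psi> \<delta> (t + h) (t + h) - \<psi> \<delta> (t + h) t = h * A \<delta> (t + h) \<xi>" for h
  proof (cases "h > 0")
   case True
   from MVT2[of t "t + h" "\<psi> \<delta> (t + h)" "A \<delta> (t + h)"] True d2[OF \<delta>]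
   obtain z where "t < z" "z < t + h" "\<psi> \<delta> (t + h) (t + h) - \<psi> \<delta> (t + h) t = (t + h - t) * A \<delta> (t + h) z" by auto
   then show ?thesis by (intro exI[of _ z]) auto
  next
   case False
   show ?thesis
   proof (cases "h = 0")
    case False
    with \<open>\<not> h > 0\<close> have "h < 0" by simp
    from MVT2[of "t + h" t "\<psi> \<delta> (t + h)" "A \<delta> (t + h)"] this d2[OF \<delta>]
    obtain z where "t + h < z" "z < t" "\<psi> \<delta> (t + h) t - \<psi> \<delta> (t + h) (t + h) = (t - (t + h)) * A \<delta> (t + h) z" by auto
    then show ?thesis by (intro exI[of _ z]) (auto simp: algebra_simps)
   qed (intro exI[of _ t], simp)
  qed
  then obtain \<xi> where \<xi>: "\<And>h. \<bar>\<xi> h - t\<bar> \<le> \<bar>h\<bar>"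
   "\<And>h. \<psi> \<delta> (t + h) (t + h) - \<psi> \<delta> (t + h) t = h * A \<delta> (t + h) (\<xi> h)" by metis
  have "((\<lambda>h. \<xi> h - t) \<longlongrightarrow> 0) (at 0)"
   by (rule Lim_null_comparison[of _ "\<lambda>h. \<bar>h\<bar>"]) (use \<xi>(1) in \<open>auto intro!: always_eventually tendsto_rabs_zero\<close>)
  from tendsto_add[OF this tendsto_const[of t]] have "(\<xi> \<longlongrightarrow> t) (at 0)" by simp
  moreover have "((\<lambda>h. t + h) \<longlongrightarrow> t) (at 0)" using tendsto_add[OF tendsto_const[of t] tendsto_ident_at[of 0 UNIV]] by simp
  ultimately have "((\<lambda>h. (t + h, \<xi> h)) \<longlongrightarrow> (t, t)) (at 0)" by (intro tendsto_Pair)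
  moreover have "isCont (\<lambda>z. A \<delta> (fst z) (snd z)) (t, t)" using Ac by (simp add: continuous_on_eq_continuous_within)
  ultimately have 1: "((\<lambda>h. A \<delta> (t + h) (\<xi> h)) \<longlongrightarrow> A \<delta> t t) (at 0)"
   using isCont_tendsto_compose[of "(t, t)" "\<lambda>z. A \<delta> (fst z) (snd z)"] by fastforce
  have 2: "((\<lambda>h. (\<psi> \<delta> (t + h) t - \<psi> \<delta> t t) / h) \<longlongrightarrow> - A \<delta> t t) (at 0)"
   using d1[OF \<delta>, of t t] t by (simp add: DERIV_def)
  from tendsto_add[OF 1 2] have "((\<lambda>h. A \<delta> (t + h) (\<xi> h) + (\<psi> \<delta> (t + h) t - \<psi> \<delta> t t) / h) \<longlongrightarrow> 0) (at 0)" by simp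
  then have "((\<lambda>h. (\<psi> \<delta> (t + h) (t + h) - \<psi> \<delta> t t) / h) \<longlongrightarrow> 0) (at 0)"
  proof (rule Lim_transform_eventually)
   show "\<forall>\<^sub>F h in at 0. A \<delta> (t + h) (\<xi> h) + (\<psi> \<delta> (t + h) t - \<psi> \<delta> t t) / h = (\<psi> \<delta> (t + h) (t + h) - \<psi> \<delta> t t) / h"
    using \<xi>(2) by (auto simp: eventually_at_filter field_simps)
  qed
  then show ?thesis by (simp add: DERIV_def)
 qed
 have const: "\<psi> \<delta> p p = \<psi> \<delta> q q" if \<delta>: "\<delta> > 0" "p + \<delta> < \<beta>" "q + \<delta> < \<beta>" for \<delta>
 proof -
  have "((\<lambda>t. \<psi> \<delta> t t) has_derivative (\<lambda>h. 0)) (at t within {\<alpha><..<\<beta> - \<delta>})" if "t \<in> {\<alpha><..<\<beta> - \<delta>}" for t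
  proof -
   have "((\<lambda>t. \<psi> \<delta> t t) has_real_derivative 0) (at t)" using that by (intro diag \<delta>) auto
   then show ?thesis by (simp add: has_field_derivative_def has_derivative_at_withinI lambda_zero)
  qed
  then have "\<exists>c. \<forall>t\<in>{\<alpha><..<\<beta> - \<delta>}. \<psi> \<delta> t t = c"
   by (intro has_derivative_zero_constant) auto
  then show ?thesis using p q \<delta> by auto
 qed
 have approx: "\<exists>\<delta>0>0. \<forall>\<delta>. 0 < \<delta> \<and> \<delta> < \<delta>0 \<longrightarrow> \<bar>\<psi> \<delta> t t - \<delta>\<^sup>2 * F t t\<bar> \<le> \<epsilon> * \<delta>\<^sup>2" if \<epsilon>: "\<epsilon> > 0" for t \<epsilon>
 proof -
  have "isCont (\<lambda>(x, y). F x y) (t, t)" using F by (simp add: continuous_on_eq_continuous_within)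
  then obtain d where d: "d > 0" "\<And>z. dist z (t, t) < d ==> dist (case z of (x, y) => F x y) (F t t) < \<epsilon>"
   using \<epsilon> unfolding continuous_at_eps_delta by fastforce
  show ?thesis
  proof (intro exI[of _ "d / 2"] conjI allI impI)
   fix \<delta> assume \<delta>: "0 < \<delta> \<and> \<delta> < d / 2"
   have near: "\<bar>F (t + x) (t + y) - F t t\<bar> \<le> \<epsilon>" if "x \<in> {0..\<delta>}" "y \<in> {0..\<delta>}" for x y
   proof -
    have "dist (t + x, t + y) (t, t) \<le> \<bar>x\<bar> + \<bar>y\<bar>"
     using sqrt_sum_squares_le_sum_abs[of x y] by (simp add: dist_Pair_Pair dist_real_def)
    also have "\<dots> < d" using that \<delta> by auto
    finally show ?thesis using d(2)[of "(t + x, t + y)"] by (simp add: dist_real_def)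
   qed
   have fi: "(\<lambda>y. F (t + x) (t + y)) integrable_on {0..\<delta>}" for x
    by (intro integrable_continuous_real Fc continuous_intros)
   have 1: "\<bar>P \<delta> (t + x) t - \<delta> * F t t\<bar> \<le> \<epsilon> * \<delta>" if x: "x \<in> {0..\<delta>}" for x
   proof -
    have "P \<delta> (t + x) t - \<delta> * F t t = integral {0..\<delta>} (\<lambda>y. F (t + x) (t + y) - F t t)"
     unfolding P_def using fi \<delta> by (subst Henstock_Kurzweil_Integration.integral_diff) auto
    also have "norm \<dots> \<le> \<epsilon> * (\<delta> - 0)"
     by (rule integral_bound) (use \<delta> near[OF x] in \<open>auto intro!: Fc continuous_intros\<close>)
    finally show ?thesis by simp
   qed
   have Pi: "(\<lambda>x. P \<delta> (t + x) t) integrable_on {0..\<delta>}"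
    by (intro integrable_continuous_real continuous_on_subset[OF Pc]) (auto intro!: continuous_intros)
   have "\<psi> \<delta> t t - \<delta>\<^sup>2 * F t t = integral {0..\<delta>} (\<lambda>x. P \<delta> (t + x) t - \<delta> * F t t)"
    unfolding \<psi>_def using Pi \<delta> by (subst Henstock_Kurzweil_Integration.integral_diff) (auto simp: power2_eq_square)
   also have "norm \<dots> \<le> (\<epsilon> * \<delta>) * (\<delta> - 0)"
    by (rule integral_bound)
      (use \<delta> 1 in \<open>auto intro!: continuous_on_diff continuous_on_subset[OF Pc] continuous_intros\<close>)
   finally show "\<bar>\<psi> \<delta> t t - \<delta>\<^sup>2 * F t t\<bar> \<le> \<epsilon> * \<delta>\<^sup>2" by (simp add: power2_eq_square mult.assoc)
  qed (use d in auto)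
 qed
 have "\<bar>F p p - F q q\<bar> \<le> 2 * \<epsilon>" if \<epsilon>: "\<epsilon> > 0" for \<epsilon>
 proof -
  obtain dp where dp: "dp > 0" "\<And>\<delta>. 0 < \<delta> ==> \<delta> < dp ==> \<bar>\<psi> \<delta> p p - \<delta>\<^sup>2 * F p p\<bar> \<le> \<epsilon> * \<delta>\<^sup>2"
   using approx[OF \<epsilon>, of p] by blast
  obtain dq where dq: "dq > 0" "\<And>\<delta>. 0 < \<delta> ==> \<delta> < dq ==> \<bar>\<psi> \<delta> q q - \<delta>\<^sup>2 * F q q\<bar> \<le> \<epsilon> * \<delta>\<^sup>2"
   using approx[OF \<epsilon>, of q] by blast
  define \<delta> where "\<delta> = min (min dp dq) (min (\<beta> - p) (\<beta> - q)) / 2"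
  have \<delta>: "\<delta> > 0" "\<delta> < dp" "\<delta> < dq" "p + \<delta> < \<beta>" "q + \<delta> < \<beta>"
   using dp(1) dq(1) p q by (auto simp: \<delta>_def min_def field_simps)
  have "\<bar>\<delta>\<^sup>2 * F p p - \<delta>\<^sup>2 * F q q\<bar> \<le> 2 * (\<epsilon> * \<delta>\<^sup>2)"
   using dp(2)[OF \<delta>(1,2)] dq(2)[OF \<delta>(1,3)] const[OF \<delta>(1,4,5)] by linarith
  moreover have "\<bar>\<delta>\<^sup>2 * F p p - \<delta>\<^sup>2 * F q q\<bar> = \<delta>\<^sup>2 * \<bar>F p p - F q q\<bar>"
   by (simp add: abs_mult flip: right_diff_distrib)
  moreover have "2 * (\<epsilon> * \<delta>\<^sup>2) = \<delta>\<^sup>2 * (2 * \<epsilon>)" by simp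
  ultimately have "\<delta>\<^sup>2 * \<bar>F p p - F q q\<bar> \<le> \<delta>\<^sup>2 * (2 * \<epsilon>)" by linarith
  then show ?thesis using \<delta>(1) by simp
 qed
 then have "\<bar>F p p - F q q\<bar> \<le> \<epsilon>" if "\<epsilon> > 0" for \<epsilon>
  using that by (metis field_sum_of_halves half_gt_zero mult_2)
 then have "\<bar>F p p - F q q\<bar> \<le> 0" by (rule field_le_epsilon[where y=0, simplified])
 then show ?thesis by simp
qed

text \<open>Sampling \<open>B s\<close> at the midpoints of ever finer cells gives jointly measurable functions, which
 converge by continuity in the second variable.\<close>

lemma caratheodory_jointly_measurable:
 fixes B :: "real => real => real"
 assumes T: "T > 0"
  and meas: "\<And>t. t \<in> {0<..<T} ==> (\<lambda>s. B s t) \<in> borel_measurable (lebesgue_on {0<..<T})"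
  and cont: "\<And>s. continuous_on {0<..<T} (B s)"
 shows "(\<lambda>(s, t). B s t) \<in> borel_measurable (lebesgue_on {0<..<T} \<Otimes>\<^sub>M lebesgue_on {0<..<T})"
proof -
 let ?\<mu> = "lebesgue_on {0<..<T}"
 define q where "q n k = T * (real k + 1 / 2) / real (Suc n)" for n k :: nat
 define cell where "cell n k = {t::real. T * real k / real (Suc n) \<le> t \<and> t < T * (real k + 1) / real (Suc n)}" for n k
 define Bn where "Bn n = (\<lambda>(s, t). \<Sum>k\<le>n. indicator (cell n k) t * B s (q n k))" for n
 have q: "q n k \<in> {0<..<T}" if "k \<le> n" for n k
 proof -
  have "T * (real k * 2) \<le> T * (real n * 2)" "0 \<le> T * (real k * 2)" using T that by auto
  then have "0 < T + T * (real k * 2)" "T * (real k * 2) < T + T * (real n * 2)" using T by linarith+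
  then show ?thesis by (auto simp: q_def field_simps)
 qed
 have cell: "cell n k \<in> sets borel" for n k
  unfolding cell_def by measurable
 have "Bn n \<in> borel_measurable (?\<mu> \<Otimes>\<^sub>M ?\<mu>)" for n
  unfolding Bn_def case_prod_unfold
 proof (intro borel_measurable_sum borel_measurable_times)
  fix k assume "k \<in> {..n}"
  then have "(\<lambda>s. B s (q n k)) \<in> borel_measurable ?\<mu>" by (intro meas q) auto
  then show "(\<lambda>x. B (fst x) (q n k)) \<in> borel_measurable (?\<mu> \<Otimes>\<^sub>M ?\<mu>)"
   by (rule measurable_compose[OF measurable_fst])
  have "(indicator (cell n k) :: real => real) \<in> borel_measurable ?\<mu>"
   using cell by (intro measurable_restrict_space1 measurable_completion) simp
  then show "(\<lambda>x. indicator (cell n k) (snd x) :: real) \<in> borel_measurable (?\<mu> \<Otimes>\<^sub>M ?\<mu>)"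
   by (rule measurable_compose[OF measurable_snd])
 qed
 moreover have "(\<lambda>n. Bn n z) \<longlonglongrightarrow> (\<lambda>(s, t). B s t) z" if zin: "z \<in> space (?\<mu> \<Otimes>\<^sub>M ?\<mu>)" for z
 proof -
  obtain s t where z: "z = (s, t)" "t \<in> {0<..<T}" using zin by (cases z) (auto simp: space_pair_measure)
  define \<kappa> where "\<kappa> n = nat \<lfloor>real (Suc n) * t / T\<rfloor>" for n
  have \<kappa>r: "real (\<kappa> n) \<le> real (Suc n) * t / T" "real (Suc n) * t / T < real (\<kappa> n) + 1" for n
   using z T by (auto simp: \<kappa>_def of_nat_nat)
  have \<kappa>n: "\<kappa> n \<le> n" for n
  proof -
   have "real (Suc n) * t < real (Suc n) * T" using z by (intro mult_strict_left_mono) auto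
   then have "real (Suc n) * t / T < real (Suc n)" using T by (simp add: pos_divide_less_eq del: of_nat_Suc)
   then have "real (\<kappa> n) < real (Suc n)" using \<kappa>r(1)[of n] by linarith
   then show ?thesis by linarith
  qed
  have incell: "t \<in> cell n k \<longleftrightarrow> k = \<kappa> n" for n k
  proof -
   have "t \<in> cell n k \<longleftrightarrow> real k \<le> real (Suc n) * t / T \<and> real (Suc n) * t / T < real k + 1"
    using T by (auto simp: cell_def field_simps)
   also have "\<dots> \<longleftrightarrow> k = \<kappa> n" using \<kappa>r[of n] by (auto; linarith)
   finally show ?thesis .
  qed
  have Bn: "Bn n z = B s (q n (\<kappa> n))" for n
  proof -
   have "Bn n z = (\<Sum>k\<le>n. if k = \<kappa> n then B s (q n k) else 0)"
    unfolding Bn_def z by (auto simp: incell indicator_def intro!: sum.cong)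
   then show ?thesis using \<kappa>n[of n] by simp
  qed
  have "(\<lambda>n. q n (\<kappa> n) - t) \<longlonglongrightarrow> 0"
  proof (rule Lim_null_comparison)
   show "(\<lambda>n. T * inverse (real (Suc n))) \<longlonglongrightarrow> 0"
    using tendsto_mult_right_zero[OF LIMSEQ_inverse_real_of_nat] .
   have "norm (q n (\<kappa> n) - t) \<le> T * inverse (real (Suc n))" for n
   proof -
    have e: "q n (\<kappa> n) - t = T / real (Suc n) * (real (\<kappa> n) + 1 / 2 - real (Suc n) * t / T)"
    proof -
     have R: "real (Suc n) \<noteq> 0" by simp
     have "T / real (Suc n) * (real (Suc n) * t / T) = t"
      using T R by (simp del: of_nat_Suc)
     moreover have "T / real (Suc n) * (real (\<kappa> n) + 1 / 2) = q n (\<kappa> n)"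
      by (simp only: q_def times_divide_eq_left)
     ultimately show ?thesis by (simp only: right_diff_distrib)
    qed
    have "\<bar>real (\<kappa> n) + 1 / 2 - real (Suc n) * t / T\<bar> \<le> 1" using \<kappa>r[of n] by linarith
    then have "T / real (Suc n) * \<bar>real (\<kappa> n) + 1 / 2 - real (Suc n) * t / T\<bar> \<le> T / real (Suc n) * 1"
     using T by (intro mult_left_mono) auto
    moreover have "\<bar>T / real (Suc n)\<bar> = T / real (Suc n)" using T by (intro abs_of_nonneg) simp
    then have "norm (q n (\<kappa> n) - t) = T / real (Suc n) * \<bar>real (\<kappa> n) + 1 / 2 - real (Suc n) * t / T\<bar>"
     unfolding e real_norm_def abs_mult by (simp only:)
    moreover have "T / real (Suc n) * 1 = T * inverse (real (Suc n))" by (simp only: mult_1_right divide_inverse)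
    ultimately show ?thesis by (simp only:)
   qed
   then show "\<forall>\<^sub>F n in sequentially. norm (q n (\<kappa> n) - t) \<le> T * inverse (real (Suc n))" by simp
  qed
  from tendsto_add[OF this tendsto_const[of t]] have "(\<lambda>n. q n (\<kappa> n)) \<longlonglongrightarrow> t" by simp
  moreover have "isCont (B s) t"
   using cont[of s] z by (simp add: continuous_on_eq_continuous_at)
  ultimately have "(\<lambda>n. B s (q n (\<kappa> n))) \<longlonglongrightarrow> B s t" by (rule isCont_tendsto_compose[rotated])
  then show ?thesis unfolding Bn by (simp only: z(1) split_conv)
 qed
 ultimately show ?thesis by (rule borel_measurable_LIMSEQ_real[rotated])
qed

lemma integral_indicator_Icc:
 fixes f :: "real => real"
 assumes t: "0 < a" "a < b" "b < T" and f: "continuous_on {a..b} f"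
 shows "(\<integral>x. indicator {a<..<b} x * f x \<partial>lebesgue_on {0<..<T}) = integral {a..b} f"
proof -
 have fi: "integrable (lebesgue_on {a..b}) f"
  using borel_integrable_atLeastAtMost'[OF f] f
  by (simp add: integral_lebesgue_on(2) set_integrable_def borel_measurable_continuous_on_indicator integrable_completion)
 have "(\<integral>x. indicator {a<..<b} x * f x \<partial>lebesgue_on {0<..<T}) = (\<integral>x. indicator {a<..<b} x *\<^sub>R f x \<partial>lebesgue)"
  unfolding integral_lebesgue_on(1)[of "{0<..<T}", simplified]
  by (intro Bochner_Integration.integral_cong refl) (use t in \<open>auto simp: indicator_def\<close>)
 also have "\<dots> = (\<integral>x. indicator {a..b} x *\<^sub>R f x \<partial>lebesgue)"
 proof (rule integral_cong_AE)
  have "(\<lambda>x. indicator {a..b} x *\<^sub>R f x) \<in> borel_measurable lebesgue"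
   using fi by (simp add: integral_lebesgue_on(2))
  then show "(\<lambda>x. indicator {a..b} x *\<^sub>R f x) \<in> borel_measurable lebesgue" .
  have im: "(indicator {a<..<b} :: real => real) \<in> borel_measurable lebesgue"
   by (intro measurable_completion) simp
  have "(\<lambda>x. indicator {a..b} x *\<^sub>R f x) \<in> borel_measurable lebesgue" by fact
  from borel_measurable_scaleR[OF im this]
  have "(\<lambda>x. indicator {a<..<b} x *\<^sub>R (indicator {a..b} x *\<^sub>R f x)) \<in> borel_measurable lebesgue" by simp
  also have "(\<lambda>x. indicator {a<..<b} x *\<^sub>R (indicator {a..b} x *\<^sub>R f x)) = (\<lambda>x. indicator {a<..<b} x *\<^sub>R f x)"
   by (auto simp: indicator_def fun_eq_iff)
  finally show "(\<lambda>x. indicator {a<..<b} x *\<^sub>R f x) \<in> borel_measurable lebesgue" .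
  have "negligible {a, b}" by simp
  then have "AE x in lebesgue. x \<notin> {a, b}" unfolding negligible_iff_null_sets by (rule AE_not_in)
  then show "AE x in lebesgue. indicator {a<..<b} x *\<^sub>R f x = indicator {a..b} x *\<^sub>R f x"
   by eventually_elim (auto simp: indicator_def)
 qed
 also have "\<dots> = integral {a..b} f"
  using lebesgue_integral_eq_integral[OF fi] by (simp add: integral_lebesgue_on(1))
 finally show ?thesis .
qed

text \<open>Integrating the two weak equations over a rectangle produces the same double integral of \<open>B\<close> with
 opposite signs. This is the weak form of \<open>\<partial>\<^sub>t M + \<partial>\<^sub>s N = 0\<close>; adding the identity with the two
 times exchanged, the sum \<open>M + N\<close> satisfies the rectangle identity. The bound \<open>G\<close> makes \<open>B\<close>
 integrable on the square, although it may be unbounded in the first variable.\<close>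

lemma conservation_interior:
 fixes M N B :: "real => real => real" and G :: "real => real"
 assumes T: "T > 0"
  and Mc: "continuous_on ({0<..<T} \<times> {0<..<T}) (\<lambda>(s, t). M s t)" and Ms: "\<And>s t. M s t = M t s"
  and Nc: "continuous_on ({0<..<T} \<times> {0<..<T}) (\<lambda>(s, t). N s t)" and Ns: "\<And>s t. N s t = N t s"
  and M': "AE s in lebesgue_on {0<..<T}. has_weak_time_deriv T (\<lambda>t. M t s) (\<lambda>t. - B s t)"
  and N': "\<And>s. s \<in> {0<..<T} ==> has_weak_time_deriv T (\<lambda>t. N t s) (\<lambda>t. B t s)"
  and Bc: "AE s in lebesgue_on {0<..<T}. continuous_on {0<..<T} (B s)"
  and BG: "AE s in lebesgue_on {0<..<T}. \<forall>t\<in>{0<..<T}. \<bar>B s t\<bar> \<le> G s"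
  and G: "integrable (lebesgue_on {0<..<T}) G"
  and p: "p \<in> {0<..<T}" and q: "q \<in> {0<..<T}"
 shows "M p p + N p p = M q q + N q q"
proof -
 let ?S = "{0<..<T}" and ?\<mu> = "lebesgue_on {0<..<T}"
 have Ss: "?S \<in> sets lebesgue" by simp
 have Mc1: "continuous_on ?S (\<lambda>t. M t s)" if "s \<in> ?S" for s
  using that by (intro continuous_on_compose2[OF Mc, of _ "\<lambda>t. (t, s)", simplified] continuous_intros) auto
 have Nc1: "continuous_on ?S (\<lambda>t. N t s)" if "s \<in> ?S" for s
  using that by (intro continuous_on_compose2[OF Nc, of _ "\<lambda>t. (t, s)", simplified] continuous_intros) auto
 interpret \<mu>: finite_measure ?\<mu> by (rule finite_measure_lebesgue_on) simp
 interpret P: pair_sigma_finite ?\<mu> ?\<mu> ..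
 define good where "good s \<longleftrightarrow> continuous_on ?S (B s) \<and> (\<forall>t\<in>?S. \<bar>B s t\<bar> \<le> G s)" for s
 have ag: "AE s in ?\<mu>. good s" using Bc BG unfolding good_def by eventually_elim simp
 define B' where "B' s t = (if good s then B s t else 0)" for s t
 have B'B: "AE s in ?\<mu>. \<forall>t. B' s t = B s t" using ag by eventually_elim (simp add: B'_def)
 have Bi: "integrable ?\<mu> (\<lambda>s. B s t)" if "t \<in> ?S" for t using N'[OF that] by (simp add: has_weak_time_deriv_def)
 have B'm: "(\<lambda>s. B' s t) \<in> borel_measurable ?\<mu>" if "t \<in> ?S" for t
  by (rule measurable_lebesgue_on_AE[OF Ss borel_measurable_integrable[OF Bi[OF that]]])
    (use B'B in eventually_elim, simp)
 have B'c: "continuous_on ?S (B' s)" for s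
 proof -
  have "B' s = (if good s then B s else (\<lambda>_. 0))" by (auto simp: B'_def fun_eq_iff)
  then show ?thesis by (auto simp: good_def)
 qed
 have jm: "(\<lambda>(s, t). B' s t) \<in> borel_measurable (?\<mu> \<Otimes>\<^sub>M ?\<mu>)"
  by (rule caratheodory_jointly_measurable[OF T B'm B'c])
 have B'G: "\<bar>B' s t\<bar> \<le> \<bar>G s\<bar>" if "t \<in> ?S" for s t using that
  by (auto simp: B'_def good_def intro: order_trans[OF _ abs_ge_self])
 have ji: "integrable (?\<mu> \<Otimes>\<^sub>M ?\<mu>) (\<lambda>(s, t). B' s t)"
 proof (rule Bochner_Integration.integrable_bound)
  have Gm: "(\<lambda>z. G (fst z)) \<in> borel_measurable (?\<mu> \<Otimes>\<^sub>M ?\<mu>)"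
   using G by (intro measurable_compose[OF measurable_fst]) auto
  show "integrable (?\<mu> \<Otimes>\<^sub>M ?\<mu>) (\<lambda>z. G (fst z))"
   by (rule P.Fubini_integrable) (use Gm G in auto)
  show "AE z in ?\<mu> \<Otimes>\<^sub>M ?\<mu>. norm (case z of (s, t) => B' s t) \<le> norm (G (fst z))"
   using B'G by (intro AE_I2) (auto simp: space_pair_measure)
 qed (rule jm)
 have ind: "(indicator {a<..<b} :: real => real) \<in> borel_measurable ?\<mu>" for a b
  by (intro measurable_restrict_space1 measurable_completion) simp
 \<comment> \<open>the rectangle identity with the two parts of the form still separate\<close>
 have R: "integral {s1..s2} (\<lambda>s. M t2 s - M t1 s) + integral {t1..t2} (\<lambda>\<tau>. N s2 \<tau> - N s1 \<tau>) = 0"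
  if s: "0 < s1" "s1 < s2" "s2 < T" and t: "0 < t1" "t1 < t2" "t2 < T" for s1 s2 t1 t2
 proof -
  let ?I = "indicator {s1<..<s2} :: real => real" and ?J = "indicator {t1<..<t2} :: real => real"
  let ?K = "\<lambda>(\<sigma>, \<tau>). ?I \<sigma> * (?J \<tau> * B' \<sigma> \<tau>)"
  have ki: "integrable (?\<mu> \<Otimes>\<^sub>M ?\<mu>) ?K"
  proof (rule Bochner_Integration.integrable_bound[OF ji])
   have "(\<lambda>z. ?I (fst z)) \<in> borel_measurable (?\<mu> \<Otimes>\<^sub>M ?\<mu>)" "(\<lambda>z. ?J (snd z)) \<in> borel_measurable (?\<mu> \<Otimes>\<^sub>M ?\<mu>)"
    by (rule measurable_compose[OF measurable_fst ind], rule measurable_compose[OF measurable_snd ind])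
   with jm show "?K \<in> borel_measurable (?\<mu> \<Otimes>\<^sub>M ?\<mu>)"
    unfolding case_prod_unfold by (intro borel_measurable_times)
   show "AE z in ?\<mu> \<Otimes>\<^sub>M ?\<mu>. norm (?K z) \<le> norm (case z of (s, t) => B' s t)"
    by (intro AE_I2) (auto simp: indicator_def)
  qed
  have Mm: "continuous_on {s1..s2} (\<lambda>s. M t2 s - M t1 s)"
   by (subst (1 2) Ms, intro continuous_on_diff continuous_on_subset[OF Mc1]) (use s t in auto)
  have Nm: "continuous_on {t1..t2} (\<lambda>\<tau>. N s2 \<tau> - N s1 \<tau>)"
   by (subst (1 2) Ns, intro continuous_on_diff continuous_on_subset[OF Nc1]) (use s t in auto)
  have "integral {s1..s2} (\<lambda>s. M t2 s - M t1 s) = (\<integral>\<sigma>. ?I \<sigma> * (M t2 \<sigma> - M t1 \<sigma>) \<partial>?\<mu>)"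
   by (rule integral_indicator_Icc[OF s Mm, symmetric])
  also have "\<dots> = (\<integral>\<sigma>. - (\<integral>\<tau>. ?K (\<sigma>, \<tau>) \<partial>?\<mu>) \<partial>?\<mu>)"
  proof (rule integral_cong_AE)
   show "(\<lambda>\<sigma>. - (\<integral>\<tau>. ?K (\<sigma>, \<tau>) \<partial>?\<mu>)) \<in> borel_measurable ?\<mu>"
    using P.integrable_fst'[OF ki] by (intro borel_measurable_uminus) auto
   have "(\<lambda>\<sigma>. M t2 \<sigma> - M t1 \<sigma>) \<in> borel_measurable ?\<mu>"
    by (subst (1 2) Ms, intro borel_measurable_diff; rule continuous_imp_measurable_on_sets_lebesgue[OF Mc1 Ss])
      (use t in auto)
   with ind show "(\<lambda>\<sigma>. ?I \<sigma> * (M t2 \<sigma> - M t1 \<sigma>)) \<in> borel_measurable ?\<mu>" by (intro borel_measurable_times)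
   have "AE s in ?\<mu>. s \<in> ?S" by (rule AE_I2) simp
   with M' B'B show "AE \<sigma> in ?\<mu>. ?I \<sigma> * (M t2 \<sigma> - M t1 \<sigma>) = - (\<integral>\<tau>. ?K (\<sigma>, \<tau>) \<partial>?\<mu>)"
   proof eventually_elim
    case (elim \<sigma>)
    have "M t2 \<sigma> - M t1 \<sigma> = (\<integral>\<tau>. ?J \<tau> * - B \<sigma> \<tau> \<partial>?\<mu>)"
     by (rule weak_time_deriv_FTC[OF elim(1) Mc1[OF elim(3)] t])
    then show ?case using elim(2) by (simp add: mult.assoc)
   qed
  qed
  also have "\<dots> = - (\<integral>\<sigma>. (\<integral>\<tau>. ?K (\<sigma>, \<tau>) \<partial>?\<mu>) \<partial>?\<mu>)" by simp
  also have "(\<integral>\<sigma>. (\<integral>\<tau>. ?K (\<sigma>, \<tau>) \<partial>?\<mu>) \<partial>?\<mu>) = (\<integral>\<tau>. (\<integral>\<sigma>. ?K (\<sigma>, \<tau>) \<partial>?\<mu>) \<partial>?\<mu>)"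
   using P.Fubini_integral[of "\<lambda>\<sigma> \<tau>. ?K (\<sigma>, \<tau>)"] ki by simp
  also have "\<dots> = (\<integral>\<tau>. ?J \<tau> * (N s2 \<tau> - N s1 \<tau>) \<partial>?\<mu>)"
  proof (rule Bochner_Integration.integral_cong[OF refl])
   fix \<tau> assume "\<tau> \<in> space ?\<mu>"
   then have \<tau>: "\<tau> \<in> ?S" by simp
   have "(\<integral>\<sigma>. ?K (\<sigma>, \<tau>) \<partial>?\<mu>) = (\<integral>\<sigma>. ?J \<tau> * (?I \<sigma> * B' \<sigma> \<tau>) \<partial>?\<mu>)"
    by (intro Bochner_Integration.integral_cong refl) (simp add: mult.left_commute)
   also have "\<dots> = ?J \<tau> * (\<integral>\<sigma>. ?I \<sigma> * B' \<sigma> \<tau> \<partial>?\<mu>)" by (rule integral_mult_right_zero)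
   also have "(\<integral>\<sigma>. ?I \<sigma> * B' \<sigma> \<tau> \<partial>?\<mu>) = (\<integral>\<sigma>. ?I \<sigma> * B \<sigma> \<tau> \<partial>?\<mu>)"
   proof (rule integral_cong_AE)
    show "AE \<sigma> in ?\<mu>. ?I \<sigma> * B' \<sigma> \<tau> = ?I \<sigma> * B \<sigma> \<tau>" using B'B by eventually_elim simp
   qed (use ind B'm[OF \<tau>] borel_measurable_integrable[OF Bi[OF \<tau>]] in \<open>auto intro!: borel_measurable_times\<close>)
   also have "\<dots> = N s2 \<tau> - N s1 \<tau>"
    by (rule weak_time_deriv_FTC[OF N'[OF \<tau>] Nc1[OF \<tau>] s, symmetric])
   finally show "(\<integral>\<sigma>. ?K (\<sigma>, \<tau>) \<partial>?\<mu>) = ?J \<tau> * (N s2 \<tau> - N s1 \<tau>)" .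
  qed
  also have "\<dots> = integral {t1..t2} (\<lambda>\<tau>. N s2 \<tau> - N s1 \<tau>)"
   by (rule integral_indicator_Icc[OF t Nm])
  finally show ?thesis by simp
 qed
 define F where "F s t = M s t + N s t" for s t
 define \<alpha> where "\<alpha> = min p q / 2"
 define \<beta> where "\<beta> = (max p q + T) / 2"
 have ab: "0 < \<alpha>" "\<alpha> < p" "\<alpha> < q" "p < \<beta>" "q < \<beta>" "\<beta> < T"
  using p q by (auto simp: \<alpha>_def \<beta>_def min_def max_def)
 define cl where "cl x = max \<alpha> (min \<beta> x)" for x
 have clr: "cl x \<in> ?S" for x using ab by (auto simp: cl_def min_def max_def)
 have clc: "continuous_on A cl" for A unfolding cl_def by (intro continuous_intros)
 have cl_id: "cl x = x" if "\<alpha> \<le> x" "x \<le> \<beta>" for x using that by (simp add: cl_def)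
 have "F (cl p) (cl p) = F (cl q) (cl q)"
 proof (rule diagonal_constant_clamped[of "\<lambda>s t. F (cl s) (cl t)", OF _ _ ab(2,4,3,5)])
  have c: "continuous_on UNIV (\<lambda>z. (cl (fst z), cl (snd z)))"
   by (intro continuous_on_Pair continuous_on_compose2[OF clc[of UNIV]] continuous_intros) auto
  have "continuous_on (?S \<times> ?S) (\<lambda>(s, t). F s t)"
   using continuous_on_add[OF Mc Nc] by (simp add: F_def case_prod_unfold)
  moreover have "range (\<lambda>z. (cl (fst z), cl (snd z))) \<subseteq> ?S \<times> ?S" by (intro image_subsetI SigmaI clr)
  ultimately show "continuous_on UNIV (\<lambda>(s, t). F (cl s) (cl t))"
   using continuous_on_compose2[OF _ c, of "?S \<times> ?S" "\<lambda>(s, t). F s t"] by (simp add: case_prod_unfold)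
  fix s t \<delta> assume st: "\<alpha> \<le> s" "s + \<delta> \<le> \<beta>" "\<alpha> \<le> t" "t + \<delta> \<le> \<beta>" "\<delta> > 0"
  have Fs: "F x y = F y x" for x y using Ms[of x y] Ns[of x y] by (simp add: F_def)
  have I: "integral {0..\<delta>} (\<lambda>x. f (a + x)) = integral {a..a + \<delta>} f" for f :: "real => real" and a
   using integral_shift_Icc_real[of 0 \<delta> f a] by (simp add: comp_def add.commute)
  have r: "0 < s" "s < s + \<delta>" "s + \<delta> < T" "0 < t" "t < t + \<delta>" "t + \<delta> < T" using st ab by auto
  have ci: "(\<lambda>x. H c x - H d x) integrable_on {a..b}"
   if "H = M \<or> H = N" "c \<in> ?S" "d \<in> ?S" "{a..b} \<subseteq> ?S" for H a b c d
  proof -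
   have "H x y = H y x" for x y using that(1) Ms[of x y] Ns[of x y] by auto
   moreover have "(\<lambda>x. H x c - H x d) integrable_on {a..b}"
    using that Mc1 Nc1 by (intro integrable_continuous_real continuous_on_diff) (auto intro: continuous_on_subset)
   ultimately show ?thesis by simp
  qed
  have "integral {0..\<delta>} (\<lambda>x. F (cl (s + x)) (cl (t + \<delta>)) - F (cl (s + x)) (cl t)) = integral {0..\<delta>} (\<lambda>x. F (t + \<delta>) (s + x) - F t (s + x))"
   by (rule Henstock_Kurzweil_Integration.integral_cong) (use st Fs in \<open>auto simp: cl_id\<close>)
  also have "\<dots> = integral {s..s + \<delta>} (\<lambda>x. F (t + \<delta>) x - F t x)" by (rule I)
  also have "\<dots> = integral {s..s + \<delta>} (\<lambda>x. (M (t + \<delta>) x - M t x) + (N (t + \<delta>) x - N t x))"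
   by (simp add: F_def algebra_simps)
  also have "\<dots> = integral {s..s + \<delta>} (\<lambda>x. M (t + \<delta>) x - M t x) + integral {s..s + \<delta>} (\<lambda>x. N (t + \<delta>) x - N t x)"
   using r by (intro Henstock_Kurzweil_Integration.integral_add ci) auto
  finally have 1: "integral {0..\<delta>} (\<lambda>x. F (cl (s + x)) (cl (t + \<delta>)) - F (cl (s + x)) (cl t))
   = integral {s..s + \<delta>} (\<lambda>x. M (t + \<delta>) x - M t x) + integral {s..s + \<delta>} (\<lambda>x. N (t + \<delta>) x - N t x)" .
  have "integral {0..\<delta>} (\<lambda>y. F (cl (s + \<delta>)) (cl (t + y)) - F (cl s) (cl (t + y))) = integral {0..\<delta>} (\<lambda>y. F (s + \<delta>) (t + y) - F s (t + y))"
   by (rule Henstock_Kurzweil_Integration.integral_cong) (use st in \<open>auto simp: cl_id\<close>)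
  also have "\<dots> = integral {t..t + \<delta>} (\<lambda>y. F (s + \<delta>) y - F s y)" by (rule I)
  also have "\<dots> = integral {t..t + \<delta>} (\<lambda>y. (M (s + \<delta>) y - M s y) + (N (s + \<delta>) y - N s y))"
   by (simp add: F_def algebra_simps)
  also have "\<dots> = integral {t..t + \<delta>} (\<lambda>y. M (s + \<delta>) y - M s y) + integral {t..t + \<delta>} (\<lambda>y. N (s + \<delta>) y - N s y)"
   using r by (intro Henstock_Kurzweil_Integration.integral_add ci) auto
  finally have 2: "integral {0..\<delta>} (\<lambda>y. F (cl (s + \<delta>)) (cl (t + y)) - F (cl s) (cl (t + y)))
   = integral {t..t + \<delta>} (\<lambda>y. M (s + \<delta>) y - M s y) + integral {t..t + \<delta>} (\<lambda>y. N (s + \<delta>) y - N s y)" .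
  show "integral {0..\<delta>} (\<lambda>x. F (cl (s + x)) (cl (t + \<delta>)) - F (cl (s + x)) (cl t))
   + integral {0..\<delta>} (\<lambda>y. F (cl (s + \<delta>)) (cl (t + y)) - F (cl s) (cl (t + y))) = 0"
   unfolding 1 2 using R[OF r(1,2,3,4,5,6)] R[OF r(4,5,6,1,2,3)] by linarith
 qed
 then show ?thesis using ab by (simp add: cl_id F_def)
qed

section \<open>Green's formula at a straight edge\<close>

abbreviation ax :: "2 => pt" where "ax l \<equiv> axis l 1"

lemma ax_Basis [simp]: "ax l \<in> Basis" by (auto simp: axis_in_Basis_iff)

lemma UNIV_pair: "i \<noteq> j ==> (UNIV :: 2 set) = {i, j}"
proof -
 assume "i \<noteq> j"
 then have "k \<in> {i, j}" for k using exhaust_2[of i] exhaust_2[of j] exhaust_2[of k] by auto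
 then show ?thesis by auto
qed

lemma lborel_pt:
 assumes ij: "i \<noteq> (j :: 2)"
 shows "(lborel :: pt measure) = distr (lborel \<Otimes>\<^sub>M lborel) borel (\<lambda>(a, b). axis i a + axis j b)"
proof (rule lborel_eqI)
 let ?f = "\<lambda>(a, b). axis i a + axis j b :: pt"
 have fm: "?f \<in> borel_measurable (borel \<Otimes>\<^sub>M borel)"
 proof -
  have "?f = (\<lambda>p. fst p *\<^sub>R ax i + snd p *\<^sub>R ax j)"
   by (auto simp: fun_eq_iff vec_eq_iff axis_def)
  then show ?thesis by simp
 qed
 have fm': "?f \<in> measurable (lborel \<Otimes>\<^sub>M lborel) borel"
  using fm by (simp cong: measurable_cong_sets sets_pair_measure_cong)
 fix l u :: pt assume lu: "\<And>b. b \<in> Basis ==> l \<bullet> b \<le> u \<bullet> b"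
 have le: "l $ k \<le> u $ k" for k using lu[of "ax k"] by (simp add: inner_axis)
 have comp: "(axis i a + axis j b) $ i = a" "(axis i a + axis j b) $ j = b" for a b :: real
  using ij by (auto simp: axis_def)
 have "?f -` box l u \<inter> space (lborel \<Otimes>\<^sub>M lborel) = {l $ i<..<u $ i} \<times> {l $ j<..<u $ j}"
 proof -
  have all2: "(\<forall>k::2. P k) \<longleftrightarrow> P i \<and> P j" for P
  proof -
   have "(\<forall>k::2. P k) \<longleftrightarrow> (\<forall>k\<in>UNIV. P k)" by simp
   also have "\<dots> \<longleftrightarrow> P i \<and> P j" unfolding UNIV_pair[OF ij] by simp
   finally show ?thesis .
  qed
  have "axis i a + axis j b \<in> box l u \<longleftrightarrow> (l $ i < a \<and> a < u $ i) \<and> (l $ j < b \<and> b < u $ j)" for a b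
   unfolding mem_box_cart all2 comp by (rule refl)
  then show ?thesis by (auto simp: space_pair_measure)
 qed
 then have "emeasure (distr (lborel \<Otimes>\<^sub>M lborel) borel ?f) (box l u)
   = emeasure (lborel \<Otimes>\<^sub>M lborel) ({l $ i<..<u $ i} \<times> {l $ j<..<u $ j})"
  using fm' by (subst emeasure_distr) auto
 also have "\<dots> = emeasure lborel {l $ i<..<u $ i} * emeasure lborel {l $ j<..<u $ j}"
  by (rule lborel.emeasure_pair_measure_Times) auto
 also have "\<dots> = ennreal ((u $ i - l $ i) * (u $ j - l $ j))"
  using le by (simp add: ennreal_mult)
 also have "(u $ i - l $ i) * (u $ j - l $ j) = (\<Prod>b\<in>Basis. (u - l) \<bullet> b)"
 proof -
  have B: "(Basis :: pt set) = {ax i, ax j}"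
   using UNIV_pair[OF ij] by (auto simp: Basis_vec_def)
  show ?thesis unfolding B using ij by (simp add: axis_eq_axis inner_axis)
 qed
 finally show "emeasure (distr (lborel \<Otimes>\<^sub>M lborel) borel ?f) (box l u) = (\<Prod>b\<in>Basis. (u - l) \<bullet> b)" .
qed simp

lemma integral_pt_iterated:
 fixes f :: "pt => real"
 assumes ij: "i \<noteq> (j :: 2)" and f: "integrable lborel f" "f \<in> borel_measurable borel"
 shows "(\<integral>x. f x \<partial>lborel) = (\<integral>a. (\<integral>b. f (axis i a + axis j b) \<partial>lborel) \<partial>lborel)"
proof -
 let ?f = "\<lambda>(a, b). axis i a + axis j b :: pt"
 have "?f = (\<lambda>p. fst p *\<^sub>R ax i + snd p *\<^sub>R ax j)"
  by (auto simp: fun_eq_iff vec_eq_iff axis_def)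
 then have "?f \<in> borel_measurable (borel \<Otimes>\<^sub>M borel)" by simp
 then have fm: "?f \<in> measurable (lborel \<Otimes>\<^sub>M lborel) borel"
  by (simp cong: measurable_cong_sets sets_pair_measure_cong)
 have i: "integrable (lborel \<Otimes>\<^sub>M lborel) (\<lambda>p. f (?f p))"
  using f(1) unfolding lborel_pt[OF ij] by (subst (asm) integrable_distr_eq[OF fm]) (use f in auto)
 have "(\<integral>x. f x \<partial>lborel) = (\<integral>p. f (?f p) \<partial>(lborel \<Otimes>\<^sub>M lborel))"
  unfolding lborel_pt[OF ij] by (rule integral_distr[OF fm]) (use f in auto)
 also have "\<dots> = (\<integral>a. (\<integral>b. f (?f (a, b)) \<partial>lborel) \<partial>lborel)"
  by (rule lborel_pair.integral_fst'[OF i, symmetric])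
 finally show ?thesis by simp
qed

definition plateau :: "real => real" where
 "plateau y = smooth_step (2 * y + 2) * smooth_step (- 2 * y + 2)"

lemma smooth_plateau: "smooth plateau"
 unfolding plateau_def
 by (intro smooth_mult smooth_compose_affine[OF bounded_linear_mult_right smooth_smooth_step])

lemma plateau_one: "\<bar>y\<bar> \<le> 1/2 ==> plateau y = 1"
 by (simp add: plateau_def smooth_step_1 abs_le_iff)

lemma plateau_zero: "1 \<le> \<bar>y\<bar> ==> plateau y = 0"
 by (auto simp: plateau_def smooth_step_0 abs_if split: if_splits)

lemma supp_plateau: "supp plateau \<subseteq> {-1..1}"
 by (rule supp_subset) (auto simp: plateau_zero)

lemma plateau_bounds: "0 \<le> plateau y" "plateau y \<le> 1"
 by (auto simp: plateau_def smooth_step_bounds intro: mult_le_one)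

abbreviation plateau' :: "real => real" where "plateau' \<equiv> pd 1 plateau"

lemma plateau'_smooth: "smooth plateau'" by (rule smooth_pd[OF smooth_plateau]) simp

lemma plateau'_zero: "1 < \<bar>y\<bar> ==> plateau' y = 0"
 by (rule pd_outside_supp, rule contra_subsetD[OF supp_plateau]) (auto simp: abs_if split: if_splits)

lemma plateau'_integrable: "integrable lborel plateau'"
 by (rule test_integrable[of _ UNIV], rule test_functionsI[OF plateau'_smooth, of "{-1..1}"])
   (auto intro!: plateau'_zero)

lemma plateau'_half_integrals:
 "(\<integral>y. indicator {0..} y * plateau' y \<partial>lborel) = -1" "(\<integral>y. indicator {..<0} y * plateau' y \<partial>lborel) = 1"
proof -
 have "(\<integral>y. indicator {0..1} y *\<^sub>R plateau' y \<partial>lborel) = plateau 1 - plateau 0"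
  by (rule integral_FTC_atLeastAtMost)
    (auto intro!: smooth_continuous plateau'_smooth has_field_derivative_at_within smooth_real_deriv smooth_plateau
     simp flip: has_real_derivative_iff_has_vector_derivative)
 also have "(\<lambda>y. indicator {0..1} y *\<^sub>R plateau' y) = (\<lambda>y. indicator {0..} y * plateau' y)"
  using plateau'_zero by (auto simp: indicator_def fun_eq_iff)
 finally show "(\<integral>y. indicator {0..} y * plateau' y \<partial>lborel) = -1" by (simp add: plateau_zero plateau_one)
 have "(\<integral>y. indicator {-1..0} y *\<^sub>R plateau' y \<partial>lborel) = plateau 0 - plateau (-1)"
  by (rule integral_FTC_atLeastAtMost)
    (auto intro!: smooth_continuous plateau'_smooth has_field_derivative_at_within smooth_real_deriv smooth_plateau
     simp flip: has_real_derivative_iff_has_vector_derivative)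
 also have "(\<integral>y. indicator {-1..0} y *\<^sub>R plateau' y \<partial>lborel) = (\<integral>y. indicator {..<0} y * plateau' y \<partial>lborel)"
 proof (rule integral_cong_AE)
  show "AE y in lborel. indicator {-1..0} y *\<^sub>R plateau' y = indicator {..<0} y * plateau' y"
   using AE_lborel_singleton[of 0] by eventually_elim (use plateau'_zero in \<open>auto simp: indicator_def\<close>)
 qed (use borel_measurable_integrable[OF plateau'_integrable] in measurable)
 finally show "(\<integral>y. indicator {..<0} y * plateau' y \<partial>lborel) = 1" by (simp add: plateau_zero plateau_one)
qed

text \<open>The support of \<open>\<psi>\<close> misses the frontier, so cutting \<open>\<psi>\<close> off outside \<open>E\<close> preserves smoothness.\<close>

lemma restrict_test_function:
 assumes E: "open E" and \<psi>: "\<psi> \<in> test_functions UNIV" and d: "supp \<psi> \<inter> frontier E = {}"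
 shows "(\<lambda>x. if x \<in> E then \<psi> x else 0) \<in> test_functions E"
  and "x \<in> E ==> pd b (\<lambda>x. if x \<in> E then \<psi> x else 0) x = pd b \<psi> x"
proof -
 let ?r = "\<lambda>\<psi> x. if x \<in> E then \<psi> x else 0 :: real"
 have oE: "open (- closure E)" by (rule open_Compl) simp
 have inE: "(?r \<psi> has_derivative f') (at x)" if "(\<psi> has_derivative f') (at x)" "x \<in> E" for \<psi> f' x
  using that by (intro has_derivative_transform_within_open[OF that(1) E]) auto
 have outE: "(?r \<psi> has_derivative (\<lambda>_. 0)) (at x)" if "x \<notin> closure E" for \<psi> x
  by (rule has_derivative_transform_within_open[where s="- closure E" and f="\<lambda>_. 0"])
    (use that closure_subset oE in auto)
 have frE: "(?r \<psi> has_derivative (\<lambda>_. 0)) (at x)" if "x \<notin> supp \<psi>" for \<psi> x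
  by (rule has_derivative_transform_within_open[where s="- supp \<psi>" and f="\<lambda>_. 0"])
    (use that supp_closed not_in_supp[of _ \<psi>] in auto)
 have cases: "x \<in> E \<or> x \<notin> closure E \<or> x \<notin> supp \<psi>" if "supp \<psi> \<inter> frontier E = {}" for x \<psi>
  using that E by (auto simp: frontier_def interior_open)
 have "C_k n (?r \<psi>)" if "smooth \<psi>" "supp \<psi> \<inter> frontier E = {}" for \<psi> n
  using that
 proof (induction n arbitrary: \<psi>)
  case 0
  have "?r \<psi> differentiable (at x)" for x
   using cases[OF 0(2), of x] inE[OF smooth_has_derivative[OF 0(1)], of x] outE[of x \<psi>] frE[of x \<psi>]
   unfolding differentiable_def by blast
  then show ?case by (simp add: differentiable_imp_continuous_within continuous_on_eq_continuous_within)
 next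
  case (Suc n)
  have "?r \<psi> differentiable (at x)" for x
   using cases[OF Suc(3), of x] inE[OF smooth_has_derivative[OF Suc(2)], of x] outE[of x \<psi>] frE[of x \<psi>]
   unfolding differentiable_def by blast
  moreover have "pd b (?r \<psi>) = ?r (pd b \<psi>)" for b
  proof
   fix x
   consider "x \<in> E" | "x \<notin> closure E" | "x \<notin> supp \<psi>" using cases[OF Suc(3)] by blast
   then show "pd b (?r \<psi>) x = ?r (pd b \<psi>) x"
   proof cases
    case 1 then show ?thesis using pd_eq[OF inE[OF smooth_has_derivative[OF Suc(2)]]] by simp
   next
    case 2 then show ?thesis using pd_eq[OF outE] closure_subset[of E] by auto
   next
    case 3 then show ?thesis using pd_eq[OF frE] pd_outside_supp[OF 3] by simp
   qed
  qed
  moreover have "C_k n (?r (pd b \<psi>))" if "b \<in> Basis" for b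
   using supp_pd[of b \<psi>] Suc(3) by (intro Suc.IH smooth_pd Suc(2) that) auto
  ultimately show ?case by simp
 qed
 then have s: "smooth (?r \<psi>)" using test_smooth[OF \<psi>] d by (simp add: smooth_def)
 have "supp \<psi> \<inter> E = supp \<psi> \<inter> closure E" using d E by (auto simp: frontier_def interior_open closure_def)
 then have "compact (supp \<psi> \<inter> E)" using test_compact[OF \<psi>] by (simp add: compact_Int_closed)
 then show "?r \<psi> \<in> test_functions E"
  by (rule test_functionsI[OF s]) (auto simp: not_in_supp)
 show "x \<in> E ==> pd b (?r \<psi>) x = pd b \<psi> x"
  by (rule pd_eq[OF inE[OF smooth_has_derivative[OF test_smooth[OF \<psi>]], unfolded o_def]])
qed

lemma seg_pt_components: "seg_pt e s $ i = fst e $ i + s * (snd e - fst e) $ i"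
 by (simp add: seg_pt_def)

lemma seg_pt_in: "0 \<le> s ==> s \<le> 1 ==> seg_pt e s \<in> seg_set e"
 by (auto simp: seg_set_def in_segment seg_pt_def algebra_simps intro!: exI[of _ s])

lemma seg_set_pt: "x \<in> seg_set e ==> \<exists>s\<in>{0..1}. x = seg_pt e s"
 by (auto simp: seg_set_def in_segment seg_pt_def algebra_simps)

lemma isCont_eq_open:
 fixes f g :: "'a::t2_space => 'b::topological_space"
 assumes "open S" "x \<in> S" "isCont f x" "\<And>y. y \<in> S ==> g y = f y"
 shows "isCont g x"
proof -
 have "\<forall>\<^sub>F y in nhds x. g y = f y" using assms unfolding eventually_nhds by blast
 then show ?thesis using isCont_cong[of g f x] assms(3) by simp
qed

text \<open>An edge of positive length, the rest \<open>Rst\<close> of the boundary touching it at most at its end points,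
 and coordinates in which the edge is a graph over the axis \<open>i\<close>.\<close>

locale straight_edge =
 fixes E :: "pt set" and e :: seg and Rst :: "pt set" and i j :: 2
 assumes E: "open E" "bounded E" and Rst: "closed Rst"
  and fr: "frontier E \<subseteq> seg_set e \<union> Rst" and Re: "Rst \<inter> seg_set e \<subseteq> {fst e, snd e}"
  and ij: "i \<noteq> j" and di: "(snd e - fst e) $ i \<noteq> 0"
begin

abbreviation d where "d \<equiv> snd e - fst e"

definition N :: "pt => real" where "N x = x $ j - x $ i * (d $ j / d $ i)"

lemma N_linear: "bounded_linear N"
 unfolding N_def by (intro bounded_linear_sub bounded_linear_vec_nth bounded_linear_mult_const)

lemma N_edge: "x \<in> seg_set e ==> N x = N (fst e)"
proof -
 assume "x \<in> seg_set e"
 then obtain s where x: "x = seg_pt e s" using seg_set_pt by blast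
 show ?thesis using di unfolding x by (simp add: N_def seg_pt_components field_simps)
qed

lemma not_end: "0 < s ==> s < 1 ==> seg_pt e s \<notin> Rst"
proof
 assume s: "0 < s" "s < 1" and "seg_pt e s \<in> Rst"
 then have "seg_pt e s = fst e \<or> seg_pt e s = snd e" using Re seg_pt_in[of s e] by auto
 define D where "D = d $ i"
 have D: "snd e $ i = fst e $ i + D" by (simp add: D_def)
 have eq: "seg_pt e s $ i = fst e $ i + s * D" by (simp add: seg_pt_components D_def)
 from \<open>seg_pt e s = fst e \<or> seg_pt e s = snd e\<close> have "s * D = 0 \<or> s * D = D"
 proof
  assume "seg_pt e s = fst e" then show ?thesis using eq by simp
 next
  assume "seg_pt e s = snd e" then show ?thesis using eq D by simp
 qed
 moreover have "D \<noteq> 0" using di by (simp add: D_def)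
 ultimately show False using s by auto
qed

text \<open>A small rectangle on one side of the edge is connected and misses the frontier.\<close>

lemma locally_constant_side:
 assumes s: "0 < s" "s < 1" and \<tau>: "\<tau> = 1 \<or> \<tau> = (-1::real)"
 shows "\<exists>\<rho>>0. \<exists>\<kappa>. \<forall>s' y. \<bar>s' - s\<bar> < \<rho> \<longrightarrow> 0 < y \<longrightarrow> y < \<rho> \<longrightarrow> indicator E (seg_pt e s' + axis j (\<tau> * y)) = (\<kappa> :: real)"
proof -
 obtain r where r: "r > 0" "ball (seg_pt e s) r \<subseteq> - Rst"
  using Rst not_end[OF s] openE[of "- Rst" "seg_pt e s"] by (auto simp: open_Compl)
 define \<rho> where "\<rho> = r / (norm d + 2)"
 have n2: "norm d + 2 > 0" using norm_ge_zero[of d] by linarith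
 have \<rho>: "\<rho> > 0" using r n2 by (simp add: \<rho>_def)
 let ?g = "\<lambda>p. seg_pt e (fst p) + axis j (\<tau> * snd p)"
 let ?R = "{s - \<rho><..<s + \<rho>} \<times> {0<..<\<rho>}"
 have g': "?g p = fst e + fst p *\<^sub>R d + snd p *\<^sub>R (\<tau> *\<^sub>R ax j)" for p
  by (simp add: seg_pt_def vec_eq_iff axis_def)
 have "connected (?g ` ?R)" unfolding g'
  by (intro connected_continuous_image continuous_intros convex_connected convex_Times convex_real_interval)
 moreover have "?g ` ?R \<inter> frontier E = {}"
 proof -
  have False if p: "p \<in> ?R" and f: "?g p \<in> frontier E" for p
  proof -
   have "?g p - seg_pt e s = (fst p - s) *\<^sub>R d + (snd p * \<tau>) *\<^sub>R ax j"
    by (simp add: seg_pt_def vec_eq_iff axis_def algebra_simps)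
   also have "norm \<dots> \<le> \<bar>fst p - s\<bar> * norm d + \<bar>snd p * \<tau>\<bar>"
    by (rule order_trans[OF norm_triangle_ineq]) simp
   also have "\<bar>snd p * \<tau>\<bar> = snd p" using \<tau> p by auto
   also have "\<bar>fst p - s\<bar> * norm d + snd p < \<rho> * norm d + \<rho> * 2"
    using p \<rho> by (intro add_le_less_mono mult_right_mono) auto
   also have "\<dots> = \<rho> * (norm d + 2)" by (rule distrib_left[symmetric])
   also have "\<dots> = r" using n2 by (simp add: \<rho>_def)
   finally have "?g p \<in> ball (seg_pt e s) r" by (simp add: dist_norm norm_minus_commute)
   then have "?g p \<notin> Rst" using r by auto
   then have "?g p \<in> seg_set e" using f fr by auto
   from N_edge[OF this] have "N (?g p) = N (fst e)" .
   moreover have "N (?g p) = N (fst e) + \<tau> * snd p"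
    using di ij by (simp add: N_def seg_pt_components axis_def field_simps)
   ultimately show False using \<tau> p by auto
  qed
  then show ?thesis by blast
 qed
 ultimately have "?g ` ?R \<inter> E = {} \<or> ?g ` ?R \<subseteq> E" using connected_Int_frontier[of "?g ` ?R" E] by blast
 then have "\<exists>\<kappa>. \<forall>p\<in>?R. indicator E (?g p) = (\<kappa> :: real)"
 proof
  assume dj: "?g ` ?R \<inter> E = {}"
  have "?g p \<notin> E" if "p \<in> ?R" for p
   by (rule mp[OF spec[OF dj[unfolded disjoint_iff]] imageI[OF that]])
  then show ?thesis by (intro exI[of _ 0] ballI indicator_simps(2))
 next
  assume ss: "?g ` ?R \<subseteq> E"
  have "?g p \<in> E" if "p \<in> ?R" for p by (rule subsetD[OF ss imageI[OF that]])
  then show ?thesis by (intro exI[of _ 1] ballI indicator_simps(1))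
 qed
 then obtain \<kappa> where \<kappa>: "\<And>p. p \<in> ?R ==> indicator E (?g p) = (\<kappa> :: real)" by (elim exE) (rule that, rule bspec)
 have "indicator E (seg_pt e s' + axis j (\<tau> * y)) = \<kappa>" if "\<bar>s' - s\<bar> < \<rho>" "0 < y" "y < \<rho>" for s' y
  using \<kappa>[of "(s', y)"] that by (auto simp: abs_less_iff)
 with \<rho> show ?thesis by blast
qed

text \<open>Near each interior point of the edge, the set \<open>E\<close> either contains or misses the points on one fixed
 side. By connectedness of the edge the answer is the same along the whole edge.\<close>

lemma side:
 assumes \<tau>: "\<tau> = 1 \<or> \<tau> = (-1::real)"
 shows "\<exists>\<kappa>. \<forall>s. 0 < s \<longrightarrow> s < 1 \<longrightarrow> (\<exists>\<rho>>0. \<forall>y. 0 < y \<longrightarrow> y < \<rho> \<longrightarrow> indicator E (seg_pt e s + axis j (\<tau> * y)) = (\<kappa> :: real))"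
proof -
 let ?P = "\<lambda>\<kappa> s. \<exists>\<rho>>0. \<forall>y. 0 < y \<longrightarrow> y < \<rho> \<longrightarrow> indicator E (seg_pt e s + axis j (\<tau> * y)) = (\<kappa> :: real)"
 have "\<exists>\<rho>>0. \<exists>\<kappa>. \<forall>s'. \<bar>s' - s\<bar> < \<rho> \<longrightarrow> ?P \<kappa> s'" if "0 < s" "s < 1" for s
  using locally_constant_side[OF that \<tau>] by meson
 then have loc: "\<exists>\<kappa>. \<exists>\<rho>>0. \<forall>s'. \<bar>s' - s\<bar> < \<rho> \<longrightarrow> ?P \<kappa> s'" if "0 < s" "s < 1" for s using that by blast
 have uniq: "\<kappa> = \<kappa>'" if P: "?P \<kappa> s" "?P \<kappa>' s" for \<kappa> \<kappa>' s
 proof -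
  obtain r1 r2 where r: "r1 > 0" "r2 > 0" "\<And>y. 0 < y ==> y < r1 ==> indicator E (seg_pt e s + axis j (\<tau> * y)) = \<kappa>"
   "\<And>y. 0 < y ==> y < r2 ==> indicator E (seg_pt e s + axis j (\<tau> * y)) = \<kappa>'" using P by blast
  define y where "y = min r1 r2 / 2"
  have "0 < y" "y < r1" "y < r2" using r(1,2) by (auto simp: y_def min_def)
  then show ?thesis using r(3)[of y] r(4)[of y] by simp
 qed
 define K where "K s = (SOME \<kappa>. ?P \<kappa> s)" for s
 have K: "?P (K s) s" if "0 < s" "s < 1" for s
 proof -
  obtain \<kappa> \<rho> where "\<rho> > 0" "\<forall>s'. \<bar>s' - s\<bar> < \<rho> \<longrightarrow> ?P \<kappa> s'" using loc[OF \<open>0 < s\<close> \<open>s < 1\<close>] by blast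
  then have "?P \<kappa> s" by simp
  then show ?thesis unfolding K_def by (rule someI)
 qed
 have "\<exists>c. \<forall>s\<in>{0<..<1}. K s = c"
 proof -
  have "K constant_on {0<..<1::real}"
  proof (rule locally_constant_imp_constant[of _ K])
   show "connected {0<..<1::real}" by simp
   fix s :: real assume s: "s \<in> {0<..<1}"
   then obtain \<kappa> \<rho> where r: "\<rho> > 0" "\<And>s'. \<bar>s' - s\<bar> < \<rho> ==> ?P \<kappa> s'" using loc[of s] by auto
   let ?U = "{0<..<1} \<inter> ball s \<rho>"
   have KU: "K x = K s" if "x \<in> ?U" for x
   proof -
    have "?P \<kappa> x" "?P \<kappa> s" using that r by (auto simp: dist_real_def abs_minus_commute)
    moreover have "?P (K x) x" "?P (K s) s" using K[of x] K[of s] that s by auto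
    ultimately show ?thesis using uniq by metis
   qed
   have "openin (top_of_set {0<..<1}) ?U" by (rule openin_open_Int[OF open_ball])
   moreover have "s \<in> ?U" using s r(1) by simp
   ultimately show "\<exists>T. openin (top_of_set {0<..<1}) T \<and> s \<in> T \<and> (\<forall>x\<in>T. K x = K s)"
    using KU by (intro exI[of _ ?U] conjI ballI)
  qed
  then show ?thesis by (auto simp: constant_on_def)
 qed
 then obtain c where c: "\<And>s. 0 < s ==> s < 1 ==> K s = c" by auto
 have "\<forall>s. 0 < s \<longrightarrow> s < 1 \<longrightarrow> ?P c s" using K c by metis
 then show ?thesis by (rule exI)
qed

lemma side_limit:
 assumes "\<forall>s. 0 < s \<longrightarrow> s < 1 \<longrightarrow> (\<exists>\<rho>>0. \<forall>y. 0 < y \<longrightarrow> y < \<rho> \<longrightarrow> indicator E (seg_pt e s + axis j (\<tau> * y)) = (\<kappa> :: real))"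
  and s: "0 < s" "s < 1" and y: "\<tau> * y > 0" and \<tau>: "\<tau> = 1 \<or> \<tau> = (-1::real)"
  and f: "isCont f (seg_pt e s)" and \<epsilon>: "\<And>n. \<epsilon> n > 0" "\<epsilon> \<longlonglongrightarrow> 0"
 shows "(\<lambda>n. indicator E (seg_pt e s + axis j (\<epsilon> n * y)) * f (seg_pt e s + axis j (\<epsilon> n * y))) \<longlonglongrightarrow> \<kappa> * f (seg_pt e s)"
proof -
 obtain \<rho> where \<rho>: "\<rho> > 0" "\<And>y. 0 < y ==> y < \<rho> ==> indicator E (seg_pt e s + axis j (\<tau> * y)) = \<kappa>"
  using assms(1) s by blast
 have t: "(\<lambda>n. \<epsilon> n * (\<tau> * y)) \<longlonglongrightarrow> 0" using tendsto_mult_left_zero[OF \<epsilon>(2)] .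
 have ev: "\<forall>\<^sub>F n in sequentially. indicator E (seg_pt e s + axis j (\<epsilon> n * y)) = \<kappa>"
  using order_tendstoD(2)[OF t \<rho>(1)]
 proof eventually_elim
  case (elim n)
  have "indicator E (seg_pt e s + axis j (\<tau> * (\<epsilon> n * (\<tau> * y)))) = \<kappa>"
   by (rule \<rho>(2)) (use elim \<epsilon>(1) y in auto)
  moreover have "\<tau> * (\<epsilon> n * (\<tau> * y)) = \<epsilon> n * y" using \<tau> by auto
  ultimately show ?case by simp
 qed
 have "(\<lambda>n. seg_pt e s + (\<epsilon> n * y) *\<^sub>R ax j) \<longlonglongrightarrow> seg_pt e s + (0 * y) *\<^sub>R ax j"
  by (intro tendsto_intros \<epsilon>(2))
 moreover have "(\<epsilon> n * y) *\<^sub>R ax j = axis j (\<epsilon> n * y)" for n by (simp add: vec_eq_iff axis_def)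
 ultimately have "(\<lambda>n. seg_pt e s + axis j (\<epsilon> n * y)) \<longlonglongrightarrow> seg_pt e s" by simp
 from isCont_tendsto_compose[OF f this]
 have "(\<lambda>n. \<kappa> * f (seg_pt e s + axis j (\<epsilon> n * y))) \<longlonglongrightarrow> \<kappa> * f (seg_pt e s)" by (intro tendsto_intros)
 then show ?thesis by (rule Lim_transform_eventually) (use ev in eventually_elim, simp)
qed

text \<open>The mass that \<open>plateau'\<close> carries on the two half lines turns the limits of \<open>Z\<close> from the two
 sides into their difference.\<close>

lemma half_line_limit:
 fixes Z :: "real => real"
 assumes Z: "Z \<in> borel_measurable borel" "\<And>y. \<bar>Z y\<bar> \<le> B"
  and p: "\<And>y. y > 0 ==> (\<lambda>n. Z (\<epsilon> n * y)) \<longlonglongrightarrow> Zp"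
  and m: "\<And>y. y < 0 ==> (\<lambda>n. Z (\<epsilon> n * y)) \<longlonglongrightarrow> Zm"
 shows "(\<lambda>n. \<integral>y. Z (\<epsilon> n * y) * plateau' y \<partial>lborel) \<longlonglongrightarrow> Zm - Zp"
proof -
 have pm: "plateau' \<in> borel_measurable borel" using borel_measurable_integrable[OF plateau'_integrable] by simp
 let ?w = "\<lambda>y. Zp * (indicator {0..} y * plateau' y) + Zm * (indicator {..<0} y * plateau' y)"
 have i: "integrable lborel (\<lambda>y. indicator {0..} y * plateau' y)" "integrable lborel (\<lambda>y. indicator {..<0} y * plateau' y)"
  using integrable_mult_indicator[OF _ plateau'_integrable, of "{0..}"] integrable_mult_indicator[OF _ plateau'_integrable, of "{..<0}"]
  by simp_all
 have "(\<lambda>n. \<integral>y. Z (\<epsilon> n * y) * plateau' y \<partial>lborel) \<longlonglongrightarrow> (\<integral>y. ?w y \<partial>lborel)"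
 proof (rule integral_dominated_convergence[where w="\<lambda>y. B * \<bar>plateau' y\<bar>"])
  show "?w \<in> borel_measurable lborel" using pm by measurable
  show "(\<lambda>y. Z (\<epsilon> n * y) * plateau' y) \<in> borel_measurable lborel" for n using pm Z(1) by measurable
  show "integrable lborel (\<lambda>y. B * \<bar>plateau' y\<bar>)" using plateau'_integrable by simp
  show "AE y in lborel. norm (Z (\<epsilon> n * y) * plateau' y) \<le> B * \<bar>plateau' y\<bar>" for n
   using Z(2) by (intro AE_I2) (simp add: abs_mult mult_right_mono)
  show "AE y in lborel. (\<lambda>n. Z (\<epsilon> n * y) * plateau' y) \<longlonglongrightarrow> ?w y"
   using AE_lborel_singleton[of 0]
  proof eventually_elim
   case (elim y)
   then consider "y > 0" | "y < 0" by linarith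
   then show ?case
   proof cases
    case 1
    then show ?thesis using tendsto_mult_right[OF p[OF 1], of "plateau' y"] by (simp add: indicator_def)
   next
    case 2
    then show ?thesis using tendsto_mult_right[OF m[OF 2], of "plateau' y"] by (simp add: indicator_def)
   qed
  qed
 qed
 also have "(\<integral>y. ?w y \<partial>lborel) = Zm - Zp"
  using i by (simp add: plateau'_half_integrals)
 finally show ?thesis .
qed

text \<open>The cut-off field vanishes near the line through the edge, so its support misses the frontier of \<open>E\<close>
 and the integral of its divergence over \<open>E\<close> vanishes. The product rule leaves the term in which the
 cutoff is differentiated.\<close>

lemma cutoff_divergence:
 fixes v :: "pt => pt"
 assumes v: "\<And>l. smooth (\<lambda>x. v x $ l)" and \<phi>: "\<phi> \<in> test_functions UNIV"
  and d: "supp \<phi> \<inter> frontier E \<subseteq> seg_set e" and \<epsilon>: "\<epsilon> > 0"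
 defines "F \<equiv> (\<lambda>x. \<Sum>l\<in>UNIV. pd (ax l) (\<lambda>x. v x $ l * \<phi> x) x)"
 shows "(\<integral>x. indicator E x * ((1 - plateau ((N x - N (fst e)) / \<epsilon>)) * F x) \<partial>lborel)
  = (\<integral>x. indicator E x * (N (v x) * \<phi> x) * (plateau' ((N x - N (fst e)) / \<epsilon>) / \<epsilon>) \<partial>lborel)"
proof -
 let ?A = "\<lambda>x. (1 / \<epsilon>) * N x + (- N (fst e) / \<epsilon>)"
 have A: "?A x = (N x - N (fst e)) / \<epsilon>" for x by (simp add: diff_divide_distrib)
 have L: "bounded_linear (\<lambda>x. (1 / \<epsilon>) * N x)" by (intro bounded_linear_const_mult N_linear)
 define \<eta> where "\<eta> x = 1 + (-1) * plateau (?A x)" for x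
 have sP: "smooth (\<lambda>x. plateau (?A x))" by (rule smooth_compose_affine[OF L smooth_plateau])
 have s\<eta>: "smooth \<eta>" unfolding \<eta>_def[abs_def] by (intro smooth_add smooth_const smooth_cmult sP)
 have pd\<eta>: "pd b \<eta> x = - (plateau' (?A x) / \<epsilon>) * N b" for b x
 proof -
  have "pd b \<eta> x = - pd b (\<lambda>x. plateau (?A x)) x"
   unfolding \<eta>_def[abs_def] by (simp only: pd_add[OF smooth_const smooth_cmult[OF sP]] pd_cmult[OF sP] pd_const; simp?)
  also have "pd b (\<lambda>x. plateau (?A x)) x = pd ((1 / \<epsilon>) * N b) plateau (?A x)"
   by (rule pd_compose_affine(1)[OF L smooth_differentiable[OF smooth_plateau]])
  also have "\<dots> = ((1 / \<epsilon>) * N b) * plateau' (?A x)"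
   using linear_cmul[OF smooth_pd_linear[OF smooth_plateau], of "(1 / \<epsilon>) * N b" 1 "?A x"] by simp
  finally show ?thesis by simp
 qed
 have s\<phi>: "smooth \<phi>" by (rule test_smooth[OF \<phi>])
 have sv\<phi>: "smooth (\<lambda>x. v x $ l * \<phi> x)" for l by (intro smooth_mult v s\<phi>)
 define w where "w l = (\<lambda>x. \<eta> x * (v x $ l * \<phi> x))" for l
 have wt: "w l \<in> test_functions UNIV" for l
  unfolding w_def using test_mult_smooth[OF \<phi> smooth_mult[OF s\<eta> v]] by (simp add: mult.assoc)
 have wd: "supp (w l) \<inter> frontier E = {}" for l
 proof -
  have "w l x = 0" if "x \<notin> supp \<phi> \<inter> {x. \<epsilon> / 2 \<le> \<bar>N x - N (fst e)\<bar>}" for x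
  proof (cases "x \<in> supp \<phi>")
   case True
   then have "\<bar>N x - N (fst e)\<bar> < \<epsilon> / 2" using that by auto
   then have "\<bar>?A x\<bar> \<le> 1 / 2" unfolding A using \<epsilon> by (simp add: field_simps)
   then show ?thesis by (simp only: w_def \<eta>_def plateau_one; simp?)
  qed (simp add: w_def not_in_supp)
  moreover have "closed (supp \<phi> \<inter> {x. \<epsilon> / 2 \<le> \<bar>N x - N (fst e)\<bar>})"
   by (intro closed_Int supp_closed closed_Collect_le continuous_intros linear_continuous_on N_linear)
  ultimately have "supp (w l) \<subseteq> supp \<phi> \<inter> {x. \<epsilon> / 2 \<le> \<bar>N x - N (fst e)\<bar>}" by (rule supp_subset)
  moreover have "N x = N (fst e)" if "x \<in> supp \<phi>" "x \<in> frontier E" for x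
   using d that by (intro N_edge) auto
  ultimately show ?thesis using \<epsilon> by fastforce
 qed
 note r = restrict_test_function[OF E(1) wt wd]
 have z: "(\<integral>x. indicator E x * pd (ax l) (w l) x \<partial>lborel) = 0" for l
 proof -
  have "(\<integral>x. indicator E x * pd (ax l) (w l) x \<partial>lborel) = (\<integral>x. pd (ax l) (\<lambda>x. if x \<in> E then w l x else 0) x \<partial>lborel)"
  proof (rule Bochner_Integration.integral_cong[OF refl])
   fix x
   show "indicator E x * pd (ax l) (w l) x = pd (ax l) (\<lambda>x. if x \<in> E then w l x else 0) x"
   proof (cases "x \<in> E")
    case False
    then have "x \<notin> supp (\<lambda>x. if x \<in> E then w l x else 0)" using test_supp[OF r(1)[of l]] by blast
    then show ?thesis using False by (simp add: pd_outside_supp)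
   qed (simp add: r(2))
  qed
  also have "\<dots> = 0" by (rule integral_pd_test[OF r(1) ax_Basis])
  finally show ?thesis .
 qed
 have pdw: "(\<Sum>l\<in>UNIV. pd (ax l) (w l) x) = \<eta> x * F x - (plateau' (?A x) / \<epsilon>) * (N (v x) * \<phi> x)" for x
 proof -
  have Nv: "N (v x) = (\<Sum>l\<in>UNIV. v x $ l * N (ax l))"
  proof -
   have "v x = (\<Sum>l\<in>UNIV. (v x $ l) *\<^sub>R ax l)" by (simp add: vec_eq_iff axis_def if_distrib cong: if_cong)
   then have "N (v x) = N (\<Sum>l\<in>UNIV. (v x $ l) *\<^sub>R ax l)" by simp
   also have "\<dots> = (\<Sum>l\<in>UNIV. v x $ l * N (ax l))"
    using bounded_linear.linear[OF N_linear] by (simp add: linear_sum linear_cmul)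
   finally show ?thesis .
  qed
  have pw: "pd (ax l) (w l) x = \<eta> x * pd (ax l) (\<lambda>x. v x $ l * \<phi> x) x + - (plateau' (?A x) / \<epsilon>) * N (ax l) * (v x $ l * \<phi> x)" for l
   unfolding w_def by (subst pd_mult[OF smooth_differentiable[OF s\<eta>] smooth_differentiable[OF sv\<phi>]]) (simp only: pd\<eta>)
  have sum2: "sum f UNIV = f i + f j" for f :: "2 => real" unfolding UNIV_pair[OF ij] using ij by simp
  have alg: "(h * ai + - c * Ni * (vi * f)) + (h * aj + - c * Nj * (vj * f)) = h * (ai + aj) - c * ((vi * Ni + vj * Nj) * f)"
   for h ai aj c Ni Nj vi vj f :: real by (simp add: algebra_simps)
  show ?thesis unfolding F_def Nv sum2 pw by (rule alg)
 qed
 have ti: "integrable lborel (\<lambda>x. indicator E x * pd (ax l) (w l) x)" for l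
 proof -
  have "integrable lborel (\<lambda>x. indicator E x *\<^sub>R pd (ax l) (w l) x)"
   using E by (intro integrable_mult_indicator test_integrable[OF test_pd[OF wt ax_Basis]]) simp
  then show ?thesis by simp
 qed
 have Ft: "F \<in> test_functions UNIV"
 proof -
  have "(\<lambda>x. v x $ l * \<phi> x) \<in> test_functions UNIV" for l by (rule test_mult_smooth[OF \<phi> v])
  then have t: "pd (ax l) (\<lambda>x. v x $ l * \<phi> x) \<in> test_functions UNIV" for l by (rule test_pd) simp
  show ?thesis unfolding F_def UNIV_pair[OF ij] using ij by (simp add: test_add t)
 qed
 have i1: "integrable lborel (\<lambda>x. indicator E x * (\<eta> x * F x))"
  using integrable_mult_indicator[OF _ test_integrable[OF test_mult_smooth[OF Ft s\<eta>]], of E] E by simp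
 have sp': "smooth (\<lambda>x. plateau' (?A x) / \<epsilon>)"
  using smooth_cmult[OF smooth_compose_affine[OF L plateau'_smooth, of "- N (fst e) / \<epsilon>"], of "1 / \<epsilon>"] by simp
 have sNv: "smooth (\<lambda>x. N (v x))" unfolding N_def
  using smooth_diff[OF v smooth_cmult[OF v, of "d $ j / d $ i"]] by (simp add: mult.commute)
 have i2: "integrable lborel (\<lambda>x. indicator E x * ((plateau' (?A x) / \<epsilon>) * (N (v x) * \<phi> x)))"
  using integrable_mult_indicator[OF _ test_integrable[OF test_mult_smooth[OF test_mult_smooth[OF \<phi> sNv] sp']], of E] E by simp
 have "0 = (\<Sum>l\<in>UNIV. (\<integral>x. indicator E x * pd (ax l) (w l) x \<partial>lborel))" by (simp add: z)
 also have "\<dots> = (\<integral>x. indicator E x * (\<Sum>l\<in>UNIV. pd (ax l) (w l) x) \<partial>lborel)"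
  unfolding sum_distrib_left by (rule Bochner_Integration.integral_sum[symmetric]) (rule ti)
 also have "\<dots> = (\<integral>x. indicator E x * (\<eta> x * F x) - indicator E x * ((plateau' (?A x) / \<epsilon>) * (N (v x) * \<phi> x)) \<partial>lborel)"
  unfolding pdw right_diff_distrib ..
 also have "\<dots> = (\<integral>x. indicator E x * (\<eta> x * F x) \<partial>lborel) - (\<integral>x. indicator E x * ((plateau' (?A x) / \<epsilon>) * (N (v x) * \<phi> x)) \<partial>lborel)"
  by (rule Bochner_Integration.integral_diff[OF i1 i2])
 finally have "(\<integral>x. indicator E x * (\<eta> x * F x) \<partial>lborel) = (\<integral>x. indicator E x * ((plateau' (?A x) / \<epsilon>) * (N (v x) * \<phi> x)) \<partial>lborel)" by simp
 moreover have "indicator E x * (\<eta> x * F x) = indicator E x * ((1 - plateau ((N x - N (fst e)) / \<epsilon>)) * F x)" for x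
  unfolding \<eta>_def A by simp
 moreover have "indicator E x * ((plateau' (?A x) / \<epsilon>) * (N (v x) * \<phi> x)) = indicator E x * (N (v x) * \<phi> x) * (plateau' ((N x - N (fst e)) / \<epsilon>) / \<epsilon>)" for x
  unfolding A by (simp only: mult_ac)
 ultimately show ?thesis by (simp only:)
qed

lemma N_axis: "N (axis i a + axis j b) = b - a * (d $ j / d $ i)"
 using ij by (simp add: N_def axis_def)

lemma edge_line:
 fixes a :: real
 defines "\<sigma> \<equiv> (a - fst e $ i) / d $ i"
 shows "axis i a + axis j (N (fst e) + a * (d $ j / d $ i) + y) = seg_pt e \<sigma> + axis j y"
proof -
 have "(axis i a + axis j (N (fst e) + a * (d $ j / d $ i) + y)) $ k = (seg_pt e \<sigma> + axis j y) $ k" for k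
 proof -
  have "k = i \<or> k = j" using UNIV_pair[OF ij] by blast
  then show ?thesis
  proof
   assume k: "k = i"
   have "\<sigma> * d $ i = a - fst e $ i" using di by (simp add: \<sigma>_def)
   then show ?thesis using ij unfolding k by (simp add: axis_def seg_pt_components)
  next
   assume k: "k = j"
   have "\<sigma> * d $ j = (a - fst e $ i) * (d $ j / d $ i)" by (simp add: \<sigma>_def)
   also have "\<dots> = a * (d $ j / d $ i) - fst e $ i * (d $ j / d $ i)" by (rule left_diff_distrib)
   finally show ?thesis using ij unfolding k by (simp add: axis_def seg_pt_components N_def)
  qed
 qed
 then show ?thesis by (simp add: vec_eq_iff)
qed

lemma seg_pt_continuous: "continuous_on A (seg_pt e)"
 unfolding seg_pt_def by (intro continuous_intros)

text \<open>As the width of the cutoff tends to zero, the divergence of the cut-off field becomes that of the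
 field, and the layer around the edge contributes a line integral weighted by the jump of the
 indicator of \<open>E\<close> across the edge. Since \<open>N\<close> is a multiple of the normal component, the constant
 \<open>\<kappa>\<close> absorbs both the jump, whichever sides of the edge belong to \<open>E\<close>, and the normalisation.\<close>

theorem green_at_edge:
 fixes v :: "pt => pt"
 assumes v: "\<And>l. smooth (\<lambda>x. v x $ l)"
 shows "\<exists>\<kappa>. \<forall>\<phi>\<in>test_functions UNIV. supp \<phi> \<inter> closure (frontier E - seg_set e) = {} \<longrightarrow>
  (\<integral>x. indicator E x * (\<Sum>l\<in>UNIV. pd (ax l) (\<lambda>x. v x $ l * \<phi> x) x) \<partial>lborel) = seg_integral e (\<lambda>x. \<kappa> * N (v x) * \<phi> x)"
proof -
 obtain \<kappa>p where \<kappa>p: "\<forall>s. 0 < s \<longrightarrow> s < 1 \<longrightarrow> (\<exists>\<rho>>0. \<forall>y. 0 < y \<longrightarrow> y < \<rho> \<longrightarrow> indicator E (seg_pt e s + axis j (1 * y)) = (\<kappa>p :: real))"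
  using side[of 1] by blast
 obtain \<kappa>m where \<kappa>m: "\<forall>s. 0 < s \<longrightarrow> s < 1 \<longrightarrow> (\<exists>\<rho>>0. \<forall>y. 0 < y \<longrightarrow> y < \<rho> \<longrightarrow> indicator E (seg_pt e s + axis j (-1 * y)) = (\<kappa>m :: real))"
  using side[of "-1"] by blast
 \<comment> \<open>jump of the indicator across the edge, times the ratio of the length elements \<open>dx\<^sub>i\<close> and \<open>ds\<close>\<close>
 define \<kappa> where "\<kappa> = (\<kappa>m - \<kappa>p) * \<bar>d $ i\<bar> / seg_length e"
 have len: "seg_length e \<noteq> 0" using di by (auto simp: seg_length_def)
 define \<epsilon> where "\<epsilon> n = inverse (real (Suc n))" for n
 have \<epsilon>: "\<epsilon> n > 0" for n by (simp add: \<epsilon>_def)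
 have \<epsilon>0: "\<epsilon> \<longlonglongrightarrow> 0" unfolding \<epsilon>_def by (rule LIMSEQ_inverse_real_of_nat)
 have [measurable]: "E \<in> sets borel" using E by simp
 have "(\<integral>x. indicator E x * (\<Sum>l\<in>UNIV. pd (ax l) (\<lambda>x. v x $ l * \<phi> x) x) \<partial>lborel) = seg_integral e (\<lambda>x. \<kappa> * N (v x) * \<phi> x)"
  if \<phi>: "\<phi> \<in> test_functions UNIV" and dis: "supp \<phi> \<inter> closure (frontier E - seg_set e) = {}" for \<phi>
 proof -
  define F where "F x = (\<Sum>l\<in>UNIV. pd (ax l) (\<lambda>x. v x $ l * \<phi> x) x)" for x
  define f where "f x = N (v x) * \<phi> x" for x
  define Z where "Z x = indicator E x * f x" for x
  have fr': "x \<in> seg_set e" if "x \<in> supp \<phi>" "x \<in> frontier E" for x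
   using dis that closure_subset[of "frontier E - seg_set e"] by blast
  have sNv: "smooth (\<lambda>x. N (v x))" unfolding N_def
   using smooth_diff[OF v smooth_cmult[OF v, of "d $ j / d $ i"]] by (simp add: mult.commute)
  have ft: "f \<in> test_functions UNIV" unfolding f_def by (rule test_mult_smooth[OF \<phi> sNv])
  have Ft: "F \<in> test_functions UNIV"
  proof -
   have "(\<lambda>x. v x $ l * \<phi> x) \<in> test_functions UNIV" for l by (rule test_mult_smooth[OF \<phi> v])
   then have t: "pd (ax l) (\<lambda>x. v x $ l * \<phi> x) \<in> test_functions UNIV" for l by (rule test_pd) simp
   show ?thesis unfolding F_def[abs_def] UNIV_pair[OF ij] using ij by (simp add: test_add t)
  qed
  have [measurable]: "f \<in> borel_measurable borel" "F \<in> borel_measurable borel" "plateau' \<in> borel_measurable borel"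
   "plateau \<in> borel_measurable borel" "N \<in> borel_measurable borel"
   by (rule test_borel[OF ft], rule test_borel[OF Ft],
     rule borel_measurable_continuous_onI[OF smooth_continuous[OF plateau'_smooth]],
     rule borel_measurable_continuous_onI[OF smooth_continuous[OF smooth_plateau]],
     rule borel_measurable_continuous_onI[OF linear_continuous_on[OF N_linear]])
  have [measurable]: "Z \<in> borel_measurable borel" unfolding Z_def by measurable
  have fc: "isCont f x" for x
   using smooth_continuous[OF test_smooth[OF ft], of UNIV] by (simp add: continuous_on_eq_continuous_within)
  obtain B where B: "B > 0" "\<And>x. \<bar>f x\<bar> \<le> B" using test_bounded[OF ft] by blast
  have ZB: "\<bar>Z x\<bar> \<le> B" for x using B(2)[of x] B(1) by (simp add: Z_def indicator_def)
  obtain R where R: "\<And>x. x \<in> supp \<phi> ==> norm x \<le> R"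
   using compact_imp_bounded[OF test_compact[OF \<phi>]] unfolding bounded_iff by blast
  have ZR: "Z x = 0" if "\<bar>x $ i\<bar> > R" for x
  proof -
   have "x \<notin> supp \<phi>" using R[of x] that component_le_norm_cart[of x i] by linarith
   then show ?thesis by (simp add: Z_def f_def not_in_supp)
  qed
  \<comment> \<open>away from the line through the edge the cutoff tends to one\<close>
  have L: "(\<lambda>n. \<integral>x. indicator E x * ((1 - plateau ((N x - N (fst e)) / \<epsilon> n)) * F x) \<partial>lborel) \<longlonglongrightarrow> (\<integral>x. indicator E x * F x \<partial>lborel)"
  proof (rule integral_dominated_convergence[where w="\<lambda>x. \<bar>F x\<bar>"])
   show "(\<lambda>x. indicator E x * F x) \<in> borel_measurable lborel"
    "\<And>n. (\<lambda>x. indicator E x * ((1 - plateau ((N x - N (fst e)) / \<epsilon> n)) * F x)) \<in> borel_measurable lborel" by measurable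
   show "integrable lborel (\<lambda>x. \<bar>F x\<bar>)" using test_integrable[OF Ft] by simp
   show "AE x in lborel. norm (indicator E x * ((1 - plateau ((N x - N (fst e)) / \<epsilon> n)) * F x)) \<le> \<bar>F x\<bar>" for n
   proof (rule AE_I2)
    fix x
    have "\<bar>1 - plateau ((N x - N (fst e)) / \<epsilon> n)\<bar> \<le> 1" using plateau_bounds[of "(N x - N (fst e)) / \<epsilon> n"] by linarith
    then have "\<bar>1 - plateau ((N x - N (fst e)) / \<epsilon> n)\<bar> * \<bar>F x\<bar> \<le> 1 * \<bar>F x\<bar>" by (intro mult_right_mono) auto
    then show "norm (indicator E x * ((1 - plateau ((N x - N (fst e)) / \<epsilon> n)) * F x)) \<le> \<bar>F x\<bar>"
     by (simp add: abs_mult indicator_def)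
   qed
   define u where "u = ax j - (d $ j / d $ i) *\<^sub>R ax i"
   have u: "N x = u \<bullet> x" for x by (simp add: u_def N_def inner_diff_left inner_axis')
   have "u $ j \<noteq> 0" using ij by (simp add: u_def axis_def)
   then have "u \<noteq> 0" by auto
   then have "negligible {x. u \<bullet> x = N (fst e)}" by (intro negligible_hyperplane) simp
   then have "AE x in lebesgue. x \<notin> {x. u \<bullet> x = N (fst e)}" unfolding negligible_iff_null_sets by (rule AE_not_in)
   then have "AE x in lborel. N x \<noteq> N (fst e)" unfolding AE_completion_iff u by simp
   then show "AE x in lborel. (\<lambda>n. indicator E x * ((1 - plateau ((N x - N (fst e)) / \<epsilon> n)) * F x)) \<longlonglongrightarrow> indicator E x * F x"
   proof eventually_elim
    case (elim x)
    have "\<forall>\<^sub>F n in sequentially. \<epsilon> n < \<bar>N x - N (fst e)\<bar>" using elim by (intro order_tendstoD(2)[OF \<epsilon>0]) auto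
    then have "\<forall>\<^sub>F n in sequentially. indicator E x * ((1 - plateau ((N x - N (fst e)) / \<epsilon> n)) * F x) = indicator E x * F x"
    proof eventually_elim
     case (elim n)
     then have "1 \<le> \<bar>(N x - N (fst e)) / \<epsilon> n\<bar>" using \<epsilon>[of n] by (simp add: field_simps)
     then show ?case by (simp only: plateau_zero; simp?)
    qed
    then show ?case by (rule tendsto_eventually)
   qed
  qed
  define c where "c a = N (fst e) + a * (d $ j / d $ i)" for a
  define J where "J n a = (\<integral>y. Z (axis i a + axis j (c a + \<epsilon> n * y)) * plateau' y \<partial>lborel)" for n a
  have RJ: "(\<integral>x. indicator E x * (N (v x) * \<phi> x) * (plateau' ((N x - N (fst e)) / \<epsilon> n) / \<epsilon> n) \<partial>lborel) = (\<integral>a. J n a \<partial>lborel)" for n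
  proof -
   let ?g = "\<lambda>x. Z x * (plateau' ((N x - N (fst e)) / \<epsilon> n) / \<epsilon> n)"
   have sp': "smooth (\<lambda>x. plateau' ((N x - N (fst e)) / \<epsilon> n) / \<epsilon> n)"
    using smooth_cmult[OF smooth_compose_affine[OF bounded_linear_const_mult[OF N_linear, of "1 / \<epsilon> n"] plateau'_smooth, of "- N (fst e) / \<epsilon> n"], of "1 / \<epsilon> n"]
    by (simp add: diff_divide_distrib)
   have "integrable lborel (\<lambda>x. indicator E x *\<^sub>R (plateau' ((N x - N (fst e)) / \<epsilon> n) / \<epsilon> n * f x))"
    by (intro integrable_mult_indicator test_integrable[OF test_mult_smooth[OF ft sp']]) simp
   then have gi: "integrable lborel ?g" by (simp add: Z_def mult_ac)
   have "(\<integral>x. indicator E x * (N (v x) * \<phi> x) * (plateau' ((N x - N (fst e)) / \<epsilon> n) / \<epsilon> n) \<partial>lborel) = (\<integral>x. ?g x \<partial>lborel)"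
    by (simp add: Z_def f_def)
   also have "\<dots> = (\<integral>a. (\<integral>b. ?g (axis i a + axis j b) \<partial>lborel) \<partial>lborel)"
    by (rule integral_pt_iterated[OF ij gi]) measurable
   also have "\<dots> = (\<integral>a. J n a \<partial>lborel)"
   proof (intro Bochner_Integration.integral_cong refl)
    fix a
    have "(\<integral>b. ?g (axis i a + axis j b) \<partial>lborel) = \<bar>\<epsilon> n\<bar> *\<^sub>R (\<integral>y. ?g (axis i a + axis j (c a + \<epsilon> n * y)) \<partial>lborel)"
     by (rule lborel_integral_real_affine) (use \<epsilon>[of n] in simp)
    also have "\<dots> = (\<integral>y. \<bar>\<epsilon> n\<bar> * ?g (axis i a + axis j (c a + \<epsilon> n * y)) \<partial>lborel)"
     by (simp only: integral_mult_right_zero real_scaleR_def)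
    also have "\<dots> = J n a" unfolding J_def
    proof (intro Bochner_Integration.integral_cong refl)
     fix y
     have "N (axis i a + axis j (c a + \<epsilon> n * y)) - N (fst e) = \<epsilon> n * y" by (simp add: N_axis c_def)
     then show "\<bar>\<epsilon> n\<bar> * ?g (axis i a + axis j (c a + \<epsilon> n * y)) = Z (axis i a + axis j (c a + \<epsilon> n * y)) * plateau' y"
      using \<epsilon>[of n] by simp
    qed
    finally show "(\<integral>b. ?g (axis i a + axis j b) \<partial>lborel) = J n a" .
   qed
   finally show ?thesis .
  qed
  define h where "h a = indicator {0<..<1} ((a - fst e $ i) / d $ i) * ((\<kappa>m - \<kappa>p) * f (seg_pt e ((a - fst e $ i) / d $ i)))" for a
  have [measurable]: "seg_pt e \<in> borel_measurable borel" by (rule borel_measurable_continuous_onI[OF seg_pt_continuous])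
  have lim: "(\<lambda>n. J n a) \<longlonglongrightarrow> h a" if a: "(a - fst e $ i) / d $ i \<noteq> 0" "(a - fst e $ i) / d $ i \<noteq> 1" for a
  proof -
   define s where "s = (a - fst e $ i) / d $ i"
   let ?p = "seg_pt e s"
   have line: "axis i a + axis j (c a + y) = ?p + axis j y" for y
    unfolding c_def s_def by (rule edge_line)
   have Jl: "J n a = (\<integral>y. (\<lambda>y. Z (?p + axis j y)) (\<epsilon> n * y) * plateau' y \<partial>lborel)" for n
    by (simp add: J_def line)
   have hs: "h a = indicator {0<..<1} s * ((\<kappa>m - \<kappa>p) * f ?p)" unfolding h_def s_def ..
   have sn: "s \<noteq> 0" "s \<noteq> 1" unfolding s_def by (rule a)+
   have ax0: "axis j (0::real) = 0" by (simp add: vec_eq_iff axis_def)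
   have axs: "y *\<^sub>R ax j = axis j y" for y :: real by (simp add: vec_eq_iff axis_def)
   have "(\<lambda>y. Z (?p + y *\<^sub>R ax j)) \<in> borel_measurable borel" by measurable
   then have Zm: "(\<lambda>y. Z (?p + axis j y)) \<in> borel_measurable borel" by (simp only: axs)
   show ?thesis
   proof (cases "0 < s \<and> s < 1")
    case True
    have "(\<lambda>n. \<integral>y. (\<lambda>y. Z (?p + axis j y)) (\<epsilon> n * y) * plateau' y \<partial>lborel) \<longlonglongrightarrow> \<kappa>m * f ?p - \<kappa>p * f ?p"
    proof (rule half_line_limit[OF Zm ZB])
     show "(\<lambda>n. Z (?p + axis j (\<epsilon> n * y))) \<longlonglongrightarrow> \<kappa>p * f ?p" if "y > 0" for y
      unfolding Z_def by (rule side_limit[OF \<kappa>p _ _ _ _ fc \<epsilon> \<epsilon>0]) (use True that in auto)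
     show "(\<lambda>n. Z (?p + axis j (\<epsilon> n * y))) \<longlonglongrightarrow> \<kappa>m * f ?p" if "y < 0" for y
      unfolding Z_def by (rule side_limit[OF \<kappa>m _ _ _ _ fc \<epsilon> \<epsilon>0]) (use True that in auto)
    qed
    moreover have "h a = \<kappa>m * f ?p - \<kappa>p * f ?p" unfolding hs using True by (simp add: left_diff_distrib)
    ultimately show ?thesis by (simp add: Jl)
   next
    case False
    then have s01: "s < 0 \<or> s > 1" using sn by auto
    have pn: "?p \<notin> seg_set e"
    proof
     assume "?p \<in> seg_set e"
     then obtain s' where s': "s' \<in> {0..1}" "?p = seg_pt e s'" using seg_set_pt by blast
     then have "?p $ i = seg_pt e s' $ i" by simp
     then have "s * d $ i = s' * d $ i" by (simp only: seg_pt_components; simp?)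
     then have "s = s'" using di by (simp only: mult_cancel_right; simp?)
     with s' s01 show False by auto
    qed
    have Zc: "isCont Z ?p"
    proof -
     consider "?p \<notin> supp \<phi>" | "?p \<in> E" | "?p \<notin> closure E"
      using fr'[of ?p] pn E by (auto simp: frontier_def interior_open)
     then show ?thesis
     proof cases
      case 1
      show ?thesis
       by (rule isCont_eq_open[of "- supp \<phi>" _ "\<lambda>_. 0"])
         (use 1 supp_closed[of \<phi>] in \<open>auto simp: Z_def f_def not_in_supp open_Compl\<close>)
     next
      case 2
      show ?thesis
       by (rule isCont_eq_open[OF E(1) 2 fc]) (auto simp: Z_def fc)
     next
      case 3
      show ?thesis
       by (rule isCont_eq_open[of "- closure E" _ "\<lambda>_. 0"]) (use 3 closure_subset[of E] in \<open>auto simp: Z_def indicator_def\<close>)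
     qed
    qed
    have Zl: "(\<lambda>n. Z (?p + axis j (\<epsilon> n * y))) \<longlonglongrightarrow> Z ?p" for y
    proof -
     have "(\<lambda>n. ?p + (\<epsilon> n * y) *\<^sub>R ax j) \<longlonglongrightarrow> ?p + (0 * y) *\<^sub>R ax j"
      by (intro tendsto_intros \<epsilon>0)
     then have "(\<lambda>n. ?p + axis j (\<epsilon> n * y)) \<longlonglongrightarrow> ?p" by (simp only: mult_zero_left scaleR_zero_left add_0_right axs ax0)
     from isCont_tendsto_compose[OF Zc this] show ?thesis .
    qed
    have "(\<lambda>n. \<integral>y. (\<lambda>y. Z (?p + axis j y)) (\<epsilon> n * y) * plateau' y \<partial>lborel) \<longlonglongrightarrow> Z ?p - Z ?p"
     by (rule half_line_limit[OF Zm ZB Zl Zl])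
    moreover have "h a = 0" unfolding hs using False by (auto simp: indicator_def)
    ultimately show ?thesis by (simp add: Jl)
   qed
  qed
  have Rl: "(\<lambda>n. \<integral>a. J n a \<partial>lborel) \<longlonglongrightarrow> (\<integral>a. h a \<partial>lborel)"
  proof (rule integral_dominated_convergence[where w="\<lambda>a. indicator {- R..R} a *\<^sub>R (B * (\<integral>y. \<bar>plateau' y\<bar> \<partial>lborel))"])
   show "h \<in> borel_measurable lborel" unfolding h_def by measurable
   show "J n \<in> borel_measurable lborel" for n
   proof -
    have e: "axis i a + axis j (c a + \<epsilon> n * y) = a *\<^sub>R ax i + (c a + \<epsilon> n * y) *\<^sub>R ax j" for a y
     by (simp add: vec_eq_iff axis_def)
    have "(\<lambda>(a, y). Z (a *\<^sub>R ax i + (c a + \<epsilon> n * y) *\<^sub>R ax j) * plateau' y) \<in> borel_measurable (borel \<Otimes>\<^sub>M borel)"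
     unfolding c_def by measurable
    then have "(\<lambda>(a, y). Z (a *\<^sub>R ax i + (c a + \<epsilon> n * y) *\<^sub>R ax j) * plateau' y) \<in> borel_measurable (lborel \<Otimes>\<^sub>M lborel)"
     by (simp cong: measurable_cong_sets sets_pair_measure_cong)
    from lborel.borel_measurable_lebesgue_integral[OF this] show ?thesis unfolding J_def[abs_def] e .
   qed
   show "integrable lborel (\<lambda>a. indicator {- R..R} a *\<^sub>R (B * (\<integral>y. \<bar>plateau' y\<bar> \<partial>lborel)))"
    by (rule borel_integrable_compact) auto
   show "AE a in lborel. norm (J n a) \<le> indicator {- R..R} a *\<^sub>R (B * (\<integral>y. \<bar>plateau' y\<bar> \<partial>lborel))" for n
   proof (rule AE_I2)
    fix a
    show "norm (J n a) \<le> indicator {- R..R} a *\<^sub>R (B * (\<integral>y. \<bar>plateau' y\<bar> \<partial>lborel))"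
    proof (cases "a \<in> {- R..R}")
     case True
     have "norm (J n a) \<le> (\<integral>y. norm (Z (axis i a + axis j (c a + \<epsilon> n * y)) * plateau' y) \<partial>lborel)"
      unfolding J_def by (rule integral_norm_bound)
     also have "\<dots> \<le> (\<integral>y. B * \<bar>plateau' y\<bar> \<partial>lborel)"
     proof (rule integral_mono_AE')
      show "integrable lborel (\<lambda>y. B * \<bar>plateau' y\<bar>)" using plateau'_integrable by simp
      show "AE y in lborel. norm (Z (axis i a + axis j (c a + \<epsilon> n * y)) * plateau' y) \<le> B * \<bar>plateau' y\<bar>"
       using ZB by (intro AE_I2) (simp add: abs_mult mult_right_mono)
     qed (use B(1) in auto)
     finally show ?thesis using True by simp
    next
     case False
     have "(axis i a + axis j (c a + \<epsilon> n * y)) $ i = a" for y using ij by (simp add: axis_def)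
     then have "Z (axis i a + axis j (c a + \<epsilon> n * y)) = 0" for y using False by (intro ZR) auto
     then show ?thesis using False by (simp add: J_def)
    qed
   qed
   have "AE a in lborel. a \<noteq> fst e $ i" "AE a in lborel. a \<noteq> fst e $ i + d $ i"
    by (rule AE_lborel_singleton)+
   then show "AE a in lborel. (\<lambda>n. J n a) \<longlonglongrightarrow> h a"
   proof eventually_elim
    case (elim a)
    define D where "D = d $ i"
    have "D \<noteq> 0" "a \<noteq> fst e $ i" "a \<noteq> fst e $ i + D" using elim di by (simp_all add: D_def)
    then have "(a - fst e $ i) / D \<noteq> 0" "(a - fst e $ i) / D \<noteq> 1" by (auto simp: field_simps)
    then show ?case by (intro lim) (simp_all add: D_def)
   qed
  qed
  have "(\<integral>a. h a \<partial>lborel) = \<bar>d $ i\<bar> *\<^sub>R (\<integral>s. h (fst e $ i + d $ i * s) \<partial>lborel)"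
   by (rule lborel_integral_real_affine[OF di])
  also have "(\<lambda>s. h (fst e $ i + d $ i * s)) = (\<lambda>s. (\<kappa>m - \<kappa>p) * (indicator {0<..<1} s * f (seg_pt e s)))"
  proof
   fix s
   have "((fst e $ i + d $ i * s) - fst e $ i) / d $ i = s" using di by (simp only: add_diff_cancel_left'; simp?)
   then show "h (fst e $ i + d $ i * s) = (\<kappa>m - \<kappa>p) * (indicator {0<..<1} s * f (seg_pt e s))"
    unfolding h_def by (simp only: mult.left_commute)
  qed
  also have "\<bar>d $ i\<bar> *\<^sub>R (\<integral>s. (\<kappa>m - \<kappa>p) * (indicator {0<..<1} s * f (seg_pt e s)) \<partial>lborel)
    = seg_length e * (\<kappa> * (\<integral>s. indicator {0<..<1} s * f (seg_pt e s) \<partial>lborel))"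
   using len by (simp add: \<kappa>_def)
  also have "(\<integral>s. indicator {0<..<1} s * f (seg_pt e s) \<partial>lborel) = (\<integral>s. f (seg_pt e s) \<partial>lebesgue_on {0..1})"
  proof -
   have "(\<integral>s. f (seg_pt e s) \<partial>lebesgue_on {0..1}) = (\<integral>s. indicator {0..1} s *\<^sub>R f (seg_pt e s) \<partial>lebesgue)"
    by (rule integral_lebesgue_on) simp
   also have "\<dots> = (\<integral>s. indicator {0..1} s * f (seg_pt e s) \<partial>lborel)"
    unfolding real_scaleR_def by (rule integral_lebesgue_borel(1)) measurable
   also have "\<dots> = (\<integral>s. indicator {0<..<1} s * f (seg_pt e s) \<partial>lborel)"
   proof (rule integral_cong_AE)
    show "AE s in lborel. indicator {0..1} s * f (seg_pt e s) = indicator {0<..<1} s * f (seg_pt e s)"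
     using AE_lborel_singleton[of 0] AE_lborel_singleton[of 1] by eventually_elim (auto simp: indicator_def)
   qed measurable
   finally show ?thesis by simp
  qed
  also have "seg_length e * (\<kappa> * (\<integral>s. f (seg_pt e s) \<partial>lebesgue_on {0..1})) = seg_integral e (\<lambda>x. \<kappa> * N (v x) * \<phi> x)"
   by (simp add: seg_integral_def f_def mult.assoc)
  finally have H: "(\<integral>a. h a \<partial>lborel) = seg_integral e (\<lambda>x. \<kappa> * N (v x) * \<phi> x)" .
  have d': "supp \<phi> \<inter> frontier E \<subseteq> seg_set e" using fr' by blast
  have "(\<lambda>n. \<integral>x. indicator E x * ((1 - plateau ((N x - N (fst e)) / \<epsilon> n)) * F x) \<partial>lborel) \<longlonglongrightarrow> (\<integral>a. h a \<partial>lborel)"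
   using Rl unfolding RJ[symmetric] F_def by (subst cutoff_divergence[OF v \<phi> d' \<epsilon>])
  from LIMSEQ_unique[OF L this] show ?thesis unfolding H F_def .
 qed
 then show ?thesis by blast
qed

end

section \<open>Weak divergence, curl and normal traces\<close>

lemma grad_components: "grad \<phi> x $ 1 = pd (ax 1) \<phi> x" "grad \<phi> x $ 2 = pd (ax 2) \<phi> x"
 by (simp_all add: grad_def vector_2)

lemma rot_components: "rot \<phi> x $ 1 = pd (ax 2) \<phi> x" "rot \<phi> x $ 2 = - pd (ax 1) \<phi> x"
 by (simp_all add: rot_def vector_2)

lemma grad_L2:
 assumes "\<phi> \<in> test_functions U" "A \<in> sets lebesgue" shows "grad \<phi> \<in> L2 A" "rot \<phi> \<in> L2 A"
proof -
 have t: "pd (ax l) \<phi> \<in> L2 A" for l by (rule test_L2[OF test_pd[OF assms(1) ax_Basis] assms(2)])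
 show "grad \<phi> \<in> L2 A"
 proof (rule L2_vecI)
  fix l :: 2 show "(\<lambda>x. grad \<phi> x $ l) \<in> L2 A"
   using exhaust_2[of l] by (elim disjE) (simp_all add: grad_components t)
 qed
 show "rot \<phi> \<in> L2 A"
 proof (rule L2_vecI)
  fix l :: 2 show "(\<lambda>x. rot \<phi> x $ l) \<in> L2 A"
   using exhaust_2[of l] by (elim disjE) (simp_all add: rot_components t L2_uminus)
 qed
qed

lemma L2_inner_grad:
 assumes "\<phi> \<in> test_functions U" "A \<in> sets lebesgue" "v \<in> L2 A"
 shows "L2_inner A v (grad \<phi>) = L2_inner A (\<lambda>x. v x $ 1) (pd (ax 1) \<phi>) + L2_inner A (\<lambda>x. v x $ 2) (pd (ax 2) \<phi>)"
  and "L2_inner A v (rot \<phi>) = L2_inner A (\<lambda>x. v x $ 1) (pd (ax 2) \<phi>) - L2_inner A (\<lambda>x. v x $ 2) (pd (ax 1) \<phi>)"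
 using grad_L2[OF assms(1,2)] assms(3)
  L2_inner_scale_right[of A "\<lambda>x. v x $ 2" "-1" "pd (ax 1) \<phi>"]
 by (simp_all add: L2_inner_vec UNIV_2 grad_components rot_components)

lemma smooth_vec_L2:
 assumes "\<And>l. smooth (\<lambda>x. v x $ l)" "A \<in> sets lebesgue" "bounded A"
 shows "v \<in> L2 A"
 by (rule L2_vecI) (intro smooth_L2 assms)

lemma has_weak_div_smooth:
 fixes v :: "pt => pt"
 assumes E: "open E" "bounded E" and v: "\<And>l. smooth (\<lambda>x. v x $ l)"
 shows "has_weak_div E v (\<lambda>x. pd (ax 1) (\<lambda>x. v x $ 1) x + pd (ax 2) (\<lambda>x. v x $ 2) x)"
  and "has_weak_curl E v (\<lambda>x. pd (ax 1) (\<lambda>x. v x $ 2) x - pd (ax 2) (\<lambda>x. v x $ 1) x)"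
proof -
 have Es: "E \<in> sets lebesgue" using E by simp
 have vL: "v \<in> L2 E" by (rule smooth_vec_L2[OF v Es E(2)])
 have pL: "pd (ax m) (\<lambda>x. v x $ l) \<in> L2 E" for l m by (intro smooth_L2 smooth_pd v Es E ax_Basis)
 have w: "L2_inner E (\<lambda>x. v x $ l) (pd (ax m) \<phi>) = - L2_inner E (pd (ax m) (\<lambda>x. v x $ l)) \<phi>"
  if "\<phi> \<in> test_functions E" for \<phi> l m
  using weak_pd_smooth[OF E(1) v[of l] ax_Basis[of m]] that by (simp add: weak_pd_def)
 show "has_weak_div E v (\<lambda>x. pd (ax 1) (\<lambda>x. v x $ 1) x + pd (ax 2) (\<lambda>x. v x $ 2) x)"
  unfolding has_weak_div_def
  by (auto simp: L2_add pL L2_inner_grad(1)[OF _ Es vL] w L2_inner_add_left[OF pL pL] test_L2[OF _ Es])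
 show "has_weak_curl E v (\<lambda>x. pd (ax 1) (\<lambda>x. v x $ 2) x - pd (ax 2) (\<lambda>x. v x $ 1) x)"
  unfolding has_weak_curl_def
  by (auto simp: L2_diff pL L2_inner_grad(2)[OF _ Es vL] w L2_inner_diff_left[OF pL pL] test_L2[OF _ Es])
qed

lemma has_weak_div_unique:
 assumes E: "open E" and d: "has_weak_div E v d" "has_weak_div E v d'"
 shows "AE x in lebesgue_on E. d x = d' x"
proof (rule L2_eq_by_test[OF E])
 fix \<theta> assume "\<theta> \<in> test_functions E"
 then have "L2_inner E v (grad \<theta>) = - L2_inner E d \<theta>" "L2_inner E v (grad \<theta>) = - L2_inner E d' \<theta>"
  using d by (simp_all add: has_weak_div_def)
 then show "L2_inner E d \<theta> = L2_inner E d' \<theta>" by simp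
qed (use d in \<open>simp_all add: has_weak_div_def\<close>)

lemma weak_div_holds: "has_weak_div E v d ==> has_weak_div E v (weak_div E v)"
 unfolding weak_div_def by (rule someI[where P = "has_weak_div E v"])

lemma weak_div_L2: "has_weak_div E v d ==> weak_div E v \<in> L2 E"
 using weak_div_holds[of E v d] by (simp add: has_weak_div_def)

lemma Hdiv_weak_div: "v \<in> Hdiv E ==> has_weak_div E v (weak_div E v)"
 using weak_div_holds by (auto simp: Hdiv_def)

lemma L2_inner_weak_div:
 assumes E: "open E" and d: "has_weak_div E v d" and q: "q \<in> L2 E"
 shows "L2_inner E (weak_div E v) q = L2_inner E d q"
 using has_weak_div_unique[OF E weak_div_holds[OF d] d] weak_div_L2[OF d] d q
 by (intro L2_inner_cong_AE) (auto simp: has_weak_div_def)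

lemma has_weak_div_lin:
 assumes E: "open E" and v: "v \<in> L2 E" "has_weak_div E v d" and w: "w \<in> L2 E" "has_weak_div E w d'"
 shows "has_weak_div E (\<lambda>x. v x + c *\<^sub>R w x) (\<lambda>x. d x + c * d' x)"
proof -
 have Es: "E \<in> sets lebesgue" using E by simp
 have dL: "d \<in> L2 E" "d' \<in> L2 E" using v w by (simp_all add: has_weak_div_def)
 show ?thesis unfolding has_weak_div_def
 proof (intro conjI ballI)
  show "(\<lambda>x. d x + c * d' x) \<in> L2 E" by (intro L2_add L2_cmult dL)
  fix \<phi> assume \<phi>: "\<phi> \<in> test_functions E"
  note g = grad_L2(1)[OF \<phi> Es] and t = test_L2[OF \<phi> Es]
  have "L2_inner E v (grad \<phi>) = - L2_inner E d \<phi>" "L2_inner E w (grad \<phi>) = - L2_inner E d' \<phi>"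
   using v w \<phi> by (simp_all add: has_weak_div_def)
  then show "L2_inner E (\<lambda>x. v x + c *\<^sub>R w x) (grad \<phi>) = - L2_inner E (\<lambda>x. d x + c * d' x) \<phi>"
   by (simp add: L2_inner_add_left[OF v(1) L2_scale[OF w(1)] g] L2_inner_add_left[OF dL(1) L2_cmult[OF dL(2)] t]
    L2_inner_scale_left L2_inner_cmult_left)
 qed
qed

lemma has_weak_curl_lin:
 assumes E: "open E" and v: "v \<in> L2 E" "has_weak_curl E v d" and w: "w \<in> L2 E" "has_weak_curl E w d'"
 shows "has_weak_curl E (\<lambda>x. v x + c *\<^sub>R w x) (\<lambda>x. d x + c * d' x)"
proof -
 have Es: "E \<in> sets lebesgue" using E by simp
 have dL: "d \<in> L2 E" "d' \<in> L2 E" using v w by (simp_all add: has_weak_curl_def)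
 show ?thesis unfolding has_weak_curl_def
 proof (intro conjI ballI)
  show "(\<lambda>x. d x + c * d' x) \<in> L2 E" by (intro L2_add L2_cmult dL)
  fix \<phi> assume \<phi>: "\<phi> \<in> test_functions E"
  note g = grad_L2(2)[OF \<phi> Es] and t = test_L2[OF \<phi> Es]
  have "L2_inner E v (rot \<phi>) = L2_inner E d \<phi>" "L2_inner E w (rot \<phi>) = L2_inner E d' \<phi>"
   using v w \<phi> by (simp_all add: has_weak_curl_def)
  then show "L2_inner E (\<lambda>x. v x + c *\<^sub>R w x) (rot \<phi>) = L2_inner E (\<lambda>x. d x + c * d' x) \<phi>"
   by (simp add: L2_inner_add_left[OF v(1) L2_scale[OF w(1)] g] L2_inner_add_left[OF dL(1) L2_cmult[OF dL(2)] t]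
    L2_inner_scale_left L2_inner_cmult_left)
 qed
qed

lemma Hdiv_lin: "open E ==> v \<in> Hdiv E ==> w \<in> Hdiv E ==> (\<lambda>x. v x + c *\<^sub>R w x) \<in> Hdiv E"
 using has_weak_div_lin[of E v _ w _ c] unfolding Hdiv_def by (auto intro!: L2_add L2_scale)

lemma weak_div_lin:
 assumes E: "open E" and v: "v \<in> Hdiv E" and w: "w \<in> Hdiv E" and q: "q \<in> L2 E"
 shows "L2_inner E (weak_div E (\<lambda>x. v x + c *\<^sub>R w x)) q = L2_inner E (weak_div E v) q + c * L2_inner E (weak_div E w) q"
proof -
 note dv = Hdiv_weak_div[OF v] and dw = Hdiv_weak_div[OF w]
 have L: "v \<in> L2 E" "w \<in> L2 E" using v w by (simp_all add: Hdiv_def)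
 have dL: "weak_div E v \<in> L2 E" "weak_div E w \<in> L2 E" using dv dw by (simp_all add: has_weak_div_def)
 show ?thesis
  using L2_inner_weak_div[OF E has_weak_div_lin[OF E L(1) dv L(2) dw] q, of c]
  by (simp add: L2_inner_add_left[OF dL(1) L2_cmult[OF dL(2)] q] L2_inner_cmult_left)
qed

lemma seg_integral_eq: "seg_integral e (\<lambda>x. g x * h x) = seg_length e * L2_inner {0..1} (\<lambda>s. g (seg_pt e s)) (\<lambda>s. h (seg_pt e s))"
 by (simp add: seg_integral_def L2_inner_def)

lemma smooth_seg_L2: "smooth f ==> (\<lambda>s. f (seg_pt e s)) \<in> L2 {0..1}"
 unfolding seg_pt_def
 by (intro L2_continuous continuous_on_compose2[OF smooth_continuous[of f UNIV]] continuous_intros) auto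

lemma has_normal_trace_lin:
 assumes E: "open E" and v: "has_normal_trace E \<Gamma> v g" and w: "has_normal_trace E \<Gamma> w h"
 shows "has_normal_trace E \<Gamma> (\<lambda>x. v x + c *\<^sub>R w x) (\<lambda>x. g x + c * h x)"
proof -
 have Es: "E \<in> sets lebesgue" using E by simp
 have H: "v \<in> Hdiv E" "w \<in> Hdiv E" using v w by (simp_all add: has_normal_trace_def)
 have L: "v \<in> L2 E" "w \<in> L2 E" using H by (simp_all add: Hdiv_def)
 have S: "(\<lambda>s. g (seg_pt e s)) \<in> L2 {0..1}" "(\<lambda>s. h (seg_pt e s)) \<in> L2 {0..1}" if "e \<in> \<Gamma>" for e
  using v w that by (simp_all add: has_normal_trace_def L2_seg_def)
 show ?thesis unfolding has_normal_trace_def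
 proof (intro conjI ballI impI)
  show "(\<lambda>x. v x + c *\<^sub>R w x) \<in> Hdiv E" by (rule Hdiv_lin[OF E H])
  show "(\<lambda>x. g x + c * h x) \<in> L2_seg e" if "e \<in> \<Gamma>" for e
   unfolding L2_seg_def using S[OF that] by (auto intro: L2_add L2_cmult)
  fix \<phi> assume \<phi>: "\<phi> \<in> test_functions UNIV" "supp \<phi> \<inter> closure (frontier E - \<Union> (seg_set ` \<Gamma>)) = {}"
  have si: "seg_integral e (\<lambda>x. (g x + c * h x) * \<phi> x) = seg_integral e (\<lambda>x. g x * \<phi> x) + c * seg_integral e (\<lambda>x. h x * \<phi> x)"
   if "e \<in> \<Gamma>" for e
   unfolding seg_integral_eq using S[OF that] smooth_seg_L2[OF test_smooth[OF \<phi>(1)], of e]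
   by (simp add: L2_inner_add_left L2_cmult L2_inner_cmult_left distrib_left)
  have "L2_inner E v (grad \<phi>) + L2_inner E (weak_div E v) \<phi> = (\<Sum>e\<in>\<Gamma>. seg_integral e (\<lambda>x. g x * \<phi> x))"
   "L2_inner E w (grad \<phi>) + L2_inner E (weak_div E w) \<phi> = (\<Sum>e\<in>\<Gamma>. seg_integral e (\<lambda>x. h x * \<phi> x))"
   using v w \<phi> by (simp_all add: has_normal_trace_def)
  then show "L2_inner E (\<lambda>x. v x + c *\<^sub>R w x) (grad \<phi>) + L2_inner E (weak_div E (\<lambda>x. v x + c *\<^sub>R w x)) \<phi>
    = (\<Sum>e\<in>\<Gamma>. seg_integral e (\<lambda>x. (g x + c * h x) * \<phi> x))"
   by (simp add: si sum.distrib weak_div_lin[OF E H test_L2[OF \<phi>(1) Es]] L2_inner_scale_left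
    L2_inner_add_left[OF L(1) L2_scale[OF L(2)] grad_L2(1)[OF \<phi>(1) Es]] flip: sum_distrib_left)
    (simp add: algebra_simps flip: distrib_left)
 qed
qed

text \<open>Fields that agree almost everywhere satisfy the same defining predicates, so that the
 divergences and traces chosen for them are literally equal.\<close>

lemma has_weak_div_cong:
 assumes E: "open E" and f: "f \<in> L2 E" and g: "g \<in> L2 E" and e: "AE x in lebesgue_on E. f x = g x"
 shows "has_weak_div E f = has_weak_div E g" "has_weak_curl E f = has_weak_curl E g"
  "weak_div E f = weak_div E g"
  "has_normal_trace E \<Gamma> f = has_normal_trace E \<Gamma> g" "normal_trace E \<Gamma> f = normal_trace E \<Gamma> g"
proof -
 have Es: "E \<in> sets lebesgue" using E by simp
 have c: "L2_inner E f q = L2_inner E g q" if "q \<in> L2 E" for q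
  using f g e that by (intro L2_inner_cong_AE) auto
 have gr: "L2_inner E f (grad \<phi>) = L2_inner E g (grad \<phi>)" "L2_inner E f (rot \<phi>) = L2_inner E g (rot \<phi>)"
  if "\<phi> \<in> test_functions U" for \<phi> U using c grad_L2[OF that Es] by auto
 show d: "has_weak_div E f = has_weak_div E g" "has_weak_curl E f = has_weak_curl E g"
  unfolding has_weak_div_def has_weak_curl_def using gr by (auto simp: fun_eq_iff)
 then show wd: "weak_div E f = weak_div E g" by (simp add: weak_div_def)
 have "f \<in> Hdiv E \<longleftrightarrow> g \<in> Hdiv E" using f g d by (simp add: Hdiv_def)
 then show "has_normal_trace E \<Gamma> f = has_normal_trace E \<Gamma> g"
  unfolding has_normal_trace_def wd
  by (intro ext conj_cong ball_cong imp_cong arg_cong2[where f = "(=)"] arg_cong2[where f = "(+)"] gr(1) refl) simp_all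
 then show "normal_trace E \<Gamma> f = normal_trace E \<Gamma> g" by (simp add: normal_trace_def)
qed

context straight_edge
begin

lemma edge_coordinates: "x = seg_pt e ((x $ i - fst e $ i) / d $ i) + (N x - N (fst e)) *\<^sub>R ax j"
proof -
 have x: "x = axis i (x $ i) + axis j (x $ j)"
 proof -
  have "x $ k = (axis i (x $ i) + axis j (x $ j)) $ k" for k
  proof -
   have "k \<in> {i, j}" unfolding UNIV_pair[OF ij, symmetric] by (rule UNIV_I)
   then consider "k = i" | "k = j" by blast
   then show ?thesis using ij by cases (simp_all add: axis_def)
  qed
  then show ?thesis unfolding vec_eq_iff by blast
 qed
 have "N (fst e) + x $ i * (d $ j / d $ i) + (N x - N (fst e)) = x $ j" by (simp add: N_def)
 then have h: "axis i (x $ i) + axis j (x $ j) = seg_pt e ((x $ i - fst e $ i) / d $ i) + axis j (N x - N (fst e))"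
  using edge_line[of "x $ i" "N x - N (fst e)"] by (simp only:)
 have h': "axis j (N x - N (fst e)) = (N x - N (fst e)) *\<^sub>R ax j" by (simp add: vec_eq_iff axis_def)
 show ?thesis by (rule x[THEN trans]) (simp only: h h')
qed

lemma frontier_rest: "closure (frontier E - seg_set e) \<subseteq> Rst"
 by (rule closure_minimal) (use fr Rst in auto)

text \<open>The test function on the parameter interval is multiplied by a plateau in the transversal direction,
 narrow enough to stay away from the other edges.\<close>

lemma test_extension:
 assumes \<theta>: "\<theta> \<in> test_functions {0<..<1}"
 obtains \<phi> where "\<phi> \<in> test_functions UNIV" "supp \<phi> \<inter> closure (frontier E - seg_set e) = {}" "\<And>s. \<phi> (seg_pt e s) = \<theta> s"
proof -
 have \<theta>s: "supp \<theta> \<subseteq> {0<..<1}" "compact (supp \<theta>)" using \<theta> by (auto simp: test_functions_def')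
 have cK: "compact (seg_pt e ` supp \<theta>)" by (intro compact_continuous_image seg_pt_continuous \<theta>s)
 have "seg_pt e s \<notin> Rst" if "s \<in> supp \<theta>" for s
 proof -
  have "0 < s" "s < 1" using \<theta>s(1) that by auto
  then show ?thesis by (rule not_end)
 qed
 then have "seg_pt e ` supp \<theta> \<inter> Rst = {}" by auto
 from separate_compact_closed[OF cK Rst this] obtain \<delta> where
  \<delta>: "\<delta> > 0" "\<And>x y. x \<in> seg_pt e ` supp \<theta> ==> y \<in> Rst ==> \<delta> \<le> dist x y" by blast
 define \<epsilon> where "\<epsilon> = \<delta> / 2"
 have \<epsilon>: "\<epsilon> > 0" "\<epsilon> < \<delta>" using \<delta> by (auto simp: \<epsilon>_def)
 define \<phi> where "\<phi> x = \<theta> ((1 / d $ i) * x $ i + (- (fst e $ i) / d $ i)) * plateau ((1 / \<epsilon>) * N x + (- N (fst e) / \<epsilon>))" for x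
 have \<sigma>: "(1 / d $ i) * x $ i + (- (fst e $ i) / d $ i) = (x $ i - fst e $ i) / d $ i" for x by (simp add: diff_divide_distrib)
 have \<eta>: "(1 / \<epsilon>) * N x + (- N (fst e) / \<epsilon>) = (N x - N (fst e)) / \<epsilon>" for x by (simp add: diff_divide_distrib)
 define S where "S = (\<lambda>p. seg_pt e (fst p) + snd p *\<^sub>R ax j) ` (supp \<theta> \<times> {- \<epsilon>..\<epsilon>})"
 have S: "compact S" unfolding S_def
  by (intro compact_continuous_image compact_Times \<theta>s continuous_intros continuous_on_compose2[OF seg_pt_continuous[of UNIV]]) auto
 have zero: "\<phi> x = 0" if "x \<notin> S" for x
 proof (rule ccontr)
  assume nz: "\<phi> x \<noteq> 0"
  let ?s = "(x $ i - fst e $ i) / d $ i" and ?y = "N x - N (fst e)"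
  have "\<theta> ?s \<noteq> 0" "plateau (?y / \<epsilon>) \<noteq> 0" using nz unfolding \<phi>_def \<sigma> \<eta> by auto
  then have "?s \<in> supp \<theta>" "\<bar>?y / \<epsilon>\<bar> < 1" using not_in_supp[of ?s \<theta>] plateau_zero[of "?y / \<epsilon>"] by (auto simp: not_less[symmetric])
  then have "(?s, ?y) \<in> supp \<theta> \<times> {- \<epsilon>..\<epsilon>}" using \<epsilon> by (auto simp: abs_less_iff field_simps)
  then have "seg_pt e ?s + ?y *\<^sub>R ax j \<in> S" unfolding S_def by (rule rev_image_eqI) simp
  with that edge_coordinates[of x] show False by simp
 qed
 have sm: "smooth \<phi>" unfolding \<phi>_def[abs_def]
  by (intro smooth_mult smooth_compose_affine[OF _ test_smooth[OF \<theta>]] smooth_compose_affine[OF _ smooth_plateau]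
    bounded_linear_const_mult N_linear bounded_linear_vec_nth)
 have t: "\<phi> \<in> test_functions UNIV" by (rule test_functionsI[OF sm S subset_UNIV zero])
 have "supp \<phi> \<subseteq> S" using zero S by (intro supp_subset compact_imp_closed) auto
 moreover have "S \<inter> Rst = {}"
 proof -
  have "seg_pt e s + y *\<^sub>R ax j \<notin> Rst" if "s \<in> supp \<theta>" "y \<in> {- \<epsilon>..\<epsilon>}" for s y
  proof
   assume "seg_pt e s + y *\<^sub>R ax j \<in> Rst"
   from \<delta>(2)[OF imageI[OF that(1)] this] have "\<delta> \<le> \<bar>y\<bar>" by (simp add: dist_norm)
   with that(2) \<epsilon> show False by auto
  qed
  then show ?thesis by (auto simp: S_def)
 qed
 ultimately have "supp \<phi> \<inter> closure (frontier E - seg_set e) = {}" using frontier_rest by blast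
 moreover have "\<phi> (seg_pt e s) = \<theta> s" for s
 proof -
  have "(seg_pt e s $ i - fst e $ i) / d $ i = s" using di by (simp add: seg_pt_components)
  moreover have "N (seg_pt e s) = N (fst e)" using di by (simp add: N_def seg_pt_components field_simps)
  ultimately show ?thesis unfolding \<phi>_def \<sigma> \<eta> by (simp add: plateau_one)
 qed
 ultimately show ?thesis using that t by blast
qed

lemma seg_length_pos: "seg_length e > 0"
 using di by (auto simp: seg_length_def)

text \<open>Two traces have the same moments against all restrictions of test functions to the edge, and these
 restrictions include every test function on the open parameter interval.\<close>

lemma trace_unique:
 assumes g: "has_normal_trace E {e} v g" and h: "has_normal_trace E {e} v h"
 shows "AE s in lebesgue_on {0..1}. g (seg_pt e s) = h (seg_pt e s)"
proof -
 let ?g = "\<lambda>s. g (seg_pt e s)" and ?h = "\<lambda>s. h (seg_pt e s)"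
 have L: "?g \<in> L2 {0..1}" "?h \<in> L2 {0..1}" using g h by (simp_all add: has_normal_trace_def L2_seg_def)
 have ss: "{0<..<1::real} \<in> sets lebesgue" "{0..1::real} \<in> sets lebesgue" "{0<..<1::real} \<subseteq> {0..1}" by auto
 have "AE s in lebesgue_on {0<..<1}. ?g s = ?h s"
 proof (rule L2_eq_by_test)
  show "?g \<in> L2 {0<..<1}" "?h \<in> L2 {0<..<1}" using L L2_subset[OF ss(2,1,3)] by blast+
  fix \<theta> :: "real => real" assume \<theta>: "\<theta> \<in> test_functions {0<..<1}"
  obtain \<phi> where \<phi>: "\<phi> \<in> test_functions UNIV" "supp \<phi> \<inter> closure (frontier E - seg_set e) = {}" "\<And>s. \<phi> (seg_pt e s) = \<theta> s"
   using test_extension[OF \<theta>] by blast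
  have "seg_integral e (\<lambda>x. g x * \<phi> x) = seg_integral e (\<lambda>x. h x * \<phi> x)"
   using g h \<phi>(1,2) unfolding has_normal_trace_def by simp
  then have "L2_inner {0..1} ?g \<theta> = L2_inner {0..1} ?h \<theta>"
   unfolding seg_integral_eq \<phi>(3) using seg_length_pos by simp
  moreover have "L2_inner {0..1} f \<theta> = L2_inner {0<..<1} f \<theta>" for f
   by (rule L2_inner_supported[OF ss(2,1,3)]) (use test_zero[OF \<theta>] in auto)
  ultimately show "L2_inner {0<..<1} ?g \<theta> = L2_inner {0<..<1} ?h \<theta>" by simp
 qed simp
 then have ae: "AE s in lebesgue. s \<in> {0<..<1} \<longrightarrow> ?g s = ?h s" by (simp only: AE_lebesgue_on_iff[OF ss(1)])
 have "negligible {0, 1::real}" by simp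
 then have "AE s in lebesgue. s \<notin> {0, 1::real}" unfolding negligible_iff_null_sets by (rule AE_not_in)
 with ae have "AE s in lebesgue. s \<in> {0..1} \<longrightarrow> ?g s = ?h s" by eventually_elim auto
 then show ?thesis by (simp only: AE_lebesgue_on_iff[OF ss(2)])
qed

lemma seg_integral_trace:
 assumes g: "has_normal_trace E {e} v g" and p: "smooth p"
 shows "seg_integral e (\<lambda>x. normal_trace E {e} v x * p x) = seg_integral e (\<lambda>x. g x * p x)"
proof -
 have h: "has_normal_trace E {e} v (normal_trace E {e} v)" unfolding normal_trace_def by (rule someI[where P = "has_normal_trace E {e} v", OF g])
 have L: "(\<lambda>s. g (seg_pt e s)) \<in> L2 {0..1}" "(\<lambda>s. normal_trace E {e} v (seg_pt e s)) \<in> L2 {0..1}"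
  using g h by (simp_all add: has_normal_trace_def L2_seg_def)
 have "L2_inner {0..1} (\<lambda>s. normal_trace E {e} v (seg_pt e s)) (\<lambda>s. p (seg_pt e s))
   = L2_inner {0..1} (\<lambda>s. g (seg_pt e s)) (\<lambda>s. p (seg_pt e s))"
  using trace_unique[OF h g] by (intro L2_inner_cong_AE L smooth_seg_L2[OF p]) auto
 then show ?thesis unfolding seg_integral_eq by (simp only:)
qed

lemma smooth_normal_trace:
 fixes v :: "pt => pt"
 assumes v: "\<And>l. smooth (\<lambda>x. v x $ l)"
 shows "\<exists>\<kappa>. has_normal_trace E {e} v (\<lambda>x. \<kappa> * N (v x))"
proof -
 have Es: "E \<in> sets lebesgue" "E \<in> sets borel" using E by auto
 obtain \<kappa> where \<kappa>: "\<And>\<phi>. \<phi> \<in> test_functions UNIV ==> supp \<phi> \<inter> closure (frontier E - seg_set e) = {} ==>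
  (\<integral>x. indicator E x * (\<Sum>l\<in>UNIV. pd (ax l) (\<lambda>x. v x $ l * \<phi> x) x) \<partial>lborel) = seg_integral e (\<lambda>x. \<kappa> * N (v x) * \<phi> x)"
  using green_at_edge[OF v] by blast
 have vL: "v \<in> L2 E" by (rule smooth_vec_L2[OF v Es(1) E(2)])
 note dv = has_weak_div_smooth(1)[OF E v]
 have sN: "smooth (\<lambda>x. \<kappa> * N (v x))" unfolding N_def
  using smooth_cmult[OF smooth_diff[OF v smooth_cmult[OF v, of "d $ j / d $ i"]], of \<kappa>] by (simp add: mult.commute)
 have "has_normal_trace E {e} v (\<lambda>x. \<kappa> * N (v x))"
  unfolding has_normal_trace_def
 proof (intro conjI ballI impI)
  show "v \<in> Hdiv E" using vL dv by (auto simp: Hdiv_def)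
  show "(\<lambda>x. \<kappa> * N (v x)) \<in> L2_seg e'" if "e' \<in> {e}" for e'
   unfolding L2_seg_def using smooth_seg_L2[OF sN] by simp
  fix \<phi> assume \<phi>: "\<phi> \<in> test_functions UNIV" "supp \<phi> \<inter> closure (frontier E - \<Union> (seg_set ` {e})) = {}"
  have sb: "f \<in> borel_measurable borel" if "smooth f" for f :: "pt => real"
   using that by (intro borel_measurable_continuous_onI smooth_continuous)
  note s\<phi> = test_smooth[OF \<phi>(1)]
  have a: "L2_inner E f g = (\<integral>x. indicator E x * (f x * g x) \<partial>lborel)" "integrable lborel (\<lambda>x. indicator E x * (f x * g x))"
   if "smooth f" "g \<in> test_functions UNIV" for f g
  proof -
   show "L2_inner E f g = (\<integral>x. indicator E x * (f x * g x) \<partial>lborel)"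
    using L2_inner_lborel[OF Es(2) sb[OF that(1)] test_borel[OF that(2)]] by simp
   show "integrable lborel (\<lambda>x. indicator E x * (f x * g x))"
    using integrable_mult_indicator[OF _ test_integrable[OF test_mult_smooth[OF that(2,1)]], of E] Es by simp
  qed
  have pt: "pd (ax l) \<phi> \<in> test_functions UNIV" for l by (rule test_pd[OF \<phi>(1) ax_Basis])
  have ps: "smooth (pd (ax l) (\<lambda>x. v x $ l))" for l by (rule smooth_pd[OF v ax_Basis])
  have prod: "pd (ax l) (\<lambda>x. v x $ l * \<phi> x) x = v x $ l * pd (ax l) \<phi> x + pd (ax l) (\<lambda>x. v x $ l) x * \<phi> x" for l x
   by (rule pd_mult) (intro smooth_differentiable v s\<phi>)+
  have "L2_inner E (weak_div E v) \<phi> = L2_inner E (pd (ax 1) (\<lambda>x. v x $ 1)) \<phi> + L2_inner E (pd (ax 2) (\<lambda>x. v x $ 2)) \<phi>"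
   unfolding L2_inner_weak_div[OF E(1) dv test_L2[OF \<phi>(1) Es(1)]]
   by (rule L2_inner_add_left) (intro smooth_L2 ps Es E test_L2[OF \<phi>(1)])+
  then have "L2_inner E v (grad \<phi>) + L2_inner E (weak_div E v) \<phi>
   = (\<integral>x. indicator E x * (v x $ 1 * pd (ax 1) \<phi> x) \<partial>lborel) + (\<integral>x. indicator E x * (v x $ 2 * pd (ax 2) \<phi> x) \<partial>lborel)
   + ((\<integral>x. indicator E x * (pd (ax 1) (\<lambda>x. v x $ 1) x * \<phi> x) \<partial>lborel) + (\<integral>x. indicator E x * (pd (ax 2) (\<lambda>x. v x $ 2) x * \<phi> x) \<partial>lborel))"
   by (simp only: L2_inner_grad(1)[OF \<phi>(1) Es(1) vL] a(1)[OF v pt] a(1)[OF ps \<phi>(1)])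
  also have "\<dots> = (\<integral>x. indicator E x * (\<Sum>l\<in>UNIV. pd (ax l) (\<lambda>x. v x $ l * \<phi> x) x) \<partial>lborel)"
   unfolding prod UNIV_2
   using a(2)[OF v pt, of 1 1] a(2)[OF v pt, of 2 2] a(2)[OF ps \<phi>(1), of 1] a(2)[OF ps \<phi>(1), of 2]
   by (simp add: distrib_left)
  also have "\<dots> = seg_integral e (\<lambda>x. \<kappa> * N (v x) * \<phi> x)"
   using \<phi> by (intro \<kappa>) auto
  finally show "L2_inner E v (grad \<phi>) + L2_inner E (weak_div E v) \<phi> = (\<Sum>e\<in>{e}. seg_integral e (\<lambda>x. \<kappa> * N (v x) * \<phi> x))"
   by simp
 qed
 then show ?thesis by blast
qed

lemma negligible_edge: "negligible (seg_set e)"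
proof -
 define u where "u = ax j - (d $ j / d $ i) *\<^sub>R ax i"
 have u: "N x = u \<bullet> x" for x by (simp add: u_def N_def inner_diff_left inner_axis')
 have "u $ j \<noteq> 0" using ij by (simp add: u_def axis_def)
 then have "u \<noteq> 0" by auto
 then have "negligible {x. u \<bullet> x = N (fst e)}" by (intro negligible_hyperplane) simp
 moreover have "seg_set e \<subseteq> {x. u \<bullet> x = N (fst e)}" using N_edge u by auto
 ultimately show ?thesis by (rule negligible_subset)
qed

end

section \<open>The local virtual element space\<close>

lemma finite_edges: "finite (edges K)" by (simp add: edges_def)

lemma closed_edges: "S \<subseteq> edges K ==> closed (\<Union> (seg_set ` S))"
 using finite_edges[of K] finite_subset by (intro closed_UN) (auto simp: seg_set_def)

lemma region_properties:
 shows "open (region K)" "bounded (region K)" "frontier (region K) \<subseteq> \<Union> (seg_set ` edges K)"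
proof -
 note c = closed_edges[of "edges K" K, OF order_refl]
 have b: "bounded (\<Union> (seg_set ` edges K))"
  using finite_edges[of K] by (intro bounded_UN) (auto simp: seg_set_def bounded_closed_segment)
 show "open (region K)" unfolding region_def by (rule open_inside[OF c])
 show "bounded (region K)" unfolding region_def by (rule bounded_inside[OF b])
 show "frontier (region K) \<subseteq> \<Union> (seg_set ` edges K)" unfolding region_def by (rule frontier_inside_subset[OF c])
qed

text \<open>Consecutive vertices differ, so they differ in some coordinate, which serves as the parameter of the
 edge.\<close>

lemma edge_straight:
 assumes K: "simple_polygon K" and e: "e \<in> edges K"
 shows "\<exists>Rst i j. straight_edge (region K) e Rst i j"
proof -
 obtain m where m: "m < length K" "e = edge K m" using e by (auto simp: edges_def)
 have len: "length K \<ge> 3" "distinct K" using K by (auto simp: simple_polygon_def)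
 have "Suc m mod length K < length K" using len by (intro mod_less_divisor) linarith
 moreover have "Suc m mod length K \<noteq> m"
 proof (cases "Suc m = length K")
  case True then show ?thesis using len by auto
 next
  case False then show ?thesis using m by simp
 qed
 ultimately have "fst e \<noteq> snd e" using m len by (simp add: edge_def nth_eq_iff_index_eq)
 then obtain i where i: "fst e $ i \<noteq> snd e $ i" by (auto simp: vec_eq_iff)
 obtain j :: 2 where j: "i \<noteq> j"
 proof (cases "i = 1")
  case True then show ?thesis using that[of 2] by simp
 next
  case False then show ?thesis using that[of 1] by simp
 qed
 let ?R = "\<Union> (seg_set ` (edges K - {e}))"
 have "?R \<inter> seg_set e \<subseteq> {fst e, snd e}"
 proof -
  have "seg_set e \<inter> seg_set e' \<subseteq> {fst e, snd e}" if "e' \<in> edges K" "e' \<noteq> e" for e'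
   using K e that unfolding simple_polygon_def pairwise_def by blast
  then show ?thesis by blast
 qed
 then have "straight_edge (region K) e ?R i j"
  using region_properties[of K] closed_edges[of "edges K - {e}" K] e i j
  by unfold_locales auto
 then show ?thesis by blast
qed

lemma V_localD:
 assumes "v \<in> V_local k K"
 shows "v \<in> Hdiv (region K)" "v \<in> Hcurl (region K)" "v \<in> L2 (region K)"
 using assms by (auto simp: V_local_def Hdiv_def)

lemma V_local_lin:
 assumes v: "v \<in> V_local k K" and w: "w \<in> V_local k K"
 shows "(\<lambda>x. v x + c *\<^sub>R w x) \<in> V_local k K"
proof -
 let ?E = "region K"
 have E: "open ?E" by (rule region_properties)
 note L = V_localD(3)[OF v] V_localD(3)[OF w]
 obtain d d' where d: "d \<in> poly_fun (int k)" "has_weak_div ?E v d" "d' \<in> poly_fun (int k)" "has_weak_div ?E w d'"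
  using v w by (auto simp: V_local_def)
 obtain r r' where r: "r \<in> poly_fun (int k - 1)" "has_weak_curl ?E v r" "r' \<in> poly_fun (int k - 1)" "has_weak_curl ?E w r'"
  using v w by (auto simp: V_local_def)
 note dl = has_weak_div_lin[OF E L(1) d(2) L(2) d(4), of c] and cl = has_weak_curl_lin[OF E L(1) r(2) L(2) r(4), of c]
 have LL: "(\<lambda>x. v x + c *\<^sub>R w x) \<in> L2 ?E" by (intro L2_add L2_scale L)
 have "\<exists>g\<in>poly_fun (int k). has_normal_trace ?E {e} (\<lambda>x. v x + c *\<^sub>R w x) g" if e: "e \<in> edges K" for e
 proof -
  obtain g h where g: "g \<in> poly_fun (int k)" "has_normal_trace ?E {e} v g" "h \<in> poly_fun (int k)" "has_normal_trace ?E {e} w h"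
   using v w e unfolding V_local_def by blast
  show ?thesis
   by (rule bexI) (rule has_normal_trace_lin[OF E g(2,4)], intro poly_fun_add poly_fun_cmult g)
 qed
 moreover have "(\<lambda>x. d x + c * d' x) \<in> poly_fun (int k)" "(\<lambda>x. r x + c * r' x) \<in> poly_fun (int k - 1)"
  by (intro poly_fun_add poly_fun_cmult d r)+
 ultimately show ?thesis using dl cl LL unfolding V_local_def Hdiv_def Hcurl_def by blast
qed

text \<open>Divergence and curl are classical derivatives, which lower the degree, and the trace on a straight edge
 is a constant multiple of a fixed linear combination of the components.\<close>

lemma poly_V_local:
 assumes K: "simple_polygon K" and v: "\<And>l. (\<lambda>x. v x $ l) \<in> poly_fun (int k)"
 shows "v \<in> V_local k K"
proof -
 let ?E = "region K"
 have E: "open ?E" "bounded ?E" by (rule region_properties)+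
 have Es: "?E \<in> sets lebesgue" using E by simp
 have s: "smooth (\<lambda>x. v x $ l)" for l by (rule smooth_poly_fun[OF v])
 note dv = has_weak_div_smooth[OF E s]
 have p: "pd (ax m) (\<lambda>x. v x $ l) \<in> poly_fun (int k - 1)" for l m
  using pd_poly_fun[OF v, of "ax m" l] exhaust_2[of m] by auto
 have p': "pd (ax m) (\<lambda>x. v x $ l) \<in> poly_fun (int k)" for l m by (rule poly_fun_mono[OF _ p]) simp
 have L: "v \<in> L2 ?E" by (rule smooth_vec_L2[OF s Es E(2)])
 have "\<exists>g\<in>poly_fun (int k). has_normal_trace ?E {e} v g" if e: "e \<in> edges K" for e
 proof -
  obtain Rst i j where "straight_edge ?E e Rst i j" using edge_straight[OF K e] by blast
  then interpret straight_edge ?E e Rst i j .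
  obtain \<kappa> where \<kappa>: "has_normal_trace ?E {e} v (\<lambda>x. \<kappa> * N (v x))" using smooth_normal_trace[OF s] by blast
  have "(\<lambda>x. \<kappa> * (v x $ j - (d $ j / d $ i) * v x $ i)) \<in> poly_fun (int k)"
   by (intro poly_fun_cmult poly_fun_diff v)
  then have "(\<lambda>x. \<kappa> * N (v x)) \<in> poly_fun (int k)" by (simp add: N_def mult.commute)
  with \<kappa> show ?thesis by blast
 qed
 moreover have "(\<lambda>x. pd (ax 1) (\<lambda>x. v x $ 1) x + pd (ax 2) (\<lambda>x. v x $ 2) x) \<in> poly_fun (int k)"
  "(\<lambda>x. pd (ax 1) (\<lambda>x. v x $ 2) x - pd (ax 2) (\<lambda>x. v x $ 1) x) \<in> poly_fun (int k - 1)"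
  by (intro poly_fun_add poly_fun_diff p p')+
 ultimately show ?thesis using dv L unfolding V_local_def Hdiv_def Hcurl_def by blast
qed

lemma V_local_cong:
 assumes f: "f \<in> V_local k K" and g: "g \<in> L2 (region K)" and e: "AE x in lebesgue_on (region K). f x = g x"
 shows "g \<in> V_local k K"
 using f has_weak_div_cong[OF region_properties(1) V_localD(3)[OF f] g e] g
 by (simp add: V_local_def Hdiv_def Hcurl_def)

subsection \<open>Degrees of freedom\<close>

lemma div_moment_lin:
 assumes v: "v \<in> V_local k K" and w: "w \<in> V_local k K" and p: "smooth p"
 shows "div_moment K p (\<lambda>x. v x + c *\<^sub>R w x) = div_moment K p v + c * div_moment K p w"
 unfolding div_moment_def
 by (rule weak_div_lin[OF region_properties(1) V_localD(1)[OF v] V_localD(1)[OF w] smooth_L2[OF p]])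
   (simp_all add: region_properties)

lemma curl_moment_lin:
 assumes v: "v \<in> V_local k K" and w: "w \<in> V_local k K" and p: "smooth p"
 shows "curl_moment K p (\<lambda>x. v x + c *\<^sub>R w x) = curl_moment K p v + c * curl_moment K p w"
proof -
 let ?E = "region K"
 have E: "open ?E" "bounded ?E" by (rule region_properties)+
 have "continuous_on UNIV (\<lambda>x. p x *\<^sub>R perp x)"
 proof (intro continuous_on_scaleR smooth_continuous[OF p])
  have "perp = (\<lambda>x. (x $ 2) *\<^sub>R ax 1 - (x $ 1) *\<^sub>R ax 2)"
  proof
   fix x
   have "perp x $ l = ((x $ 2) *\<^sub>R ax 1 - (x $ 1) *\<^sub>R ax 2) $ l" for l
    using exhaust_2[of l] by (auto simp: perp_def vector_2 axis_def)
   then show "perp x = (x $ 2) *\<^sub>R ax 1 - (x $ 1) *\<^sub>R ax 2" by (simp only: vec_eq_iff) blast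
  qed
  then show "continuous_on UNIV perp" by (rule ssubst) (intro continuous_intros)
 qed
 then have L: "(\<lambda>x. p x *\<^sub>R perp x) \<in> L2 ?E" using E by (intro L2_continuous) auto
 show ?thesis unfolding curl_moment_def
  by (simp add: L2_inner_add_left[OF V_localD(3)[OF v] L2_scale[OF V_localD(3)[OF w]] L] L2_inner_scale_left)
qed

lemma edge_moment_lin:
 assumes K: "simple_polygon K" and e: "e \<in> edges K"
  and v: "v \<in> V_local k K" and w: "w \<in> V_local k K" and p: "smooth p"
 shows "edge_moment K e p (\<lambda>x. v x + c *\<^sub>R w x) = edge_moment K e p v + c * edge_moment K e p w"
proof -
 let ?E = "region K"
 obtain Rst i j where "straight_edge ?E e Rst i j" using edge_straight[OF K e] by blast
 then interpret straight_edge ?E e Rst i j .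
 obtain g h where g: "has_normal_trace ?E {e} v g" "has_normal_trace ?E {e} w h"
  using v w e unfolding V_local_def by blast
 have L: "(\<lambda>s. g (seg_pt e s)) \<in> L2 {0..1}" "(\<lambda>s. h (seg_pt e s)) \<in> L2 {0..1}"
  using g by (simp_all add: has_normal_trace_def L2_seg_def)
 show ?thesis unfolding edge_moment_def
  unfolding seg_integral_trace[OF has_normal_trace_lin[OF E(1) g] p] seg_integral_trace[OF g(1) p] seg_integral_trace[OF g(2) p]
  unfolding seg_integral_eq
  by (simp add: L2_inner_add_left[OF L(1) L2_cmult[OF L(2)] smooth_seg_L2[OF p]] L2_inner_cmult_left distrib_left)
qed

section \<open>Integrals over a decomposition\<close>

lemma L2_indicator:
 assumes f: "f \<in> L2 A" and B: "B \<in> sets borel"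
 shows "(\<lambda>x. indicator B x *\<^sub>R f x) \<in> L2 A"
proof -
 have i: "(indicator B :: 'a => real) \<in> borel_measurable (lebesgue_on A)"
  using B by (intro measurable_restrict_space1 measurable_completion) simp
 have m: "(\<lambda>x. indicator B x *\<^sub>R f x) \<in> borel_measurable (lebesgue_on A)"
  by (intro borel_measurable_scaleR i L2_measurable[OF f])
 have "integrable (lebesgue_on A) (\<lambda>x. (norm (indicator B x *\<^sub>R f x))\<^sup>2)"
  by (rule Bochner_Integration.integrable_bound[OF L2_integrable[OF f]])
    (use m in measurable, auto simp: indicator_def)
 with m show ?thesis by (simp add: L2_def)
qed

text \<open>A nonempty open set is not negligible.\<close>

lemma AE_open_witness:
 fixes U :: "'a::euclidean_space set"
 assumes S: "S \<in> sets lebesgue" and P: "AE x in lebesgue_on S. P x" and U: "open U" "U \<subseteq> S" "U \<noteq> {}"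
 shows "\<exists>x\<in>U. P x"
proof (rule ccontr)
 assume "\<not> (\<exists>x\<in>U. P x)"
 then have n: "\<not> P x" if "x \<in> U" for x using that by blast
 have "AE x in lebesgue. x \<in> S \<longrightarrow> P x" using P unfolding AE_lebesgue_on_iff[OF S] .
 then have "AE x in lebesgue. x \<notin> U" by eventually_elim (use n U(2) in auto)
 then have "U \<in> null_sets lebesgue" using U(1) by (subst AE_iff_null_sets) auto
 then have "negligible U" by (simp add: negligible_iff_null_sets)
 then show False using open_not_negligible[OF U(1,3)] by contradiction
qed

lemma L2_inner_empty: "L2_inner {} f g = 0"
 by (simp add: L2_inner_def integral_lebesgue_on(1))

locale mesh_domain =
 fixes \<Omega> :: "pt set" and \<T> :: mesh
 assumes \<Omega>: "open \<Omega>" "bounded \<Omega>" and dec: "decomposition \<Omega> \<T>"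
begin

definition skeleton :: "pt set" where
 "skeleton = (\<Union>K\<in>\<T>. \<Union> (seg_set ` edges K))"

lemma finite_mesh: "finite \<T>" using dec by (simp add: decomposition_def)

lemma mesh_polygon: "K \<in> \<T> ==> simple_polygon K"
 and region_subset: "K \<in> \<T> ==> region K \<subseteq> \<Omega>"
 using dec by (simp_all add: decomposition_def)

lemma region_disjoint: "K \<in> \<T> ==> K' \<in> \<T> ==> x \<in> region K ==> x \<in> region K' ==> K' = K"
 using dec unfolding decomposition_def pairwise_def by blast

lemma \<Omega>_sets: "\<Omega> \<in> sets lebesgue" using \<Omega> by simp

lemma region_sets: "region K \<in> sets lebesgue" "region K \<in> sets borel"
 using region_properties(1)[of K] by simp_all

lemma skeleton_closed: "closed skeleton"
 unfolding skeleton_def using finite_mesh closed_edges[OF order_refl] by (intro closed_UN) auto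

lemma skeleton_negligible: "negligible skeleton"
proof -
 have "negligible (seg_set e)" if K: "K \<in> \<T>" "e \<in> edges K" for K e
 proof -
  obtain Rst i j where "straight_edge (region K) e Rst i j" using edge_straight[OF mesh_polygon[OF K(1)] K(2)] by blast
  then show ?thesis by (rule straight_edge.negligible_edge)
 qed
 then have "negligible (\<Union> (seg_set ` edges K))" if "K \<in> \<T>" for K
  using that finite_edges[of K] by (intro negligible_Union) auto
 then show ?thesis unfolding skeleton_def using finite_mesh by (intro negligible_Union) auto
qed

lemma covered:
 assumes "x \<in> \<Omega>" "x \<notin> skeleton" obtains K where "K \<in> \<T>" "x \<in> region K"
proof -
 have "x \<in> closure \<Omega>" using assms closure_subset by blast
 then obtain K where K: "K \<in> \<T>" "x \<in> closure (region K)" using dec by (auto simp: decomposition_def)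
 have "x \<in> region K"
 proof (rule ccontr)
  assume "x \<notin> region K"
  then have "x \<in> frontier (region K)" using K region_properties(1)[of K] by (simp add: frontier_def interior_open)
  then have "x \<in> skeleton" using region_properties(3)[of K] K unfolding skeleton_def by blast
  with assms show False by simp
 qed
 with K that show ?thesis by blast
qed

lemma AE_skeleton: "AE x in lebesgue. x \<notin> skeleton"
 using skeleton_negligible unfolding negligible_iff_null_sets by (rule AE_not_in)

lemma mesh_sum:
 fixes g :: "polygon => 'b::real_vector"
 assumes "K \<in> \<T>" "x \<in> region K"
 shows "(\<Sum>K'\<in>\<T>. indicator (region K') x *\<^sub>R g K') = g K"
proof -
 have "(\<Sum>K'\<in>\<T>. indicator (region K') x *\<^sub>R g K') = (\<Sum>K'\<in>\<T>. if K = K' then g K' else 0)"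
 proof (rule sum.cong[OF refl])
  fix K' assume K': "K' \<in> \<T>"
  show "indicator (region K') x *\<^sub>R g K' = (if K = K' then g K' else 0)"
  proof (cases "K = K'")
   case True then show ?thesis using assms(2) by simp
  next
   case False
   then have "x \<notin> region K'" using region_disjoint[OF assms(1) K' assms(2)] by blast
   then show ?thesis using False by simp
  qed
 qed
 also have "\<dots> = g K" using assms finite_mesh by simp
 finally show ?thesis .
qed

lemma L2_region: "f \<in> L2 \<Omega> ==> K \<in> \<T> ==> f \<in> L2 (region K)"
 by (rule L2_subset[OF \<Omega>_sets region_sets(1) region_subset])

lemma AE_region: "AE x in lebesgue_on \<Omega>. P x ==> K \<in> \<T> ==> AE x in lebesgue_on (region K). P x"
 by (rule AE_subset[OF \<Omega>_sets region_sets(1) region_subset])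

text \<open>The points of \<open>\<Omega>\<close> outside the regions lie on the edges, which are negligible.\<close>

lemma L2_inner_mesh:
 fixes f g :: "pt => 'b::euclidean_space"
 assumes f: "f \<in> L2 \<Omega>" and g: "g \<in> L2 \<Omega>"
 shows "L2_inner \<Omega> f g = (\<Sum>K\<in>\<T>. L2_inner (region K) f g)"
proof -
 let ?I = "\<lambda>A x. indicator A x *\<^sub>R (f x \<bullet> g x)"
 have i\<Omega>: "integrable lebesgue (?I \<Omega>)"
  using L2_integrable_inner[OF f g] unfolding integral_lebesgue_on(2)[OF \<Omega>_sets] .
 have iK: "integrable lebesgue (?I (region K))" if "K \<in> \<T>" for K
  using L2_integrable_inner[OF L2_region[OF f that] L2_region[OF g that]]
  unfolding integral_lebesgue_on(2)[OF region_sets(1)] .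
 have "L2_inner \<Omega> f g = (\<integral>x. ?I \<Omega> x \<partial>lebesgue)"
  unfolding L2_inner_def integral_lebesgue_on(1)[OF \<Omega>_sets] ..
 also have "\<dots> = (\<integral>x. (\<Sum>K\<in>\<T>. ?I (region K) x) \<partial>lebesgue)"
 proof (rule integral_cong_AE)
  show "?I \<Omega> \<in> borel_measurable lebesgue" using i\<Omega> by (rule borel_measurable_integrable)
  show "(\<lambda>x. \<Sum>K\<in>\<T>. ?I (region K) x) \<in> borel_measurable lebesgue"
   by (intro borel_measurable_sum borel_measurable_integrable iK)
  show "AE x in lebesgue. ?I \<Omega> x = (\<Sum>K\<in>\<T>. ?I (region K) x)"
   using AE_skeleton
  proof eventually_elim
   case (elim x)
   show ?case
   proof (cases "x \<in> \<Omega>")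
    case True
    then obtain K where K: "K \<in> \<T>" "x \<in> region K" using elim by (rule covered)
    show ?thesis using True mesh_sum[OF K, of "\<lambda>_. f x \<bullet> g x"] by simp
   next
    case False
    then have "x \<notin> region K" if "K \<in> \<T>" for K using that region_subset by blast
    then show ?thesis using False by simp
   qed
  qed
 qed
 also have "\<dots> = (\<Sum>K\<in>\<T>. \<integral>x. ?I (region K) x \<partial>lebesgue)" by (rule Bochner_Integration.integral_sum[OF iK])
 also have "\<dots> = (\<Sum>K\<in>\<T>. L2_inner (region K) f g)"
  unfolding L2_inner_def integral_lebesgue_on(1)[OF region_sets(1)] ..
 finally show ?thesis .
qed

lemma L2_norm_mesh: "f \<in> L2 \<Omega> ==> (L2_norm \<Omega> f)\<^sup>2 = (\<Sum>K\<in>\<T>. (L2_norm (region K) f)\<^sup>2)"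
 by (simp add: L2_norm_power2 L2_inner_mesh)

lemma L2_norm_region_le: "f \<in> L2 \<Omega> ==> K \<in> \<T> ==> L2_norm (region K) f \<le> L2_norm \<Omega> f"
 by (rule power2_le_imp_le[OF _ L2_norm_nonneg]) (auto simp: L2_norm_mesh intro!: member_le_sum finite_mesh)

lemma piecewise_constant_weight:
 fixes q r :: "pt => real"
 assumes \<alpha>: "\<And>K x. K \<in> \<T> ==> x \<in> region K ==> \<alpha> x = a K" and q: "q \<in> L2 \<Omega>"
 shows "(\<lambda>x. \<alpha> x * q x) \<in> L2 \<Omega>"
  and "r \<in> L2 \<Omega> ==> L2_inner \<Omega> (\<lambda>x. \<alpha> x * q x) r = (\<Sum>K\<in>\<T>. a K * L2_inner (region K) q r)"
proof -
 have "(\<lambda>x. \<Sum>K\<in>\<T>. a K * (indicator (region K) x *\<^sub>R q x)) \<in> L2 \<Omega>"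
  by (intro L2_sum L2_cmult L2_indicator finite_mesh region_sets q)
 moreover have "AE x in lebesgue_on \<Omega>. (\<Sum>K\<in>\<T>. a K * (indicator (region K) x *\<^sub>R q x)) = \<alpha> x * q x"
  unfolding AE_lebesgue_on_iff[OF \<Omega>_sets] using AE_skeleton
 proof eventually_elim
  case (elim x)
  show ?case
  proof
   assume "x \<in> \<Omega>"
   then obtain K where K: "K \<in> \<T>" "x \<in> region K" using elim by (rule covered)
   show "(\<Sum>K\<in>\<T>. a K * (indicator (region K) x *\<^sub>R q x)) = \<alpha> x * q x"
    using mesh_sum[OF K, of "\<lambda>K. a K * q x"] \<alpha>[OF K] by (simp add: mult.left_commute)
  qed
 qed
 ultimately show L: "(\<lambda>x. \<alpha> x * q x) \<in> L2 \<Omega>" by (rule L2_cong_AE[OF \<Omega>_sets])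
 assume r: "r \<in> L2 \<Omega>"
 have "L2_inner (region K) (\<lambda>x. \<alpha> x * q x) r = a K * L2_inner (region K) q r" if K: "K \<in> \<T>" for K
 proof -
  have "L2_inner (region K) (\<lambda>x. \<alpha> x * q x) r = L2_inner (region K) (\<lambda>x. a K * q x) r"
   unfolding L2_inner_def using \<alpha>[OF K] by (intro Bochner_Integration.integral_cong) simp_all
  then show ?thesis by (simp only: L2_inner_cmult_left)
 qed
 then show "L2_inner \<Omega> (\<lambda>x. \<alpha> x * q x) r = (\<Sum>K\<in>\<T>. a K * L2_inner (region K) q r)"
  by (simp add: L2_inner_mesh[OF L r])
qed

end

section \<open>Local projections and the stabilised form\<close>

lemma poly_fun_L2: "p \<in> poly_fun n ==> p \<in> L2 (region K)"
 by (intro smooth_L2 smooth_poly_fun) (use region_properties(1,2)[of K] in auto)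

lemma proj_lin:
 assumes K: "region K \<noteq> {}" and f: "f \<in> L2 (region K)" and g: "g \<in> L2 (region K)"
 shows "proj k K (\<lambda>x. f x + c * g x) = (\<lambda>x. proj k K f x + c * proj k K g x)"
proof (rule proj_characterisation(3)[OF region_properties(1,2) K])
 note F = proj_characterisation[OF region_properties(1,2) K f, where k = k]
  and G = proj_characterisation[OF region_properties(1,2) K g, where k = k]
 show "(\<lambda>x. f x + c * g x) \<in> L2 (region K)" by (intro L2_add L2_cmult f g)
 show "(\<lambda>x. proj k K f x + c * proj k K g x) \<in> poly_fun (int k)"
  by (intro poly_fun_add poly_fun_cmult F(1) G(1))
 fix q assume q: "q \<in> poly_fun (int k)"
 note L = poly_fun_L2[OF q, of K] L2_diff[OF f poly_fun_L2[OF F(1)]] L2_diff[OF g poly_fun_L2[OF G(1)]]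
 have "(\<lambda>x. f x + c * g x - (proj k K f x + c * proj k K g x)) = (\<lambda>x. (f x - proj k K f x) + c * (g x - proj k K g x))"
  by (simp add: algebra_simps)
 then show "L2_inner (region K) (\<lambda>x. f x + c * g x - (proj k K f x + c * proj k K g x)) q = 0"
  by (simp only: L2_inner_add_left[OF L(2) L2_cmult[OF L(3)] L(1)] L2_inner_cmult_left F(2)[OF q] G(2)[OF q])
qed

lemma proj_poly:
 assumes K: "region K \<noteq> {}" and p: "p \<in> poly_fun (int k)"
 shows "proj k K p = p"
 by (rule proj_characterisation(3)[OF region_properties(1,2) K poly_fun_L2[OF p] p]) (simp add: L2_inner_zero)

lemma proj_cong:
 assumes K: "region K \<noteq> {}" and f: "f \<in> L2 (region K)" and g: "g \<in> L2 (region K)"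
  and e: "AE x in lebesgue_on (region K). f x = g x"
 shows "proj k K f = proj k K g"
proof (rule proj_characterisation(3)[OF region_properties(1,2) K f])
 note G = proj_characterisation[OF region_properties(1,2) K g, where k = k]
 show "proj k K g \<in> poly_fun (int k)" by (rule G(1))
 fix q assume q: "q \<in> poly_fun (int k)"
 have "L2_inner (region K) (\<lambda>x. f x - proj k K g x) q = L2_inner (region K) (\<lambda>x. g x - proj k K g x) q"
  by (rule L2_inner_cong_AE) (use e in \<open>auto intro!: L2_diff f g poly_fun_L2[OF G(1)] poly_fun_L2[OF q]\<close>)
 then show "L2_inner (region K) (\<lambda>x. f x - proj k K g x) q = 0" by (simp only: G(2)[OF q])
qed

lemma proj_vec_nth: "(\<lambda>x. proj_vec k K v x $ l) = proj k K (\<lambda>x. v x $ l)"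
 by (simp add: proj_vec_def)

lemma proj_vec_poly:
 assumes "region K \<noteq> {}" "v \<in> L2 (region K)" shows "(\<lambda>x. proj_vec k K v x $ l) \<in> poly_fun (int k)"
 unfolding proj_vec_nth by (rule proj_characterisation(1)[OF region_properties(1,2) assms(1) L2_vec_nth[OF assms(2)]])

lemma proj_vec_L2: "region K \<noteq> {} ==> v \<in> L2 (region K) ==> proj_vec k K v \<in> L2 (region K)"
 by (rule L2_vecI) (rule poly_fun_L2[OF proj_vec_poly])

lemma proj_vec_eqI:
 assumes "\<And>l. proj k K (\<lambda>x. v x $ l) = (\<lambda>x. w x $ l)"
 shows "proj_vec k K v = w"
proof
 fix x show "proj_vec k K v x = w x"
  unfolding vec_eq_iff proj_vec_def by (simp add: fun_cong[OF assms])
qed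

lemma proj_vec_lin:
 assumes K: "region K \<noteq> {}" and v: "v \<in> L2 (region K)" and w: "w \<in> L2 (region K)"
 shows "proj_vec k K (\<lambda>x. v x + c *\<^sub>R w x) = (\<lambda>x. proj_vec k K v x + c *\<^sub>R proj_vec k K w x)"
 by (rule proj_vec_eqI) (simp add: proj_lin[OF K L2_vec_nth[OF v] L2_vec_nth[OF w]] proj_vec_def)

lemma proj_vec_cong:
 assumes K: "region K \<noteq> {}" and v: "v \<in> L2 (region K)" and w: "w \<in> L2 (region K)"
  and e: "AE x in lebesgue_on (region K). v x = w x"
 shows "proj_vec k K v = proj_vec k K w"
proof (rule proj_vec_eqI)
 fix l show "proj k K (\<lambda>x. v x $ l) = (\<lambda>x. proj_vec k K w x $ l)"
  unfolding proj_vec_nth by (rule proj_cong[OF K L2_vec_nth[OF v] L2_vec_nth[OF w]]) (use e in auto)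
qed

lemma proj_vec_idem:
 assumes K: "region K \<noteq> {}" and v: "v \<in> L2 (region K)"
 shows "proj_vec k K (proj_vec k K v) = proj_vec k K v"
proof (rule proj_vec_eqI)
 fix l show "proj k K (\<lambda>x. proj_vec k K v x $ l) = (\<lambda>x. proj_vec k K v x $ l)"
  by (rule proj_poly[OF K proj_vec_poly[OF K v]])
qed

lemma proj_vec_orthogonal:
 assumes K: "region K \<noteq> {}" and v: "v \<in> L2 (region K)"
 shows "L2_inner (region K) (\<lambda>x. v x - proj_vec k K v x) (proj_vec k K v) = 0"
proof -
 have "L2_inner (region K) (\<lambda>x. v x $ l - proj k K (\<lambda>x. v x $ l) x) (proj k K (\<lambda>x. v x $ l)) = 0" for l
  by (intro proj_characterisation(2) proj_characterisation(1) region_properties K L2_vec_nth v)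
 then show ?thesis
  unfolding L2_inner_vec[OF L2_diff[OF v proj_vec_L2[OF K v]] proj_vec_L2[OF K v]] by (simp add: proj_vec_def)
qed

lemma proj_vec_pythagoras:
 assumes K: "region K \<noteq> {}" and v: "v \<in> L2 (region K)"
 shows "(L2_norm (region K) v)\<^sup>2 = (L2_norm (region K) (\<lambda>x. v x - proj_vec k K v x))\<^sup>2 + (L2_norm (region K) (proj_vec k K v))\<^sup>2"
 by (rule L2_pythagoras[OF v proj_vec_L2[OF K v] proj_vec_orthogonal[OF K v]])

text \<open>The part of a field that the stabilisation sees.\<close>

definition null_part :: "nat => polygon => (pt => pt) => pt => pt" where
 "null_part k K v x = v x - proj_vec k K v x"

lemma null_part:
 assumes P: "simple_polygon K" and K: "region K \<noteq> {}" and v: "v \<in> V_local k K"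
 shows "null_part k K v \<in> V_local k K" and "proj_vec k K (null_part k K v) x = 0"
proof -
 have vL: "v \<in> L2 (region K)" by (rule V_localD[OF v])
 have n: "null_part k K v = (\<lambda>x. v x + (-1) *\<^sub>R proj_vec k K v x)" by (simp add: null_part_def[abs_def])
 show "null_part k K v \<in> V_local k K" unfolding n
  by (intro V_local_lin v poly_V_local[OF P] proj_vec_poly[OF K vL])
 show "proj_vec k K (null_part k K v) x = 0" unfolding n
  by (simp only: proj_vec_lin[OF K vL proj_vec_L2[OF K vL]] proj_vec_idem[OF K vL]) simp
qed

lemma null_part_lin:
 assumes K: "region K \<noteq> {}" and v: "v \<in> V_local k K" and w: "w \<in> V_local k K"
 shows "null_part k K (\<lambda>x. v x + c *\<^sub>R w x) = (\<lambda>x. null_part k K v x + c *\<^sub>R null_part k K w x)"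
 unfolding null_part_def[abs_def] proj_vec_lin[OF K V_localD(3)[OF v] V_localD(3)[OF w]]
 by (simp add: algebra_simps)

lemma m_local_eq: "m_local k \<B> K v w = L2_inner (region K) (proj_vec k K v) (proj_vec k K w)
  + (diam K)\<^sup>2 * dof_product \<B> K (null_part k K v) (null_part k K w)"
 by (simp add: m_local_def null_part_def[abs_def])

text \<open>A polygon whose region were empty would have diameter zero and contribute to none of the sums.\<close>

lemma m_local_empty: "region K = {} ==> m_local k \<B> K v w = 0"
 by (simp add: m_local_eq diam_def L2_inner_empty)

lemma dof_product_commute: "dof_product \<B> K v w = dof_product \<B> K w v"
 by (simp add: dof_product_def mult.commute)

lemma dof_product_nonneg: "0 \<le> dof_product \<B> K v v"
 unfolding dof_product_def by (intro add_nonneg_nonneg sum_nonneg) simp_all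

lemma m_local_commute: "m_local k \<B> K v w = m_local k \<B> K w v"
 by (simp add: m_local_eq dof_product_commute[of \<B> K "null_part k K v"] L2_inner_commute[of _ "proj_vec k K v"])

lemma m_local_nonneg: "0 \<le> m_local k \<B> K v v"
 unfolding m_local_eq by (intro add_nonneg_nonneg mult_nonneg_nonneg dof_product_nonneg L2_inner_self_nonneg) simp

lemma is_basis_onD:
 assumes "is_basis_on A B P" shows "finite B" "B \<subseteq> P"
 by (rule conjunct1[OF assms[unfolded is_basis_on_def]],
   rule conjunct1[OF conjunct2[OF assms[unfolded is_basis_on_def]]])

locale mesh_dofs = mesh_domain +
 fixes k :: nat and \<B> :: dof_bases and C1 C2 :: real
 assumes dofs: "dof_choice k \<T> \<B>" and scaled: "properly_scaled k \<T> C1 C2 \<B>" and C1: "C1 > 0" and C2: "C2 > 0"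
begin

lemma basis_smooth:
 assumes K: "K \<in> \<T>"
 shows "p \<in> div_basis \<B> K ==> smooth p" "p \<in> curl_basis \<B> K ==> smooth p"
  "e \<in> edges K ==> p \<in> edge_basis \<B> K e ==> smooth p"
 and basis_finite: "finite (div_basis \<B> K)" "finite (curl_basis \<B> K)" "e \<in> edges K ==> finite (edge_basis \<B> K e)"
proof -
 have b: "is_basis_on (region K) (insert (\<lambda>_. 1) (div_basis \<B> K)) (poly_fun (int k))"
  "is_basis_on (region K) (curl_basis \<B> K) (poly_fun (int k - 1))"
  "e \<in> edges K ==> is_basis_on (seg_set e) (edge_basis \<B> K e) (poly_fun (int k))"
  using dofs K unfolding dof_choice_def by blast+
 note d1 = is_basis_onD[OF b(1)] and d2 = is_basis_onD[OF b(2)] and d3 = is_basis_onD[OF b(3)]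
 show "smooth p" if "p \<in> div_basis \<B> K" by (rule smooth_poly_fun[OF subsetD[OF d1(2)]]) (simp add: that)
 show "smooth p" if "p \<in> curl_basis \<B> K" by (rule smooth_poly_fun[OF subsetD[OF d2(2) that]])
 show "smooth p" if "e \<in> edges K" "p \<in> edge_basis \<B> K e" by (rule smooth_poly_fun[OF subsetD[OF d3(2)[OF that(1)] that(2)]])
 show "finite (div_basis \<B> K)" using d1(1) by simp
 show "finite (curl_basis \<B> K)" by (rule d2(1))
 show "finite (edge_basis \<B> K e)" if "e \<in> edges K" by (rule d3(1)[OF that])
qed

lemma dof_product_lin:
 assumes K: "K \<in> \<T>" and v: "v \<in> V_local k K" and w: "w \<in> V_local k K"
 shows "dof_product \<B> K (\<lambda>x. v x + c *\<^sub>R w x) z = dof_product \<B> K v z + c * dof_product \<B> K w z"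
proof -
 have 1: "(\<Sum>p\<in>div_basis \<B> K. div_moment K p (\<lambda>x. v x + c *\<^sub>R w x) * div_moment K p z)
   = (\<Sum>p\<in>div_basis \<B> K. div_moment K p v * div_moment K p z) + c * (\<Sum>p\<in>div_basis \<B> K. div_moment K p w * div_moment K p z)"
  unfolding sum_distrib_left sum.distrib[symmetric]
  by (rule sum.cong[OF refl], subst div_moment_lin[OF v w basis_smooth(1)[OF K]], assumption) (simp add: algebra_simps)
 have 2: "(\<Sum>p\<in>curl_basis \<B> K. curl_moment K p (\<lambda>x. v x + c *\<^sub>R w x) * curl_moment K p z)
   = (\<Sum>p\<in>curl_basis \<B> K. curl_moment K p v * curl_moment K p z) + c * (\<Sum>p\<in>curl_basis \<B> K. curl_moment K p w * curl_moment K p z)"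
  unfolding sum_distrib_left sum.distrib[symmetric]
  by (rule sum.cong[OF refl], subst curl_moment_lin[OF v w basis_smooth(2)[OF K]], assumption) (simp add: algebra_simps)
 have 3: "(\<Sum>e\<in>edges K. \<Sum>p\<in>edge_basis \<B> K e. edge_moment K e p (\<lambda>x. v x + c *\<^sub>R w x) * edge_moment K e p z)
   = (\<Sum>e\<in>edges K. \<Sum>p\<in>edge_basis \<B> K e. edge_moment K e p v * edge_moment K e p z)
    + c * (\<Sum>e\<in>edges K. \<Sum>p\<in>edge_basis \<B> K e. edge_moment K e p w * edge_moment K e p z)"
  unfolding sum_distrib_left sum.distrib[symmetric]
  by (intro sum.cong refl, subst edge_moment_lin[OF mesh_polygon[OF K] _ v w basis_smooth(3)[OF K]]) (simp_all add: algebra_simps)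
 show ?thesis unfolding dof_product_def 1 2 3 by (simp add: algebra_simps)
qed

lemma m_local_lin:
 assumes K: "K \<in> \<T>" and v: "v \<in> V_local k K" and w: "w \<in> V_local k K" and z: "z \<in> V_local k K"
 shows "m_local k \<B> K (\<lambda>x. v x + c *\<^sub>R w x) z = m_local k \<B> K v z + c * m_local k \<B> K w z"
proof (cases "region K = {}")
 case True then show ?thesis by (simp add: m_local_empty)
next
 case False
 note L = V_localD(3)[OF v] V_localD(3)[OF w] V_localD(3)[OF z]
 note PL = proj_vec_L2[OF False L(1), of k] proj_vec_L2[OF False L(2), of k] proj_vec_L2[OF False L(3), of k]
 show ?thesis
  unfolding m_local_eq null_part_lin[OF False v w] proj_vec_lin[OF False L(1,2)]
   dof_product_lin[OF K null_part(1)[OF mesh_polygon[OF K] False v] null_part(1)[OF mesh_polygon[OF K] False w]]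
   L2_inner_add_left[OF PL(1) L2_scale[OF PL(2)] PL(3)] L2_inner_scale_left
  by (simp add: algebra_simps)
qed

lemma dof_null_part:
 assumes K: "K \<in> \<T>" "region K \<noteq> {}" and v: "v \<in> V_local k K"
 shows "(diam K)\<^sup>2 * dof_product \<B> K (null_part k K v) (null_part k K v) \<le> C2 * (L2_norm (region K) (null_part k K v))\<^sup>2"
 using scaled K null_part[OF mesh_polygon[OF K(1)] K(2) v] unfolding properly_scaled_def by blast

lemma m_local_bound:
 assumes K: "K \<in> \<T>" and v: "v \<in> V_local k K"
 shows "m_local k \<B> K v v \<le> (1 + C2) * (L2_norm (region K) v)\<^sup>2"
proof (cases "region K = {}")
 case True then show ?thesis using C2 by (simp add: m_local_empty)
next
 case False
 let ?a = "(L2_norm (region K) (null_part k K v))\<^sup>2" and ?b = "(L2_norm (region K) (proj_vec k K v))\<^sup>2"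
 have n: "(L2_norm (region K) v)\<^sup>2 = ?a + ?b"
  unfolding null_part_def[abs_def] by (rule proj_vec_pythagoras[OF False V_localD(3)[OF v]])
 have "m_local k \<B> K v v \<le> ?b + C2 * ?a"
  using dof_null_part[OF K False v] by (simp add: m_local_eq L2_norm_power2)
 moreover have "0 \<le> ?a" "0 \<le> C2 * ?b" using C2 by simp_all
 moreover have "(1 + C2) * (?a + ?b) = ?a + ?b + C2 * ?a + C2 * ?b" by (simp add: algebra_simps)
 ultimately show ?thesis unfolding n by linarith
qed

abbreviation Vk :: "(pt => pt) set" where
 "Vk \<equiv> {v \<in> L2 \<Omega>. \<forall>K\<in>\<T>. v \<in> V_local k K}"

lemma Vk_lin: "v \<in> Vk ==> w \<in> Vk ==> (\<lambda>x. v x + c *\<^sub>R w x) \<in> Vk"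
 using V_local_lin by (auto intro!: L2_add L2_scale)

lemma m_h_commute: "m_h k \<B> \<T> v w = m_h k \<B> \<T> w v"
 unfolding m_h_def by (rule sum.cong[OF refl m_local_commute])

lemma m_h_nonneg: "0 \<le> m_h k \<B> \<T> v v"
 unfolding m_h_def by (intro sum_nonneg m_local_nonneg)

lemma m_h_lin:
 assumes "v \<in> Vk" "w \<in> Vk" "z \<in> Vk"
 shows "m_h k \<B> \<T> (\<lambda>x. v x + c *\<^sub>R w x) z = m_h k \<B> \<T> v z + c * m_h k \<B> \<T> w z"
 unfolding m_h_def sum_distrib_left sum.distrib[symmetric]
 by (rule sum.cong[OF refl], rule m_local_lin) (use assms in auto)

lemma m_h_self_bound:
 assumes v: "v \<in> Vk" shows "m_h k \<B> \<T> v v \<le> (1 + C2) * (L2_norm \<Omega> v)\<^sup>2"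
proof -
 have L: "v \<in> L2 \<Omega>" using v by simp
 show ?thesis unfolding m_h_def L2_norm_mesh[OF L] sum_distrib_left
  by (intro sum_mono m_local_bound) (use v in auto)
qed

lemma nonneg_quadratic:
 fixes A B D :: real
 assumes q: "\<And>c. 0 \<le> A + 2 * c * B + c\<^sup>2 * D" and D: "0 \<le> D"
 shows "B\<^sup>2 \<le> A * D"
proof (cases "D = 0")
 case True
 have "B = 0"
 proof (rule ccontr)
  assume "B \<noteq> 0"
  then have "2 * (- (A + 1) / (2 * B)) * B = - (A + 1)" by simp
  with q[of "- (A + 1) / (2 * B)"] True show False by simp
 qed
 then show ?thesis using True by simp
next
 case False
 then have D: "D > 0" using D by simp
 have "0 \<le> A + 2 * (- B / D) * B + (- B / D)\<^sup>2 * D" by (rule q)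
 also have "\<dots> = A - B\<^sup>2 / D" using D by (simp add: field_simps power2_eq_square)
 finally show ?thesis using D by (simp add: field_simps)
qed

text \<open>The Cauchy--Schwarz inequality for the positive semidefinite form \<open>m_h\<close>, combined with the upper bound
 for the scaled stabilisation.\<close>

lemma m_h_bound:
 assumes v: "v \<in> Vk" and w: "w \<in> Vk"
 shows "\<bar>m_h k \<B> \<T> v w\<bar> \<le> (1 + C2) * L2_norm \<Omega> v * L2_norm \<Omega> w"
proof -
 let ?m = "m_h k \<B> \<T>"
 have "0 \<le> ?m v v + 2 * c * ?m v w + c\<^sup>2 * ?m w w" for c
 proof -
  let ?z = "\<lambda>x. v x + c *\<^sub>R w x"
  note z = Vk_lin[OF v w, of c]
  have "?m ?z ?z = ?m v ?z + c * ?m w ?z" by (rule m_h_lin[OF v w z])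
  also have "\<dots> = (?m v v + c * ?m w v) + c * (?m v w + c * ?m w w)"
   by (simp only: m_h_commute[of v ?z] m_h_commute[of w ?z] m_h_lin[OF v w v] m_h_lin[OF v w w])
  also have "\<dots> = ?m v v + 2 * c * ?m v w + c\<^sup>2 * ?m w w"
   by (simp only: m_h_commute[of w v]) (simp add: algebra_simps power2_eq_square)
  finally show ?thesis using m_h_nonneg[of ?z] by simp
 qed
 then have "(?m v w)\<^sup>2 \<le> ?m v v * ?m w w" by (rule nonneg_quadratic[OF _ m_h_nonneg])
 also have "\<dots> \<le> ((1 + C2) * (L2_norm \<Omega> v)\<^sup>2) * ((1 + C2) * (L2_norm \<Omega> w)\<^sup>2)"
  using C2 by (intro mult_mono m_h_self_bound v w m_h_nonneg) simp
 also have "\<dots> = ((1 + C2) * L2_norm \<Omega> v * L2_norm \<Omega> w)\<^sup>2" by (simp add: power2_eq_square algebra_simps)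
 finally show ?thesis
  using C2 by (intro power2_le_imp_le[of "\<bar>_\<bar>"]) (auto intro!: mult_nonneg_nonneg L2_norm_nonneg)
qed

lemma moments_zero:
 assumes f: "f \<in> L2 (region K)" and z: "\<And>i j. i + j \<le> k ==> L2_inner (region K) f (mono2 i j) = 0"
  and q: "q \<in> poly_fun (int k)"
 shows "L2_inner (region K) f q = 0"
 using q
proof (induction rule: poly_fun_induct)
 case zero show ?case by (rule L2_inner_zero)
next
 case (mono i j c q)
 have m: "mono2 i j \<in> L2 (region K)" by (rule poly_fun_L2[OF poly_fun_mono2[OF order_refl]])
 have "i + j \<le> k" using mono(1) by simp
 then show ?case
  using L2_inner_add_right[OF L2_cmult[OF m] poly_fun_L2[OF mono(2)] f, of c] mono(3) z
  by (simp add: L2_inner_cmult_right)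
qed

lemma separating:
 assumes v: "v \<in> V_local k K" and K: "K \<in> \<T>" "region K \<noteq> {}"
  and mo: "\<And>l i j. i + j \<le> k ==> L2_inner (region K) (\<lambda>x. v x $ l) (mono2 i j) = 0"
  and d: "dof_product \<B> K v v = 0"
 shows "L2_norm (region K) v = 0"
proof -
 have "proj k K (\<lambda>x. v x $ l) = (\<lambda>x. (0::pt) $ l)" for l
  using moments_zero[OF L2_vec_nth[OF V_localD(3)[OF v]] mo]
  by (intro proj_characterisation(3) region_properties K L2_vec_nth[OF V_localD(3)[OF v]])
    (simp_all add: poly_fun_zero)
 then have "proj_vec k K v = (\<lambda>x. 0)" by (rule proj_vec_eqI)
 then have "C1 * (L2_norm (region K) v)\<^sup>2 \<le> (diam K)\<^sup>2 * dof_product \<B> K v v"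
  using scaled K v unfolding properly_scaled_def by simp
 then have "(L2_norm (region K) v)\<^sup>2 \<le> 0" using C1 d by (simp add: mult_le_0_iff)
 then show ?thesis by simp
qed

text \<open>If the polynomial moments of a field vanish, its projection is zero and the lower bound for the scaled
 stabilisation applies; if moreover all degrees of freedom vanish, so does the field.\<close>

lemma proximal_subspace:
 assumes X: "X \<subseteq> Vk" and X0: "(\<lambda>x. 0) \<in> X"
  and lin: "\<And>f g c. f \<in> X ==> g \<in> X ==> (\<lambda>x. f x + c *\<^sub>R g x) \<in> X"
 shows "proximal \<Omega> X"
proof -
 \<comment> \<open>projections onto polynomials are unique on nonempty regions only\<close>
 define T' where "T' = {K \<in> \<T>. region K \<noteq> {}}"
 define J :: "((pt => pt) => real) set" where "J = (\<Union>K\<in>T'.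
  (\<lambda>(l, i, j) v. L2_inner (region K) (\<lambda>x. v x $ l) (mono2 i j)) ` (UNIV \<times> {..k} \<times> {..k})
  \<union> div_moment K ` div_basis \<B> K \<union> curl_moment K ` curl_basis \<B> K
  \<union> (\<Union>e\<in>edges K. edge_moment K e ` edge_basis \<B> K e))"
 show ?thesis
 proof (rule proximal_functionals[where J = J and \<Lambda> = "\<lambda>j. j"])
  show "finite J" unfolding J_def T'_def
   using finite_mesh basis_finite finite_edges by auto
  show "X \<subseteq> L2 \<Omega>" using X by blast
  show "(\<lambda>x. 0) \<in> X" by (rule X0)
  show "(\<lambda>x. f x + c *\<^sub>R g x) \<in> X" if "f \<in> X" "g \<in> X" for f g c using that by (rule lin)
 next
  fix j f g and c :: real assume j: "j \<in> J" and fX: "f \<in> X" and gX: "g \<in> X"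
  from j obtain K where K: "K \<in> T'" and jK: "j \<in> (\<lambda>(l, i, j) v. L2_inner (region K) (\<lambda>x. v x $ l) (mono2 i j)) ` (UNIV \<times> {..k} \<times> {..k})
   \<union> div_moment K ` div_basis \<B> K \<union> curl_moment K ` curl_basis \<B> K
   \<union> (\<Union>e\<in>edges K. edge_moment K e ` edge_basis \<B> K e)"
   unfolding J_def by (rule UN_E)
  have K: "K \<in> \<T>" using K by (simp add: T'_def)
  have f: "f \<in> V_local k K" and g: "g \<in> V_local k K" using X fX gX K by blast+
  from jK consider (mo) l a b where "j = (\<lambda>v. L2_inner (region K) (\<lambda>x. v x $ l) (mono2 a b))"
   | (dv) p where "p \<in> div_basis \<B> K" "j = div_moment K p" | (cu) p where "p \<in> curl_basis \<B> K" "j = curl_moment K p"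
   | (ed) e p where "e \<in> edges K" "p \<in> edge_basis \<B> K e" "j = edge_moment K e p"
   by (auto simp: image_iff)
  then show "j (\<lambda>x. f x + c *\<^sub>R g x) = j f + c * j g"
  proof cases
   case mo
   have m: "mono2 a b \<in> L2 (region K)" by (rule poly_fun_L2[OF poly_fun_mono2[OF order_refl]])
   show ?thesis unfolding mo
    using L2_inner_add_left[OF L2_vec_nth[OF V_localD(3)[OF f]] L2_cmult[OF L2_vec_nth[OF V_localD(3)[OF g]]] m, of l c l]
    by (simp add: L2_inner_cmult_left)
  next
   case dv show ?thesis unfolding dv(2) by (rule div_moment_lin[OF f g basis_smooth(1)[OF K dv(1)]])
  next
   case cu show ?thesis unfolding cu(2) by (rule curl_moment_lin[OF f g basis_smooth(2)[OF K cu(1)]])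
  next
   case ed show ?thesis unfolding ed(3) by (rule edge_moment_lin[OF mesh_polygon[OF K] ed(1) f g basis_smooth(3)[OF K ed(1,2)]])
  qed
 next
  fix f assume fX: "f \<in> X" and zero: "\<And>j. j \<in> J ==> j f = 0"
  have "L2_norm (region K) f = 0" if K: "K \<in> \<T>" for K
  proof (cases "region K = {}")
   case True then show ?thesis using L2_norm_power2[of "region K" f] by (simp add: L2_inner_empty)
  next
   case False
   have KT: "K \<in> T'" using K False by (simp add: T'_def)
   have f: "f \<in> V_local k K" using X fX K by blast
   have "L2_inner (region K) (\<lambda>x. f x $ l) (mono2 a b) = 0" if "a + b \<le> k" for l a b
   proof -
    have "(l, a, b) \<in> UNIV \<times> {..k} \<times> {..k}" using that by simp
    then have "(\<lambda>(l, i, j) v. L2_inner (region K) (\<lambda>x. v x $ l) (mono2 i j)) (l, a, b) \<in> J"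
     unfolding J_def using KT by blast
    from zero[OF this] show ?thesis by simp
   qed
   moreover have "div_moment K p f = 0" if "p \<in> div_basis \<B> K" for p
    by (rule zero) (use that KT in \<open>auto simp: J_def\<close>)
   moreover have "curl_moment K p f = 0" if "p \<in> curl_basis \<B> K" for p
    by (rule zero) (use that KT in \<open>auto simp: J_def\<close>)
   moreover have "edge_moment K e p f = 0" if "e \<in> edges K" "p \<in> edge_basis \<B> K e" for e p
    by (rule zero) (use that KT in \<open>auto simp: J_def\<close>)
   ultimately show ?thesis
    by (intro separating[OF f K False]) (simp_all add: dof_product_def)
  qed
  moreover have "f \<in> L2 \<Omega>" using X fX by blast
  ultimately have "(L2_norm \<Omega> f)\<^sup>2 = 0" by (simp add: L2_norm_mesh)
  then show "L2_norm \<Omega> f = 0" by simp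
 qed
qed

end

section \<open>Conservation of energy\<close>

lemma C0_time_in: "u \<in> C0_time T X N ==> t \<in> {0..T} ==> u t \<in> X"
 by (simp add: C0_time_def)

lemma C0_time_mono: "u \<in> C0_time T X N ==> (\<And>t. t \<in> {0..T} ==> u t \<in> Y) ==> u \<in> C0_time T Y N"
 by (simp add: C0_time_def)

lemma C0_time_seq:
 fixes u :: "real => pt => 'b::euclidean_space"
 assumes u: "u \<in> C0_time T X (L2_norm A)" and t: "t \<in> {0..T}" and x: "\<And>n. x n \<in> {0..T}" "x \<longlonglongrightarrow> t"
 shows "(\<lambda>n. L2_norm A (\<lambda>y. u (x n) y - u t y)) \<longlonglongrightarrow> 0"
proof -
 have z: "L2_norm A (\<lambda>y. u t y - u t y) = 0" by (simp add: L2_norm_def)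
 have "((\<lambda>s. L2_norm A (\<lambda>y. u s y - u t y)) \<longlongrightarrow> 0) (at t within {0..T})"
  using u t unfolding C0_time_def by blast
 then have "continuous (at t within {0..T}) (\<lambda>s. L2_norm A (\<lambda>y. u s y - u t y))"
  unfolding continuous_within z .
 from continuous_within_tendsto_compose'[OF this x] show ?thesis unfolding z .
qed

text \<open>A bounded bilinear form is jointly continuous, and composing it with a curve that is continuous in the
 norm preserves this.\<close>

lemma form_continuous:
 fixes u :: "real => pt => 'b::euclidean_space" and m :: "(pt => 'b) => (pt => 'b) => real" and C :: real
 assumes u: "u \<in> C0_time T X (L2_norm A)" and X: "X \<subseteq> L2 A"
  and diff: "\<And>v w. v \<in> X ==> w \<in> X ==> (\<lambda>x. v x - w x) \<in> X"
  and sym: "\<And>v w. m v w = m w v"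
  and lin: "\<And>v w z. v \<in> X ==> w \<in> X ==> z \<in> X ==> m (\<lambda>x. v x - w x) z = m v z - m w z"
  and bd: "\<And>v w. v \<in> X ==> w \<in> X ==> \<bar>m v w\<bar> \<le> C * L2_norm A v * L2_norm A w" and C: "C \<ge> 0"
 shows "continuous_on ({0..T} \<times> {0..T}) (\<lambda>(s, t). m (u s) (u t))"
 unfolding continuous_on_sequentially
proof (intro allI ballI impI, elim conjE)
 fix x :: "nat => real \<times> real" and a
 assume a: "a \<in> {0..T} \<times> {0..T}" and xS: "\<forall>n. x n \<in> {0..T} \<times> {0..T}" and xa: "x \<longlonglongrightarrow> a"
 define s t s0 t0 where "s n = fst (x n)" and "t n = snd (x n)" and "s0 = fst a" and "t0 = snd a" for n
 have I: "s n \<in> {0..T}" "t n \<in> {0..T}" "s0 \<in> {0..T}" "t0 \<in> {0..T}" for n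
  using spec[OF xS, of n] a by (auto simp: s_def t_def s0_def t0_def)
 have "s \<longlonglongrightarrow> s0" "t \<longlonglongrightarrow> t0" unfolding s_def[abs_def] t_def[abs_def] s0_def t0_def
  using xa by (rule tendsto_fst tendsto_snd)+
 note e = C0_time_seq[OF u I(3) I(1) this(1)] and d = C0_time_seq[OF u I(4) I(2) this(2)]
 let ?e = "\<lambda>n. L2_norm A (\<lambda>y. u (s n) y - u s0 y)" and ?d = "\<lambda>n. L2_norm A (\<lambda>y. u (t n) y - u t0 y)"
 have uX: "u r \<in> X" if "r \<in> {0..T}" for r by (rule C0_time_in[OF u that])
 have uL: "u r \<in> L2 A" if "r \<in> {0..T}" for r using uX[OF that] X by blast
 let ?R = "\<lambda>n. C * ?e n * (?d n + L2_norm A (u t0)) + C * ?d n * L2_norm A (u s0)"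
 have b: "norm (m (u (s n)) (u (t n)) - m (u s0) (u t0)) \<le> ?R n" for n
 proof -
  note J = uX[OF I(1)[of n]] uX[OF I(2)[of n]] uX[OF I(3)] uX[OF I(4)]
  have "m (u (s n)) (u (t n)) - m (u s0) (u t0)
    = m (\<lambda>y. u (s n) y - u s0 y) (u (t n)) + m (\<lambda>y. u (t n) y - u t0 y) (u s0)"
   by (simp add: lin[OF J(1,3,2)] lin[OF J(2,4,3)] sym[of "u s0"])
  moreover have "\<bar>m (\<lambda>y. u (s n) y - u s0 y) (u (t n))\<bar> \<le> C * ?e n * L2_norm A (u (t n))"
   by (rule bd[OF diff[OF J(1,3)] J(2)])
  moreover have "\<bar>m (\<lambda>y. u (t n) y - u t0 y) (u s0)\<bar> \<le> C * ?d n * L2_norm A (u s0)"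
   by (rule bd[OF diff[OF J(2,4)] J(3)])
  moreover have "C * ?e n * L2_norm A (u (t n)) \<le> C * ?e n * (?d n + L2_norm A (u t0))"
   using L2_norm_triangle[OF L2_diff[OF uL[OF I(2)[of n]] uL[OF I(4)]] uL[OF I(4)]] C
   by (intro mult_left_mono mult_nonneg_nonneg L2_norm_nonneg) simp_all
  ultimately show ?thesis unfolding real_norm_def by linarith
 qed
 have "?R \<longlonglongrightarrow> C * 0 * (0 + L2_norm A (u t0)) + C * 0 * L2_norm A (u s0)"
  by (intro tendsto_intros e d)
 then have R0: "?R \<longlonglongrightarrow> 0" by simp
 have "(\<lambda>n. m (u (s n)) (u (t n)) - m (u s0) (u t0)) \<longlonglongrightarrow> 0"
  by (rule Lim_null_comparison[OF always_eventually[OF allI[OF b]] R0])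
 then have "(\<lambda>n. m (u (s n)) (u (t n))) \<longlonglongrightarrow> m (u s0) (u t0)" by (rule LIM_zero_cancel)
 then show "((\<lambda>(s, t). m (u s) (u t)) \<circ> x) \<longlonglongrightarrow> (case a of (s, t) => m (u s) (u t))"
  by (simp add: comp_def case_prod_unfold s_def t_def s0_def t0_def)
qed

lemma functional_continuous:
 fixes p :: "real => pt => 'b::euclidean_space"
 assumes p: "p \<in> C0_time T Y (L2_norm A)" and Y: "Y \<subseteq> L2 A" and d: "d \<in> L2 A"
 shows "continuous_on {0..T} (\<lambda>t. L2_inner A d (p t))"
 unfolding continuous_on_sequentially
proof (intro allI ballI impI, elim conjE)
 fix x :: "nat => real" and a
 assume a: "a \<in> {0..T}" and xS: "\<forall>n. x n \<in> {0..T}" and xa: "x \<longlonglongrightarrow> a"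
 have xS: "x n \<in> {0..T}" for n using xS by blast
 have L: "p r \<in> L2 A" if "r \<in> {0..T}" for r using C0_time_in[OF p that] Y by blast
 have "(\<lambda>n. L2_norm A d * L2_norm A (\<lambda>y. p (x n) y - p a y)) \<longlonglongrightarrow> L2_norm A d * 0"
  by (intro tendsto_intros C0_time_seq[OF p a xS xa])
 then have R0: "(\<lambda>n. L2_norm A d * L2_norm A (\<lambda>y. p (x n) y - p a y)) \<longlonglongrightarrow> 0" by simp
 have b: "norm (L2_inner A d (p (x n)) - L2_inner A d (p a)) \<le> L2_norm A d * L2_norm A (\<lambda>y. p (x n) y - p a y)" for n
  using L2_Cauchy_Schwarz[OF d L2_diff[OF L[OF xS] L[OF a]]] by (simp add: L2_inner_diff_right[OF L[OF xS] L[OF a] d])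
 have "(\<lambda>n. L2_inner A d (p (x n)) - L2_inner A d (p a)) \<longlonglongrightarrow> 0"
  by (rule Lim_null_comparison[OF always_eventually[OF allI[OF b]] R0])
 then show "((\<lambda>t. L2_inner A d (p t)) \<circ> x) \<longlonglongrightarrow> L2_inner A d (p a)"
  unfolding comp_def by (rule LIM_zero_cancel)
qed

text \<open>Every time is a limit of times at which membership holds, since those have full measure.\<close>

lemma C0_time_in_closed:
 fixes u :: "real => pt => 'b::euclidean_space"
 assumes T: "T > 0" and u: "u \<in> C0_time T (L2 A) (L2_norm A)"
  and ae: "AE s in lebesgue_on {0<..<T}. u s \<in> X"
  and cl: "\<And>f. f \<in> L2 A ==> (\<And>e. e > 0 ==> \<exists>q\<in>X. L2_norm A (\<lambda>x. f x - q x) < e) ==> f \<in> X"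
  and t: "t \<in> {0..T}"
 shows "u t \<in> X"
proof (rule cl)
 show "u t \<in> L2 A" by (rule C0_time_in[OF u t])
 fix e :: real assume e: "e > 0"
 have lim: "((\<lambda>s. L2_norm A (\<lambda>x. u s x - u t x)) \<longlongrightarrow> 0) (at t within {0..T})"
  using u t unfolding C0_time_def by blast
 obtain \<delta> where \<delta>: "\<delta> > 0"
  and near: "\<And>s. s \<in> {0..T} ==> s \<noteq> t ==> dist s t < \<delta> ==> dist (L2_norm A (\<lambda>x. u s x - u t x)) 0 < e"
  using tendstoD[OF lim e] unfolding eventually_at by blast
 define I where "I = (if t < T then {t<..<min T (t + \<delta>)} else {max 0 (T - \<delta>)<..<T})"
 have I: "open I" "I \<subseteq> {0<..<T}" "I \<noteq> {}" using t T \<delta> by (auto simp: I_def)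
 obtain s where s: "s \<in> I" "u s \<in> X" using AE_open_witness[OF _ ae I] by auto
 have "s \<in> {0..T}" "s \<noteq> t" "dist s t < \<delta>" using s(1) t T \<delta> by (auto simp: I_def dist_real_def split: if_splits)
 from near[OF this] have "L2_norm A (\<lambda>x. u t x - u s x) < e"
  by (simp add: L2_norm_minus_commute[of A "u t"] L2_norm_nonneg)
 with s(2) show "\<exists>q\<in>X. L2_norm A (\<lambda>x. u t x - q x) < e" by blast
qed

text \<open>Continuity in the energy norm carries the conservation between interior times to the initial time.\<close>

lemma energy_conserved:
 fixes u :: "real => pt => pt" and p :: "real => pt => real" and C D :: real
  and m :: "(pt => pt) => (pt => pt) => real" and n :: "(pt => real) => (pt => real) => real"
 assumes T: "T > 0"
  and u: "u \<in> C0_time T X (L2_norm \<Omega>)" "X \<subseteq> L2 \<Omega>" "\<And>v w. v \<in> X ==> w \<in> X ==> (\<lambda>x. v x - w x) \<in> X"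
  and m: "\<And>v w. m v w = m w v"
   "\<And>v w z. v \<in> X ==> w \<in> X ==> z \<in> X ==> m (\<lambda>x. v x - w x) z = m v z - m w z"
   "\<And>v w. v \<in> X ==> w \<in> X ==> \<bar>m v w\<bar> \<le> C * L2_norm \<Omega> v * L2_norm \<Omega> w" "C \<ge> 0"
  and p: "p \<in> C0_time T Y (L2_norm \<Omega>)" "Y \<subseteq> L2 \<Omega>" "\<And>v w. v \<in> Y ==> w \<in> Y ==> (\<lambda>x. v x - w x) \<in> Y"
  and n: "\<And>v w. n v w = n w v"
   "\<And>v w z. v \<in> Y ==> w \<in> Y ==> z \<in> Y ==> n (\<lambda>x. v x - w x) z = n v z - n w z"
   "\<And>v w. v \<in> Y ==> w \<in> Y ==> \<bar>n v w\<bar> \<le> D * L2_norm \<Omega> v * L2_norm \<Omega> w" "D \<ge> 0"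
  and H: "AE s in lebesgue_on {0<..<T}. u s \<in> Hdiv \<Omega>"
  and G: "integrable (lebesgue_on {0<..<T}) (\<lambda>s. (Hdiv_norm \<Omega> (u s))\<^sup>2)"
  and eq1: "AE s in lebesgue_on {0<..<T}. has_weak_time_deriv T (\<lambda>t. m (u t) (u s)) (\<lambda>t. - b_form \<Omega> (u s) (p t))"
  and eq2: "\<And>s. s \<in> {0<..<T} ==> has_weak_time_deriv T (\<lambda>t. n (p t) (p s)) (\<lambda>t. b_form \<Omega> (u t) (p s))"
  and t: "t \<in> {0<..<T}"
 shows "m (u t) (u t) + n (p t) (p t) = m (u 0) (u 0) + n (p 0) (p 0)"
proof -
 let ?S = "{0<..<T}" and ?I = "{0..T}"
 have SI: "?S \<subseteq> ?I" "?S \<times> ?S \<subseteq> ?I \<times> ?I" by auto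
 note Mc = form_continuous[OF u m] and Nc = form_continuous[OF p n]
 have pL: "p r \<in> L2 \<Omega>" if "r \<in> ?I" for r using C0_time_in[OF p(1) that] p(2) by blast
 have Qc: "continuous_on (?I \<times> ?I) (\<lambda>(s, t). L2_inner \<Omega> (p s) (p t))"
 proof (rule form_continuous[OF p, where C = 1])
  show "L2_inner \<Omega> v w = L2_inner \<Omega> w v" for v w :: "pt => real" by (rule L2_inner_commute)
  show "L2_inner \<Omega> (\<lambda>x. v x - w x) z = L2_inner \<Omega> v z - L2_inner \<Omega> w z"
   if "v \<in> Y" "w \<in> Y" "z \<in> Y" for v w z using that p(2) by (intro L2_inner_diff_left) auto
  show "\<bar>L2_inner \<Omega> v w\<bar> \<le> 1 * L2_norm \<Omega> v * L2_norm \<Omega> w" if "v \<in> Y" "w \<in> Y" for v w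
   using L2_Cauchy_Schwarz[of v \<Omega> w] that p(2) by auto
 qed simp_all
 have diag: "continuous_on ?I (\<lambda>t. f t t)" if "continuous_on (?I \<times> ?I) (\<lambda>(s, t). f s t)" for f :: "real => real => real"
 proof -
  have a: "continuous_on ?I (\<lambda>t. (t, t))" by (intro continuous_intros)
  have b: "(\<lambda>t. (t, t)) ` ?I \<subseteq> ?I \<times> ?I" by auto
  from continuous_on_compose2[OF that a b] show ?thesis by simp
 qed
 have "bounded ((\<lambda>t. L2_inner \<Omega> (p t) (p t)) ` ?I)"
  by (intro compact_imp_bounded compact_continuous_image diag[OF Qc] compact_Icc)
 then obtain P where P': "\<forall>y\<in>(\<lambda>t. L2_inner \<Omega> (p t) (p t)) ` ?I. norm y \<le> P"
  unfolding bounded_iff by blast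
 have P: "(L2_norm \<Omega> (p t))\<^sup>2 \<le> P" if "t \<in> ?I" for t
  using bspec[OF P' imageI[OF that]] by (simp add: L2_norm_power2)
 \<comment> \<open>only squares of norms are known to be integrable or bounded\<close>
 have sq: "x \<le> 1 + x\<^sup>2" for x :: real
 proof -
  have "0 \<le> (x - 1/2)\<^sup>2" by simp
  also have "\<dots> = x\<^sup>2 - x + 1/4" by (simp add: power2_eq_square algebra_simps)
  finally show ?thesis by simp
 qed
 have pP: "L2_norm \<Omega> (p t) \<le> 1 + P" if "t \<in> ?I" for t using P[OF that] sq[of "L2_norm \<Omega> (p t)"] by linarith
 have const: "m (u x) (u x) + n (p x) (p x) = m (u y) (u y) + n (p y) (p y)" if xy: "x \<in> ?S" "y \<in> ?S" for x y
 proof (rule conservation_interior[where M = "\<lambda>s t. m (u s) (u t)" and N = "\<lambda>s t. n (p s) (p t)"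
    and B = "\<lambda>s t. b_form \<Omega> (u s) (p t)" and G = "\<lambda>s. (1 + (Hdiv_norm \<Omega> (u s))\<^sup>2) * (1 + P)", OF T _ m(1) _ n(1) eq1 eq2 _ _ _ xy])
  show "continuous_on (?S \<times> ?S) (\<lambda>(s, t). m (u s) (u t))" by (rule continuous_on_subset[OF Mc SI(2)])
  show "continuous_on (?S \<times> ?S) (\<lambda>(s, t). n (p s) (p t))" by (rule continuous_on_subset[OF Nc SI(2)])
  show "AE s in lebesgue_on ?S. continuous_on ?S (\<lambda>t. b_form \<Omega> (u s) (p t))"
   using H
  proof eventually_elim
   case (elim s)
   show ?case unfolding b_form_def
    by (rule continuous_on_subset[OF functional_continuous[OF p(1,2) weak_div_L2[OF Hdiv_weak_div[OF elim]]] SI(1)])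
  qed
  show "AE s in lebesgue_on ?S. \<forall>t\<in>?S. \<bar>b_form \<Omega> (u s) (p t)\<bar> \<le> (1 + (Hdiv_norm \<Omega> (u s))\<^sup>2) * (1 + P)"
   using H
  proof eventually_elim
   case (elim s)
   show ?case
   proof
    fix t assume t: "t \<in> ?S"
    then have tI: "t \<in> ?I" by simp
    let ?d = "weak_div \<Omega> (u s)"
    have "\<bar>b_form \<Omega> (u s) (p t)\<bar> \<le> L2_norm \<Omega> ?d * L2_norm \<Omega> (p t)"
     unfolding b_form_def by (rule L2_Cauchy_Schwarz[OF weak_div_L2[OF Hdiv_weak_div[OF elim]] pL[OF tI]])
    also have "\<dots> \<le> (1 + (Hdiv_norm \<Omega> (u s))\<^sup>2) * (1 + P)"
    proof (rule mult_mono[OF _ pP[OF tI] _ L2_norm_nonneg])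
     have "(Hdiv_norm \<Omega> (u s))\<^sup>2 = (L2_norm \<Omega> (u s))\<^sup>2 + (L2_norm \<Omega> ?d)\<^sup>2" unfolding Hdiv_norm_def by simp
     then show "L2_norm \<Omega> ?d \<le> 1 + (Hdiv_norm \<Omega> (u s))\<^sup>2"
      using sq[of "L2_norm \<Omega> ?d"] zero_le_power2[of "L2_norm \<Omega> (u s)"] by linarith
    qed simp
    finally show "\<bar>b_form \<Omega> (u s) (p t)\<bar> \<le> (1 + (Hdiv_norm \<Omega> (u s))\<^sup>2) * (1 + P)" .
   qed
  qed
  interpret finite_measure "lebesgue_on ?S" by (rule finite_measure_lebesgue_on) simp
  show "integrable (lebesgue_on ?S) (\<lambda>s. (1 + (Hdiv_norm \<Omega> (u s))\<^sup>2) * (1 + P))"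
   by (intro integrable_mult_left Bochner_Integration.integrable_add integrable_const G)
 qed
 let ?E = "\<lambda>t. m (u t) (u t) + n (p t) (p t)"
 have Ec: "continuous_on ?I ?E" by (intro continuous_on_add diag Mc Nc)
 \<comment> \<open>interior times that tend to the initial time\<close>
 define x where "x i = t * inverse (real (Suc i))" for i
 have x: "x i \<in> ?S" for i
 proof -
  have i: "0 < inverse (real (Suc i))" "inverse (real (Suc i)) \<le> 1" by (auto simp: field_simps)
  then have "0 < x i" "x i \<le> t * 1" unfolding x_def using t by (auto intro!: mult_left_mono mult_pos_pos)
  then show ?thesis using t by simp
 qed
 have "x \<longlonglongrightarrow> t * 0" unfolding x_def[abs_def] by (intro tendsto_mult tendsto_const LIMSEQ_inverse_real_of_nat)
 then have x0: "x \<longlonglongrightarrow> 0" by simp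
 have "(\<lambda>i. ?E (x i)) \<longlonglongrightarrow> ?E 0"
 proof (rule continuous_on_tendsto_compose[OF Ec x0])
  show "0 \<in> ?I" using T by simp
  show "\<forall>\<^sub>F i in sequentially. x i \<in> ?I" using x SI(1) by (intro always_eventually) blast
 qed
 then have "(\<lambda>i. ?E t) \<longlonglongrightarrow> ?E 0" by (simp only: const[OF x t])
 then show ?thesis by (simp add: LIMSEQ_const_iff)
qed

section \<open>The global spaces\<close>

lemma V_space_lin:
 assumes \<Omega>: "open \<Omega>" and v: "v \<in> V_space \<Omega> \<Gamma>" and w: "w \<in> V_space \<Omega> \<Gamma>"
 shows "(\<lambda>x. v x + c *\<^sub>R w x) \<in> V_space \<Omega> \<Gamma>"
 using v w Hdiv_lin[OF \<Omega>, of v w c] has_normal_trace_lin[OF \<Omega>, of \<Gamma> v "\<lambda>_. 0" w "\<lambda>_. 0" c]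
 by (simp add: V_space_def)

context mesh_dofs
begin

lemma V_discrete_Vk: "V_discrete k \<Omega> \<Gamma> \<T> \<subseteq> Vk"
 by (auto simp: V_discrete_def V_space_def Hdiv_def)

lemma V_discrete_lin:
 "v \<in> V_discrete k \<Omega> \<Gamma> \<T> ==> w \<in> V_discrete k \<Omega> \<Gamma> \<T> ==> (\<lambda>x. v x + c *\<^sub>R w x) \<in> V_discrete k \<Omega> \<Gamma> \<T>"
 unfolding V_discrete_def using V_space_lin[OF \<Omega>(1)] V_local_lin by simp

lemma V_discrete_diff:
 assumes "v \<in> V_discrete k \<Omega> \<Gamma> \<T>" "w \<in> V_discrete k \<Omega> \<Gamma> \<T>"
 shows "(\<lambda>x. v x - w x) \<in> V_discrete k \<Omega> \<Gamma> \<T>"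
 using V_discrete_lin[OF assms, of "-1"] by simp

text \<open>Needed because closedness in the norm only provides a representative that agrees almost everywhere.\<close>

lemma V_discrete_cong:
 assumes v: "v \<in> V_discrete k \<Omega> \<Gamma> \<T>" and w: "w \<in> L2 \<Omega>" and e: "AE x in lebesgue_on \<Omega>. v x = w x"
 shows "w \<in> V_discrete k \<Omega> \<Gamma> \<T>"
proof -
 have vL: "v \<in> L2 \<Omega>" using v V_discrete_Vk by blast
 have "w \<in> V_local k K" if K: "K \<in> \<T>" for K
  using v K by (intro V_local_cong[OF _ L2_region[OF w K] AE_region[OF e K]]) (simp add: V_discrete_def)
 moreover have "w \<in> V_space \<Omega> \<Gamma>"
  using v w has_weak_div_cong(1,4)[OF \<Omega>(1) vL w e] by (simp add: V_discrete_def V_space_def Hdiv_def)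
 ultimately show ?thesis by (simp add: V_discrete_def)
qed

lemma V_discrete_closed:
 assumes ne: "v0 \<in> V_discrete k \<Omega> \<Gamma> \<T>" and f: "f \<in> L2 \<Omega>"
  and approx: "\<And>e. e > 0 ==> \<exists>q\<in>V_discrete k \<Omega> \<Gamma> \<T>. L2_norm \<Omega> (\<lambda>x. f x - q x) < e"
 shows "f \<in> V_discrete k \<Omega> \<Gamma> \<T>"
proof -
 have "(\<lambda>x. v0 x - v0 x) \<in> V_discrete k \<Omega> \<Gamma> \<T>" by (rule V_discrete_diff[OF ne ne])
 then have "(\<lambda>x. 0) \<in> V_discrete k \<Omega> \<Gamma> \<T>" by simp
 then have P: "proximal \<Omega> (V_discrete k \<Omega> \<Gamma> \<T>)"
  by (rule proximal_subspace[OF V_discrete_Vk]) (rule V_discrete_lin)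
 have "V_discrete k \<Omega> \<Gamma> \<T> \<subseteq> L2 \<Omega>" using V_discrete_Vk by blast
 from proximal_closed[OF P this V_discrete_diff f approx]
 obtain q where "q \<in> V_discrete k \<Omega> \<Gamma> \<T>" and e: "AE x in lebesgue_on \<Omega>. f x = q x" by blast
 then show ?thesis using e by (intro V_discrete_cong[OF _ f]) auto
qed

end

section \<open>The wave speed\<close>

lemma n_form_commute: "n_form \<Omega> c p q = n_form \<Omega> c q p"
 unfolding n_form_def L2_inner_def by (simp add: mult.commute)

lemma weighted_norm: "(L2_norm \<Omega> (\<lambda>x. inverse (c x) * q x))\<^sup>2 = n_form \<Omega> c q q"
 unfolding L2_norm_power2 n_form_def L2_inner_def by (simp add: divide_inverse power2_eq_square algebra_simps)

locale mesh_speed = mesh_domain +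
 fixes c :: "pt => real"
 assumes c_pos: "\<And>x. x \<in> \<Omega> ==> c x > 0" and c_const: "\<And>K. K \<in> \<T> ==> c constant_on region K"
begin

text \<open>The constant value of \<open>1 / c\<close> on an element; zero is a harmless value for an empty region.\<close>

definition slowness :: "polygon => real" where
 "slowness K = (if region K = {} then 0 else inverse (c (SOME x. x \<in> region K)))"

lemma slowness_eq:
 assumes K: "K \<in> \<T>" and x: "x \<in> region K"
 shows "inverse (c x) = slowness K"
proof -
 have "(SOME x. x \<in> region K) \<in> region K" using x by (rule someI[where P = "\<lambda>x. x \<in> region K"])
 then have "c (SOME x. x \<in> region K) = c x" using c_const[OF K] x unfolding constant_on_def by metis
 then show ?thesis using x by (auto simp: slowness_def)
qed

lemma slowness_nonneg:
 assumes K: "K \<in> \<T>" shows "slowness K \<ge> 0"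
proof (cases "region K = {}")
 case False
 then obtain x where x: "x \<in> region K" by blast
 then have "c x > 0" using c_pos region_subset[OF K] by blast
 then show ?thesis using slowness_eq[OF K x] by (simp flip: slowness_eq[OF K x])
qed (simp add: slowness_def)

lemma n_form_mesh:
 assumes p: "p \<in> L2 \<Omega>" and q: "q \<in> L2 \<Omega>"
 shows "n_form \<Omega> c p q = (\<Sum>K\<in>\<T>. (slowness K)\<^sup>2 * L2_inner (region K) p q)"
proof -
 have "(\<lambda>x. p x / (c x)\<^sup>2) = (\<lambda>x. (inverse (c x))\<^sup>2 * p x)" by (simp add: divide_inverse power_inverse mult.commute)
 then have "n_form \<Omega> c p q = L2_inner \<Omega> (\<lambda>x. (inverse (c x))\<^sup>2 * p x) q" by (simp only: n_form_def)
 also have "\<dots> = (\<Sum>K\<in>\<T>. (slowness K)\<^sup>2 * L2_inner (region K) p q)"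
  by (rule piecewise_constant_weight(2)[OF _ p q]) (simp only: slowness_eq)
 finally show ?thesis .
qed

lemma n_form_diff:
 assumes p: "p \<in> L2 \<Omega>" and q: "q \<in> L2 \<Omega>" and r: "r \<in> L2 \<Omega>"
 shows "n_form \<Omega> c (\<lambda>x. p x - q x) r = n_form \<Omega> c p r - n_form \<Omega> c q r"
 unfolding n_form_mesh[OF L2_diff[OF p q] r] n_form_mesh[OF p r] n_form_mesh[OF q r] sum_subtractf[symmetric]
 by (rule sum.cong[OF refl]) (simp add: L2_inner_diff_left L2_region p q r right_diff_distrib)

lemma n_form_bound:
 assumes p: "p \<in> L2 \<Omega>" and q: "q \<in> L2 \<Omega>"
 shows "\<bar>n_form \<Omega> c p q\<bar> \<le> (\<Sum>K\<in>\<T>. (slowness K)\<^sup>2) * L2_norm \<Omega> p * L2_norm \<Omega> q"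
proof -
 have "\<bar>n_form \<Omega> c p q\<bar> \<le> (\<Sum>K\<in>\<T>. \<bar>(slowness K)\<^sup>2 * L2_inner (region K) p q\<bar>)"
  unfolding n_form_mesh[OF p q] by (rule sum_abs)
 also have "\<dots> \<le> (\<Sum>K\<in>\<T>. (slowness K)\<^sup>2 * (L2_norm \<Omega> p * L2_norm \<Omega> q))"
 proof (rule sum_mono)
  fix K assume K: "K \<in> \<T>"
  have "\<bar>L2_inner (region K) p q\<bar> \<le> L2_norm (region K) p * L2_norm (region K) q"
   by (rule L2_Cauchy_Schwarz[OF L2_region[OF p K] L2_region[OF q K]])
  also have "\<dots> \<le> L2_norm \<Omega> p * L2_norm \<Omega> q"
   by (intro mult_mono L2_norm_region_le p q K L2_norm_nonneg)
  finally show "\<bar>(slowness K)\<^sup>2 * L2_inner (region K) p q\<bar> \<le> (slowness K)\<^sup>2 * (L2_norm \<Omega> p * L2_norm \<Omega> q)"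
   unfolding abs_mult by (simp add: mult_left_mono)
 qed
 also have "\<dots> = (\<Sum>K\<in>\<T>. (slowness K)\<^sup>2) * L2_norm \<Omega> p * L2_norm \<Omega> q"
  by (simp add: sum_distrib_right mult.assoc)
 finally show ?thesis .
qed

text \<open>The set \<open>region K \<times> {0<..<T}\<close> is open and nonempty, so the essential supremum dominates the value
 there. It is finite because \<open>1 / c\<close> takes finitely many values off the edges, and it is a
 supremum of a measurable function because \<open>1 / c\<close> agrees almost everywhere with a step function.\<close>

lemma slowness_le_c_hat:
 assumes T: "T > 0" and K: "K \<in> \<T>"
 shows "(slowness K)\<^sup>2 \<le> (c_hat \<Omega> T c)\<^sup>2"
proof (cases "region K = {}")
 case True then show ?thesis by (simp add: slowness_def)
next
 case False
 let ?S = "\<Omega> \<times> {0<..<T}" and ?g = "\<lambda>z::pt \<times> real. \<bar>inverse (c (fst z))\<bar>"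
 have oS: "open ?S" by (intro open_Times \<Omega> open_greaterThanLessThan)
 then have Ss: "?S \<in> sets lebesgue" by simp
 have cs: "closed (skeleton \<times> (UNIV :: real set))" by (intro closed_Times skeleton_closed closed_UNIV)
 have "emeasure lborel (skeleton \<times> (UNIV :: real set)) = emeasure (lborel \<Otimes>\<^sub>M lborel) (skeleton \<times> (UNIV :: real set))"
  by (simp only: lborel_prod)
 also have "\<dots> = emeasure lborel skeleton * emeasure lborel (UNIV :: real set)"
  using skeleton_closed by (intro lborel.emeasure_pair_measure_Times) simp_all
 also have "emeasure lborel skeleton = 0"
  using skeleton_negligible skeleton_closed
  by (simp add: negligible_iff_null_sets null_sets_def borel_closed emeasure_completion main_part_sets)
 finally have "skeleton \<times> (UNIV :: real set) \<in> null_sets lborel" using cs by (simp add: null_sets_def borel_closed)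
 then have "skeleton \<times> (UNIV :: real set) \<in> null_sets lebesgue" by (rule null_sets_completionI)
 then have ae: "AE z in lebesgue. z \<notin> skeleton \<times> (UNIV :: real set)" by (rule AE_not_in)
 have sk: "AE z in lebesgue_on ?S. \<exists>K\<in>\<T>. fst z \<in> region K"
  unfolding AE_lebesgue_on_iff[OF Ss] using ae
 proof eventually_elim
  case (elim z)
  show ?case
  proof
   assume "z \<in> ?S"
   then have "fst z \<in> \<Omega>" "fst z \<notin> skeleton" using elim by (auto simp: mem_Times_iff)
   then obtain K where "K \<in> \<T>" "fst z \<in> region K" by (rule covered)
   then show "\<exists>K\<in>\<T>. fst z \<in> region K" by blast
  qed
 qed
 let ?h = "\<lambda>z::pt \<times> real. (\<Sum>K\<in>\<T>. indicator (region K) (fst z) *\<^sub>R slowness K)"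
 have val: "?g z = slowness K'" if "K' \<in> \<T>" "fst z \<in> region K'" for z K'
  using slowness_eq[OF that] slowness_nonneg[OF that(1)] by simp
 have bh: "?h \<in> borel_measurable (lebesgue_on ?S)"
 proof -
  have "(\<lambda>z::pt \<times> real. indicator (region K) (fst z) :: real) \<in> borel_measurable borel" for K
  proof (rule measurable_compose[where g = "indicator (region K)" and N = borel])
   show "fst \<in> borel_measurable (borel :: (pt \<times> real) measure)"
    by (intro borel_measurable_continuous_onI continuous_on_fst continuous_on_id)
   show "(indicator (region K) :: pt => real) \<in> borel_measurable borel"
    using region_sets(2)[of K] by simp
  qed
  then have "?h \<in> borel_measurable borel" by (intro borel_measurable_sum borel_measurable_scaleR) auto
  then have "?h \<in> borel_measurable lborel" by simp
  then show ?thesis by (intro measurable_restrict_space1 measurable_completion)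
 qed
 have gm: "?g \<in> borel_measurable (lebesgue_on ?S)"
 proof (rule measurable_lebesgue_on_AE[OF Ss bh])
  show "AE z in lebesgue_on ?S. ?h z = ?g z" using sk
  proof eventually_elim
   case (elim z)
   then obtain K' where K': "K' \<in> \<T>" "fst z \<in> region K'" by blast
   show ?case unfolding mesh_sum[OF K'] by (rule val[OF K', symmetric])
  qed
 qed
 let ?e = "esssup (lebesgue_on ?S) (\<lambda>z. ereal (?g z))"
 have em: "(\<lambda>z. ereal (?g z)) \<in> borel_measurable (lebesgue_on ?S)" using gm by simp
 have ch: "c_hat \<Omega> T c = real_of_ereal ?e" by (simp add: c_hat_def case_prod_unfold)
 have up: "?e \<le> ereal (\<Sum>K\<in>\<T>. slowness K)"
 proof (rule esssup_I[OF em])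
  show "AE z in lebesgue_on ?S. ereal (?g z) \<le> ereal (\<Sum>K\<in>\<T>. slowness K)" using sk
  proof eventually_elim
   case (elim z)
   then obtain K' where K': "K' \<in> \<T>" "fst z \<in> region K'" by blast
   have "slowness K' \<le> (\<Sum>K\<in>\<T>. slowness K)" by (intro member_le_sum finite_mesh K' slowness_nonneg) simp
   then show ?case by (simp only: val[OF K'] ereal_less_eq)
  qed
 qed
 have "\<exists>z\<in>region K \<times> {0<..<T}. ereal (?g z) \<le> ?e"
  by (rule AE_open_witness[OF Ss esssup_AE])
    (use False T region_properties(1)[of K] region_subset[OF K] in \<open>auto intro: open_Times\<close>)
 then obtain z where z: "z \<in> region K \<times> {0<..<T}" "ereal (?g z) \<le> ?e" by (rule bexE)
 have "ereal (slowness K) \<le> ?e" using z val[OF K, of z] by (simp only: mem_Times_iff)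
 then have "slowness K \<le> c_hat \<Omega> T c" using up unfolding ch by (cases ?e) auto
 then show ?thesis using slowness_nonneg[OF K] by (intro power_mono)
qed

end

section \<open>The energy error at the initial time\<close>

definition proj_error :: "nat => polygon => (pt => real) => real" where
 "proj_error k K f = (L2_norm (region K) (\<lambda>x. f x - proj k K f x))\<^sup>2"

lemma proj_error_nonneg: "0 \<le> proj_error k K f"
 by (simp add: proj_error_def)

lemma L2_norm_empty: "(L2_norm {} f)\<^sup>2 = 0"
 by (simp add: L2_norm_power2 L2_inner_empty)

lemma proj_error_eq:
 assumes f: "f \<in> L2 (region K)"
 shows "(L2_norm (region K) f)\<^sup>2 - (L2_norm (region K) (proj k K f))\<^sup>2 = proj_error k K f"
proof (cases "region K = {}")
 case True then show ?thesis by (simp add: proj_error_def L2_norm_empty)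
next
 case False
 note P = proj_characterisation[OF region_properties(1,2) False f, where k = k]
 show ?thesis using L2_pythagoras[OF f poly_fun_L2[OF P(1)] P(2)[OF P(1)]] by (simp add: proj_error_def)
qed

lemma proj_vec_error_eq:
 assumes K: "region K \<noteq> {}" and v: "v \<in> L2 (region K)"
 shows "(L2_norm (region K) v)\<^sup>2 - (L2_norm (region K) (proj_vec k K v))\<^sup>2 = (\<Sum>l\<in>UNIV. proj_error k K (\<lambda>x. v x $ l))"
proof -
 have n: "(L2_norm (region K) w)\<^sup>2 = (\<Sum>l\<in>UNIV. (L2_norm (region K) (\<lambda>x. w x $ l))\<^sup>2)"
  if "w \<in> L2 (region K)" for w :: "pt => pt"
  by (simp add: L2_norm_power2 L2_inner_vec[OF that that])
 show ?thesis
  unfolding n[OF v] n[OF proj_vec_L2[OF K v]] sum_subtractf[symmetric] proj_vec_nth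
  by (rule sum.cong[OF refl proj_error_eq[OF L2_vec_nth[OF v]]])
qed

context mesh_domain
begin

lemma mesh_size_ge: "K \<in> \<T> ==> diam K \<le> mesh_size \<T>"
 unfolding mesh_size_def using finite_mesh by (intro cSUP_upper bdd_above_finite finite_imageI)

text \<open>The projection is at least as good as the polynomial of the Bramble--Hilbert estimate, and the radius of
 the ball is at least \<open>\<rho>\<close> times the diameter.\<close>

lemma proj_error_bound:
 assumes \<rho>: "\<rho> > 0" and reg: "regular_mesh \<rho> \<T>" and K: "K \<in> \<T>" and f: "f \<in> sobolev (Suc k) (region K)"
 shows "proj_error k K f \<le> (4 * (1 + 1 / \<rho>\<^sup>2)) ^ Suc k * mesh_size \<T> ^ (2 * Suc k) * (sobolev_seminorm (Suc k) (region K) f)\<^sup>2"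
proof (cases "region K = {}")
 case True
 have "0 \<le> (4 * (1 + 1 / \<rho>\<^sup>2)) ^ Suc k" by (intro zero_le_power) simp
 moreover have "0 \<le> mesh_size \<T> ^ (2 * Suc k)" unfolding power_mult by (rule zero_le_power[OF zero_le_power2])
 ultimately have "0 \<le> (4 * (1 + 1 / \<rho>\<^sup>2)) ^ Suc k * mesh_size \<T> ^ (2 * Suc k) * (sobolev_seminorm (Suc k) (region K) f)\<^sup>2"
  by (intro mult_nonneg_nonneg[OF mult_nonneg_nonneg zero_le_power2])
 then show ?thesis using True by (simp add: proj_error_def L2_norm_empty)
next
 case False
 let ?E = "region K" and ?H = "mesh_size \<T>"
 have E: "open ?E" "bounded ?E" by (rule region_properties)+
 have dist: "norm (x - y) \<le> diam K" if "x \<in> ?E" "y \<in> ?E" for x y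
  using diameter_bounded_bound[OF E(2) that] by (simp add: diam_def dist_norm)
 obtain x where x: "x \<in> ?E" using False by blast
 obtain \<epsilon> where \<epsilon>: "\<epsilon> > 0" "cball x \<epsilon> \<subseteq> ?E" using E(1) x unfolding open_contains_cball by blast
 have "x + \<epsilon> *\<^sub>R e1 \<in> ?E" using \<epsilon> by (intro subsetD[OF \<epsilon>(2)]) (simp add: dist_norm norm_axis_1)
 from dist[OF this x] have "\<epsilon> \<le> diam K" using \<epsilon>(1) by (simp add: norm_axis_1)
 then have d: "0 < diam K" using \<epsilon>(1) by simp
 obtain z r where r: "\<rho> * diam K \<le> r" and st: "star_shaped_wrt ?E (ball z r)"
  using reg K unfolding regular_mesh_def by blast
 have r0: "0 < r" using r mult_pos_pos[OF \<rho> d] by linarith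
 have fL: "f \<in> L2 ?E" using f by (simp add: sobolev_def)
 obtain p where p: "p \<in> poly_fun (int k)" and
  pb: "(L2_norm ?E (\<lambda>x. f x - p x))\<^sup>2 \<le> (4 * (diam K)\<^sup>2 * (1 + (diam K / r)\<^sup>2)) ^ Suc k * (sobolev_seminorm (Suc k) ?E f)\<^sup>2"
 proof -
  have "\<exists>p\<in>poly_fun (int k). (L2_norm ?E (\<lambda>x. f x - p x))\<^sup>2
   \<le> (4 * (diam K)\<^sup>2 * (1 + (diam K / r)\<^sup>2)) ^ Suc k * (sobolev_seminorm (Suc k) ?E f)\<^sup>2"
   by (rule bramble_hilbert[OF E r0 _ _ dist f, of z]) (use st in \<open>auto simp: star_shaped_wrt_def\<close>)
  then show ?thesis using that by blast
 qed
 note P = proj_characterisation[OF E False fL, where k = k]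
 have "L2_norm ?E (\<lambda>x. f x - proj k K f x) \<le> L2_norm ?E (\<lambda>x. f x - p x)"
  by (rule projection_minimises[OF fL _ P(1) P(2) p poly_fun_diff[OF P(1) p]]) (auto intro: poly_fun_L2)
 then have "proj_error k K f \<le> (L2_norm ?E (\<lambda>x. f x - p x))\<^sup>2"
  unfolding proj_error_def by (intro power_mono L2_norm_nonneg)
 also note pb
 also have "(4 * (diam K)\<^sup>2 * (1 + (diam K / r)\<^sup>2)) ^ Suc k * (sobolev_seminorm (Suc k) ?E f)\<^sup>2
   \<le> (4 * (1 + 1 / \<rho>\<^sup>2) * ?H\<^sup>2) ^ Suc k * (sobolev_seminorm (Suc k) ?E f)\<^sup>2"
 proof (intro mult_right_mono power_mono)
  have H: "(diam K)\<^sup>2 \<le> ?H\<^sup>2" using mesh_size_ge[OF K] d by (intro power_mono) simp_all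
  have "diam K / r \<le> 1 / \<rho>" using r r0 \<rho> by (simp add: field_simps)
  then have "(diam K / r)\<^sup>2 \<le> (1 / \<rho>)\<^sup>2" using d r0 by (intro power_mono) simp_all
  then have "1 + (diam K / r)\<^sup>2 \<le> 1 + 1 / \<rho>\<^sup>2" by (simp add: power_divide)
  then have "4 * (diam K)\<^sup>2 * (1 + (diam K / r)\<^sup>2) \<le> 4 * ?H\<^sup>2 * (1 + 1 / \<rho>\<^sup>2)"
   using H by (intro mult_mono) simp_all
  then show "4 * (diam K)\<^sup>2 * (1 + (diam K / r)\<^sup>2) \<le> 4 * (1 + 1 / \<rho>\<^sup>2) * ?H\<^sup>2" by (simp only: mult_ac)
  show "0 \<le> 4 * (diam K)\<^sup>2 * (1 + (diam K / r)\<^sup>2)" by simp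
 qed simp
 also have "(4 * (1 + 1 / \<rho>\<^sup>2) * ?H\<^sup>2) ^ Suc k = (4 * (1 + 1 / \<rho>\<^sup>2)) ^ Suc k * ?H ^ (2 * Suc k)"
  unfolding power_mult by (rule power_mult_distrib)
 finally show ?thesis .
qed

lemma global_proj_region:
 assumes K: "K \<in> \<T>"
 shows "AE x in lebesgue_on \<Omega>. q x = global_proj k \<T> f x ==> AE x in lebesgue_on (region K). q x = proj k K f x"
  and "AE x in lebesgue_on \<Omega>. v x = global_proj_vec k \<T> w x ==> AE x in lebesgue_on (region K). v x = proj_vec k K w x"
proof -
 have s: "AE x in lebesgue_on (region K). x \<in> region K" by (rule AE_I2) simp
 assume "AE x in lebesgue_on \<Omega>. q x = global_proj k \<T> f x"
 from AE_region[OF this K] s show "AE x in lebesgue_on (region K). q x = proj k K f x"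
 proof eventually_elim
  case (elim x) then show ?case using mesh_sum[OF K elim(2), of "\<lambda>K. proj k K f x"] by (simp add: global_proj_def)
 qed
next
 have s: "AE x in lebesgue_on (region K). x \<in> region K" by (rule AE_I2) simp
 assume "AE x in lebesgue_on \<Omega>. v x = global_proj_vec k \<T> w x"
 from AE_region[OF this K] s show "AE x in lebesgue_on (region K). v x = proj_vec k K w x"
 proof eventually_elim
  case (elim x) then show ?case using mesh_sum[OF K elim(2), of "\<lambda>K. proj_vec k K w x"] by (simp add: global_proj_vec_def)
 qed
qed

end

text \<open>On a polynomial field the stabilisation vanishes, since it is bounded by the norm of the part that the
 projection annihilates. What remains is Pythagoras for the projection.\<close>

lemma (in mesh_dofs) m_local_initial:
 assumes K: "K \<in> \<T>" and w: "w \<in> L2 (region K)" and v: "v \<in> V_local k K"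
  and e: "AE x in lebesgue_on (region K). v x = proj_vec k K w x"
 shows "(L2_norm (region K) w)\<^sup>2 - m_local k \<B> K v v = (\<Sum>l\<in>UNIV. proj_error k K (\<lambda>x. w x $ l))"
proof (cases "region K = {}")
 case True then show ?thesis by (simp add: m_local_empty proj_error_def L2_norm_empty)
next
 case False
 have P: "proj_vec k K v = proj_vec k K w"
  using proj_vec_cong[OF False V_localD(3)[OF v] proj_vec_L2[OF False w] e, of k] proj_vec_idem[OF False w] by simp
 have nL: "null_part k K v \<in> L2 (region K)" by (rule V_localD(3)[OF null_part(1)[OF mesh_polygon[OF K] False v]])
 have "AE x in lebesgue_on (region K). null_part k K v x = 0" using e by (simp add: null_part_def P)
 then have "L2_norm (region K) (null_part k K v) = 0" using L2_norm_eq_0[OF nL] by simp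
 then have "(diam K)\<^sup>2 * dof_product \<B> K (null_part k K v) (null_part k K v) \<le> 0"
  using dof_null_part[OF K False v] by simp
 moreover have "0 \<le> (diam K)\<^sup>2 * dof_product \<B> K (null_part k K v) (null_part k K v)"
  by (intro mult_nonneg_nonneg dof_product_nonneg) simp
 ultimately have "m_local k \<B> K v v = (L2_norm (region K) (proj_vec k K w))\<^sup>2"
  unfolding m_local_eq P L2_norm_power2 by linarith
 then show ?thesis using proj_vec_error_eq[OF False w, of k] by simp
qed

section \<open>The energy error of the virtual element solution\<close>

locale vem_setting = mesh_dofs + mesh_speed
begin

lemma continuous_energy:
 assumes T: "T > 0" and p0: "p0 \<in> L2 \<Omega>"
  and sol: "weak_solution \<Omega> \<Gamma>N {} c T (\<lambda>_ _. 0) u0 p0 u p" and u0: "u0 \<in> L2 \<Omega>"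
  and t: "t \<in> {0<..<T}"
 shows "(energy_norm \<Omega> c (u t) (p t))\<^sup>2 = (L2_norm \<Omega> u0)\<^sup>2 + n_form \<Omega> c p0 p0"
proof -
 have uC: "u \<in> C0_time T (L2 \<Omega>) (L2_norm \<Omega>)" and pC: "p \<in> C0_time T (L2 \<Omega>) (L2_norm \<Omega>)"
  and uV: "AE s in lebesgue_on {0<..<T}. u s \<in> V_space \<Omega> \<Gamma>N"
  and G: "integrable (lebesgue_on {0<..<T}) (\<lambda>t. (Hdiv_norm \<Omega> (u t))\<^sup>2)"
  and e1: "\<And>v. v \<in> V_space \<Omega> \<Gamma>N ==> has_weak_time_deriv T (\<lambda>t. L2_inner \<Omega> (u t) v) (\<lambda>t. - b_form \<Omega> v (p t))"
  and e2: "\<And>q. q \<in> L2 \<Omega> ==> has_weak_time_deriv T (\<lambda>t. n_form \<Omega> c (p t) q) (\<lambda>t. b_form \<Omega> (u t) q)"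
  and i: "AE x in lebesgue_on \<Omega>. u 0 x = u0 x" "AE x in lebesgue_on \<Omega>. p 0 x = p0 x"
  using sol by (simp_all add: weak_solution_def L2_time_def r_form_def F_form_def m_form_def L2_inner_zero)
 have "L2_inner \<Omega> (u t) (u t) + n_form \<Omega> c (p t) (p t) = L2_inner \<Omega> (u 0) (u 0) + n_form \<Omega> c (p 0) (p 0)"
 proof (rule energy_conserved[OF T uC order_refl _ _ _ _ zero_le_one pC order_refl _ _ _ _ _ _ G _ _ t,
   where m = "L2_inner \<Omega>" and n = "n_form \<Omega> c" and D = "\<Sum>K\<in>\<T>. (slowness K)\<^sup>2"])
  show "AE s in lebesgue_on {0<..<T}. u s \<in> Hdiv \<Omega>" using uV by eventually_elim (simp add: V_space_def)
  show "AE s in lebesgue_on {0<..<T}. has_weak_time_deriv T (\<lambda>t. L2_inner \<Omega> (u t) (u s)) (\<lambda>t. - b_form \<Omega> (u s) (p t))"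
   using uV by eventually_elim (rule e1)
  show "has_weak_time_deriv T (\<lambda>t. n_form \<Omega> c (p t) (p s)) (\<lambda>t. b_form \<Omega> (u t) (p s))" if "s \<in> {0<..<T}" for s
   by (rule e2, rule C0_time_in[OF pC]) (use that in auto)
  show "\<bar>L2_inner \<Omega> v w\<bar> \<le> 1 * L2_norm \<Omega> v * L2_norm \<Omega> w" if "v \<in> L2 \<Omega>" "w \<in> L2 \<Omega>" for v w :: "pt => pt"
   using L2_Cauchy_Schwarz[OF that] by simp
  show "0 \<le> (\<Sum>K\<in>\<T>. (slowness K)\<^sup>2)" by (simp add: sum_nonneg)
 qed (fact L2_diff L2_inner_commute L2_inner_diff_left n_form_commute n_form_diff n_form_bound)+
 moreover have "L2_inner \<Omega> (u 0) (u 0) = L2_inner \<Omega> u0 u0"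
  by (rule L2_inner_cong_AE) (use i(1) u0 C0_time_in[OF uC, of 0] T in auto)
 moreover have "n_form \<Omega> c (p 0) (p 0) = n_form \<Omega> c p0 p0"
 proof -
  have p00: "p 0 \<in> L2 \<Omega>" using C0_time_in[OF pC, of 0] T by simp
  have "L2_inner (region K) (p 0) (p 0) = L2_inner (region K) p0 p0" if "K \<in> \<T>" for K
   using AE_region[OF i(2) that] L2_region[OF p0 that] L2_region[OF p00 that] by (intro L2_inner_cong_AE)
  then show ?thesis by (simp add: n_form_mesh p0 p00)
 qed
 moreover have "(energy_norm \<Omega> c (u t) (p t))\<^sup>2 = L2_inner \<Omega> (u t) (u t) + n_form \<Omega> c (p t) (p t)"
  by (simp add: energy_norm_def weighted_norm[symmetric] L2_norm_power2[symmetric])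
 ultimately show ?thesis by (simp add: L2_norm_power2)
qed

lemma broken_poly_diff:
 assumes "p \<in> broken_poly k \<Omega> \<T>" "q \<in> broken_poly k \<Omega> \<T>"
 shows "(\<lambda>x. p x - q x) \<in> broken_poly k \<Omega> \<T>"
proof -
 have "\<exists>r\<in>poly_fun (int k). AE x in lebesgue_on (region K). p x - q x = r x" if "K \<in> \<T>" for K
 proof -
  from assms that obtain a b where a: "a \<in> poly_fun (int k)" "AE x in lebesgue_on (region K). p x = a x"
   and b: "b \<in> poly_fun (int k)" "AE x in lebesgue_on (region K). q x = b x" unfolding broken_poly_def by blast
  have "AE x in lebesgue_on (region K). p x - q x = a x - b x" using a(2) b(2) by eventually_elim simp
  then show ?thesis using poly_fun_diff[OF a(1) b(1)] by (rule bexI)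
 qed
 then show ?thesis using assms by (simp add: broken_poly_def L2_diff)
qed

text \<open>The membership of \<open>u 0\<close> in the virtual element space is recorded as well, because the initial energy is
 computed from it.\<close>

lemma discrete_energy:
 assumes T: "T > 0"
  and sol: "vem_solution k \<B> \<T> \<Omega> \<Gamma>N {} c T (\<lambda>_ _. 0) u0 p0 u p"
  and t: "t \<in> {0<..<T}"
 shows "(discrete_energy_norm k \<B> \<T> \<Omega> c (u t) (p t))\<^sup>2 = m_h k \<B> \<T> (u 0) (u 0) + n_form \<Omega> c (p 0) (p 0)"
  and "u 0 \<in> V_discrete k \<Omega> \<Gamma>N \<T>" and "p 0 \<in> L2 \<Omega>"
proof -
 let ?V = "V_discrete k \<Omega> \<Gamma>N \<T>" and ?Q = "broken_poly k \<Omega> \<T>"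
 have uC: "u \<in> C0_time T (L2 \<Omega>) (L2_norm \<Omega>)" and pC: "p \<in> C0_time T ?Q (L2_norm \<Omega>)"
  and uV: "AE s in lebesgue_on {0<..<T}. u s \<in> ?V"
  and G: "integrable (lebesgue_on {0<..<T}) (\<lambda>t. (Hdiv_norm \<Omega> (u t))\<^sup>2)"
  and e1: "\<And>v. v \<in> ?V ==> has_weak_time_deriv T (\<lambda>t. m_h k \<B> \<T> (u t) v) (\<lambda>t. - b_form \<Omega> v (p t))"
  and e2: "\<And>q. q \<in> ?Q ==> has_weak_time_deriv T (\<lambda>t. n_form \<Omega> c (p t) q) (\<lambda>t. b_form \<Omega> (u t) q)"
  using sol by (simp_all add: vem_solution_def L2_time_def r_form_def F_form_def L2_inner_zero)
 have QL: "?Q \<subseteq> L2 \<Omega>" by (auto simp: broken_poly_def)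
 have VL: "?V \<subseteq> L2 \<Omega>" using V_discrete_Vk by blast
 obtain s0 where "u s0 \<in> ?V" using AE_open_witness[OF _ uV, of "{0<..<T}"] T by auto
 note cl = V_discrete_closed[OF this]
 have uin: "u s \<in> ?V" if "s \<in> {0..T}" for s by (rule C0_time_in_closed[OF T uC uV cl that])
 have uC': "u \<in> C0_time T ?V (L2_norm \<Omega>)" by (rule C0_time_mono[OF uC uin])
 have E: "m_h k \<B> \<T> (u t) (u t) + n_form \<Omega> c (p t) (p t) = m_h k \<B> \<T> (u 0) (u 0) + n_form \<Omega> c (p 0) (p 0)"
 proof (rule energy_conserved[OF T uC' VL V_discrete_diff _ _ _ _ pC QL broken_poly_diff _ _ _ _ _ G _ _ t,
   where m = "m_h k \<B> \<T>" and n = "n_form \<Omega> c" and C = "1 + C2" and D = "\<Sum>K\<in>\<T>. (slowness K)\<^sup>2"])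
  show "AE s in lebesgue_on {0<..<T}. u s \<in> Hdiv \<Omega>"
   using uV by eventually_elim (simp add: V_discrete_def V_space_def)
  show "AE s in lebesgue_on {0<..<T}. has_weak_time_deriv T (\<lambda>t. m_h k \<B> \<T> (u t) (u s)) (\<lambda>t. - b_form \<Omega> (u s) (p t))"
   using uV by eventually_elim (rule e1)
  show "has_weak_time_deriv T (\<lambda>t. n_form \<Omega> c (p t) (p s)) (\<lambda>t. b_form \<Omega> (u t) (p s))" if "s \<in> {0<..<T}" for s
   by (rule e2, rule C0_time_in[OF pC]) (use that in auto)
  show "m_h k \<B> \<T> (\<lambda>x. v x - w x) z = m_h k \<B> \<T> v z - m_h k \<B> \<T> w z" if "v \<in> ?V" "w \<in> ?V" "z \<in> ?V" for v w z
   using m_h_lin[OF subsetD[OF V_discrete_Vk that(1)] subsetD[OF V_discrete_Vk that(2)] subsetD[OF V_discrete_Vk that(3)], of "-1"]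
   by simp
  show "\<bar>m_h k \<B> \<T> v w\<bar> \<le> (1 + C2) * L2_norm \<Omega> v * L2_norm \<Omega> w" if "v \<in> ?V" "w \<in> ?V" for v w
   by (rule m_h_bound[OF subsetD[OF V_discrete_Vk that(1)] subsetD[OF V_discrete_Vk that(2)]])
  show "n_form \<Omega> c (\<lambda>x. v x - w x) z = n_form \<Omega> c v z - n_form \<Omega> c w z" if "v \<in> ?Q" "w \<in> ?Q" "z \<in> ?Q" for v w z
   using that QL by (intro n_form_diff) auto
  show "\<bar>n_form \<Omega> c v w\<bar> \<le> (\<Sum>K\<in>\<T>. (slowness K)\<^sup>2) * L2_norm \<Omega> v * L2_norm \<Omega> w" if "v \<in> ?Q" "w \<in> ?Q" for v w
   using that QL by (intro n_form_bound) auto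
  show "0 \<le> 1 + C2" using C2 by simp
  show "0 \<le> (\<Sum>K\<in>\<T>. (slowness K)\<^sup>2)" by (simp add: sum_nonneg)
  show "m_h k \<B> \<T> v w = m_h k \<B> \<T> w v" for v w by (rule m_h_commute)
  show "n_form \<Omega> c v w = n_form \<Omega> c w v" for v w by (rule n_form_commute)
 qed assumption+
 have "0 \<le> n_form \<Omega> c (p t) (p t)" unfolding weighted_norm[symmetric] by simp
 then have "(discrete_energy_norm k \<B> \<T> \<Omega> c (u t) (p t))\<^sup>2 = m_h k \<B> \<T> (u t) (u t) + n_form \<Omega> c (p t) (p t)"
  using m_h_nonneg[of "u t"] by (simp add: discrete_energy_norm_def weighted_norm)
 then show "(discrete_energy_norm k \<B> \<T> \<Omega> c (u t) (p t))\<^sup>2 = m_h k \<B> \<T> (u 0) (u 0) + n_form \<Omega> c (p 0) (p 0)"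
  unfolding E .
 show "u 0 \<in> ?V" using uin T by simp
 show "p 0 \<in> L2 \<Omega>" using C0_time_in[OF pC, of 0] T QL by auto
qed

lemma energy_error:
 assumes T: "T > 0" and u0: "u0 \<in> L2 \<Omega>" and p0: "p0 \<in> L2 \<Omega>"
  and sol: "weak_solution \<Omega> \<Gamma>N {} c T (\<lambda>_ _. 0) u0 p0 u p"
  and vem: "vem_solution k \<B> \<T> \<Omega> \<Gamma>N {} c T (\<lambda>_ _. 0) u0 p0 uh ph"
  and t: "t \<in> {0<..<T}"
 shows "(energy_norm \<Omega> c (u t) (p t))\<^sup>2 - (discrete_energy_norm k \<B> \<T> \<Omega> c (uh t) (ph t))\<^sup>2
  = (\<Sum>K\<in>\<T>. (\<Sum>l\<in>UNIV. proj_error k K (\<lambda>x. u0 x $ l)) + (slowness K)\<^sup>2 * proj_error k K p0)"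
proof -
 note D = discrete_energy[OF T vem t]
 have i: "AE x in lebesgue_on \<Omega>. uh 0 x = global_proj_vec k \<T> u0 x" "AE x in lebesgue_on \<Omega>. ph 0 x = global_proj k \<T> p0 x"
  using vem unfolding vem_solution_def by blast+
 have U: "(L2_norm (region K) u0)\<^sup>2 - m_local k \<B> K (uh 0) (uh 0) = (\<Sum>l\<in>UNIV. proj_error k K (\<lambda>x. u0 x $ l))" if K: "K \<in> \<T>" for K
  using D(2) K by (intro m_local_initial L2_region[OF u0 K] global_proj_region(2)[OF K i(1)]) (simp_all add: V_discrete_def)
 have P: "L2_inner (region K) p0 p0 - L2_inner (region K) (ph 0) (ph 0) = proj_error k K p0" if K: "K \<in> \<T>" for K
 proof (cases "region K = {}")
  case True then show ?thesis by (simp add: proj_error_def L2_norm_empty L2_inner_empty)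
 next
  case False
  note pK = L2_region[OF p0 K] and qK = L2_region[OF D(3) K] and e = global_proj_region(1)[OF K i(2)]
  have pr: "proj k K p0 \<in> L2 (region K)"
   by (rule poly_fun_L2[OF proj_characterisation(1)[OF region_properties(1,2) False pK]])
  have "L2_inner (region K) (ph 0) (ph 0) = L2_inner (region K) (proj k K p0) (proj k K p0)"
   by (rule L2_inner_cong_AE[OF qK pr qK pr e e])
  then show ?thesis using proj_error_eq[OF pK, of k] by (simp add: L2_norm_power2)
 qed
 have "(energy_norm \<Omega> c (u t) (p t))\<^sup>2 - (discrete_energy_norm k \<B> \<T> \<Omega> c (uh t) (ph t))\<^sup>2
  = ((\<Sum>K\<in>\<T>. (L2_norm (region K) u0)\<^sup>2) - (\<Sum>K\<in>\<T>. m_local k \<B> K (uh 0) (uh 0)))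
   + ((\<Sum>K\<in>\<T>. (slowness K)\<^sup>2 * L2_inner (region K) p0 p0) - (\<Sum>K\<in>\<T>. (slowness K)\<^sup>2 * L2_inner (region K) (ph 0) (ph 0)))"
  unfolding continuous_energy[OF T p0 sol u0 t] D(1) m_h_def L2_norm_mesh[OF u0] n_form_mesh[OF p0 p0] n_form_mesh[OF D(3) D(3)]
  by simp
 also have "\<dots> = (\<Sum>K\<in>\<T>. ((L2_norm (region K) u0)\<^sup>2 - m_local k \<B> K (uh 0) (uh 0))
   + (slowness K)\<^sup>2 * (L2_inner (region K) p0 p0 - L2_inner (region K) (ph 0) (ph 0)))"
  by (simp add: sum_subtractf sum.distrib right_diff_distrib)
 also have "\<dots> = (\<Sum>K\<in>\<T>. (\<Sum>l\<in>UNIV. proj_error k K (\<lambda>x. u0 x $ l)) + (slowness K)\<^sup>2 * proj_error k K p0)"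
  by (rule sum.cong[OF refl]) (simp only: U P)
 finally show ?thesis .
qed

lemma energy_error_bound:
 assumes \<rho>: "\<rho> > 0" and reg: "regular_mesh \<rho> \<T>" and T: "T > 0"
  and u0: "u0 \<in> broken_sobolev_vec (Suc k) \<Omega> \<T>" and p0: "p0 \<in> broken_sobolev (Suc k) \<Omega> \<T>"
 shows "(\<Sum>K\<in>\<T>. (\<Sum>l\<in>UNIV. proj_error k K (\<lambda>x. u0 x $ l)) + (slowness K)\<^sup>2 * proj_error k K p0)
  \<le> (4 * (1 + 1 / \<rho>\<^sup>2)) ^ Suc k * mesh_size \<T> ^ (2 * Suc k) *
   ((broken_seminorm_vec (Suc k) \<T> u0)\<^sup>2 + (c_hat \<Omega> T c)\<^sup>2 * (broken_seminorm (Suc k) \<T> p0)\<^sup>2)"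
proof -
 let ?C = "(4 * (1 + 1 / \<rho>\<^sup>2)) ^ Suc k * mesh_size \<T> ^ (2 * Suc k)"
 let ?s = "\<lambda>K f. (sobolev_seminorm (Suc k) (region K) f)\<^sup>2"
 have b: "(broken_seminorm (Suc k) \<T> f)\<^sup>2 = (\<Sum>K\<in>\<T>. ?s K f)" for f
  unfolding broken_seminorm_def by (simp add: sum_nonneg)
 have bv: "(broken_seminorm_vec (Suc k) \<T> u0)\<^sup>2 = (\<Sum>K\<in>\<T>. \<Sum>l\<in>UNIV. ?s K (\<lambda>x. u0 x $ l))"
  unfolding broken_seminorm_vec_def by (subst sum.swap) (simp add: sum_nonneg b)
 have "(\<Sum>K\<in>\<T>. (\<Sum>l\<in>UNIV. proj_error k K (\<lambda>x. u0 x $ l)) + (slowness K)\<^sup>2 * proj_error k K p0)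
  \<le> (\<Sum>K\<in>\<T>. (\<Sum>l\<in>UNIV. ?C * ?s K (\<lambda>x. u0 x $ l)) + (c_hat \<Omega> T c)\<^sup>2 * (?C * ?s K p0))"
 proof (intro sum_mono add_mono)
  fix K assume K: "K \<in> \<T>"
  show "proj_error k K (\<lambda>x. u0 x $ l) \<le> ?C * ?s K (\<lambda>x. u0 x $ l)" for l
   by (rule proj_error_bound[OF \<rho> reg K]) (use u0 K in \<open>simp add: broken_sobolev_vec_def broken_sobolev_def\<close>)
  have "proj_error k K p0 \<le> ?C * ?s K p0"
   by (rule proj_error_bound[OF \<rho> reg K]) (use p0 K in \<open>simp add: broken_sobolev_def\<close>)
  then show "(slowness K)\<^sup>2 * proj_error k K p0 \<le> (c_hat \<Omega> T c)\<^sup>2 * (?C * ?s K p0)"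
   by (intro mult_mono slowness_le_c_hat[OF T K] proj_error_nonneg zero_le_power2)
 qed
 also have "\<dots> = ?C * ((broken_seminorm_vec (Suc k) \<T> u0)\<^sup>2 + (c_hat \<Omega> T c)\<^sup>2 * (broken_seminorm (Suc k) \<T> p0)\<^sup>2)"
  unfolding b bv by (simp only: sum.distrib distrib_left sum_distrib_left mult.left_commute)
 finally show ?thesis .
qed

end

theorem proposition4p3:
  fixes \<Omega> :: "(real^2) set" and k :: nat and \<rho> :: real
  assumes "polygonal_domain \<Omega>" and "\<rho> > 0"
  shows "\<exists>C>0. \<forall>\<Gamma>D \<Gamma>N \<Gamma>R \<T> c T f u\<^sub>0 p\<^sub>0 u p \<B> C\<^sub>1 C\<^sub>2 u\<^sub>h p\<^sub>h.
     boundary_division \<Omega> \<Gamma>D \<Gamma>N \<Gamma>R \<longrightarrow>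
     decomposition \<Omega> \<T> \<longrightarrow>
     matches_boundary \<Omega> \<Gamma>D \<Gamma>N \<Gamma>R \<T> \<longrightarrow>
     regular_mesh \<rho> \<T> \<longrightarrow>
     (\<forall>x\<in>\<Omega>. c x > 0) \<longrightarrow> (\<forall>K\<in>\<T>. c constant_on region K) \<longrightarrow>
     T > 0 \<longrightarrow>
     f = (\<lambda>_ _. 0) \<longrightarrow> \<Gamma>R = {} \<longrightarrow>
     u\<^sub>0 \<in> L2 \<Omega> \<longrightarrow> p\<^sub>0 \<in> L2 \<Omega> \<longrightarrow>
     weak_solution \<Omega> \<Gamma>N \<Gamma>R c T f u\<^sub>0 p\<^sub>0 u p \<longrightarrow>
     dof_choice k \<T> \<B> \<longrightarrow>
     C\<^sub>1 > 0 \<longrightarrow> C\<^sub>2 > 0 \<longrightarrow> properly_scaled k \<T> C\<^sub>1 C\<^sub>2 \<B> \<longrightarrow>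
     vem_solution k \<B> \<T> \<Omega> \<Gamma>N \<Gamma>R c T f u\<^sub>0 p\<^sub>0 u\<^sub>h p\<^sub>h \<longrightarrow>
     u\<^sub>0 \<in> broken_sobolev_vec (k + 1) \<Omega> \<T> \<longrightarrow>
     p\<^sub>0 \<in> broken_sobolev (k + 1) \<Omega> \<T> \<longrightarrow>
     (\<forall>t\<in>{0<..<T}.
        0 \<le> (energy_norm \<Omega> c (u t) (p t))\<^sup>2
             - (discrete_energy_norm k \<B> \<T> \<Omega> c (u\<^sub>h t) (p\<^sub>h t))\<^sup>2 \<and>
        (energy_norm \<Omega> c (u t) (p t))\<^sup>2
             - (discrete_energy_norm k \<B> \<T> \<Omega> c (u\<^sub>h t) (p\<^sub>h t))\<^sup>2
          \<le> C * mesh_size \<T> ^ (2 * (k + 1)) *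
              ((broken_seminorm_vec (k + 1) \<T> u\<^sub>0)\<^sup>2
                + (c_hat \<Omega> T c)\<^sup>2 * (broken_seminorm (k + 1) \<T> p\<^sub>0)\<^sup>2))"
proof (intro exI[where x = "(4 * (1 + 1 / \<rho>\<^sup>2)) ^ Suc k"] conjI allI impI ballI)
  show "0 < (4 * (1 + 1 / \<rho>\<^sup>2)) ^ Suc k" by (intro zero_less_power mult_pos_pos add_pos_nonneg) simp_all
next
  fix \<Gamma>D \<Gamma>N \<Gamma>R \<T> c T f u0 p0 u p \<B> C1 C2 uh ph t
  assume h: "decomposition \<Omega> \<T>" "regular_mesh \<rho> \<T>" "\<forall>x\<in>\<Omega>. c x > 0" "\<forall>K\<in>\<T>. c constant_on region K"
    "T > 0" and f: "f = (\<lambda>_ _. 0)" "\<Gamma>R = {}"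
    and d: "u0 \<in> L2 \<Omega>" "p0 \<in> L2 \<Omega>" and s: "weak_solution \<Omega> \<Gamma>N \<Gamma>R c T f u0 p0 u p"
    and B: "dof_choice k \<T> \<B>" "C1 > 0" "C2 > 0" "properly_scaled k \<T> C1 C2 \<B>"
    and v: "vem_solution k \<B> \<T> \<Omega> \<Gamma>N \<Gamma>R c T f u0 p0 uh ph"
    and sob: "u0 \<in> broken_sobolev_vec (k + 1) \<Omega> \<T>" "p0 \<in> broken_sobolev (k + 1) \<Omega> \<T>"
    and t: "t \<in> {0<..<T}"
  have "open \<Omega>" "bounded \<Omega>" using assms(1) by (simp_all add: polygonal_domain_def)
  then interpret vem_setting \<Omega> \<T> k \<B> C1 C2 c
    using h B by unfold_locales auto
  note e = energy_error[OF h(5) d s[unfolded f] v[unfolded f] t]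
  show "0 \<le> (energy_norm \<Omega> c (u t) (p t))\<^sup>2 - (discrete_energy_norm k \<B> \<T> \<Omega> c (uh t) (ph t))\<^sup>2"
    unfolding e by (intro sum_nonneg add_nonneg_nonneg mult_nonneg_nonneg proj_error_nonneg zero_le_power2)
  show "(energy_norm \<Omega> c (u t) (p t))\<^sup>2 - (discrete_energy_norm k \<B> \<T> \<Omega> c (uh t) (ph t))\<^sup>2
      \<le> (4 * (1 + 1 / \<rho>\<^sup>2)) ^ Suc k * mesh_size \<T> ^ (2 * (k + 1)) *
        ((broken_seminorm_vec (k + 1) \<T> u0)\<^sup>2 + (c_hat \<Omega> T c)\<^sup>2 * (broken_seminorm (k + 1) \<T> p0)\<^sup>2)"
    unfolding e using energy_error_bound[OF assms(2) h(2) h(5), of u0 p0] sob by simp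
qed

end
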